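(* There are a deterministic algorithm and an absolute constant $C$ such that the following holds. Let $V$ be a set of $n$ items with an unknown total order, let $k$ be an integer with $1\le k\le n$, let the input be $k$ together with the outcomes of $m$ pre-existing comparisons between pairs of items of $V$ (all consistent with the unknown total order), and suppose that $T_k\ge 2$. Then the algorithm outputs the smallest $k$ items in sorted (increasing) order in at most $C\,(m+\mathrm{OPT}(k))$ time, using at most $C\cdot\mathrm{OPT}(k)$ additional comparisons.
   Context: The pre-existing comparison outcomes are represented by a directed acyclic graph $G$ on vertex set $V$, with an arc $vw$ for each outcome $v<w$, given for example as a list of its $m$ arcs in arbitrary order. An algorithm learns more about the unknown total order only by making additional binary comparisons "is $x<y$?" between items. Each comparison takes unit time, and other computation is charged in the standard unit-cost RAM model. A topological order of $G$ is a total order of $V$ such that $v<w$ for every arc $vw$. $T_k$ is the number of possible outputs: the number of sequences of $k$ distinct vertices that are the first $k$ vertices, in order, of some topological order of $G$. $\mathrm{OPT}(k)$ denotes the minimum, over all algorithms (comparison decision trees) that correctly determine the sorted sequence of the $k$ smallest items given $G$ and $k$, of the worst-case number of additional comparisons made, the worst case being over all topological orders of the fixed graph $G$. *)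

theory Defs
  imports Complex_Main
begin

section \<open>Topological orders and the possible outputs\<close>

text \<open>A total order is the relation \<open>L\<close> with \<open>(v, w) \<in> L\<close> iff \<open>v < w\<close>. It is required to live on
  \<open>V\<close>, so that distinct orders of \<open>V\<close> are distinct relations. Acyclicity of the graph \<open>(V, A)\<close> and
  \<open>A \<subseteq> V \<times> V\<close> follow from the existence of a topological order.\<close>

definition topological_order :: "'a set \<Rightarrow> 'a rel \<Rightarrow> 'a rel \<Rightarrow> bool" where
  "topological_order V A L \<longleftrightarrow> L \<subseteq> V \<times> V \<and> strict_linear_order_on V L \<and> A \<subseteq> L"

definition smallest_sorted :: "'a set \<Rightarrow> 'a rel \<Rightarrow> nat \<Rightarrow> 'a list \<Rightarrow> bool" where
  "smallest_sorted V L k xs \<longleftrightarrow>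
     length xs = k \<and> set xs \<subseteq> V \<and> sorted_wrt (\<lambda>x y. (x, y) \<in> L) xs \<and>
     (\<forall>x \<in> set xs. \<forall>y \<in> V - set xs. (x, y) \<in> L)"

definition num_outputs :: "'a set \<Rightarrow> 'a rel \<Rightarrow> nat \<Rightarrow> nat" where
  "num_outputs V A k = card {xs. \<exists>L. topological_order V A L \<and> smallest_sorted V L k xs}"


section \<open>Comparison decision trees and the optimal number of comparisons\<close>

text \<open>\<open>Ask x y t f\<close> asks ``is \<open>x < y\<close>?'' and continues with \<open>t\<close> if so, and with \<open>f\<close> otherwise.\<close>

datatype (items: 'a, 'b) decision_tree =
    Answer 'b
  | Ask 'a 'a "('a, 'b) decision_tree" "('a, 'b) decision_tree"

primrec answer :: "'a rel \<Rightarrow> ('a, 'b) decision_tree \<Rightarrow> 'b" where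
  "answer L (Answer z) = z"
| "answer L (Ask x y t f) = (if (x, y) \<in> L then answer L t else answer L f)"

primrec num_asked :: "'a rel \<Rightarrow> ('a, 'b) decision_tree \<Rightarrow> nat" where
  "num_asked L (Answer z) = 0"
| "num_asked L (Ask x y t f) = Suc (if (x, y) \<in> L then num_asked L t else num_asked L f)"

definition correct_tree :: "'a set \<Rightarrow> 'a rel \<Rightarrow> nat \<Rightarrow> ('a, 'a list) decision_tree \<Rightarrow> bool" where
  "correct_tree V A k t \<longleftrightarrow>
     items t \<subseteq> V \<and> (\<forall>L. topological_order V A L \<longrightarrow> smallest_sorted V L k (answer L t))"

definition worst_case :: "'a set \<Rightarrow> 'a rel \<Rightarrow> ('a, 'b) decision_tree \<Rightarrow> nat" where
  "worst_case V A t = Max ((\<lambda>L. num_asked L t) ` {L. topological_order V A L})"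

text \<open>The infimum of a nonempty set of natural numbers is its minimum; asking for all pairs shows
  that a correct tree exists if \<open>V\<close> is finite and \<open>k \<le> card V\<close>.\<close>

definition OPT :: "'a set \<Rightarrow> 'a rel \<Rightarrow> nat \<Rightarrow> nat" where
  "OPT V A k = Inf (worst_case V A ` {t. correct_tree V A k t})"


section \<open>Unit-cost random access machines with a comparison oracle\<close>

text \<open>A program is a list of instructions whose arguments are register names, constants and jump
  targets. Registers and memory cells hold natural numbers, and every instruction takes one unit of
  time. The only arithmetic is addition and truncated subtraction, as unit-cost multiplication
  would be too powerful for numbers of unbounded size. \<open>Compare d a b\<close> is the only access to the
  unknown order: it compares the two items whose names are in registers \<open>a\<close> and \<open>b\<close>.\<close>

datatype instr =
    Const nat nat
  | Copy nat nat
  | Add nat nat nat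
  | Sub nat nat nat
  | Load nat nat
  | Store nat nat
  | Jump nat
  | Jump_Zero nat nat
  | Compare nat nat nat

record config =
  pc :: nat
  reg :: "nat \<Rightarrow> nat"
  mem :: "nat \<Rightarrow> nat"
  comps :: nat

definition set_reg :: "nat \<Rightarrow> nat \<Rightarrow> config \<Rightarrow> config" where
  "set_reg d x c = c\<lparr>pc := Suc (pc c), reg := (reg c)(d := x)\<rparr>"

primrec exec :: "nat rel \<Rightarrow> instr \<Rightarrow> config \<Rightarrow> config" where
  "exec L (Const d x) c = set_reg d x c"
| "exec L (Copy d a) c = set_reg d (reg c a) c"
| "exec L (Add d a b) c = set_reg d (reg c a + reg c b) c"
| "exec L (Sub d a b) c = set_reg d (reg c a - reg c b) c"
| "exec L (Load d a) c = set_reg d (mem c (reg c a)) c"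
| "exec L (Store a b) c = c\<lparr>pc := Suc (pc c), mem := (mem c)(reg c a := reg c b)\<rparr>"
| "exec L (Jump l) c = c\<lparr>pc := l\<rparr>"
| "exec L (Jump_Zero a l) c = c\<lparr>pc := (if reg c a = 0 then l else Suc (pc c))\<rparr>"
| "exec L (Compare d a b) c =
     (set_reg d (if (reg c a, reg c b) \<in> L then 1 else 0) c)\<lparr>comps := Suc (comps c)\<rparr>"

text \<open>A machine halts by leaving its program; a halted configuration does not change any more.\<close>

definition halted :: "instr list \<Rightarrow> config \<Rightarrow> bool" where
  "halted P c \<longleftrightarrow> length P \<le> pc c"

definition step :: "nat rel \<Rightarrow> instr list \<Rightarrow> config \<Rightarrow> config" where
  "step L P c = (if halted P c then c else exec L (P ! pc c) c)"

definition run :: "nat rel \<Rightarrow> instr list \<Rightarrow> nat \<Rightarrow> config \<Rightarrow> config" where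
  "run L P t c = (step L P ^^ t) c"

text \<open>The items are \<open>0, \<dots>, n - 1\<close>. Registers 0, 1, 2 initially hold \<open>n\<close>, \<open>k\<close>, \<open>m\<close>, and the
  memory cells \<open>2 * i\<close> and \<open>2 * i + 1\<close> hold tail and head of the \<open>i\<close>-th arc; everything else is 0.
  The output is expected in the first \<open>k\<close> memory cells.\<close>

definition init_config :: "nat \<Rightarrow> nat \<Rightarrow> (nat \<times> nat) list \<Rightarrow> config" where
  "init_config n k arcs =
     \<lparr>pc = 0,
      reg = (\<lambda>_. 0)(0 := n, 1 := k, 2 := length arcs),
      mem = (\<lambda>j. if j < 2 * length arcs
                 then (if even j then fst (arcs ! (j div 2)) else snd (arcs ! (j div 2)))
                 else 0),
      comps = 0\<rparr>"

definition result :: "nat \<Rightarrow> config \<Rightarrow> nat list" where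
  "result k c = map (mem c) [0..<k]"

end

theory Submission
  imports Defs "HOL-Combinatorics.Multiset_Permutations"
begin

text \<open>
  The algorithm is topological heapsort with a longest path \<open>P\<close> kept apart. An item off \<open>P\<close> enters a
  heap when its last predecessor is output, and the next output is either the minimum of the heap or
  the first vertex of \<open>P\<close> to come. To decide which, an item is located in the rest of \<open>P\<close> by exponential
  search, only once, when it first becomes the minimum of the heap. The heap is a list of winner trees
  of doubling sizes, so that deleting an item costs the logarithm of the number of later insertions.

  All costs are bounded by lower bounds on \<open>OPT\<close>. First, \<open>T\<^sub>k \<le> 2 ^ OPT\<close>. As \<open>P\<close>, being
  a longest path, has one vertex on every level of the graph, listing the vertices level by level
  leaves enough choices for \<open>2 ^ (number of outputs off P) \<le> T\<^sub>k\<^sup>2\<close>. An item that could be the \<open>k\<close>-th but is not output must be compared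
  with a smaller one, so only \<open>O(OPT)\<close> items enter the heap. Finally, moving the items freely within
  the time intervals in which they are in the heap yields many possible outputs, so the logarithms of
  the lengths of these intervals add up to \<open>O(OPT)\<close>.
\<close>

section \<open>Lower bounds on the optimal number of comparisons\<close>

text \<open>A heap alone is too expensive: \<open>k\<close>, and with it the number of heap
  operations, may far exceed \<open>OPT\<close>, for instance if the graph is nearly a chain. With P
  outside, every heap operation is paid for by \<open>OPT\<close>, and the remaining work is linear
  in \<open>m\<close> and the number of sources. Merging P back must then be cheap, too. A search
  costs the logarithm of the number of path vertices found smaller. If the item is output, they have
  all been output while it was in the heap; if it never is, the search was cut off at the number of
  outputs to come. Either way the interval of the item is long enough, so the same count pays for
  searches and deletions. Time is measured in events, insertions and outputs, because then only
  O(OPT) times are not occupied by outputs from P, and remembering which of them are used costs one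
  bit each. Searched items that are never output extend the arranged set beyond \<open>k\<close> and
  bring in a factorial. Since there is at most one search per output, such items can replace the
  last outputs in any arrangement, so the number of outputs bounds this factorial as well.\<close>

definition output_seqs :: "'a set \<Rightarrow> 'a rel \<Rightarrow> nat \<Rightarrow> 'a list set" where
  "output_seqs V A k = {xs. distinct xs \<and> set xs \<subseteq> V \<and> length xs = k \<and>
     (\<forall>i < k. \<forall>u. (u, xs ! i) \<in> A \<longrightarrow> u \<in> set (take i xs))}"

definition outputs :: "'a set \<Rightarrow> 'a rel \<Rightarrow> nat \<Rightarrow> 'a list set" where
  "outputs V A k = {xs. \<exists>L. topological_order V A L \<and> smallest_sorted V L k xs}"

lemma topological_order_finite: "finite V \<Longrightarrow> finite {L. topological_order V A L}"
  by (rule finite_subset[of _ "Pow (V \<times> V)"]) (auto simp: topological_order_def)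

lemma topological_orderD:
  assumes "topological_order V A L"
  shows "trans L" "irrefl L" "total_on V L" "L \<subseteq> V \<times> V" "A \<subseteq> L"
  using assms by (auto simp: topological_order_def strict_linear_order_on_def)

lemma topological_order_asym:
  "topological_order V A L \<Longrightarrow> (x, y) \<in> L \<Longrightarrow> (y, x) \<notin> L"
  by (meson topological_orderD(1,2) irrefl_def transD)

text \<open>Of two outputs for the same order, take a vertex of one that is missing in the other: it is
  both smaller and larger than a vertex missing in the former.\<close>

lemma smallest_sorted_unique:
  assumes L: "topological_order V A L" and fin: "finite V"
    and xs: "smallest_sorted V L k xs" and ys: "smallest_sorted V L k ys"
  shows "xs = ys"
proof -
  have dist: "distinct zs" if "sorted_wrt (\<lambda>x y. (x, y) \<in> L) zs" for zs
    using that topological_orderD(2)[OF L] by (induction zs) (auto simp: irrefl_def)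
  have dx: "distinct xs" and dy: "distinct ys"
    using dist xs ys by (auto simp: smallest_sorted_def)
  have card: "card (set xs) = k" "card (set ys) = k"
    using dx dy xs ys by (auto simp: smallest_sorted_def distinct_card)
  have "set xs = set ys"
  proof (rule ccontr)
    assume "set xs \<noteq> set ys"
    then have "\<not> set xs \<subseteq> set ys" "\<not> set ys \<subseteq> set xs"
      using card by (metis card_subset_eq List.finite_set)+
    then obtain x y where "x \<in> set xs" "x \<notin> set ys" "y \<in> set ys" "y \<notin> set xs" by blast
    then have "(x, y) \<in> L" "(y, x) \<in> L" using xs ys by (auto simp: smallest_sorted_def)
    then show False using topological_order_asym[OF L] by blast
  qed
  moreover have "us = vs" if "sorted_wrt (\<lambda>x y. (x, y) \<in> L) us" "sorted_wrt (\<lambda>x y. (x, y) \<in> L) vs"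
    "set us = set vs" for us vs
    using that
  proof (induction us arbitrary: vs)
    case (Cons u us)
    then obtain v ws where vs: "vs = v # ws" by (cases vs) auto
    have "u = v"
    proof (rule ccontr)
      assume "u \<noteq> v"
      then have "u \<in> set ws" "v \<in> set us" using Cons.prems(3) vs by auto
      then show False using Cons.prems(1,2) vs topological_order_asym[OF L] by auto
    qed
    moreover have "set us = set ws"
      using Cons.prems vs \<open>u = v\<close> dist[OF Cons.prems(1)] dist[OF Cons.prems(2)] by auto
    ultimately show ?case using Cons vs by simp
  qed simp
  ultimately show ?thesis using xs ys by (auto simp: smallest_sorted_def)
qed

text \<open>A witness order lists \<open>xs\<close> first and keeps \<open>L\<close> on all other
  vertices; closure of \<open>xs\<close> under predecessors makes every arc go forward. With this
  inclusion, a lower bound on the number of outputs only requires building closed sequences, never a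
  total order.\<close>

lemma output_seqs_subset_outputs:
  assumes L: "topological_order V A L"
  shows "output_seqs V A k \<subseteq> outputs V A k"
proof
  fix xs assume xs: "xs \<in> output_seqs V A k"
  define before where "before = {(xs ! i, xs ! j) | i j. i < j \<and> j < k}"
  define L' where "L' = before \<union> set xs \<times> (V - set xs) \<union> (L \<inter> (V - set xs) \<times> (V - set xs))"
  note LD = topological_orderD[OF L]
  have d: "distinct xs" and sub: "set xs \<subseteq> V" and len: "length xs = k"
    and cl: "\<And>i u. i < k \<Longrightarrow> (u, xs ! i) \<in> A \<Longrightarrow> u \<in> set (take i xs)"
    using xs by (auto simp: output_seqs_def)
  have b_in: "before \<subseteq> set xs \<times> set xs" using len by (fastforce simp: before_def)
  have b_ir: "(x, x) \<notin> before" for x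
    using d len by (auto simp: before_def nth_eq_iff_index_eq)
  have b_tr: "(x, z) \<in> before" if xyz: "(x, y) \<in> before" "(y, z) \<in> before" for x y z
  proof -
    obtain i j j' l where "x = xs ! i" "y = xs ! j" "i < j" "j < k" "y = xs ! j'" "z = xs ! l" "j' < l" "l < k"
      using xyz unfolding before_def by blast
    moreover from this have "j = j'" using d len by (simp add: nth_eq_iff_index_eq)
    ultimately show ?thesis unfolding before_def by force
  qed
  have b_tot: "(x, y) \<in> before \<or> (y, x) \<in> before" if xy: "x \<in> set xs" "y \<in> set xs" "x \<noteq> y" for x y
  proof -
    obtain i j where ij: "x = xs ! i" "y = xs ! j" "i < k" "j < k" using xy len by (auto simp: in_set_conv_nth)
    then have "i < j \<or> j < i" using xy(3) by (cases i j rule: linorder_cases) auto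
    then show ?thesis using ij unfolding before_def by blast
  qed
  have "trans L'"
    unfolding trans_def L'_def using b_tr b_in LD(1)[unfolded trans_def] by blast
  moreover have "irrefl L'" using b_ir LD(2) by (auto simp: irrefl_def L'_def)
  moreover have "total_on V L'" using b_tot LD(3) by (auto simp: total_on_def L'_def)
  moreover have "L' \<subseteq> V \<times> V" using b_in sub by (auto simp: L'_def)
  moreover have "A \<subseteq> L'"
  proof
    fix e assume "e \<in> A"
    then obtain u v where e: "e = (u, v)" "(u, v) \<in> A" "(u, v) \<in> L" "u \<in> V" "v \<in> V"
      using LD(4,5) by (cases e) auto
    show "e \<in> L'"
    proof (cases "v \<in> set xs")
      case True
      then obtain j where j: "j < k" "v = xs ! j" using len by (auto simp: in_set_conv_nth)
      then have "u \<in> set (take j xs)" using cl e by blast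
      then obtain i where "i < j" "u = xs ! i" using j len by (auto simp: in_set_conv_nth)
      then show ?thesis using j e by (auto simp: L'_def before_def)
    next
      case False
      then show ?thesis using e by (auto simp: L'_def)
    qed
  qed
  ultimately have "topological_order V A L'"
    by (simp add: topological_order_def strict_linear_order_on_def)
  moreover have "sorted_wrt (\<lambda>x y. (x, y) \<in> L') xs"
    using len by (auto simp: sorted_wrt_iff_nth_less L'_def before_def)
  then have "smallest_sorted V L' k xs"
    using len sub by (auto simp: smallest_sorted_def L'_def)
  ultimately show "xs \<in> outputs V A k" by (auto simp: outputs_def)
qed

lemma num_outputs_eq: "num_outputs V A k = card (outputs V A k)"
  by (simp add: num_outputs_def outputs_def)

lemma finite_outputs: "finite V \<Longrightarrow> finite (outputs V A k)"
  by (rule finite_subset[OF _ finite_lists_length_eq[of V k]])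
    (auto simp: outputs_def smallest_sorted_def)

lemma finite_output_seqs: "finite V \<Longrightarrow> finite (output_seqs V A k)"
  by (rule finite_subset[OF _ finite_lists_length_eq[of V k]]) (auto simp: output_seqs_def)

lemma card_output_seqs_le:
  assumes "topological_order V A L" "finite V"
  shows "card (output_seqs V A k) \<le> num_outputs V A k"
  unfolding num_outputs_eq
  using card_mono[OF finite_outputs[OF assms(2)] output_seqs_subset_outputs[OF assms(1)]] .

subsection \<open>A correct tree exists\<close>

text \<open>Asks every pair of a list and collects the affirmed ones in \<open>R\<close>, so that
  the answer may be any function of the order.\<close>

primrec ask_all :: "('a \<times> 'a) list \<Rightarrow> 'a rel \<Rightarrow> ('a rel \<Rightarrow> 'b) \<Rightarrow> ('a, 'b) decision_tree" where
  "ask_all [] R F = Answer (F R)"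
| "ask_all (p # ps) R F = Ask (fst p) (snd p) (ask_all ps (insert p R) F) (ask_all ps R F)"

lemma answer_ask_all: "answer L (ask_all ps R F) = F (R \<union> (L \<inter> set ps))"
  by (induction ps arbitrary: R) (auto intro!: arg_cong[where f = F])

lemma items_ask_all: "items (ask_all ps R F) \<subseteq> fst ` set ps \<union> snd ` set ps"
proof (induction ps arbitrary: R)
  case (Cons p ps)
  show ?case using Cons[of "insert p R"] Cons[of R] by auto
qed simp

lemma smallest_sorted_exists:
  assumes L: "topological_order V A L" and "finite V" "k \<le> card V"
  shows "\<exists>xs. smallest_sorted V L k xs"
  using assms(3)
proof (induction k)
  case 0
  then show ?case by (auto simp: smallest_sorted_def intro: exI[of _ "[]"])
next
  case (Suc k)
  note LD = topological_orderD[OF L]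
  obtain xs where xs: "smallest_sorted V L k xs" using Suc by auto
  let ?R = "V - set xs"
  have "card (set xs) \<le> k" using xs by (metis card_length smallest_sorted_def)
  then have "\<not> V \<subseteq> set xs" using Suc.prems card_mono[of "set xs" V] by auto
  then have "?R \<noteq> {}" by blast
  moreover have "wf (L \<inter> ?R \<times> ?R)"
  proof (rule finite_acyclic_wf)
    show "finite (L \<inter> ?R \<times> ?R)" using assms(2) by auto
    have "acyclic L" using LD(1,2) by (auto simp: acyclic_def irrefl_def trancl_id)
    then show "acyclic (L \<inter> ?R \<times> ?R)" by (rule acyclic_subset) auto
  qed
  ultimately obtain x where x: "x \<in> ?R" "\<And>y. (y, x) \<in> L \<inter> ?R \<times> ?R \<Longrightarrow> y \<notin> ?R"
    by (metis equals0I wfE_min)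
  then have "\<And>y. y \<in> ?R \<Longrightarrow> y \<noteq> x \<Longrightarrow> (x, y) \<in> L"
    using LD(3) by (auto simp: total_on_def)
  then have "smallest_sorted V L (Suc k) (xs @ [x])"
    using xs x(1) by (auto simp: smallest_sorted_def sorted_wrt_append)
  then show ?case by blast
qed

text \<open>Without a correct tree \<open>OPT\<close> would be the infimum of the empty set, which
  is 0; existence makes it an attained minimum.\<close>

lemma correct_tree_exists:
  assumes "finite V" "k \<le> card V"
  shows "\<exists>t. correct_tree V A k t"
proof -
  obtain ps where ps: "set ps = V \<times> V" using assms(1) by (metis finite_SigmaI finite_list)
  let ?t = "ask_all ps {} (\<lambda>L. SOME xs. smallest_sorted V L k xs)"
  have "items ?t \<subseteq> V" using items_ask_all[of ps] ps by force
  moreover have "smallest_sorted V L k (answer L ?t)" if L: "topological_order V A L" for L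
  proof -
    have "L \<inter> set ps = L" using topological_orderD(4)[OF L] ps by auto
    then show ?thesis unfolding answer_ask_all
      using someI_ex[OF smallest_sorted_exists[OF L assms]] by simp
  qed
  ultimately show ?thesis by (auto simp: correct_tree_def)
qed

lemma OPT_attained:
  assumes "finite V" "k \<le> card V"
  obtains t where "correct_tree V A k t"
    "\<And>L. topological_order V A L \<Longrightarrow> num_asked L t \<le> OPT V A k"
proof -
  have "worst_case V A ` {t. correct_tree V A k t} \<noteq> {}"
    using correct_tree_exists[OF assms, of A] by blast
  then have "OPT V A k \<in> worst_case V A ` {t. correct_tree V A k t}"
    unfolding OPT_def by (rule Inf_nat_def1)
  then obtain t where t: "correct_tree V A k t" "OPT V A k = worst_case V A t" by auto
  moreover have "num_asked L t \<le> worst_case V A t" if "topological_order V A L" for L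
    unfolding worst_case_def using that topological_order_finite[OF assms(1)] by (intro Max_ge) auto
  ultimately show thesis using that by metis
qed

subsection \<open>The information-theoretic bound\<close>

text \<open>The set \<open>S\<close> is split along the branches instead of counting leaves, because
  a branch that no order in \<open>S\<close> reaches may be arbitrarily deep.\<close>

lemma card_answers:
  "finite S \<Longrightarrow> (\<And>L. L \<in> S \<Longrightarrow> num_asked L t \<le> d) \<Longrightarrow> card ((\<lambda>L. answer L t) ` S) \<le> 2 ^ d"
proof (induction t arbitrary: S d)
  case (Answer z)
  have "(\<lambda>L. answer L (Answer z)) ` S \<subseteq> {z}" by auto
  then have "card ((\<lambda>L. answer L (Answer z)) ` S) \<le> card {z}" by (intro card_mono) auto
  also have "\<dots> \<le> 2 ^ d" by simp
  finally show ?case .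
next
  case (Ask x y t f)
  show ?case
  proof (cases "S = {}")
    case False
    then obtain d' where d: "d = Suc d'" using Ask.prems(2) by (cases d) fastforce+
    let ?S1 = "{L \<in> S. (x, y) \<in> L}" and ?S2 = "{L \<in> S. (x, y) \<notin> L}"
    have "(\<lambda>L. answer L (Ask x y t f)) ` S = (\<lambda>L. answer L t) ` ?S1 \<union> (\<lambda>L. answer L f) ` ?S2"
      by (auto simp: image_iff)
    then have "card ((\<lambda>L. answer L (Ask x y t f)) ` S) \<le>
        card ((\<lambda>L. answer L t) ` ?S1) + card ((\<lambda>L. answer L f) ` ?S2)"
      by (simp add: card_Un_le)
    also have "card ((\<lambda>L. answer L t) ` ?S1) \<le> 2 ^ d'"
      using Ask.prems d by (intro Ask.IH(1)) fastforce+
    also have "card ((\<lambda>L. answer L f) ` ?S2) \<le> 2 ^ d'"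
      using Ask.prems d by (intro Ask.IH(2)) fastforce+
    finally show ?thesis using d by simp
  qed simp
qed

lemma num_outputs_le_OPT:
  assumes fin: "finite V" and "k \<le> card V"
  shows "num_outputs V A k \<le> 2 ^ OPT V A k"
proof -
  obtain t where t: "correct_tree V A k t"
      "\<And>L. topological_order V A L \<Longrightarrow> num_asked L t \<le> OPT V A k"
    using OPT_attained[OF assms] by metis
  have "outputs V A k \<subseteq> (\<lambda>L. answer L t) ` {L. topological_order V A L}"
    using t(1) smallest_sorted_unique[OF _ fin] unfolding outputs_def correct_tree_def by blast
  then have "num_outputs V A k \<le> card ((\<lambda>L. answer L t) ` {L. topological_order V A L})"
    unfolding num_outputs_eq
    by (intro card_mono finite_imageI topological_order_finite fin)
  also have "\<dots> \<le> 2 ^ OPT V A k"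
    using t(2) topological_order_finite[OF fin] by (intro card_answers) auto
  finally show ?thesis .
qed

subsection \<open>The certificate bound\<close>

primrec asked :: "'a rel \<Rightarrow> ('a, 'b) decision_tree \<Rightarrow> ('a \<times> 'a) set" where
  "asked L (Answer z) = {}"
| "asked L (Ask x y t f) = insert (x, y) (if (x, y) \<in> L then asked L t else asked L f)"

lemma card_asked: "finite (asked L t) \<and> card (asked L t) \<le> num_asked L t"
  by (induction t) (auto simp: card_insert_if)

lemma answer_cong: "(\<And>p. p \<in> asked L t \<Longrightarrow> p \<in> L \<longleftrightarrow> p \<in> L') \<Longrightarrow> answer L' t = answer L t"
  by (induction t) auto

text \<open>Without a comparison of \<open>y\<close> with a smaller item that is not among the first \<open>k - 1\<close>, one
  could move \<open>y\<close> to the \<open>k\<close>-th place.\<close>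

lemma free_le_OPT:
  assumes fin: "finite V" and "k \<le> card V" and L: "topological_order V A L"
    and vs: "smallest_sorted V L k vs" and k: "0 < k"
    and Y: "Y \<subseteq> V - set vs" "\<And>y u. y \<in> Y \<Longrightarrow> (u, y) \<in> A \<Longrightarrow> u \<in> set (take (k - 1) vs)"
  shows "card Y \<le> OPT V A k"
proof -
  note LD = topological_orderD[OF L]
  obtain t where t: "correct_tree V A k t" "num_asked L t \<le> OPT V A k"
    using OPT_attained[OF assms(1,2)] L by metis
  have ans: "answer L t = vs"
    using t(1) L smallest_sorted_unique[OF L fin _ vs] by (auto simp: correct_tree_def)
  define us where "us = take (k - 1) vs"
  have us: "\<And>u v. u \<in> set us \<Longrightarrow> v \<in> V - set us \<Longrightarrow> (u, v) \<in> L"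
  proof -
    fix u v assume u: "u \<in> set us" and v: "v \<in> V - set us"
    obtain i where i: "i < k - 1" "u = vs ! i"
      using u vs by (auto simp: us_def in_set_conv_nth smallest_sorted_def)
    show "(u, v) \<in> L"
    proof (cases "v \<in> set vs")
      case True
      then obtain j where j: "j < k" "v = vs ! j" using vs by (auto simp: in_set_conv_nth smallest_sorted_def)
      have "\<not> j < k - 1"
      proof
        assume "j < k - 1"
        then have "v \<in> set us" using j vs
          by (auto simp: us_def in_set_conv_nth smallest_sorted_def intro!: exI[of _ j])
        then show False using v by simp
      qed
      then show ?thesis using i j vs by (auto simp: smallest_sorted_def sorted_wrt_iff_nth_less)
    next
      case False
      then show ?thesis using vs v i k by (auto simp: smallest_sorted_def)
    qed
  qed
  have "\<exists>p \<in> asked L t. \<exists>z. (z, y) \<in> L \<and> (p = (z, y) \<or> p = (y, z))" if y: "y \<in> Y" for y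
  proof (rule ccontr)
    assume no: "\<not> ?thesis"
    \<comment> \<open>\<open>B\<close> is what \<open>y\<close> has to overtake; \<open>L'\<close>
      puts \<open>y\<close> directly behind \<open>us\<close>, in the place of the k-th
      output.\<close>
    define B where "B = {z. (z, y) \<in> L \<and> z \<notin> set us}"
    define L' where "L' = (L - B \<times> {y}) \<union> {y} \<times> B"
    have yV: "y \<in> V" "y \<notin> set vs" "y \<notin> set us" using y Y(1) by (auto simp: us_def dest: in_set_takeD)
    have yB: "y \<notin> B" using LD(2) by (auto simp: B_def irrefl_def)
    have B: "z \<in> B \<longleftrightarrow> (z, y) \<in> L \<and> z \<notin> set us" for z by (simp add: B_def)
    have "trans L'"
    proof (rule transI)
      fix a b c assume ab: "(a, b) \<in> L'" and bc: "(b, c) \<in> L'"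
      have tr: "\<And>p q r. (p, q) \<in> L \<Longrightarrow> (q, r) \<in> L \<Longrightarrow> (p, r) \<in> L" using LD(1) by (meson transD)
      have as: "\<And>p q. (p, q) \<in> L \<Longrightarrow> (q, p) \<notin> L" using topological_order_asym[OF L] by blast
      have inV: "\<And>p q. (p, q) \<in> L \<Longrightarrow> p \<in> V \<and> q \<in> V" using LD(4) by auto
      have ir: "\<And>p. (p, p) \<notin> L" using LD(2) by (auto simp: irrefl_def)
      consider "a = y" "b \<in> B" | "(a, b) \<in> L" "b = y" "a \<notin> B" | "(a, b) \<in> L" "b \<noteq> y"
        using ab by (auto simp: L'_def)
      then show "(a, c) \<in> L'"
      proof cases
        case 1
        then have "(b, c) \<in> L" "c \<noteq> y" using bc yB by (auto simp: L'_def)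
        show ?thesis
        proof (cases "(y, c) \<in> L")
          case True
          then show ?thesis using 1 yB by (auto simp: L'_def)
        next
          case False
          then have "(c, y) \<in> L" using \<open>c \<noteq> y\<close> LD(3) yV inV[OF \<open>(b, c) \<in> L\<close>] by (auto simp: total_on_def)
          moreover have "c \<notin> set us" using us[of c b] 1 \<open>(b, c) \<in> L\<close> as inV by (auto simp: B)
          ultimately show ?thesis using 1 by (auto simp: L'_def B)
        qed
      next
        case 2
        then have "a \<in> set us" by (auto simp: B)
        show ?thesis
        proof (cases "c \<in> B")
          case True
          then show ?thesis using us[of a c] \<open>a \<in> set us\<close> inV yB by (auto simp: L'_def B)
        next
          case False
          then have "(y, c) \<in> L" using bc 2 yB by (auto simp: L'_def)
          then show ?thesis using 2 tr ir by (auto simp: L'_def)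
        qed
      next
        case 3
        then have "(b, c) \<in> L" using bc by (auto simp: L'_def)
        then have "(a, c) \<in> L" using 3 tr by blast
        moreover have "\<not> (c = y \<and> a \<in> B)"
        proof
          assume c: "c = y \<and> a \<in> B"
          then have "b \<in> set us" using bc 3 \<open>(b, c) \<in> L\<close> yB by (auto simp: L'_def B)
          moreover have "a \<in> V - set us" using c inV by (auto simp: B)
          ultimately show False using us 3 as by blast
        qed
        ultimately show ?thesis by (auto simp: L'_def)
      qed
    qed
    moreover have "irrefl L'" using LD(2) yB by (auto simp: irrefl_def L'_def)
    moreover have "total_on V L'" using LD(3) by (auto simp: total_on_def L'_def)
    moreover have "L' \<subseteq> V \<times> V" using LD(4) yV by (auto simp: L'_def B_def)
    moreover have "A \<subseteq> L'" using LD(5) Y(2)[OF y] by (auto simp: L'_def B_def us_def)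
    ultimately have L': "topological_order V A L'"
      by (simp add: topological_order_def strict_linear_order_on_def)
    \<comment> \<open>Only pairs of \<open>y\<close> with elements of \<open>B\<close> are reversed,
      and none of them is asked. So the tree gives the same answer, although
      \<open>vs ! (k - 1)\<close> is now larger than \<open>y\<close>.\<close>
    have "answer L' t = vs"
      unfolding ans[symmetric] using no LD(2)
      by (intro answer_cong) (auto simp: L'_def B_def irrefl_def)
    then have ss: "smallest_sorted V L' k vs" using t(1) L' by (auto simp: correct_tree_def)
    have lv: "length vs = k" using vs by (simp add: smallest_sorted_def)
    have last: "vs ! (k - 1) \<in> set vs" using lv k by simp
    have "distinct vs" using vs LD(2)
      by (auto simp: smallest_sorted_def distinct_conv_nth sorted_wrt_iff_nth_less irrefl_def)
        (metis linorder_neqE_nat)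
    then have "vs ! (k - 1) \<notin> set us"
      using lv k by (auto simp: us_def in_set_conv_nth nth_eq_iff_index_eq)
    moreover have "(vs ! (k - 1), y) \<in> L" using vs last yV by (auto simp: smallest_sorted_def)
    ultimately have "(vs ! (k - 1), y) \<notin> L'" using yB by (auto simp: L'_def B)
    then show False using ss last yV by (auto simp: smallest_sorted_def)
  qed
  then obtain g where g: "\<And>y. y \<in> Y \<Longrightarrow> g y \<in> asked L t \<and> (\<exists>z. (z, y) \<in> L \<and> (g y = (z, y) \<or> g y = (y, z)))"
    by metis
  \<comment> \<open>In each chosen pair \<open>y\<close> is the larger item, so the pair determines
    it.\<close>
  have "inj_on g Y"
  proof (rule inj_onI)
    fix y y' assume "y \<in> Y" "y' \<in> Y" "g y = g y'"
    then show "y = y'"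
      using g[of y] g[of y'] topological_order_asym[OF L] LD(2) by (auto simp: irrefl_def)
  qed
  then have "card Y \<le> card (asked L t)"
    using g card_asked[of L t] by (intro card_inj_on_le) auto
  then show ?thesis using card_asked[of L t] t(2) by linarith
qed

section \<open>Lower bounds on the number of outputs\<close>

subsection \<open>Vertices off a longest path\<close>

definition level_seqs :: "'a set \<Rightarrow> ('a \<Rightarrow> nat) \<Rightarrow> nat \<Rightarrow> 'a list set" where
  "level_seqs V dep j = {xs. distinct xs \<and> set xs \<subseteq> V \<and> length xs = j \<and>
     (\<forall>i < j. \<forall>y \<in> V. dep y < dep (xs ! i) \<longrightarrow> y \<in> set (take i xs))}"

lemma finite_level_seqs: "finite V \<Longrightarrow> finite (level_seqs V dep j)"
  by (rule finite_subset[OF _ finite_lists_length_eq[of V j]]) (auto simp: level_seqs_def)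

text \<open>At each position the next vertex is free among the remaining ones on the lowest
  unfinished level. The choice is forced only if it finishes that level. So every position yields a
  factor 2, except for one position per finished level, and these are counted by the second
  factor.\<close>

lemma card_level_seqs:
  assumes fin: "finite V" and dep: "\<And>v. v \<in> V \<Longrightarrow> dep v < N" and "j \<le> card V"
  shows "2 ^ j \<le> card (level_seqs V dep j) * 2 ^ card {e. e < N \<and> card {v \<in> V. dep v \<le> e} \<le> j}"
  using assms(3)
proof (induction j)
  case 0
  have "[] \<in> level_seqs V dep 0" by (simp add: level_seqs_def)
  then have "level_seqs V dep 0 \<noteq> {}" by blast
  then have "1 \<le> card (level_seqs V dep 0)"
    using finite_level_seqs[OF fin, of dep 0] by (simp add: Suc_le_eq card_gt_0_iff)
  then show ?case by simp
next
  case (Suc j)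
  let ?n = "\<lambda>e. card {v \<in> V. dep v \<le> e}"
  let ?E = "\<lambda>j. {e. e < N \<and> ?n e \<le> j}"
  define e where "e xs = Min (dep ` (V - set xs))" for xs
  define M where "M xs = {v \<in> V - set xs. dep v = e xs}" for xs
  have *: "M xs \<noteq> {} \<and> (\<forall>x \<in> M xs. xs @ [x] \<in> level_seqs V dep (Suc j)) \<and>
      card (M xs) + j = ?n (e xs) \<and> e xs < N" if xs: "xs \<in> level_seqs V dep j" for xs
  proof -
    have x: "distinct xs" "set xs \<subseteq> V" "length xs = j"
        "\<And>i y. i < j \<Longrightarrow> y \<in> V \<Longrightarrow> dep y < dep (xs ! i) \<Longrightarrow> y \<in> set (take i xs)"
      using xs by (auto simp: level_seqs_def)
    have cj: "card (set xs) = j" using x by (simp add: distinct_card)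
    have ne: "V - set xs \<noteq> {}" using Suc.prems cj x(2) by auto
    have fR: "finite (dep ` (V - set xs))" using fin by simp
    have e_in: "e xs \<in> dep ` (V - set xs)" unfolding e_def using ne fR by (intro Min_in) auto
    have e_le: "\<And>v. v \<in> V \<Longrightarrow> v \<notin> set xs \<Longrightarrow> e xs \<le> dep v" unfolding e_def using fR by auto
    have le_e: "dep v \<le> e xs" if v: "v \<in> set xs" for v
    proof (rule ccontr)
      assume gt: "\<not> dep v \<le> e xs"
      obtain i where "i < j" "v = xs ! i" using v x(3) by (auto simp: in_set_conv_nth)
      moreover obtain y where "y \<in> V - set xs" "dep y = e xs" using e_in by auto
      ultimately show False using x(4)[of i y] gt by (auto dest: in_set_takeD)
    qed
    have "M xs \<noteq> {}" using e_in by (auto simp: M_def)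
    moreover have "xs @ [y] \<in> level_seqs V dep (Suc j)" if y: "y \<in> M xs" for y
    proof -
      have y': "y \<in> V" "y \<notin> set xs" "dep y = e xs" using y by (auto simp: M_def)
      have "z \<in> set (take i (xs @ [y]))"
        if i: "i < Suc j" "z \<in> V" "dep z < dep ((xs @ [y]) ! i)" for i z
      proof (cases "i < j")
        case True
        then show ?thesis using x(3) x(4)[of i z] i by (auto simp: nth_append)
      next
        case False
        then have "i = j" using i by simp
        then show ?thesis using x(3) i y' e_le[of z] by (auto simp: nth_append)
      qed
      then show ?thesis using x(1-3) y' by (simp add: level_seqs_def)
    qed
    moreover have "{v \<in> V. dep v \<le> e xs} = M xs \<union> set xs"
    proof
      show "{v \<in> V. dep v \<le> e xs} \<subseteq> M xs \<union> set xs" using e_le by (auto simp: M_def intro: antisym)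
      show "M xs \<union> set xs \<subseteq> {v \<in> V. dep v \<le> e xs}" using x(2) le_e by (auto simp: M_def)
    qed
    then have "card {v \<in> V. dep v \<le> e xs} = card (M xs) + j"
      using card_Un_disjoint[of "M xs" "set xs"] cj fin by (auto simp: M_def)
    moreover have "e xs < N" using e_in dep by auto
    ultimately show ?thesis by simp
  qed
  have fM: "finite (M xs)" for xs using fin by (simp add: M_def)
  let ?S = "Sigma (level_seqs V dep j) M"
  have "inj_on (\<lambda>(xs, x). xs @ [x]) ?S" by (auto simp: inj_on_def)
  moreover have "(\<lambda>(xs, x). xs @ [x]) ` ?S \<subseteq> level_seqs V dep (Suc j)" using * by auto
  ultimately have S: "card ?S \<le> card (level_seqs V dep (Suc j))"
    using finite_level_seqs[OF fin] by (intro card_inj_on_le) auto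
  have cS: "card ?S = (\<Sum>xs \<in> level_seqs V dep j. card (M xs))"
    using finite_level_seqs[OF fin] fM by simp
  have IH: "2 ^ j \<le> card (level_seqs V dep j) * 2 ^ card (?E j)" using Suc by simp
  have fE: "finite (?E (Suc j))" by simp
  show ?case
  \<comment> \<open>Either some level is finished after \<open>Suc j\<close> vertices, and then the
    number of finished levels grows; or none is, and then every \<open>M xs\<close> has a second
    element.\<close>
  proof (cases "\<exists>e0 < N. ?n e0 = Suc j")
    case True
    have "1 \<le> card (M xs)" if "xs \<in> level_seqs V dep j" for xs
    proof -
      have "card (M xs) \<noteq> 0" using *[OF that] fM by simp
      then show ?thesis by simp
    qed
    then have "card (level_seqs V dep j) \<le> card ?S"
      unfolding cS using sum_bounded_below[of "level_seqs V dep j" "1 :: nat" "\<lambda>xs. card (M xs)"] by simp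
    moreover have "card (?E j) < card (?E (Suc j))"
    proof (rule psubset_card_mono[OF fE])
      obtain e0 where "e0 < N" "?n e0 = Suc j" using True by blast
      then have "e0 \<in> ?E (Suc j)" "e0 \<notin> ?E j" by simp_all
      moreover have "?E j \<subseteq> ?E (Suc j)" by (simp add: Collect_mono_iff)
      ultimately show "?E j \<subset> ?E (Suc j)" by blast
    qed
    ultimately have "card (level_seqs V dep j) * 2 ^ Suc (card (?E j)) \<le>
        card (level_seqs V dep (Suc j)) * 2 ^ card (?E (Suc j))"
      using S by (intro mult_le_mono power_increasing) auto
    then show ?thesis using IH by simp
  next
    case False
    have "2 \<le> card (M xs)" if xs: "xs \<in> level_seqs V dep j" for xs
    proof -
      have "card (M xs) \<noteq> 0" using *[OF xs] fM by simp
      moreover have "card (M xs) \<noteq> 1" using *[OF xs] False by auto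
      ultimately show ?thesis by linarith
    qed
    then have "card (level_seqs V dep j) * 2 \<le> card ?S"
      unfolding cS using sum_bounded_below[of "level_seqs V dep j" "2 :: nat" "\<lambda>xs. card (M xs)"] by simp
    moreover have "card (?E j) \<le> card (?E (Suc j))" by (intro card_mono fE) auto
    ultimately have "card (level_seqs V dep j) * 2 * 2 ^ card (?E j) \<le>
        card (level_seqs V dep (Suc j)) * 2 ^ card (?E (Suc j))"
      using S by (intro mult_le_mono power_increasing) auto
    then show ?thesis using IH by simp
  qed
qed

text \<open>Every level that \<open>D\<close> reaches beyond the end of the path in \<open>D\<close> has two vertices.\<close>

lemma off_path_bound:
  fixes dep :: "'a \<Rightarrow> nat" and p :: "nat \<Rightarrow> 'a"
  assumes fin: "finite V" and AV: "A \<subseteq> V \<times> V"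
    and arc: "\<And>u v. (u, v) \<in> A \<Longrightarrow> dep u < dep v"
    and pred: "\<And>v. v \<in> V \<Longrightarrow> 0 < dep v \<Longrightarrow> \<exists>u. (u, v) \<in> A \<and> Suc (dep u) = dep v"
    and dep: "\<And>v. v \<in> V \<Longrightarrow> dep v < N"
    and p: "\<And>i. i < N \<Longrightarrow> p i \<in> V \<and> dep (p i) = i" "\<And>i. Suc i < N \<Longrightarrow> (p i, p (Suc i)) \<in> A"
    and D: "D \<subseteq> V" "\<And>u v. (u, v) \<in> A \<Longrightarrow> v \<in> D \<Longrightarrow> u \<in> D"
  shows "2 ^ card (D - p ` {..<N}) \<le> card (output_seqs V A (card D)) ^ 2"
proof -
  let ?n = "\<lambda>e. card {v \<in> V. dep v \<le> e}"
  define k where "k = card D"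
  define q where "q = card (D - p ` {..<N})"
  define d where "d = card {e. e < N \<and> ?n e \<le> k}"
  define a where "a = card {i. i < N \<and> p i \<in> D}"
  have fD: "finite D" using D(1) fin finite_subset by blast
  have inj: "inj_on p {..<N}" using p(1) by (metis inj_onI lessThan_iff)
  have down: "X = {..<card X}" if "finite X" "\<And>i. Suc i \<in> X \<Longrightarrow> i \<in> X" for X :: "nat set"
  proof -
    have dn: "i \<in> X \<Longrightarrow> j \<le> i \<Longrightarrow> j \<in> X" for i j
      by (induction i) (use that(2) le_Suc_eq in auto)
    show ?thesis
    proof (cases "X = {}")
      case False
      then have "X = {..Max X}" using dn[OF Max_in[OF that(1) False]] Max_ge[OF that(1)] by auto
      then have "X = {..<Suc (Max X)}" by (simp add: lessThan_Suc_atMost)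
      then show ?thesis by (metis card_lessThan)
    qed simp
  qed
  have aI: "{i. i < N \<and> p i \<in> D} = {..<a}"
    unfolding a_def using p(2) D(2) by (intro down) auto
  have dI: "{e. e < N \<and> ?n e \<le> k} = {..<d}"
    unfolding d_def
  proof (intro down)
    fix i assume i: "Suc i \<in> {e. e < N \<and> ?n e \<le> k}"
    have "?n i \<le> ?n (Suc i)" using fin by (intro card_mono) auto
    then show "i \<in> {e. e < N \<and> ?n e \<le> k}" using i by auto
  qed simp
  have kaq: "k = a + q"
  proof -
    have "D = p ` {..<a} \<union> (D - p ` {..<N})" using aI by auto
    moreover have "card (p ` {..<a}) = a"
      using card_image[OF inj_on_subset[OF inj, of "{..<a}"]] aI by force
    moreover have "p ` {..<a} \<inter> (D - p ` {..<N}) = {}" using aI by auto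
    moreover have "card (p ` {..<a} \<union> (D - p ` {..<N})) = card (p ` {..<a}) + card (D - p ` {..<N})"
      using calculation(3) fD by (intro card_Un_disjoint) auto
    ultimately show ?thesis unfolding k_def q_def by simp
  qed
  have pD: "p i \<notin> D" if i: "a \<le> i" "i < N" for i
  proof
    assume "p i \<in> D"
    then have "i \<in> {..<a}" using i(2) aI by blast
    then show False using i(1) by simp
  qed
  \<comment> \<open>The \<open>d\<close> levels that fit into the first \<open>k\<close> places are
    the lost factors in \<open>card_level_seqs\<close>. If \<open>d \<le> a\<close>, the path
    vertices in \<open>D\<close> account for them. Otherwise each level from \<open>a\<close> to
    \<open>d - 1\<close> contains a path vertex outside \<open>D\<close> and, as \<open>D\<close>
    reaches level \<open>d\<close>, also a vertex of \<open>D\<close>. Hence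
    \<open>d + (d - a) \<le> k\<close>, and \<open>k = a + q\<close>.\<close>
  have "2 * d + q \<le> 2 * k"
  proof (cases "d \<le> a")
    case True
    then show ?thesis using kaq by simp
  next
    case False
    have dN: "d - 1 < N" "?n (d - 1) \<le> k" using dI False by force+
    have lv: "{v \<in> V. dep v \<le> d - 1} = {v \<in> V. dep v < d}" using False by auto
    \<comment> \<open>Otherwise \<open>D\<close> would consist of all vertices below level
      \<open>d\<close>, among them \<open>p a\<close>, which is not in \<open>D\<close>.\<close>
    have "\<exists>x \<in> D. d \<le> dep x"
    proof (rule ccontr)
      assume "\<not> ?thesis"
      then have "D \<subseteq> {v \<in> V. dep v < d}" using D(1) by auto
      then have "D = {v \<in> V. dep v < d}"
        using dN(2) fin lv unfolding k_def by (intro card_seteq) auto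
      moreover have "a < N" "p a \<in> V" "dep (p a) < d" using False dN p(1)[of a] by auto
      ultimately show False using pD[of a] by auto
    qed
    then obtain x where x: "x \<in> D" "d \<le> dep x" by blast
    have "\<exists>y \<in> D. dep y = e" if "e \<le> dep x" for e
      using that
    proof (induction rule: inc_induct)
      case base
      then show ?case using x by blast
    next
      case (step m)
      then obtain y where y: "y \<in> D" "dep y = Suc m" by blast
      then obtain u where "(u, y) \<in> A" "Suc (dep u) = dep y" using pred[of y] D(1) by auto
      then show ?case using y D(2) by (intro bexI[of _ u]) auto
    qed
    then obtain y where y: "\<And>e. e \<le> dep x \<Longrightarrow> y e \<in> D \<and> dep (y e) = e" by metis
    have c1: "card (p ` {..<d}) = d"
      using card_image[OF inj_on_subset[OF inj, of "{..<d}"]] dN by force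
    have "inj_on y {a..<d}" using y x(2) by (intro inj_onI) (metis atLeastLessThan_iff dual_order.trans less_imp_le)
    then have c2: "card (y ` {a..<d}) = d - a" by (simp add: card_image)
    have "p ` {..<d} \<inter> y ` {a..<d} = {}"
    proof -
      have False if "i < d" "a \<le> e" "e < d" "p i = y e" for i e
      proof -
        have "i = e" using that p(1)[of i] y[of e] x dN by auto
        moreover have "e < N" using that(3) dN(1) by simp
        ultimately show False using that y[of e] pD[of e] x by auto
      qed
      then show ?thesis by auto
    qed
    then have "card (p ` {..<d} \<union> y ` {a..<d}) = d + (d - a)"
      using c1 c2 by (subst card_Un_disjoint) auto
    moreover have "p ` {..<d} \<union> y ` {a..<d} \<subseteq> {v \<in> V. dep v < d}"
      using p(1) y x dN D(1) by fastforce
    then have "card (p ` {..<d} \<union> y ` {a..<d}) \<le> card {v \<in> V. dep v < d}"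
      using fin by (intro card_mono) auto
    ultimately have "d + (d - a) \<le> card {v \<in> V. dep v < d}" by simp
    then show ?thesis using dN(2) lv kaq False by simp
  qed
  moreover have "2 ^ k \<le> card (output_seqs V A k) * 2 ^ d"
  proof -
    have "level_seqs V dep k \<subseteq> output_seqs V A k"
      using arc AV unfolding level_seqs_def output_seqs_def by blast
    then have "card (level_seqs V dep k) \<le> card (output_seqs V A k)"
      by (intro card_mono finite_output_seqs fin)
    then show ?thesis
      using card_level_seqs[where V = V and dep = dep and N = N and j = k, OF fin dep] card_mono[OF fin D(1)]
      unfolding d_def k_def by (meson le_trans mult_le_mono1)
  qed
  \<comment> \<open>Squared because the estimate above bounds \<open>2 * d\<close> rather than
    \<open>d\<close>.\<close>
  then have "2 ^ (2 * k) \<le> card (output_seqs V A k) ^ 2 * 2 ^ (2 * d)"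
  proof -
    assume a: "2 ^ k \<le> card (output_seqs V A k) * 2 ^ d"
    have "2 ^ (2 * k) = (2 ^ k :: nat) ^ 2" by (simp add: power_mult[symmetric] mult.commute)
    also have "\<dots> \<le> (card (output_seqs V A k) * 2 ^ d) ^ 2" using a by (intro power_mono) auto
    also have "\<dots> = card (output_seqs V A k) ^ 2 * 2 ^ (2 * d)"
      by (simp add: power_mult_distrib power_mult[symmetric] mult.commute)
    finally show ?thesis .
  qed
  ultimately have "2 ^ (2 * d) * 2 ^ q \<le> 2 ^ (2 * d) * card (output_seqs V A k) ^ 2"
  proof -
    have "2 ^ (2 * d) * 2 ^ q = (2 ^ (2 * d + q) :: nat)" by (simp add: power_add)
    also have "\<dots> \<le> 2 ^ (2 * k)" using \<open>2 * d + q \<le> 2 * k\<close> by (intro power_increasing) auto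
    also have "\<dots> \<le> card (output_seqs V A k) ^ 2 * 2 ^ (2 * d)" by fact
    finally show ?thesis by (simp add: mult.commute)
  qed
  then show ?thesis unfolding q_def k_def by simp
qed

subsection \<open>Free vertices\<close>

text \<open>The last \<open>h\<close> outputs are replaced by an arbitrary arrangement of
  \<open>h\<close> vertices of \<open>Y\<close>. These must be free once \<open>k - h\<close>
  vertices have been output; as the times \<open>s\<close> are distinct, at most \<open>h\<close>
  vertices of \<open>Y\<close> have a time of \<open>k - h\<close> or later.\<close>

lemma fact_half_le:
  assumes fin: "finite V" and vs: "vs \<in> output_seqs V A k"
    and Y: "Y \<subseteq> V - set vs" and s: "inj_on s Y" "\<And>y. y \<in> Y \<Longrightarrow> s y < k"
    and free: "\<And>u y. y \<in> Y \<Longrightarrow> (u, y) \<in> A \<Longrightarrow> u \<in> set (take (s y) vs)"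
  shows "fact (card Y div 2) \<le> card (output_seqs V A k)"
proof -
  define h where "h = card Y div 2"
  have fY: "finite Y" using Y fin by (meson finite_Diff finite_subset)
  have "card Y \<le> k" using card_inj_on_le[OF s(1), of "{..<k}"] s(2) by auto
  then have hk: "h \<le> k" by (simp add: h_def)
  define Y1 where "Y1 = {y \<in> Y. s y < k - h}"
  have "card (Y - Y1) \<le> card {k - h..<k}"
    using s by (intro card_inj_on_le[of s]) (auto simp: Y1_def inj_on_def)
  then have "h \<le> card Y1"
  proof -
    have "Y1 \<subseteq> Y" by (auto simp: Y1_def)
    then have "card Y = card Y1 + card (Y - Y1)"
      using fY by (metis card_Diff_subset card_mono finite_subset le_add_diff_inverse)
    moreover have "card (Y - Y1) \<le> h" using \<open>card (Y - Y1) \<le> card {k - h..<k}\<close> hk by simp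
    moreover have "2 * h \<le> card Y" by (simp add: h_def)
    ultimately show ?thesis by linarith
  qed
  then obtain Y2 where Y2: "Y2 \<subseteq> Y1" "card Y2 = h" "finite Y2" by (meson obtain_subset_with_card_n)
  have v: "distinct vs" "set vs \<subseteq> V" "length vs = k"
      "\<And>i u. i < k \<Longrightarrow> (u, vs ! i) \<in> A \<Longrightarrow> u \<in> set (take i vs)"
    using vs by (auto simp: output_seqs_def)
  let ?f = "\<lambda>ys. take (k - h) vs @ ys"
  have "?f ys \<in> output_seqs V A k" if "ys \<in> permutations_of_set Y2" for ys
  proof -
    have ys: "set ys = Y2" "distinct ys" "length ys = h"
      using that Y2 by (auto simp: permutations_of_set_def distinct_card)
    have "u \<in> set (take i (?f ys))" if i: "i < k" "(u, ?f ys ! i) \<in> A" for i u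
    proof (cases "i < k - h")
      case True
      then have "i < length (take (k - h) vs)" using v(3) by simp
      then have "?f ys ! i = vs ! i" "take i (?f ys) = take i vs"
        using True by (auto simp: nth_append)
      then show ?thesis using i v(4) by simp
    next
      case False
      have "ys ! (i - (k - h)) \<in> Y2" using False i ys hk by auto
      then have "u \<in> set (take (s (ys ! (i - (k - h)))) vs)" "s (ys ! (i - (k - h))) < k - h"
        using i(2) False v(3) free Y2(1) by (auto simp: nth_append Y1_def)
      then have "u \<in> set (take (k - h) vs)"
        by (meson less_imp_le_nat set_take_subset_set_take subsetD)
      then show ?thesis using False v(3) by auto
    qed
    then show ?thesis using ys v Y2(1) Y hk unfolding output_seqs_def
      by (auto simp: Y1_def dest: in_set_takeD)
  qed
  then have "card (permutations_of_set Y2) \<le> card (output_seqs V A k)"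
    using finite_output_seqs[OF fin] by (intro card_inj_on_le[of ?f]) (auto simp: inj_on_def)
  then show ?thesis using Y2 by (simp add: h_def)
qed

text \<open>Splits \<open>fact r\<close> into a binomial coefficient and two factorials of about
  \<open>r div 2\<close>. This turns the bound of \<open>fact_half_le\<close> into one on
  \<open>fact r\<close>, at the price of \<open>4 ^ r\<close>.\<close>

lemma fact_le_half_sq: "(fact r :: nat) \<le> 4 ^ r * fact (r div 2) ^ 2"
proof -
  define h where "h = r div 2"
  have le: "h \<le> r" by (simp add: h_def)
  have b: "r choose h \<le> 2 ^ r"
    using member_le_sum[of h "{..r}" "\<lambda>i. r choose i"] le choose_row_sum[of r] by auto
  have "fact (r - h) \<le> (2 ^ r * fact h :: nat)"
  proof -
    have "fact (r - h) \<le> (fact (Suc h) :: nat)" by (rule fact_mono) (auto simp: h_def)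
    also have "\<dots> = Suc h * fact h" by simp
    also have "Suc h \<le> 2 ^ r"
    proof (cases r)
      case (Suc r')
      then have "Suc h \<le> Suc r'" by (simp add: h_def)
      also have "\<dots> \<le> 2 ^ r" using Suc less_exp[of r] by linarith
      finally show ?thesis .
    qed (simp add: h_def)
    finally show ?thesis by simp
  qed
  then have "fact h * fact (r - h) * (r choose h) \<le> fact h * (2 ^ r * fact h) * 2 ^ r"
    using b by (intro mult_le_mono) auto
  also have "fact h * fact (r - h) * (r choose h) = (fact r :: nat)" by (rule binomial_fact_lemma[OF le])
  also have "fact h * (2 ^ r * fact h) * 2 ^ r = (2 ^ r * 2 ^ r) * (fact h :: nat) ^ 2"
    by (simp add: power2_eq_square mult_ac)
  also have "(2 ^ r * 2 ^ r :: nat) = 4 ^ r" by (simp flip: power_mult_distrib)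
  finally show ?thesis by (simp add: h_def)
qed

section \<open>Linear extensions of predecessor-closed sets\<close>

text \<open>The linear extensions of the graph on \<open>W\<close>, provided that \<open>W\<close>
  contains all predecessors of its vertices; if one is missing, the set is empty.\<close>

definition orders :: "'a rel \<Rightarrow> 'a set \<Rightarrow> 'a list set" where
  "orders A W = {zs \<in> output_seqs W A (card W). set zs = W}"

text \<open>The first \<open>k\<close> entries form a possible output, and the other
  \<open>r\<close> entries are charged with all their arrangements.\<close>

lemma card_orders_le:
  assumes fin: "finite V" and W: "W \<subseteq> V" "card W = k + r"
  shows "card (orders A W) \<le> card (output_seqs V A k) * fact r"
proof -
  have fW: "finite W" using fin W finite_subset by blast
  let ?P = "{xs \<in> output_seqs V A k. set xs \<subseteq> W}"
  let ?S = "Sigma ?P (\<lambda>xs. permutations_of_set (W - set xs))"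
  have c: "card (permutations_of_set (W - set xs)) = fact r" if "xs \<in> ?P" for xs
    using that W fW by (auto simp: output_seqs_def card_Diff_subset distinct_card)
  have "(\<lambda>zs. (take k zs, drop k zs)) ` orders A W \<subseteq> ?S"
  proof clarsimp
    fix zs assume "zs \<in> orders A W"
    then have z: "distinct zs" "set zs = W" "length zs = k + r"
        "\<And>i u. i < k + r \<Longrightarrow> (u, zs ! i) \<in> A \<Longrightarrow> u \<in> set (take i zs)"
      using W by (auto simp: orders_def output_seqs_def)
    have "W = set (take k zs) \<union> set (drop k zs)" using z(2) by (metis append_take_drop_id set_append)
    moreover have "set (take k zs) \<inter> set (drop k zs) = {}"
      using z(1) by (simp add: set_take_disj_set_drop_if_distinct)
    ultimately have W': "set (take k zs) \<subseteq> W" "W - set (take k zs) = set (drop k zs)" by blast+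
    have "u \<in> set (take i (take k zs))" if "i < k" "(u, take k zs ! i) \<in> A" for i u
      using z(4)[of i u] that by simp
    then have "take k zs \<in> output_seqs V A k"
      using z(1,3) W' W(1) by (simp add: output_seqs_def)
    moreover have "drop k zs \<in> permutations_of_set (W - set (take k zs))"
      using z(1) W'(2) by (simp add: permutations_of_set_def)
    ultimately show "take k zs \<in> output_seqs V A k \<and> set (take k zs) \<subseteq> W \<and>
        drop k zs \<in> permutations_of_set (W - set (take k zs))"
      using W' by blast
  qed
  then have "card (orders A W) \<le> card ?S"
    using finite_output_seqs[OF fin] fW
    by (intro card_inj_on_le[of "\<lambda>zs. (take k zs, drop k zs)"])
      (auto intro!: inj_onI, metis append_take_drop_id)
  also have "card ?S = card ?P * fact r"
    using finite_output_seqs[OF fin] fW c by (subst card_SigmaI) auto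
  also have "\<dots> \<le> card (output_seqs V A k) * fact r"
    using finite_output_seqs[OF fin] by (intro mult_le_mono1 card_mono) auto
  finally show ?thesis .
qed

subsection \<open>Placing vertices in their time intervals\<close>

definition before :: "'a list \<Rightarrow> 'a \<Rightarrow> 'a \<Rightarrow> bool" where
  "before zs a b \<longleftrightarrow> (\<exists>i j. i < j \<and> j < length zs \<and> zs ! i = a \<and> zs ! j = b)"

lemma before_key:
  fixes f :: "'a \<Rightarrow> nat"
  assumes "sorted (map f zs)" "a \<in> set zs" "b \<in> set zs" 
  shows "f a < f b \<Longrightarrow> before zs a b" and "before zs a b \<Longrightarrow> f a \<le> f b"
proof -
  obtain i j where ij: "i < length zs" "zs ! i = a" "j < length zs" "zs ! j = b"
    using assms by (auto simp: in_set_conv_nth)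
  { assume "f a < f b"
    then have "\<not> j \<le> i" using sorted_nth_mono[OF assms(1), of j i] ij by auto
    then have "i < j" by simp
    then show "before zs a b" using ij unfolding before_def by blast }
  { assume "before zs a b"
    then show "f a \<le> f b"
      using sorted_nth_mono[OF assms(1)] unfolding before_def by (metis length_map less_imp_le nth_map order.strict_trans) }
qed

lemma before_total:
  assumes "distinct zs" "a \<in> set zs" "b \<in> set zs" "a \<noteq> b"
  shows "before zs a b \<longleftrightarrow> \<not> before zs b a"
proof -
  obtain i j where ij: "i < length zs" "zs ! i = a" "j < length zs" "zs ! j = b"
    using assms by (auto simp: in_set_conv_nth)
  have "before zs a b \<longleftrightarrow> i < j" "before zs b a \<longleftrightarrow> j < i"
    using ij assms(1) unfolding before_def by (metis nth_eq_iff_index_eq less_trans)+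
  moreover have "i \<noteq> j" using ij assms(4) by auto
  ultimately show ?thesis by auto
qed

lemma before_irrefl: "distinct zs \<Longrightarrow> \<not> before zs a a"
  unfolding before_def by (auto simp: nth_eq_iff_index_eq)

lemma before_trans: "distinct zs \<Longrightarrow> before zs a b \<Longrightarrow> before zs b c \<Longrightarrow> before zs a c"
  unfolding before_def by (metis less_trans nth_eq_iff_index_eq)

text \<open>A choice \<open>g\<close> of a time for every \<open>x \<in> X\<close> is determined by the resulting order \<open>zs\<close> and a subset
  of \<open>card X + card F\<close> numbers, where \<open>F\<close> are the times not taken by \<open>Q\<close>: the time of \<open>x\<close> is the number
  of earlier times, those in \<open>F\<close> and those of the elements of \<open>Q\<close> that precede \<open>x\<close> in \<open>zs\<close>.\<close>

lemma prod_intervals_le: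
  fixes lo hi :: "'a \<Rightarrow> nat"
  assumes fin: "finite X" "finite Q" "X \<inter> Q = {}"
    and lohi: "\<And>x. x \<in> X \<Longrightarrow> lo x \<le> hi x \<and> hi x < M"
    and hiQ: "inj_on hi Q" "\<And>w. w \<in> Q \<Longrightarrow> lo w = hi w \<and> hi w < M"
    and arc: "\<And>u v. (u, v) \<in> A \<Longrightarrow> v \<in> X \<union> Q \<Longrightarrow> u \<in> X \<union> Q \<and> hi u < lo v"
  shows "(\<Prod>x \<in> X. Suc (hi x - lo x)) \<le> 2 ^ (card X + card ({..<M} - hi ` Q)) * card (orders A (X \<union> Q))"
proof -
  define F where "F = {..<M} - hi ` Q"
  have fF: "finite F" by (simp add: F_def)
  obtain ws where ws: "set ws = X \<union> Q" "distinct ws"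
    using finite_distinct_list[of "X \<union> Q"] fin by auto
  \<comment> \<open>Even keys for \<open>X\<close> and odd ones for \<open>Q\<close>: at equal times
    the element of \<open>X\<close> comes first, so that \<open>w \<in> Q\<close> precedes
    \<open>x\<close> exactly if \<open>hi w < g x\<close>.\<close>
  define key where "key g v = (if v \<in> X then 2 * g v else 2 * hi v + 1)" for g :: "'a \<Rightarrow> nat" and v
  define zs where "zs g = sort_key (key g) ws" for g
  define \<phi> where "\<phi> g x = card {f \<in> F. f < g x}" for g :: "'a \<Rightarrow> nat" and x :: 'a
  \<comment> \<open>\<open>\<phi>\<close> is only weakly increasing along \<open>zs g\<close>.
    Adding the rank within \<open>X\<close> makes it strict, so that the set of values together with
    \<open>zs g\<close> determines the value of each \<open>x\<close>.\<close>
  define \<sigma> where "\<sigma> g x = \<phi> g x + card {y \<in> X. before (zs g) y x}" for g x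
  let ?G = "Pi\<^sub>E X (\<lambda>x. {lo x..hi x})"
  have z: "distinct (zs g)" "set (zs g) = X \<union> Q" "sorted (map (key g) (zs g))" for g
    using ws by (auto simp: zs_def)
  \<comment> \<open>Every time below \<open>g x\<close> is either in \<open>F\<close> or taken by
    exactly one element of \<open>Q\<close>.\<close>
  have g_eq: "g x = \<phi> g x + card {w \<in> Q. before (zs g) w x}" if g: "g \<in> ?G" and x: "x \<in> X" for g x
  proof -
    have "before (zs g) w x \<longleftrightarrow> hi w < g x" if w: "w \<in> Q" for w
    proof -
      have "w \<notin> X" using w fin(3) by auto
      moreover have "w \<in> set (zs g)" "x \<in> set (zs g)" using w x z by auto
      ultimately show ?thesis using before_key[OF z(3)[of g], of w x] x by (auto simp: key_def)
    qed
    then have e: "{w \<in> Q. before (zs g) w x} = {w \<in> Q. hi w < g x}" by auto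
    have gM: "g x < M" using g x lohi[OF x] by (force simp: PiE_iff)
    have "{..<g x} = {f \<in> F. f < g x} \<union> hi ` {w \<in> Q. hi w < g x}"
      using gM by (auto simp: F_def)
    moreover have "{f \<in> F. f < g x} \<inter> hi ` {w \<in> Q. hi w < g x} = {}" by (auto simp: F_def)
    ultimately have "card {..<g x} = \<phi> g x + card (hi ` {w \<in> Q. hi w < g x})"
      unfolding \<phi>_def using fF fin by (simp add: card_Un_disjoint)
    moreover have "card (hi ` {w \<in> Q. hi w < g x}) = card {w \<in> Q. hi w < g x}"
      using hiQ(1) by (intro card_image) (auto simp: inj_on_def)
    ultimately show ?thesis using e by simp
  qed
  have \<sigma>_less: "\<sigma> g y < \<sigma> g x" if "x \<in> X" "y \<in> X" "before (zs g) y x" for g x y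
  proof -
    have "key g y \<le> key g x" using before_key(2)[OF z(3)] that z(2) by blast
    then have "g y \<le> g x" using that by (simp add: key_def)
    then have "\<phi> g y \<le> \<phi> g x" unfolding \<phi>_def using fF by (intro card_mono) auto
    moreover have "card {v \<in> X. before (zs g) v y} < card {v \<in> X. before (zs g) v x}"
    proof (rule psubset_card_mono)
      show "{v \<in> X. before (zs g) v y} \<subset> {v \<in> X. before (zs g) v x}"
        using that before_trans[OF z(1)] before_irrefl[OF z(1)] by blast
    qed (use fin in simp)
    ultimately show ?thesis by (simp add: \<sigma>_def)
  qed
  \<comment> \<open>By strict monotonicity the rank of a value among all values is the rank of its
    item in \<open>zs g\<close>, which is how the decoding finds the value of
    \<open>x\<close>.\<close>
  have \<sigma>_rank: "card {s \<in> \<sigma> g ` X. s < \<sigma> g x} = card {y \<in> X. before (zs g) y x}" if x: "x \<in> X" for g x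
  proof -
    have "before (zs g) y x \<longleftrightarrow> \<sigma> g y < \<sigma> g x" if "y \<in> X" for y
      using \<sigma>_less x that before_total[OF z(1)[of g], of y x] z(2)[of g]
      by (metis UnCI less_asym less_irrefl)
    then have "{s \<in> \<sigma> g ` X. s < \<sigma> g x} = \<sigma> g ` {y \<in> X. before (zs g) y x}" by auto
    moreover have "inj_on (\<sigma> g) X"
      using \<sigma>_less before_total[OF z(1)[of g]] z(2)[of g] by (intro inj_onI) (metis UnCI less_irrefl)
    then have "inj_on (\<sigma> g) {y \<in> X. before (zs g) y x}" by (rule inj_on_subset) auto
    ultimately show ?thesis by (simp add: card_image)
  qed
  have \<sigma>_bound: "\<sigma> g ` X \<subseteq> {..<card X + card F}" for g
  proof clarsimp
    fix x assume x: "x \<in> X"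
    have "\<phi> g x \<le> card F" unfolding \<phi>_def using fF by (intro card_mono) auto
    moreover have "card {y \<in> X. before (zs g) y x} < card X"
      using x fin before_irrefl[OF z(1)] by (intro psubset_card_mono) auto
    ultimately show "\<sigma> g x < card X + card F" by (simp add: \<sigma>_def)
  qed
  have inj: "inj_on (\<lambda>g. (zs g, \<sigma> g ` X)) ?G"
  proof (rule inj_onI)
    fix g g' assume g: "g \<in> ?G" and g': "g' \<in> ?G" and "(zs g, \<sigma> g ` X) = (zs g', \<sigma> g' ` X)"
    then have e: "zs g = zs g'" "\<sigma> g ` X = \<sigma> g' ` X" by auto
    have "g x = g' x" if x: "x \<in> X" for x
    proof -
      have "\<sigma> g x = \<sigma> g' x"
      proof (rule ccontr)
        have *: "card {s \<in> S. s < a} < card {s \<in> S. s < b}"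
          if "finite S" "a \<in> S" "a < b" for S :: "nat set" and a b
          using that by (intro psubset_card_mono) auto
        have S: "finite (\<sigma> g ` X)" "\<sigma> g x \<in> \<sigma> g ` X" "\<sigma> g' x \<in> \<sigma> g ` X"
          using fin x by (simp_all add: e(2)) (simp flip: e(2))
        have "card {s \<in> \<sigma> g ` X. s < \<sigma> g x} = card {s \<in> \<sigma> g ` X. s < \<sigma> g' x}"
          using \<sigma>_rank[OF x, of g] \<sigma>_rank[OF x, of g'] unfolding e by simp
        moreover assume "\<sigma> g x \<noteq> \<sigma> g' x"
        ultimately show False
          using *[OF S(1,2), of "\<sigma> g' x"] *[OF S(1,3), of "\<sigma> g x"] by (auto simp: neq_iff)
      qed
      then have "\<phi> g x = \<phi> g' x" using e by (simp add: \<sigma>_def)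
      then show ?thesis using g_eq[OF g x] g_eq[OF g' x] e by simp
    qed
    then show "g = g'" by (rule PiE_ext[OF g g'])
  qed
  have "(\<lambda>g. (zs g, \<sigma> g ` X)) ` ?G \<subseteq> orders A (X \<union> Q) \<times> Pow {..<card X + card F}"
  proof clarify
    fix g assume g: "g \<in> ?G"
    have len: "length (zs g) = card (X \<union> Q)" using z by (metis distinct_card)
    have "u \<in> set (take i (zs g))" if i: "i < card (X \<union> Q)" "(u, zs g ! i) \<in> A" for i u
    proof -
      define v where "v = zs g ! i"
      have v: "v \<in> X \<union> Q" unfolding v_def using i len z(2) by (metis nth_mem)
      have u: "u \<in> X \<union> Q" "hi u < lo v" using arc[OF _ v] i(2) by (auto simp: v_def)
      \<comment> \<open>The strict gap \<open>hi u < lo v\<close> absorbs the offset 1 of the keys,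
        whether \<open>u\<close> and \<open>v\<close> belong to \<open>X\<close> or to
        \<open>Q\<close>.\<close>
      have "key g u \<le> 2 * hi u + 1" using u(1) g lohi by (auto simp: key_def PiE_iff)
      also have "\<dots> < 2 * lo v" using u(2) by simp
      also have "\<dots> \<le> key g v" using v g hiQ(2)[of v] by (auto simp: key_def PiE_iff)
      finally have "before (zs g) u v" using before_key(1)[OF z(3)] u v z(2) by blast
      then obtain j where "j < i" "zs g ! j = u"
        using i len z(1) unfolding before_def v_def by (metis nth_eq_iff_index_eq)
      then show ?thesis using i len by (force simp: in_set_conv_nth)
    qed
    then have "zs g \<in> orders A (X \<union> Q)" using z len by (auto simp: orders_def output_seqs_def)
    moreover have "\<sigma> g ` X \<in> Pow {..<card X + card F}" using \<sigma>_bound by blast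
    ultimately show "zs g \<in> orders A (X \<union> Q) \<and> \<sigma> g ` X \<in> Pow {..<card X + card F}" by blast
  qed
  moreover have "finite (orders A (X \<union> Q))"
    unfolding orders_def using finite_output_seqs[of "X \<union> Q" A] fin by simp
  ultimately have "card ?G \<le> card (orders A (X \<union> Q) \<times> Pow {..<card X + card F})"
    by (intro card_inj_on_le[OF inj] finite_cartesian_product) auto
  also have "\<dots> = 2 ^ (card X + card F) * card (orders A (X \<union> Q))"
    by (simp add: card_cartesian_product card_Pow)
  also have "card ?G = (\<Prod>x \<in> X. Suc (hi x - lo x))"
    using fin lohi by (subst card_PiE) (auto intro!: prod.cong simp: Suc_diff_le)
  finally show ?thesis by (simp add: F_def)
qed

text \<open>The logarithm of the counting bound. One factor \<open>?T\<close> comes from the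
  beginning of a linear extension and two from the factorial for the \<open>card Y\<close> vertices
  behind it, hence \<open>3 * OPT V A k\<close>.\<close>

lemma sum_exponents_le:
  fixes lo hi e s :: "'a \<Rightarrow> nat"
  assumes L: "topological_order V A L" and fin: "finite V" and k: "k \<le> card V"
    and vs: "vs \<in> output_seqs V A k"
    and Y: "Y \<subseteq> V - set vs" and s: "inj_on s Y" "\<And>y. y \<in> Y \<Longrightarrow> s y < k"
    and free: "\<And>u y. y \<in> Y \<Longrightarrow> (u, y) \<in> A \<Longrightarrow> u \<in> set (take (s y) vs)"
    and XQ: "X \<inter> Q = {}" "X \<union> Q = set vs \<union> Y"
    and lohi: "\<And>x. x \<in> X \<Longrightarrow> lo x \<le> hi x \<and> hi x < M"
    and hiQ: "inj_on hi Q" "\<And>w. w \<in> Q \<Longrightarrow> lo w = hi w \<and> hi w < M"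
    and arc: "\<And>u v. (u, v) \<in> A \<Longrightarrow> v \<in> X \<union> Q \<Longrightarrow> hi u < lo v"
    and e: "\<And>x. x \<in> X \<Longrightarrow> 2 ^ e x \<le> Suc (hi x - lo x)"
  shows "sum e X \<le> card X + card ({..<M} - hi ` Q) + 2 * card Y + 3 * OPT V A k"
proof -
  let ?T = "card (output_seqs V A k)" and ?r = "card Y"
  have fY: "finite Y" using Y fin by (meson finite_Diff finite_subset)
  have v: "distinct vs" "set vs \<subseteq> V" "length vs = k"
      "\<And>i u. i < k \<Longrightarrow> (u, vs ! i) \<in> A \<Longrightarrow> u \<in> set (take i vs)"
    using vs by (auto simp: output_seqs_def)
  have fXQ: "finite X" "finite Q" using XQ(2) fY by (metis finite_Un List.finite_set)+
  have sub: "X \<union> Q \<subseteq> V" using XQ(2) v Y by auto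
  have cW: "card (X \<union> Q) = k + ?r"
    unfolding XQ(2) using Y fY v by (subst card_Un_disjoint) (auto simp: distinct_card)
  have cl: "u \<in> X \<union> Q" if uw: "(u, w) \<in> A" "w \<in> X \<union> Q" for u w
  proof -
    consider "w \<in> set vs" | "w \<in> Y" using uw XQ by auto
    then show ?thesis
    proof cases
      case 1
      then obtain i where "i < k" "w = vs ! i" using v(3) by (auto simp: in_set_conv_nth)
      then have "u \<in> set vs" using v(4) uw(1) by (metis in_set_takeD)
      then show ?thesis using XQ by auto
    next
      case 2
      then show ?thesis using free[OF 2 uw(1)] XQ by (auto dest: in_set_takeD)
    qed
  qed
  have T: "?T \<le> 2 ^ OPT V A k"
    using card_output_seqs_le[OF L fin] num_outputs_le_OPT[OF fin k] le_trans by blast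
  have "2 ^ sum e X = (\<Prod>x \<in> X. 2 ^ e x :: nat)" by (simp add: power_sum)
  also have "\<dots> \<le> (\<Prod>x \<in> X. Suc (hi x - lo x))" using e by (intro prod_mono) auto
  also have "\<dots> \<le> 2 ^ (card X + card ({..<M} - hi ` Q)) * card (orders A (X \<union> Q))"
    using arc cl by (intro prod_intervals_le[OF fXQ XQ(1) lohi hiQ]) auto
  also have "card (orders A (X \<union> Q)) \<le> ?T * fact ?r" by (rule card_orders_le[OF fin sub cW])
  also have "(fact ?r :: nat) \<le> 4 ^ ?r * fact (?r div 2) ^ 2" by (rule fact_le_half_sq)
  also have "(fact (?r div 2) :: nat) \<le> ?T" by (rule fact_half_le[OF fin vs Y s free])
  finally have "2 ^ sum e X \<le> 2 ^ (card X + card ({..<M} - hi ` Q)) * (?T * (4 ^ ?r * ?T ^ 2))"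
    by (simp add: power_mono)
  also have "\<dots> = 2 ^ (card X + card ({..<M} - hi ` Q) + 2 * ?r) * ?T ^ 3"
    by (simp add: power_add power_mult power3_eq_cube power2_eq_square)
  also have "\<dots> \<le> 2 ^ (card X + card ({..<M} - hi ` Q) + 2 * ?r) * (2 ^ OPT V A k) ^ 3"
    using T by (intro mult_le_mono2 power_mono) auto
  also have "\<dots> = 2 ^ (card X + card ({..<M} - hi ` Q) + 2 * ?r + 3 * OPT V A k)"
    by (simp add: power_add power_mult[symmetric] mult.commute)
  finally show ?thesis by simp
qed

section \<open>Histories\<close>

text \<open>\<open>Inl x\<close> stands for the insertion of \<open>x\<close> into the heap, \<open>Inr v\<close> for the output of \<open>v\<close>.\<close>

definition inserted :: "('a + 'a) list \<Rightarrow> 'a list" where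
  "inserted ev = [x. Inl x \<leftarrow> ev]"

definition popped :: "('a + 'a) list \<Rightarrow> 'a list" where
  "popped ev = [x. Inr x \<leftarrow> ev]"

lemma history_simps [simp]:
  "inserted [] = []" "inserted (Inl x # ev) = x # inserted ev" "inserted (Inr x # ev) = inserted ev"
  "inserted (ev @ ev') = inserted ev @ inserted ev'"
  "popped [] = []" "popped (Inl x # ev) = popped ev" "popped (Inr x # ev) = x # popped ev"
  "popped (ev @ ev') = popped ev @ popped ev'"
  by (auto simp: inserted_def popped_def)

lemma set_inserted: "set (inserted ev) = {x. Inl x \<in> set ev}"
  and set_popped: "set (popped ev) = {x. Inr x \<in> set ev}"
  by (auto simp: inserted_def popped_def split: sum.splits)

lemma distinct_history: "distinct ev \<longleftrightarrow> distinct (inserted ev) \<and> distinct (popped ev)"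
proof (induction ev)
  case (Cons e ev)
  then show ?case by (cases e) (auto simp: set_inserted set_popped)
qed simp

lemma length_history: "length ev = length (inserted ev) + length (popped ev)"
proof (induction ev)
  case (Cons e ev)
  then show ?case by (cases e) auto
qed simp

definition ix :: "'b list \<Rightarrow> 'b \<Rightarrow> nat" where
  "ix ev e = (LEAST i. i < length ev \<and> ev ! i = e)"

lemma ix: "e \<in> set ev \<Longrightarrow> ix ev e < length ev \<and> ev ! ix ev e = e"
  unfolding ix_def by (rule LeastI_ex) (simp add: in_set_conv_nth)

lemma ix_eq: "distinct ev \<Longrightarrow> i < length ev \<Longrightarrow> ix ev (ev ! i) = i"
  using ix[of "ev ! i" ev] nth_eq_iff_index_eq[of ev "ix ev (ev ! i)" i] by simp

lemma ix_less: "distinct ev \<Longrightarrow> b \<le> length ev \<Longrightarrow> e \<in> set (take b ev) \<Longrightarrow> ix ev e < b"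
  using ix_eq[of ev] by (auto simp: in_set_conv_nth)

lemma smallest_sorted_distinct:
  assumes "topological_order V A L" "smallest_sorted V L k vs"
  shows "distinct vs"
proof -
  have "sorted_wrt (\<lambda>x y. (x, y) \<in> L) zs \<Longrightarrow> distinct zs" for zs
    using topological_orderD(2)[OF assms(1)] by (induction zs) (auto simp: irrefl_def)
  then show ?thesis using assms(2) by (simp add: smallest_sorted_def)
qed

lemma smallest_sorted_output_seqs:
  assumes L: "topological_order V A L" and vs: "smallest_sorted V L k vs"
  shows "vs \<in> output_seqs V A k"
proof -
  have "u \<in> set (take i vs)" if i: "i < k" "(u, vs ! i) \<in> A" for i u
  proof -
    have uL: "(u, vs ! i) \<in> L" "u \<in> V" using i topological_orderD(4,5)[OF L] by auto
    have len: "length vs = k" using vs by (simp add: smallest_sorted_def)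
    have "u \<in> set vs"
    proof (rule ccontr)
      assume "u \<notin> set vs"
      then have "(vs ! i, u) \<in> L" using vs uL i len by (auto simp: smallest_sorted_def)
      then show False using uL topological_order_asym[OF L] by blast
    qed
    then obtain j where j: "j < k" "u = vs ! j" using len by (auto simp: in_set_conv_nth)
    have "j < i"
    proof (rule ccontr)
      assume "\<not> j < i"
      then consider "i = j" | "i < j" by linarith
      then have "j = i \<or> (vs ! i, vs ! j) \<in> L"
        using vs j len by cases (auto simp: smallest_sorted_def sorted_wrt_iff_nth_less)
      then show False
        using uL j topological_order_asym[OF L uL(1)] topological_orderD(2)[OF L] by (auto simp: irrefl_def)
    qed
    then show ?thesis using j len i by (auto simp: in_set_conv_nth)
  qed
  then show ?thesis
    using vs smallest_sorted_distinct[OF L vs] by (auto simp: output_seqs_def smallest_sorted_def)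
qed

section \<open>Charging the costs of one run to \<open>OPT\<close>\<close>

context
  fixes V :: "'a set" and A L :: "'a rel" and k :: nat and vs :: "'a list" and P :: "'a set"
    and ev :: "('a + 'a) list"
  assumes L: "topological_order V A L" and fin: "finite V" and k: "0 < k" "k \<le> card V"
    and vs: "smallest_sorted V L k vs" and pop: "popped ev = vs"
    and off: "2 ^ card (set vs - P) \<le> card (output_seqs V A k) ^ 2"
    and ins: "distinct (inserted ev)" "set (inserted ev) \<subseteq> V - P"
    and free: "\<And>a x u. a < length ev \<Longrightarrow> ev ! a = Inl x \<Longrightarrow> (u, x) \<in> A \<Longrightarrow> u \<in> set (popped (take a ev))"
    and early: "\<And>a x. a < length ev \<Longrightarrow> ev ! a = Inl x \<Longrightarrow> length (popped (take a ev)) < k"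
    and via: "\<And>b v. b < length ev \<Longrightarrow> ev ! b = Inr v \<Longrightarrow> v \<notin> P \<Longrightarrow> Inl v \<in> set (take b ev)"
begin

lemma T_le: "card (output_seqs V A k) \<le> 2 ^ OPT V A k"
  using card_output_seqs_le[OF L fin] num_outputs_le_OPT[OF fin k(2)] le_trans by blast

lemma off_path_le: "card (set vs - P) \<le> 2 * OPT V A k"
proof -
  have "2 ^ card (set vs - P) \<le> ((2 :: nat) ^ OPT V A k) ^ 2"
    using off power_mono[OF T_le, of 2] by (rule le_trans) simp
  also have "\<dots> = 2 ^ (2 * OPT V A k)" by (simp add: power_mult[symmetric] mult.commute)
  finally show ?thesis by simp
qed

text \<open>Outputs off \<open>P\<close> contribute \<open>2 * OPT\<close> by the level argument.
  Every other inserted item entered the heap before the k-th output was made, so it could have been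
  the k-th itself and falls under \<open>free_le_OPT\<close>.\<close>

lemma inserted_le: "length (inserted ev) \<le> 3 * OPT V A k"
proof -
  let ?R = "set (inserted ev) - set vs"
  have "card ?R \<le> OPT V A k"
  proof (rule free_le_OPT[OF fin k(2) L vs k(1)])
    show "?R \<subseteq> V - set vs" using ins by auto
    fix y u assume y: "y \<in> ?R" "(u, y) \<in> A"
    then obtain a where a: "a < length ev" "ev ! a = Inl y" by (auto simp: set_inserted in_set_conv_nth)
    have "popped (take a ev) @ popped (drop a ev) = vs"
      using pop by (metis append_take_drop_id history_simps(8))
    then have "popped (take a ev) = take (length (popped (take a ev))) vs" by (metis append_eq_conv_conj)
    moreover have "length (popped (take a ev)) \<le> k - 1" using early[OF a] by simp
    ultimately have "set (popped (take a ev)) \<subseteq> set (take (k - 1) vs)" by (metis set_take_subset_set_take)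
    then show "u \<in> set (take (k - 1) vs)" using free[OF a y(2)] by blast
  qed
  moreover have "length (inserted ev) = card (set (inserted ev))" using ins(1) by (simp add: distinct_card)
  moreover have "set (inserted ev) \<subseteq> (set vs - P) \<union> ?R" using ins(2) by auto
  then have "card (set (inserted ev)) \<le> card ((set vs - P) \<union> ?R)" by (intro card_mono) auto
  moreover have "card ((set vs - P) \<union> ?R) \<le> card (set vs - P) + card ?R" by (rule card_Un_le)
  ultimately show ?thesis using off_path_le by linarith
qed

text \<open>Used twice: for the searches, where \<open>Y\<close> are the items searched but never
  output, and for the deletions, where \<open>Y\<close> is empty. Path vertices keep the time of
  their output, all others move freely between their insertion and their output or, for
  \<open>Y\<close>, the end of the history.\<close>

lemma sum_costs_le:
  assumes Y: "Y \<subseteq> set (inserted ev) - set vs" and s: "inj_on s Y" "\<And>y. y \<in> Y \<Longrightarrow> s y < k"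
    and free_Y: "\<And>u y. y \<in> Y \<Longrightarrow> (u, y) \<in> A \<Longrightarrow> u \<in> set (take (s y) vs)"
    and e1: "\<And>x. x \<in> set vs - P \<Longrightarrow> \<exists>a b. a < length ev \<and> b < length ev \<and> ev ! a = Inl x \<and> ev ! b = Inr x \<and> 2 ^ e x \<le> Suc (b - a)"
    and e2: "\<And>x. x \<in> Y \<Longrightarrow> \<exists>a. a < length ev \<and> ev ! a = Inl x \<and> 2 ^ e x \<le> Suc (length ev - a)"
  shows "sum e ((set vs - P) \<union> Y) \<le> 18 * OPT V A k + 1"
proof -
  note dvs = smallest_sorted_distinct[OF L vs]
  have dev: "distinct ev" using dvs pop ins(1) by (simp add: distinct_history)
  \<comment> \<open>Time \<open>length ev\<close> is an extra slot for the items that stay in the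
    heap, whence there are \<open>Suc (length ev)\<close> times.\<close>
  define hi where "hi x = (if x \<in> set vs then ix ev (Inr x) else length ev)" for x
  define Q where "Q = set vs \<inter> P"
  define X where "X = (set vs - P) \<union> Y"
  define lo where "lo x = (if x \<in> Q then hi x else ix ev (Inl x))" for x
  have Inr: "Inr v \<in> set ev" if "v \<in> set vs" for v using that pop set_popped[of ev] by auto
  have Inl: "Inl x \<in> set ev" if "x \<in> X" for x
  proof (cases "x \<in> Y")
    case True
    then show ?thesis using Y by (auto simp: set_inserted)
  next
    case False
    then have "x \<in> set vs" "x \<notin> P" using that by (auto simp: X_def)
    then show ?thesis using via[of "ix ev (Inr x)" x] ix[OF Inr] by (auto dest: in_set_takeD)
  qed
  have XQ: "X \<inter> Q = {}" using Y by (auto simp: X_def Q_def)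
  have lohi: "lo x \<le> hi x \<and> hi x < Suc (length ev)" if "x \<in> X" for x
  proof -
    have "x \<notin> Q" using that XQ by auto
    show ?thesis
    proof (cases "x \<in> set vs")
      case True
      then have "x \<notin> P" using that Y by (auto simp: X_def)
      then have "Inl x \<in> set (take (ix ev (Inr x)) ev)" using via[of "ix ev (Inr x)" x] ix[OF Inr[OF True]] by simp
      then have "ix ev (Inl x) < ix ev (Inr x)"
        using ix_less[OF dev] ix[OF Inr[OF True]] by simp
      then show ?thesis using True \<open>x \<notin> Q\<close> ix[OF Inr[OF True]] by (simp add: lo_def hi_def)
    next
      case False
      then show ?thesis using ix[OF Inl[OF that]] \<open>x \<notin> Q\<close> by (simp add: lo_def hi_def)
    qed
  qed
  have hiQ: "inj_on hi Q"
  proof (rule inj_onI)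
    fix v w assume a: "v \<in> Q" "w \<in> Q" "hi v = hi w"
    have h: "ev ! hi v = Inr v" "ev ! hi w = Inr w"
      using ix[OF Inr, of v] ix[OF Inr, of w] a(1,2) by (simp_all add: hi_def Q_def)
    have "(Inr v :: 'a + 'a) = ev ! hi w" unfolding a(3)[symmetric] by (rule h(1)[symmetric])
    also have "\<dots> = Inr w" by (rule h(2))
    finally show "v = w" by (rule sum.inject(2)[THEN iffD1])
  qed
  have hiQ2: "lo w = hi w \<and> hi w < Suc (length ev)" if "w \<in> Q" for w
    using that ix[OF Inr, of w] by (simp add: lo_def hi_def Q_def less_SucI)
  \<comment> \<open>A predecessor is output before \<open>v\<close> is inserted, or before the path
    vertex \<open>v\<close> is output. So intervals joined by an arc are disjoint, and any choice of
    times respects the arcs.\<close>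
  have arc: "hi u < lo v" if uv: "(u, v) \<in> A" "v \<in> X \<union> Q" for u v
  proof -
    define c where "c = lo v"
    have c: "c < length ev \<and> u \<in> set (popped (take c ev))"
    proof (cases "v \<in> Q")
      case False
      then have v: "v \<in> X" "c = ix ev (Inl v)" using uv by (auto simp: lo_def c_def)
      then show ?thesis using ix[OF Inl[OF v(1)]] free[of c v u] uv by simp
    next
      case True
      then have v: "v \<in> set vs" "c = ix ev (Inr v)" by (auto simp: lo_def c_def hi_def Q_def)
      note i = ix[OF Inr[OF v(1)]]
      have "ev = take c ev @ Inr v # drop (Suc c) ev" using i v(2) id_take_nth_drop[of c ev] by simp
      then have e: "vs = popped (take c ev) @ v # popped (drop (Suc c) ev)"
        using pop by (metis history_simps(7,8))
      have uL: "(u, v) \<in> L" "u \<in> V" using uv topological_orderD(4,5)[OF L] by auto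
      have "u \<in> set vs"
      proof (rule ccontr)
        assume "u \<notin> set vs"
        then have "(v, u) \<in> L" using vs uL v by (auto simp: smallest_sorted_def)
        then show False using uL topological_order_asym[OF L] by blast
      qed
      moreover have "u \<noteq> v" using uL topological_orderD(2)[OF L] by (auto simp: irrefl_def)
      moreover have "u \<notin> set (popped (drop (Suc c) ev))"
      proof
        assume "u \<in> set (popped (drop (Suc c) ev))"
        then have "(v, u) \<in> L" using vs e by (auto simp: smallest_sorted_def sorted_wrt_append)
        then show False using uL topological_order_asym[OF L] by blast
      qed
      ultimately have "u \<in> set (popped (take c ev))" by (subst (asm) e) auto
      then show ?thesis using i v(2) by simp
    qed
    then have "Inr u \<in> set (take c ev)" by (simp add: set_popped)
    then have "ix ev (Inr u) < c" "u \<in> set vs"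
      using ix_less[OF dev, of c] c pop set_popped[of ev] by (auto dest: in_set_takeD)
    then show ?thesis by (simp add: hi_def c_def)
  qed
  have "sum e X \<le> card X + card ({..<Suc (length ev)} - hi ` Q) + 2 * card Y + 3 * OPT V A k"
  proof (rule sum_exponents_le[OF L fin k(2) smallest_sorted_output_seqs[OF L vs] _ s free_Y XQ _ lohi hiQ hiQ2 arc])
    show "Y \<subseteq> V - set vs" using Y ins(2) by auto
    show "X \<union> Q = set vs \<union> Y" by (auto simp: X_def Q_def)
    show "2 ^ e x \<le> Suc (hi x - lo x)" if "x \<in> X" for x
    proof (cases "x \<in> set vs")
      case True
      then have "x \<in> set vs - P" using that Y by (auto simp: X_def)
      then obtain a b where "a < length ev" "b < length ev" "ev ! a = Inl x" "ev ! b = Inr x" "2 ^ e x \<le> Suc (b - a)"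
        using e1 by blast
      moreover from this have "ix ev (Inl x) = a" "ix ev (Inr x) = b" using ix_eq[OF dev] by metis+
      ultimately show ?thesis using True that XQ by (auto simp: hi_def lo_def)
    next
      case False
      then have "x \<in> Y" using that by (auto simp: X_def)
      then obtain a where "a < length ev" "ev ! a = Inl x" "2 ^ e x \<le> Suc (length ev - a)"
        using e2 by blast
      moreover from this have "ix ev (Inl x) = a" using ix_eq[OF dev] by metis
      ultimately show ?thesis using False that XQ by (auto simp: hi_def lo_def)
    qed
  qed
  moreover have XI: "X \<subseteq> set (inserted ev)" using Inl by (auto simp: set_inserted)
  then have "card X \<le> length (inserted ev)" using card_mono[OF _ XI] card_length[of "inserted ev"] by simp
  moreover have "card Y + card (set vs - P) = card X"
    unfolding X_def using Y finite_subset[of Y "set (inserted ev)"] by (subst card_Un_disjoint) auto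
  moreover have "card ({..<Suc (length ev)} - hi ` Q) = Suc (length ev) - card Q"
  proof -
    have "hi ` Q \<subseteq> {..<Suc (length ev)}" using hiQ2 by auto
    then show ?thesis using card_Diff_subset[of "hi ` Q" "{..<Suc (length ev)}"] card_image[OF hiQ] by (simp add: Q_def)
  qed
  moreover have "length ev = length (inserted ev) + card (set vs)"
    using length_history[of ev] pop dvs by (simp add: distinct_card)
  moreover have "card (set vs) = card Q + card (set vs - P)"
  proof -
    have "set vs = Q \<union> (set vs - P)" by (auto simp: Q_def)
    moreover have "card (Q \<union> (set vs - P)) = card Q + card (set vs - P)"
      by (rule card_Un_disjoint) (auto simp: Q_def)
    ultimately show ?thesis by simp
  qed
  \<comment> \<open>The times not taken by \<open>Q\<close> number 1 plus the insertions plus the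
    outputs off \<open>P\<close>. With \<open>inserted_le\<close> the summands add up to at most
    \<open>15 * OPT V A k + 1\<close>.\<close>
  ultimately show ?thesis using inserted_le unfolding X_def by linarith
qed

end

section \<open>A structured language with arrays\<close>

datatype cmd =
    Set nat nat
  | Mov nat nat
  | Plus nat nat nat
  | Minus nat nat nat
  | Get nat nat nat
  | Put nat nat nat
  | Raw_Get nat nat
  | Raw_Put nat nat
  | Less nat nat nat
  | Seq cmd cmd (infixr \<open>;;\<close> 60)
  | Cond nat cmd cmd
  | While nat cmd

record state =
  rg :: "nat \<Rightarrow> nat"
  ar :: "nat \<Rightarrow> nat \<Rightarrow> nat"
  raw :: "nat \<Rightarrow> nat"
  tm :: nat
  cm :: nat

definition put_rg :: "nat \<Rightarrow> nat \<Rightarrow> nat \<Rightarrow> state \<Rightarrow> state" where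
  "put_rg d x c s = s\<lparr>rg := (rg s)(d := x), tm := tm s + c\<rparr>"

definition tick :: "nat \<Rightarrow> state \<Rightarrow> state" where
  "tick c s = s\<lparr>tm := tm s + c\<rparr>"

text \<open>\<open>B\<close> is the first address behind the raw memory; \<open>tm\<close> counts machine steps.\<close>

inductive ex :: "nat rel \<Rightarrow> nat \<Rightarrow> cmd \<Rightarrow> state \<Rightarrow> state \<Rightarrow> bool" for L B where
  "ex L B (Set d x) s (put_rg d x 1 s)"
| "ex L B (Mov d a) s (put_rg d (rg s a) 1 s)"
| "ex L B (Plus d a b) s (put_rg d (rg s a + rg s b) 1 s)"
| "ex L B (Minus d a b) s (put_rg d (rg s a - rg s b) 1 s)"
| "ex L B (Get d a i) s (put_rg d (ar s a (rg s i)) 8 s)"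
| "ex L B (Put a i x) s (s\<lparr>ar := (ar s)(a := (ar s a)(rg s i := rg s x)), tm := tm s + 8\<rparr>)"
| "rg s i < B \<Longrightarrow> ex L B (Raw_Get d i) s (put_rg d (raw s (rg s i)) 1 s)"
| "rg s i < B \<Longrightarrow> ex L B (Raw_Put i x) s (s\<lparr>raw := (raw s)(rg s i := rg s x), tm := tm s + 1\<rparr>)"
| "ex L B (Less d a b) s
     ((put_rg d (if (rg s a, rg s b) \<in> L then 1 else 0) 1 s)\<lparr>cm := Suc (cm s)\<rparr>)"
| "ex L B c s s' \<Longrightarrow> ex L B d s' s'' \<Longrightarrow> ex L B (c ;; d) s s''"
| "rg s x \<noteq> 0 \<Longrightarrow> ex L B c (tick 1 s) s' \<Longrightarrow> ex L B (Cond x c d) s (tick 1 s')"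
| "rg s x = 0 \<Longrightarrow> ex L B d (tick 1 s) s' \<Longrightarrow> ex L B (Cond x c d) s s'"
| "rg s x \<noteq> 0 \<Longrightarrow> ex L B c (tick 1 s) s' \<Longrightarrow> ex L B (While x c) (tick 1 s') s'' \<Longrightarrow>
     ex L B (While x c) s s''"
| "rg s x = 0 \<Longrightarrow> ex L B (While x c) s (tick 1 s)"

inductive_cases ex_elims:
  "ex L B (Set d x) s s'" "ex L B (Mov d a) s s'" "ex L B (Plus d a b) s s'" "ex L B (Minus d a b) s s'"
  "ex L B (Get d a i) s s'" "ex L B (Put a i x) s s'" "ex L B (Raw_Get d i) s s'" "ex L B (Raw_Put i x) s s'"
  "ex L B (Less d a b) s s'" "ex L B (c ;; d) s s'" "ex L B (Cond x c d) s s'"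

text \<open>Total correctness: a finite execution has to exist, so every loop is shown to terminate
  by an induction. \<open>compile_correct\<close> turns this execution into a machine run.\<close>

definition wp :: "nat rel \<Rightarrow> nat \<Rightarrow> cmd \<Rightarrow> (state \<Rightarrow> bool) \<Rightarrow> state \<Rightarrow> bool" where
  "wp L B c Q s \<longleftrightarrow> (\<exists>s'. ex L B c s s' \<and> Q s')"

lemma wp_basic:
  "wp L B (Set d x) Q s = Q (put_rg d x 1 s)"
  "wp L B (Mov d a) Q s = Q (put_rg d (rg s a) 1 s)"
  "wp L B (Plus d a b) Q s = Q (put_rg d (rg s a + rg s b) 1 s)"
  "wp L B (Minus d a b) Q s = Q (put_rg d (rg s a - rg s b) 1 s)"
  "wp L B (Get d a i) Q s = Q (put_rg d (ar s a (rg s i)) 8 s)"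
  "wp L B (Put a i x) Q s = Q (s\<lparr>ar := (ar s)(a := (ar s a)(rg s i := rg s x)), tm := tm s + 8\<rparr>)"
  "wp L B (Raw_Get d i) Q s = (rg s i < B \<and> Q (put_rg d (raw s (rg s i)) 1 s))"
  "wp L B (Raw_Put i x) Q s =
     (rg s i < B \<and> Q (s\<lparr>raw := (raw s)(rg s i := rg s x), tm := tm s + 1\<rparr>))"
  "wp L B (Less d a b) Q s =
     Q ((put_rg d (if (rg s a, rg s b) \<in> L then 1 else 0) 1 s)\<lparr>cm := Suc (cm s)\<rparr>)"
  unfolding wp_def by (auto intro: ex.intros elim: ex_elims)

lemma ex_Cond_iff:
  "ex L B (Cond x c d) s s' \<longleftrightarrow>
     (if rg s x \<noteq> 0 then \<exists>s''. ex L B c (tick 1 s) s'' \<and> s' = tick 1 s'' else ex L B d (tick 1 s) s')"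
    (is "?l \<longleftrightarrow> ?r")
proof
  assume ?l
  then show ?r by (rule ex_elims(11)) auto
next
  assume ?r
  then show ?l by (auto split: if_splits intro: ex.intros(11)[simplified] ex.intros(12)[simplified])
qed

lemma ex_Seq_iff: "ex L B (c ;; d) s s'' \<longleftrightarrow> (\<exists>s'. ex L B c s s' \<and> ex L B d s' s'')"
  using ex.intros(10) by (auto elim!: ex_elims(10))

lemma wp_Seq: "wp L B (c ;; e) Q s = wp L B c (wp L B e Q) s"
  unfolding wp_def ex_Seq_iff by blast

lemma wp_Cond:
  "wp L B (Cond x c e) Q s =
     (if rg s x \<noteq> 0 then wp L B c (\<lambda>s. Q (tick 1 s)) (tick 1 s) else wp L B e Q (tick 1 s))"
  unfolding wp_def ex_Cond_iff by auto

lemmas wp_simps = wp_basic wp_Seq wp_Cond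

lemma wp_mono: "wp L B c Q s \<Longrightarrow> (\<And>s. Q s \<Longrightarrow> Q' s) \<Longrightarrow> wp L B c Q' s"
  unfolding wp_def by blast

section \<open>Compilation\<close>

text \<open>Machine registers 0 and 1 are scratch, register 2 holds \<open>B\<close>, and register \<open>v\<close> of the language
  is machine register \<open>v + 3\<close>. The raw memory below \<open>B\<close> holds the input and receives the output;
  above it the arrays are interleaved, with entry \<open>i\<close> of array \<open>a < 16\<close> in cell \<open>B + 16 * i + a\<close>.\<close>

definition addr_code :: "nat \<Rightarrow> nat \<Rightarrow> instr list" where
  "addr_code a i = [Add 0 (i + 3) (i + 3), Add 0 0 0, Add 0 0 0, Add 0 0 0, Add 0 0 2, Const 1 a, Add 0 0 1]"

fun comp_len :: "cmd \<Rightarrow> nat" where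
  "comp_len (Get d a i) = 8"
| "comp_len (Put a i x) = 8"
| "comp_len (c ;; d) = comp_len c + comp_len d"
| "comp_len (Cond x c d) = comp_len c + comp_len d + 2"
| "comp_len (While x c) = comp_len c + 2"
| "comp_len _ = 1"

fun compile :: "nat \<Rightarrow> cmd \<Rightarrow> instr list" where
  "compile p (Set d x) = [Const (d + 3) x]"
| "compile p (Mov d a) = [Copy (d + 3) (a + 3)]"
| "compile p (Plus d a b) = [Add (d + 3) (a + 3) (b + 3)]"
| "compile p (Minus d a b) = [Sub (d + 3) (a + 3) (b + 3)]"
| "compile p (Get d a i) = addr_code a i @ [Load (d + 3) 0]"
| "compile p (Put a i x) = addr_code a i @ [Store 0 (x + 3)]"
| "compile p (Raw_Get d i) = [Load (d + 3) (i + 3)]"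
| "compile p (Raw_Put i x) = [Store (i + 3) (x + 3)]"
| "compile p (Less d a b) = [Compare (d + 3) (a + 3) (b + 3)]"
| "compile p (c ;; d) = compile p c @ compile (p + comp_len c) d"
| "compile p (Cond x c d) = Jump_Zero (x + 3) (p + comp_len c + 2) # compile (p + 1) c @
     Jump (p + comp_len c + comp_len d + 2) # compile (p + comp_len c + 2) d"
| "compile p (While x c) = Jump_Zero (x + 3) (p + comp_len c + 2) # compile (p + 1) c @ [Jump p]"

fun arrays_ok :: "cmd \<Rightarrow> bool" where
  "arrays_ok (Get d a i) = (a < 16)"
| "arrays_ok (Put a i x) = (a < 16)"
| "arrays_ok (c ;; d) = (arrays_ok c \<and> arrays_ok d)"
| "arrays_ok (Cond x c d) = (arrays_ok c \<and> arrays_ok d)"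
| "arrays_ok (While x c) = arrays_ok c"
| "arrays_ok _ = True"

lemma length_compile [simp]: "length (compile p c) = comp_len c"
  by (induction c arbitrary: p) (auto simp: addr_code_def)

definition code_at :: "instr list \<Rightarrow> nat \<Rightarrow> instr list \<Rightarrow> bool" where
  "code_at P p xs \<longleftrightarrow> (\<exists>ys zs. P = ys @ xs @ zs \<and> length ys = p)"

lemma code_at_append:
  assumes "code_at P p (xs @ ys)"
  shows "code_at P p xs \<and> code_at P (p + length xs) ys"
proof -
  obtain us vs where "P = us @ (xs @ ys) @ vs" "length us = p"
    using assms unfolding code_at_def by blast
  then have "P = us @ xs @ (ys @ vs) \<and> length us = p"
    "P = (us @ xs) @ ys @ vs \<and> length (us @ xs) = p + length xs" by simp_all
  then show ?thesis unfolding code_at_def by blast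
qed

lemma code_at_Cons:
  assumes "code_at P p (x # xs)"
  shows "p < length P \<and> P ! p = x \<and> code_at P (Suc p) xs"
proof -
  obtain us vs where "P = us @ (x # xs) @ vs" "length us = p"
    using assms unfolding code_at_def by blast
  then have "P = (us @ [x]) @ xs @ vs \<and> length (us @ [x]) = Suc p"
    "p < length P" "P ! p = x" by (auto simp: nth_append)
  then show ?thesis unfolding code_at_def by blast
qed

definition corr :: "nat \<Rightarrow> nat \<Rightarrow> state \<Rightarrow> config \<Rightarrow> bool" where
  "corr B p s c \<longleftrightarrow> pc c = p \<and> reg c 2 = B \<and> (\<forall>v. reg c (v + 3) = rg s v) \<and>
     (\<forall>a i. a < 16 \<longrightarrow> mem c (B + 16 * i + a) = ar s a i) \<and>
     (\<forall>j < B. mem c j = raw s j) \<and> comps c = cm s"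

lemma run_add: "run L P (t + u) c = run L P u (run L P t c)"
  unfolding run_def by (simp add: add.commute[of t] funpow_add)

lemma run_Suc: "run L P (Suc t) c = run L P t (step L P c)"
  unfolding run_def by (simp add: funpow_swap1)

lemma run_0: "run L P 0 c = c"
  unfolding run_def by simp

lemma step_at: "code_at P (pc c) (x # xs) \<Longrightarrow> step L P c = exec L x c"
  by (auto simp: step_def halted_def dest: code_at_Cons)

fun straight :: "instr \<Rightarrow> bool" where
  "straight (Jump l) = False"
| "straight (Jump_Zero a l) = False"
| "straight _ = True"

lemma pc_exec_straight: "straight x \<Longrightarrow> pc (exec L x c) = Suc (pc c)"
  by (cases x) (auto simp: set_reg_def)

lemma run_straight:
  assumes "code_at P (pc c) xs" and "\<forall>x \<in> set xs. straight x"
  shows "run L P (length xs) c = fold (exec L) xs c"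
  using assms
proof (induction xs arbitrary: c)
  case Nil
  then show ?case by (simp add: run_0)
next
  case (Cons x xs)
  then have "step L P c = exec L x c" using step_at by blast
  moreover have "code_at P (pc (exec L x c)) xs"
    using Cons.prems code_at_Cons by (fastforce simp: pc_exec_straight)
  then have "run L P (length xs) (exec L x c) = fold (exec L) xs (exec L x c)"
    using Cons.IH Cons.prems(2) by simp
  ultimately show ?case by (simp add: run_Suc)
qed

lemma addr_inj: "B + 16 * i + a = B + 16 * j + b \<longleftrightarrow> i = j \<and> a = (b :: nat)" if "a < 16" "b < 16"
proof
  assume "B + 16 * i + a = B + 16 * j + b"
  then have e: "16 * i + a = 16 * j + b" by simp
  then have "(16 * i + a) mod 16 = (16 * j + b) mod 16" by (rule arg_cong)
  then have "a = b" using that by simp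
  then show "i = j \<and> a = b" using e by simp
qed simp

lemma fold_addr_code:
  "fold (exec L) (addr_code a i) k =
     k\<lparr>pc := pc k + 7, reg := (reg k)(0 := reg k 2 + 16 * reg k (i + 3) + a, 1 := a)\<rparr>"
  by (simp add: addr_code_def set_reg_def fun_eq_iff)

lemma run_addr_code:
  assumes "code_at P (pc k) (addr_code a i @ [x])" and "straight x"
  shows "run L P 8 k = exec L x (k\<lparr>pc := pc k + 7,
    reg := (reg k)(0 := reg k 2 + 16 * reg k (i + 3) + a, 1 := a)\<rparr>)"
proof -
  have "length (addr_code a i @ [x]) = 8" by (simp add: addr_code_def)
  moreover have "\<forall>y \<in> set (addr_code a i @ [x]). straight y"
    using assms(2) by (simp add: addr_code_def)
  ultimately show ?thesis
    using run_straight[OF assms(1), of L] by (simp add: fold_addr_code)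
qed

definition instr_at :: "instr list \<Rightarrow> nat \<Rightarrow> instr \<Rightarrow> bool" where
  "instr_at P p x \<longleftrightarrow> p < length P \<and> P ! p = x"

lemma step_nth: "instr_at P p x \<Longrightarrow> pc c = p \<Longrightarrow> step L P c = exec L x c"
  by (simp add: instr_at_def step_def halted_def)

lemma code_at_Cond:
  assumes "code_at P p (compile p (Cond x c d))"
  shows "instr_at P p (Jump_Zero (x + 3) (p + comp_len c + 2))"
    and "code_at P (p + 1) (compile (p + 1) c)"
    and "instr_at P (p + 1 + comp_len c) (Jump (p + comp_len c + comp_len d + 2))"
    and "code_at P (p + comp_len c + 2) (compile (p + comp_len c + 2) d)"
proof -
  have 1: "code_at P p (Jump_Zero (x + 3) (p + comp_len c + 2) # compile (p + 1) c @
     Jump (p + comp_len c + comp_len d + 2) # compile (p + comp_len c + 2) d)"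
    using assms by simp
  note 2 = code_at_Cons[OF 1]
  have 3: "code_at P (Suc p) (compile (p + 1) c @
     Jump (p + comp_len c + comp_len d + 2) # compile (p + comp_len c + 2) d)"
    using 2 by blast
  note 4 = code_at_append[OF 3]
  have 5: "code_at P (Suc p + comp_len c)
      (Jump (p + comp_len c + comp_len d + 2) # compile (p + comp_len c + 2) d)"
    using 4 by simp
  note 6 = code_at_Cons[OF 5]
  show "instr_at P p (Jump_Zero (x + 3) (p + comp_len c + 2))"
    using 2 by (simp add: instr_at_def)
  show "code_at P (p + 1) (compile (p + 1) c)"
    using 4 by simp
  show "instr_at P (p + 1 + comp_len c) (Jump (p + comp_len c + comp_len d + 2))"
    using 6 by (simp add: instr_at_def)
  show "code_at P (p + comp_len c + 2) (compile (p + comp_len c + 2) d)"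
    using 6 by simp
qed

lemma code_at_While:
  assumes "code_at P p (compile p (While x c))"
  shows "instr_at P p (Jump_Zero (x + 3) (p + comp_len c + 2))"
    and "code_at P (p + 1) (compile (p + 1) c)"
    and "instr_at P (p + 1 + comp_len c) (Jump p)"
proof -
  have 1: "code_at P p (Jump_Zero (x + 3) (p + comp_len c + 2) # compile (p + 1) c @ [Jump p])"
    using assms by simp
  note 2 = code_at_Cons[OF 1]
  have 3: "code_at P (Suc p) (compile (p + 1) c @ [Jump p])"
    using 2 by blast
  note 4 = code_at_append[OF 3]
  have 5: "code_at P (Suc p + comp_len c) [Jump p]"
    using 4 by simp
  note 6 = code_at_Cons[OF 5]
  show "instr_at P p (Jump_Zero (x + 3) (p + comp_len c + 2))"
    using 2 by (simp add: instr_at_def)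
  show "code_at P (p + 1) (compile (p + 1) c)"
    using 4 by simp
  show "instr_at P (p + 1 + comp_len c) (Jump p)"
    using 6 by (simp add: instr_at_def)
qed

lemma run_one: "code_at P (pc c) [x] \<Longrightarrow> run L P (Suc 0) c = exec L x c"
  by (simp add: run_Suc run_0 step_at)

text \<open>\<open>tm\<close> is exact rather than an upper bound: it includes the jump over the
  second branch of a conditional and the jump back to the head of a loop. Induction on the
  execution, not on the command, covers the iterations of a loop, which all run at the same code
  position.\<close>

lemma compile_correct:
  assumes "ex L B c s s'"
  shows "code_at P p (compile p c) \<Longrightarrow> arrays_ok c \<Longrightarrow> corr B p s k \<Longrightarrow>
    \<exists>k'. run L P (tm s' - tm s) k = k' \<and> corr B (p + comp_len c) s' k' \<and> tm s \<le> tm s'"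
  using assms
proof (induction arbitrary: p k rule: ex.induct)
  case (1 d x s)
  then have "run L P (Suc 0) k = exec L (hd (compile p (Set d x))) k"
    by (intro run_one) (simp add: corr_def)
  then show ?case using 1
    by (auto simp: corr_def put_rg_def set_reg_def)
next
  case (2 d a s)
  then have "run L P (Suc 0) k = exec L (hd (compile p (Mov d a))) k"
    by (intro run_one) (simp add: corr_def)
  then show ?case using 2
    by (auto simp: corr_def put_rg_def set_reg_def)
next
  case (3 d a b s)
  then have "run L P (Suc 0) k = exec L (hd (compile p (Plus d a b))) k"
    by (intro run_one) (simp add: corr_def)
  then show ?case using 3
    by (auto simp: corr_def put_rg_def set_reg_def)
next
  case (4 d a b s)
  then have "run L P (Suc 0) k = exec L (hd (compile p (Minus d a b))) k"
    by (intro run_one) (simp add: corr_def)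
  then show ?case using 4
    by (auto simp: corr_def put_rg_def set_reg_def)
next
  case (5 d a i s)
  have "run L P 8 k = exec L (Load (d + 3) 0) (k\<lparr>pc := pc k + 7,
      reg := (reg k)(0 := reg k 2 + 16 * reg k (i + 3) + a, 1 := a)\<rparr>)"
    using 5 by (intro run_addr_code) (simp_all add: corr_def)
  then show ?case using 5
    by (auto simp: corr_def put_rg_def set_reg_def)
next
  case (6 a i x s)
  have "run L P 8 k = exec L (Store 0 (x + 3)) (k\<lparr>pc := pc k + 7,
      reg := (reg k)(0 := reg k 2 + 16 * reg k (i + 3) + a, 1 := a)\<rparr>)"
    using 6 by (intro run_addr_code) (simp_all add: corr_def)
  then show ?case using 6
    by (auto simp: corr_def addr_inj)
next
  case (7 s i d)
  then have "run L P (Suc 0) k = exec L (hd (compile p (Raw_Get d i))) k"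
    by (intro run_one) (simp add: corr_def)
  then show ?case using 7
    by (auto simp: corr_def put_rg_def set_reg_def)
next
  case (8 s i x)
  then have "run L P (Suc 0) k = exec L (hd (compile p (Raw_Put i x))) k"
    by (intro run_one) (simp add: corr_def)
  then show ?case using 8
    by (auto simp: corr_def put_rg_def set_reg_def)
next
  case (9 d a b s)
  then have "run L P (Suc 0) k = exec L (hd (compile p (Less d a b))) k"
    by (intro run_one) (simp add: corr_def)
  then show ?case using 9
    by (auto simp: corr_def put_rg_def set_reg_def)
next
  case (10 c s s' d s'')
  have "code_at P p (compile p c)" and d: "code_at P (p + comp_len c) (compile (p + comp_len c) d)"
    using code_at_append[of P p "compile p c"] 10(5) by simp_all
  then obtain k1 where k1: "run L P (tm s' - tm s) k = k1" "corr B (p + comp_len c) s' k1" "tm s \<le> tm s'"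
    using 10(3)[of p k] 10(6,7) by auto
  then obtain k2 where k2: "run L P (tm s'' - tm s') k1 = k2"
      "corr B (p + comp_len c + comp_len d) s'' k2" "tm s' \<le> tm s''"
    using 10(4)[OF d, of k1] 10(6) by auto
  have "run L P (tm s'' - tm s) k = k2"
    using run_add[of L P "tm s' - tm s" "tm s'' - tm s'" k] k1 k2 by simp
  then show ?case using k1 k2 by (auto simp: add.assoc)
next
  case (11 s x c s' d)
  note b = code_at_Cond[OF 11(4)]
  have s1: "step L P k = k\<lparr>pc := Suc p\<rparr>"
    using step_nth[OF b(1)] 11(1,6) by (simp add: corr_def)
  have "corr B (p + 1) (tick 1 s) (k\<lparr>pc := Suc p\<rparr>)" using 11(6) by (simp add: corr_def tick_def)
  then obtain k1 where k1: "run L P (tm s' - Suc (tm s)) (k\<lparr>pc := Suc p\<rparr>) = k1"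
      "corr B (p + 1 + comp_len c) s' k1" "Suc (tm s) \<le> tm s'"
    using 11(3)[OF b(2)] 11(5) by (auto simp: tick_def)
  have s2: "step L P k1 = k1\<lparr>pc := p + comp_len c + comp_len d + 2\<rparr>"
    using step_nth[OF b(3)] k1 by (simp add: corr_def)
  have "run L P (1 + (tm s' - Suc (tm s)) + 1) k = k1\<lparr>pc := p + comp_len c + comp_len d + 2\<rparr>"
    unfolding run_add by (simp add: run_Suc run_0 s1 s2 k1)
  moreover have "1 + (tm s' - Suc (tm s)) + 1 = tm (tick 1 s') - tm s"
    using k1 by (simp add: tick_def)
  ultimately show ?case using k1 by (auto simp: corr_def tick_def)
next
  case (12 s x d s' c)
  note b = code_at_Cond[OF 12(4)]
  have s1: "step L P k = k\<lparr>pc := p + comp_len c + 2\<rparr>"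
    using step_nth[OF b(1)] 12(1,6) by (auto simp: corr_def)
  have "corr B (p + comp_len c + 2) (tick 1 s) (k\<lparr>pc := p + comp_len c + 2\<rparr>)"
    using 12(6) by (simp add: corr_def tick_def)
  then obtain k1 where k1: "run L P (tm s' - Suc (tm s)) (k\<lparr>pc := p + comp_len c + 2\<rparr>) = k1"
      "corr B (p + comp_len c + 2 + comp_len d) s' k1" "Suc (tm s) \<le> tm s'"
    using 12(3)[OF b(4)] 12(5) by (auto simp: tick_def)
  have "run L P (1 + (tm s' - Suc (tm s))) k = k1"
    unfolding run_add k1(1)[symmetric] by (simp add: run_Suc run_0 s1)
  moreover have "1 + (tm s' - Suc (tm s)) = tm s' - tm s"
    using k1 by simp
  ultimately show ?case using k1 by (auto simp: ac_simps)
next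
  case (13 s x c s' s'')
  note b = code_at_While[OF 13(6)]
  have s1: "step L P k = k\<lparr>pc := Suc p\<rparr>"
    using step_nth[OF b(1)] 13(1,8) by (simp add: corr_def)
  have "corr B (p + 1) (tick 1 s) (k\<lparr>pc := Suc p\<rparr>)" using 13(8) by (simp add: corr_def tick_def)
  then obtain k1 where k1: "run L P (tm s' - Suc (tm s)) (k\<lparr>pc := Suc p\<rparr>) = k1"
      "corr B (p + 1 + comp_len c) s' k1" "Suc (tm s) \<le> tm s'"
    using 13(4)[OF b(2)] 13(7) by (auto simp: tick_def)
  have s2: "step L P k1 = k1\<lparr>pc := p\<rparr>"
    using step_nth[OF b(3)] k1 by (simp add: corr_def)
  have "corr B p (tick 1 s') (k1\<lparr>pc := p\<rparr>)" using k1 by (simp add: corr_def tick_def)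
  then obtain k2 where k2: "run L P (tm s'' - Suc (tm s')) (k1\<lparr>pc := p\<rparr>) = k2"
      "corr B (p + comp_len (While x c)) s'' k2" "Suc (tm s') \<le> tm s''"
    using 13(5)[OF 13(6,7)] by (auto simp: tick_def)
  have "run L P (1 + (tm s' - Suc (tm s)) + 1 + (tm s'' - Suc (tm s'))) k = k2"
    unfolding run_add by (simp add: run_Suc run_0 s1 s2 k1 k2)
  moreover have "1 + (tm s' - Suc (tm s)) + 1 + (tm s'' - Suc (tm s')) = tm s'' - tm s"
    using k1 k2 by simp
  ultimately show ?case using k1 k2 by auto
next
  case (14 s x c)
  have s1: "step L P k = k\<lparr>pc := p + comp_len c + 2\<rparr>"
    using step_nth[OF code_at_While(1)[OF 14(2)]] 14(1,4) by (auto simp: corr_def)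
  then show ?case using 14(4) by (auto simp: corr_def tick_def run_Suc run_0)
qed

text \<open>Register 2 becomes \<open>2 * m + n\<close>: the raw memory must contain the
  \<open>2 * m\<close> input cells and the output cells, of which there are at most
  \<open>n\<close>. The 5 steps taken here are the initial \<open>tm\<close> of
  \<open>start\<close>.\<close>

definition prologue :: "instr list" where
  "prologue = [Copy 3 0, Copy 4 1, Copy 5 2, Add 2 2 2, Add 2 2 0]"

definition start :: "nat \<Rightarrow> nat \<Rightarrow> (nat \<times> nat) list \<Rightarrow> state" where
  "start n k arcs = \<lparr>rg = (\<lambda>_. 0)(0 := n, 1 := k, 2 := length arcs), ar = (\<lambda>_ _. 0),
     raw = mem (init_config n k arcs), tm = 5, cm = 0\<rparr>"

lemma machine_run:
  assumes ok: "arrays_ok c" and e: "wp L (2 * length arcs + n) c Q (start n k arcs)"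
    and kn: "k \<le> n"
  obtains s where "Q s"
    and "halted (prologue @ compile 5 c) (run L (prologue @ compile 5 c) (tm s) (init_config n k arcs))"
    and "result k (run L (prologue @ compile 5 c) (tm s) (init_config n k arcs)) = map (raw s) [0..<k]"
    and "comps (run L (prologue @ compile 5 c) (tm s) (init_config n k arcs)) = cm s"
proof -
  define P where "P = prologue @ compile 5 c"
  define B where "B = 2 * length arcs + n"
  let ?c = "init_config n k arcs"
  have p0: "code_at P (pc ?c) prologue"
    by (auto simp: code_at_def P_def init_config_def)
  have l: "length prologue = 5" by (simp add: prologue_def)
  have "run L P 5 ?c = fold (exec L) prologue ?c"
    using run_straight[OF p0, of L] unfolding l by (auto simp: prologue_def set_reg_def)
  then have "corr B 5 (start n k arcs) (run L P 5 ?c)"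
    by (auto simp: corr_def prologue_def set_reg_def init_config_def start_def B_def)
  moreover have "code_at P 5 (compile 5 c)"
    unfolding code_at_def P_def using l by force
  moreover obtain s where s: "ex L B c (start n k arcs) s" "Q s"
    using e unfolding wp_def B_def by blast
  ultimately obtain c' where c': "run L P (tm s - 5) (run L P 5 ?c) = c'"
     "corr B (5 + comp_len c) s c'" "5 \<le> tm s"
    using compile_correct[OF s(1) _ ok] by (fastforce simp: start_def)
  have "run L P (tm s) ?c = c'"
    using run_add[of L P 5 "tm s - 5" ?c] c' by simp
  then show thesis using that[OF s(2)] c' kn l unfolding P_def
    by (auto simp: halted_def corr_def result_def B_def)
qed

section \<open>Winner trees\<close>

text \<open>Node numbers: the leaf of item \<open>x\<close> is \<open>Suc x\<close>, and 0 is the null pointer. A node stores the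
  leaf number of the smallest item below it that is still present.\<close>

datatype tree = Leaf nat | Node nat tree tree

fun rid :: "tree \<Rightarrow> nat" where
  "rid (Leaf x) = Suc x"
| "rid (Node a l r) = a"

fun iids :: "tree \<Rightarrow> nat list" where
  "iids (Leaf x) = []"
| "iids (Node a l r) = a # iids l @ iids r"

fun tids :: "tree \<Rightarrow> nat list" where
  "tids (Leaf x) = [Suc x]"
| "tids (Node a l r) = a # tids l @ tids r"

fun leaves :: "tree \<Rightarrow> nat list" where
  "leaves (Leaf x) = [x]"
| "leaves (Node a l r) = leaves l @ leaves r"

fun full :: "nat \<Rightarrow> tree \<Rightarrow> bool" where
  "full h (Leaf x) \<longleftrightarrow> h = 0"
| "full h (Node a l r) \<longleftrightarrow> (\<exists>h'. h = Suc h' \<and> full h' l \<and> full h' r)"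

text \<open>The parent pointer of the root is left open, as it belongs to whatever the tree hangs
  from; a tree can thus be moved without being checked again.\<close>

fun trep :: "(nat \<Rightarrow> nat) \<Rightarrow> (nat \<Rightarrow> nat) \<Rightarrow> (nat \<Rightarrow> nat) \<Rightarrow> tree \<Rightarrow> bool" where
  "trep lf rt pr (Leaf x) \<longleftrightarrow> True"
| "trep lf rt pr (Node a l r) \<longleftrightarrow> lf a = rid l \<and> rt a = rid r \<and> pr (rid l) = a \<and> pr (rid r) = a \<and>
     trep lf rt pr l \<and> trep lf rt pr r"

text \<open>A doubly linked list: on the spine, \<open>rt\<close> leads to the next level and
  \<open>pr\<close> back to the previous one. With the tree of its level as left child, a spine node
  is an ordinary binary node, and the whole heap is a single binary tree.\<close>

fun links :: "(nat \<Rightarrow> nat) \<Rightarrow> (nat \<Rightarrow> nat) \<Rightarrow> nat \<Rightarrow> nat list \<Rightarrow> nat \<Rightarrow> bool" where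
  "links rt pr p [] i \<longleftrightarrow> i = 0"
| "links rt pr p (s # ss) i \<longleftrightarrow> i = s \<and> pr s = p \<and> links rt pr s ss (rt s)"

fun walk :: "(nat \<Rightarrow> nat) \<Rightarrow> nat \<Rightarrow> nat list \<Rightarrow> nat \<Rightarrow> bool" where
  "walk pr c [] e \<longleftrightarrow> c = e"
| "walk pr c (u # us) e \<longleftrightarrow> c = u \<and> walk pr (pr u) us e"

lemma walk_append: "walk pr c (us @ vs) e \<longleftrightarrow> (\<exists>d. walk pr c us d \<and> walk pr d vs e)"
  by (induction us arbitrary: c) auto

lemma length_leaves: "full h t \<Longrightarrow> length (leaves t) = 2 ^ h"
  by (induction t arbitrary: h) auto

lemma rid_in_tids: "rid t \<in> set (tids t)"
  by (cases t) auto

lemma iids_subset: "set (iids t) \<subseteq> set (tids t)"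
  by (induction t) auto

lemma distinct_iids: "distinct (tids t) \<Longrightarrow> distinct (iids t)"
proof (induction t)
  case (Node a l r)
  then show ?case using iids_subset[of l] iids_subset[of r] by auto
qed simp

lemma set_tids: "set (tids t) = set (iids t) \<union> Suc ` set (leaves t)"
  by (induction t) auto

lemma trep_cong:
  assumes "trep lf rt pr t" "distinct (tids t)"
    and "\<And>a. a \<in> set (iids t) \<Longrightarrow> lf' a = lf a \<and> rt' a = rt a"
    and "\<And>a. a \<in> set (tids t) \<Longrightarrow> a \<noteq> rid t \<Longrightarrow> pr' a = pr a"
  shows "trep lf' rt' pr' t"
  using assms
proof (induction t)
  case (Node a l r)
  have *: "rid l \<noteq> a" "rid r \<noteq> a" using Node.prems(2) rid_in_tids[of l] rid_in_tids[of r] by auto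
  have "trep lf' rt' pr' l"
    using Node.prems by (intro Node.IH(1)) auto
  moreover have "trep lf' rt' pr' r"
    using Node.prems by (intro Node.IH(2)) auto
  ultimately show ?case using Node.prems * rid_in_tids[of l] rid_in_tids[of r] by auto
qed simp

lemma links_cong:
  "links rt pr p ss i \<Longrightarrow> (\<And>s. s \<in> set ss \<Longrightarrow> rt' s = rt s \<and> pr' s = pr s) \<Longrightarrow> links rt' pr' p ss i"
  by (induction ss arbitrary: p i) auto

lemma links_snoc:
  assumes "links rt pr p ss i" "distinct (ss @ [s])" "pr' s = last (p # ss)" "rt' s = 0"
    "\<And>a. a \<in> set ss \<Longrightarrow> pr' a = pr a"
    "\<And>a. a \<in> set ss \<Longrightarrow> a \<noteq> last ss \<Longrightarrow> rt' a = rt a"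
    "ss \<noteq> [] \<Longrightarrow> rt' (last ss) = s"
  shows "links rt' pr' p (ss @ [s]) (if ss = [] then s else i)"
  using assms
proof (induction ss arbitrary: p i)
  case (Cons a ss)
  have "links rt' pr' a (ss @ [s]) (if ss = [] then s else rt a)"
  proof (rule Cons.IH)
    show "\<And>b. b \<in> set ss \<Longrightarrow> b \<noteq> last ss \<Longrightarrow> rt' b = rt b"
      using Cons.prems(6) by (metis empty_iff last_ConsR list.set(1) list.set_intros(2))
  qed (use Cons.prems in auto)
  moreover have "rt' a = (if ss = [] then s else rt a)"
  proof (cases "ss = []")
    case True
    then show ?thesis using Cons.prems(7) by simp
  next
    case False
    then have "a \<noteq> last ss" using Cons.prems(2) last_in_set[of ss] by auto
    then show ?thesis using Cons.prems(1) Cons.prems(6)[of a] False by simp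
  qed
  moreover have "pr' a = p" "i = a" using Cons.prems(1) Cons.prems(5)[of a] by simp_all
  ultimately show ?case by simp
qed simp

lemma links_nth:
  "links rt pr p (xs @ s # ys) i \<Longrightarrow> pr s = last (p # xs) \<and> rt s = (if ys = [] then 0 else hd ys)"
  by (induction xs arbitrary: p i) (cases ys; auto)+

lemma links_hd: "links rt pr p ss i \<Longrightarrow> i = (if ss = [] then 0 else hd ss)"
  by (cases ss) auto

lemma links_walk: "links rt pr p (xs @ s # ys) i \<Longrightarrow> walk pr s (s # rev xs) p"
proof (induction xs arbitrary: p i)
  case (Cons x xs)
  then have "walk pr s (s # rev xs) x" "pr x = p" by auto
  then show ?case using walk_append[of pr s "s # rev xs" "[x]" p] by auto
qed simp

lemma tree_walk:
  assumes "trep lf rt pr t" "distinct (iids t)" "full h t" "x \<in> set (leaves t)"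
  shows "\<exists>us. walk pr (pr (Suc x)) us (pr (rid t)) \<and> length us = h \<and> set us \<subseteq> set (iids t) \<and> distinct us"
  using assms
proof (induction t arbitrary: h)
  case (Leaf y)
  then show ?case by (intro exI[of _ "[]"]) auto
next
  case (Node a l r)
  obtain h' where h: "h = Suc h'" "full h' l" "full h' r" using Node.prems(3) by auto
  have "\<exists>us c. (c = l \<or> c = r) \<and> walk pr (pr (Suc x)) us (pr (rid c)) \<and> length us = h' \<and>
      set us \<subseteq> set (iids c) \<and> distinct us"
  proof (cases "x \<in> set (leaves l)")
    case True
    have "\<exists>us. walk pr (pr (Suc x)) us (pr (rid l)) \<and> length us = h' \<and> set us \<subseteq> set (iids l) \<and> distinct us"
      using True Node.prems by (intro Node.IH(1)[OF _ _ h(2)]) auto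
    then show ?thesis by blast
  next
    case False
    have "\<exists>us. walk pr (pr (Suc x)) us (pr (rid r)) \<and> length us = h' \<and> set us \<subseteq> set (iids r) \<and> distinct us"
      using False Node.prems by (intro Node.IH(2)[OF _ _ h(3)]) auto
    then show ?thesis by blast
  qed
  then obtain us c where us: "c = l \<or> c = r" "walk pr (pr (Suc x)) us (pr (rid c))" "length us = h'"
      "set us \<subseteq> set (iids c)" "distinct us" by blast
  have "walk pr (pr (Suc x)) (us @ [a]) (pr a)"
    using us(1,2) Node.prems(1) by (auto simp: walk_append)
  moreover have "a \<notin> set us" using us(1,4) Node.prems(2) by auto
  ultimately show ?case using us h by (intro exI[of _ "us @ [a]"]) auto
qed

subsection \<open>Minima\<close>

text \<open>The winner 0 marks a subtree without present items and is neutral.\<close>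

definition comb :: "nat rel \<Rightarrow> nat \<Rightarrow> nat \<Rightarrow> nat" where
  "comb L a b = (if a = 0 then b else if b = 0 then a else if (a - 1, b - 1) \<in> L then a else b)"

definition is_min :: "nat rel \<Rightarrow> nat \<Rightarrow> nat set \<Rightarrow> bool" where
  "is_min L w S \<longleftrightarrow> (if w = 0 then S = {} else w - 1 \<in> S \<and> (\<forall>y \<in> S. y = w - 1 \<or> (w - 1, y) \<in> L))"

lemma is_min_comb:
  assumes L: "topological_order V A L" and V: "S \<subseteq> V" "T \<subseteq> V"
    and "is_min L a S" "is_min L b T"
  shows "is_min L (comb L a b) (S \<union> T)"
proof -
  have tr: "(x, y) \<in> L \<Longrightarrow> (y, z) \<in> L \<Longrightarrow> (x, z) \<in> L" for x y z
    using topological_orderD(1)[OF L] by (meson transD)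
  have tot: "x \<in> V \<Longrightarrow> y \<in> V \<Longrightarrow> x = y \<or> (x, y) \<in> L \<or> (y, x) \<in> L" for x y
    using topological_orderD(3)[OF L] by (auto simp: total_on_def)
  show ?thesis
  proof (cases "a = 0 \<or> b = 0")
    case True
    then show ?thesis using assms by (auto simp: is_min_def comb_def split: if_splits)
  next
    case False
    then have ab: "a - 1 \<in> S" "\<And>y. y \<in> S \<Longrightarrow> y = a - 1 \<or> (a - 1, y) \<in> L"
      "b - 1 \<in> T" "\<And>y. y \<in> T \<Longrightarrow> y = b - 1 \<or> (b - 1, y) \<in> L" using assms(4,5) by (auto simp: is_min_def)
    show ?thesis
    proof (cases "(a - 1, b - 1) \<in> L")
      case True
      then have "(a - 1, y) \<in> L" if "y \<in> T" for y
        using ab(4)[OF that] tr[of "a - 1" "b - 1" y] by auto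
      then show ?thesis using True False ab(1,2) by (auto simp: comb_def is_min_def)
    next
      case F: False
      then have "a - 1 = b - 1 \<or> (b - 1, a - 1) \<in> L" using tot[of "a - 1" "b - 1"] ab V by auto
      then have "y = b - 1 \<or> (b - 1, y) \<in> L" if "y \<in> S" for y
        using ab(2)[OF that] tr by auto
      then show ?thesis using False F ab by (auto simp: comb_def is_min_def)
    qed
  qed
qed

definition locally_min :: "nat rel \<Rightarrow> (nat \<Rightarrow> nat) \<Rightarrow> (nat \<Rightarrow> nat) \<Rightarrow> (nat \<Rightarrow> nat) \<Rightarrow> nat \<Rightarrow> bool" where
  "locally_min L lf rt wn a \<longleftrightarrow> wn a = comb L (wn (lf a)) (wn (rt a))"

lemma tree_min:
  assumes L: "topological_order V A L" and "trep lf rt pr t" "set (leaves t) \<subseteq> V"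
    and "\<And>a. a \<in> set (iids t) \<Longrightarrow> locally_min L lf rt wn a"
    and "\<And>x. x \<in> set (leaves t) \<Longrightarrow> wn (Suc x) = (if x \<in> S then Suc x else 0)"
  shows "is_min L (wn (rid t)) (set (leaves t) \<inter> S)"
  using assms(2-)
proof (induction t)
  case (Leaf x)
  then show ?case by (auto simp: is_min_def)
next
  case (Node a l r)
  have "is_min L (comb L (wn (rid l)) (wn (rid r))) (set (leaves l) \<inter> S \<union> set (leaves r) \<inter> S)"
    using Node.prems by (intro is_min_comb[OF L] Node.IH) auto
  moreover have "wn a = comb L (wn (rid l)) (wn (rid r))"
    using Node.prems by (auto simp: locally_min_def)
  ultimately show ?case by (simp add: Int_Un_distrib2)
qed

subsection \<open>The spine\<close>

text \<open>Level \<open>i\<close> of the spine holds one or two complete trees of height \<open>i\<close>; two trees are kept as the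
  two subtrees of one tree of height \<open>Suc i\<close>. Newer items are on lower levels, so an item on level \<open>i\<close>
  is older than \<open>2 ^ i - 1\<close> items.\<close>

type_synonym spine = "(nat \<times> bool \<times> tree) list"

definition block_ok :: "(nat \<Rightarrow> nat) \<Rightarrow> (nat \<Rightarrow> nat) \<Rightarrow> (nat \<Rightarrow> nat) \<Rightarrow> (nat \<Rightarrow> nat) \<Rightarrow> nat \<times> bool \<times> tree \<Rightarrow> bool" where
  "block_ok lf rt pr dg = (\<lambda>(s, d, t). lf s = rid t \<and> pr (rid t) = s \<and> dg s = of_bool d \<and> trep lf rt pr t)"

definition all_ids :: "spine \<Rightarrow> nat list" where
  "all_ids sp = concat (map (\<lambda>(s, d, t). s # tids t) sp)"

definition inner_ids :: "spine \<Rightarrow> nat set" where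
  "inner_ids sp = (\<Union>(s, d, t) \<in> set sp. insert s (set (iids t)))"

text \<open>Reversing puts the highest and oldest level first, so the list shows the items in the
  order of their insertion. Deleted items remain in it; only their winners become 0.\<close>

definition contents :: "spine \<Rightarrow> nat list" where
  "contents sp = concat (rev (map (\<lambda>(s, d, t). leaves t) sp))"

fun heights_ok :: "nat \<Rightarrow> spine \<Rightarrow> bool" where
  "heights_ok h [] \<longleftrightarrow> True"
| "heights_ok h ((s, d, t) # sp) \<longleftrightarrow> full (h + of_bool d) t \<and> heights_ok (Suc h) sp"

text \<open>The potential that amortizes insertions: the number of digits 2 in a binary counter with
  digits 1 and 2.\<close>

definition carries :: "spine \<Rightarrow> nat" where
  "carries sp = length (filter (\<lambda>(s, d, t). d) sp)"

lemma heights_ok_append: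
  "heights_ok h (xs @ ys) \<longleftrightarrow> heights_ok h xs \<and> heights_ok (h + length xs) ys"
proof (induction xs arbitrary: h)
  case (Cons x xs)
  obtain s d t where "x = (s, d, t)" by (cases x) auto
  then show ?case using Cons[of "Suc h"] by simp
qed simp

lemma contents_simps [simp]:
  "contents [] = []"
  "contents ((s, d, t) # sp) = contents sp @ leaves t"
  "contents (xs @ ys) = contents ys @ contents xs"
  by (auto simp: contents_def)

lemma all_ids_simps [simp]:
  "all_ids [] = []"
  "all_ids ((s, d, t) # sp) = s # tids t @ all_ids sp"
  "all_ids (xs @ ys) = all_ids xs @ all_ids ys"
  by (auto simp: all_ids_def)

lemma inner_ids_simps [simp]:
  "inner_ids [] = {}"
  "inner_ids ((s, d, t) # sp) = insert s (set (iids t)) \<union> inner_ids sp"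
  "inner_ids (xs @ ys) = inner_ids xs \<union> inner_ids ys"
  by (auto simp: inner_ids_def)

lemma set_all_ids: "set (all_ids sp) = inner_ids sp \<union> Suc ` set (contents sp)"
  by (induction sp) (auto simp: set_tids)

text \<open>A geometric sum, since level \<open>i\<close> holds at least one full tree with
  \<open>2 ^ i\<close> leaves.\<close>

lemma length_contents: "heights_ok h sp \<Longrightarrow> 2 ^ (h + length sp) \<le> length (contents sp) + 2 ^ h"
proof (induction sp arbitrary: h)
  case (Cons x sp)
  obtain s d t where x: "x = (s, d, t)" by (cases x) auto
  then have "2 ^ (Suc h + length sp) \<le> length (contents sp) + 2 ^ Suc h"
    and "full (h + of_bool d) t" using Cons.IH[of "Suc h"] Cons.prems by simp_all
  moreover have "(2 :: nat) ^ h \<le> 2 ^ (h + of_bool d)" by (intro power_increasing) auto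
  ultimately show ?case using x length_leaves[of "h + of_bool d" t] by simp
qed simp

lemma spine_min:
  assumes L: "topological_order V A L"
    and "links rt pr p (map fst sp) i" "\<And>b. b \<in> set sp \<Longrightarrow> block_ok lf rt pr dg b"
    and "set (contents sp) \<subseteq> V"
    and "\<And>a. a \<in> inner_ids sp \<Longrightarrow> locally_min L lf rt wn a"
    and "\<And>x. x \<in> set (contents sp) \<Longrightarrow> wn (Suc x) = (if x \<in> S then Suc x else 0)"
    and "wn 0 = 0"
  shows "is_min L (wn i) (set (contents sp) \<inter> S)"
  using assms(2-)
proof (induction sp arbitrary: p i)
  case Nil
  then show ?case by (simp add: is_min_def)
next
  case (Cons b sp)
  obtain s d t where b: "b = (s, d, t)" by (cases b) auto
  have ok: "block_ok lf rt pr dg (s, d, t)" using Cons.prems(2) b by auto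
  have l: "links rt pr s (map fst sp) (rt s)" and i: "i = s" using Cons.prems(1) b by auto
  have "is_min L (wn (rt s)) (set (contents sp) \<inter> S)"
    using Cons.prems b by (intro Cons.IH[OF l]) auto
  moreover have "is_min L (wn (rid t)) (set (leaves t) \<inter> S)"
    using Cons.prems b ok by (intro tree_min[OF L]) (auto simp: block_ok_def)
  ultimately have "is_min L (comb L (wn (rid t)) (wn (rt s)))
      (set (leaves t) \<inter> S \<union> set (contents sp) \<inter> S)"
    using Cons.prems(3) b by (intro is_min_comb[OF L]) auto
  moreover have "wn s = comb L (wn (rid t)) (wn (rt s))"
    using Cons.prems(4)[of s] b ok by (auto simp: locally_min_def block_ok_def)
  ultimately show ?case using i b by (simp add: Int_Un_distrib2 Un_commute)
qed

text \<open>If this holds for all nodes, a node is a child of its parent only, so that a changed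
  winner can invalidate no other node than that parent.\<close>

definition parent_ok :: "(nat \<Rightarrow> nat) \<Rightarrow> (nat \<Rightarrow> nat) \<Rightarrow> (nat \<Rightarrow> nat) \<Rightarrow> nat \<Rightarrow> bool" where
  "parent_ok lf rt pr a \<longleftrightarrow> (\<forall>c. c \<noteq> 0 \<longrightarrow> c = lf a \<or> c = rt a \<longrightarrow> pr c = a)"

lemma tree_parent_ok: "trep lf rt pr t \<Longrightarrow> a \<in> set (iids t) \<Longrightarrow> parent_ok lf rt pr a"
  by (induction t) (auto simp: parent_ok_def)

lemma spine_parent_ok:
  assumes "links rt pr p (map fst sp) i" "\<And>b. b \<in> set sp \<Longrightarrow> block_ok lf rt pr dg b"
    and "a \<in> inner_ids sp"
  shows "parent_ok lf rt pr a"
  using assms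
proof (induction sp arbitrary: p i)
  case (Cons b sp)
  obtain s d t where b: "b = (s, d, t)" by (cases b) auto
  have ok: "block_ok lf rt pr dg (s, d, t)" using Cons.prems(2) b by auto
  have l: "links rt pr s (map fst sp) (rt s)" using Cons.prems(1) b by auto
  consider "a = s" | "a \<in> set (iids t)" | "a \<in> inner_ids sp" using Cons.prems(3) b by auto
  then show ?case
  proof cases
    case 1
    have "rt s \<noteq> 0 \<Longrightarrow> pr (rt s) = s" using l by (cases sp) auto
    then show ?thesis using ok 1 by (auto simp: parent_ok_def block_ok_def)
  next
    case 2
    then show ?thesis using ok tree_parent_ok by (auto simp: block_ok_def)
  next
    case 3
    then show ?thesis using Cons.IH[OF l] Cons.prems(2) by auto
  qed
qed simp

text \<open>On level \<open>e\<close> the tree has height at most \<open>e + 1\<close>, and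
  \<open>e + 1\<close> spine nodes lead from it to the root. The \<open>e\<close> lower levels hold
  at least \<open>2 ^ e - 1\<close> items, all newer than \<open>x\<close>. So the length of the
  walk is logarithmic in the number of later insertions.\<close>

lemma spine_walk:
  assumes sp: "links rt pr 0 (map fst sp) i" "\<And>b. b \<in> set sp \<Longrightarrow> block_ok lf rt pr dg b"
    and "distinct (all_ids sp)" "heights_ok 0 sp" "x \<in> set (contents sp)"
  shows "\<exists>us e as bs. walk pr (pr (Suc x)) us 0 \<and> distinct us \<and> set us \<subseteq> inner_ids sp \<and>
    length us \<le> 2 * e + 2 \<and> contents sp = as @ x # bs \<and> 2 ^ e \<le> length bs + 1"
proof -
  obtain s d t where b: "(s, d, t) \<in> set sp" "x \<in> set (leaves t)"
    using assms(5) by (auto simp: contents_def)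
  obtain pre post where sp_eq: "sp = pre @ (s, d, t) # post" using b(1) by (meson split_list)
  have ok: "trep lf rt pr t" "pr (rid t) = s" using sp(2)[OF b(1)] by (auto simp: block_ok_def)
  have dt: "distinct (iids t)"
  proof -
    have "distinct (tids t)" using assms(3) sp_eq by simp
    then show ?thesis by (rule distinct_iids)
  qed
  have h: "full (length pre + of_bool d) t" "heights_ok 0 pre"
    using assms(4) sp_eq by (auto simp: heights_ok_append)
  obtain us where us: "walk pr (pr (Suc x)) us s" "length us = length pre + of_bool d"
      "set us \<subseteq> set (iids t)" "distinct us"
    using tree_walk[OF ok(1) dt h(1) b(2)] ok(2) by auto
  have w: "walk pr s (s # rev (map fst pre)) 0"
    using links_walk[of rt pr 0 "map fst pre" s "map fst post" i] sp(1) sp_eq by simp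
  have pre: "set (map fst pre) \<subseteq> set (all_ids pre)" "set (map fst pre) \<subseteq> inner_ids pre"
    by (auto simp: all_ids_def inner_ids_def)
  have dpre: "distinct (all_ids pre) \<Longrightarrow> distinct (map fst pre)"
  proof (induction pre)
    case (Cons y pre)
    moreover have "set (map fst pre) \<subseteq> set (all_ids pre)" by (auto simp: all_ids_def)
    ultimately show ?case by (cases y) auto
  qed simp
  have "walk pr (pr (Suc x)) (us @ s # rev (map fst pre)) 0"
    using us(1) w unfolding walk_append by blast
  moreover have "distinct (us @ s # rev (map fst pre))"
  proof -
    have a: "distinct (all_ids pre)" "s \<notin> set (tids t)" "s \<notin> set (all_ids pre)"
      "set (all_ids pre) \<inter> set (tids t) = {}" using assms(3) sp_eq by auto
    have u: "set us \<subseteq> set (tids t)" using us(3) iids_subset[of t] by blast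
    have "set us \<inter> set (s # rev (map fst pre)) = {}"
      using a(2,4) u pre(1) unfolding set_simps set_rev by blast
    moreover have "distinct (s # rev (map fst pre))"
      using dpre[OF a(1)] a(3) pre(1) by auto
    ultimately show ?thesis using us(4) by simp
  qed
  moreover have "set (us @ s # rev (map fst pre)) \<subseteq> inner_ids sp"
    using us(3) pre(2) sp_eq by auto
  moreover have "length (us @ s # rev (map fst pre)) \<le> 2 * length pre + 2" using us(2) by simp
  moreover obtain p q where "leaves t = p @ x # q" using b(2) by (meson split_list)
  then have "contents sp = (contents post @ p) @ x # (q @ contents pre)" using sp_eq by simp
  moreover have "2 ^ length pre \<le> length (q @ contents pre) + 1"
    using length_contents[OF h(2)] by simp
  ultimately show ?thesis by blast
qed

section \<open>The heap program\<close>

abbreviation (input) "rN \<equiv> 0 :: nat"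
abbreviation (input) "rK \<equiv> 1 :: nat"
abbreviation (input) "rM \<equiv> 2 :: nat"
abbreviation (input) "rONE \<equiv> 3 :: nat"
abbreviation (input) "rROOT \<equiv> 4 :: nat"
abbreviation (input) "rNEW \<equiv> 5 :: nat"
abbreviation (input) "rT \<equiv> 6 :: nat"
abbreviation (input) "rCUR \<equiv> 7 :: nat"
abbreviation (input) "rPREV \<equiv> 8 :: nat"
abbreviation (input) "rC \<equiv> 9 :: nat"
abbreviation (input) "rW \<equiv> 10 :: nat"
abbreviation (input) "rX \<equiv> 11 :: nat"
abbreviation (input) "rY \<equiv> 12 :: nat"
abbreviation (input) "rP \<equiv> 13 :: nat"
abbreviation (input) "rQ \<equiv> 14 :: nat"
abbreviation (input) "rZERO \<equiv> 15 :: nat"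
abbreviation (input) "rF \<equiv> 16 :: nat"

abbreviation (input) "aLFT \<equiv> 9 :: nat"
abbreviation (input) "aRGT \<equiv> 10 :: nat"
abbreviation (input) "aPAR \<equiv> 11 :: nat"
abbreviation (input) "aWIN \<equiv> 12 :: nat"
abbreviation (input) "aDIG \<equiv> 13 :: nat"

lemma wp_While_iff:
  "wp L B (While x c) Q s =
     (if rg s x \<noteq> 0 then wp L B c (\<lambda>s'. wp L B (While x c) Q (tick 1 s')) (tick 1 s) else Q (tick 1 s))"
proof -
  have "ex L B (While x c) s s' \<longleftrightarrow>
      (if rg s x \<noteq> 0 then \<exists>s1. ex L B c (tick 1 s) s1 \<and> ex L B (While x c) (tick 1 s1) s' else s' = tick 1 s)"
    (is "?l \<longleftrightarrow> ?r") for s'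
  proof
    assume ?l
    then show ?r by (cases rule: ex.cases) auto
  next
    assume ?r
    then show ?l by (auto split: if_splits intro: ex.intros(13)[simplified] ex.intros(14)[simplified])
  qed
  then show ?thesis unfolding wp_def by auto
qed

lemmas exec_simps = wp_simps put_rg_def tick_def

definition frame :: "nat set \<Rightarrow> nat set \<Rightarrow> state \<Rightarrow> state \<Rightarrow> bool" where
  "frame R S s s' \<longleftrightarrow> (\<forall>x. x \<notin> R \<longrightarrow> rg s' x = rg s x) \<and> (\<forall>a. a \<notin> S \<longrightarrow> ar s' a = ar s a) \<and> raw s' = raw s"

definition comb_cmd :: cmd where
  "comb_cmd = Cond rX
     (Cond rY
       (Minus rP rX rONE ;; Minus rQ rY rONE ;; Less rP rP rQ ;; Cond rP (Mov rW rX) (Mov rW rY))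
       (Mov rW rX))
     (Mov rW rY)"

lemma comb_cmd_ok:
  assumes "rg s rONE = 1"
    and "\<And>s'. frame {rW, rP, rQ} {} s s' \<Longrightarrow> rg s' rW = comb L (rg s rX) (rg s rY) \<Longrightarrow>
      tm s' \<le> tm s + 10 \<Longrightarrow> cm s' \<le> cm s + 1 \<Longrightarrow> Q s'"
  shows "wp L B comb_cmd Q s"
  unfolding comb_cmd_def
  by (auto simp: exec_simps assms(1) intro!: assms(2)) (auto simp: frame_def comb_def)

definition fix_body :: cmd where
  "fix_body = Get rX aLFT rCUR ;; Get rX aWIN rX ;; Get rY aRGT rCUR ;; Get rY aWIN rY ;; comb_cmd ;;
     Put aWIN rCUR rW ;; Get rCUR aPAR rCUR"

lemma fix_body_ok:
  assumes "rg s rCUR = u" "rg s rONE = 1"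
    and "\<And>s'. frame {rCUR, rX, rY, rW, rP, rQ} {aWIN} s s' \<Longrightarrow>
      ar s' aWIN = (ar s aWIN)(u := comb L (ar s aWIN (ar s aLFT u)) (ar s aWIN (ar s aRGT u))) \<Longrightarrow>
      rg s' rCUR = ar s aPAR u \<Longrightarrow> tm s' \<le> tm s + 58 \<Longrightarrow> cm s' \<le> cm s + 1 \<Longrightarrow> Q s'"
  shows "wp L B fix_body Q s"
  unfolding fix_body_def
  apply (simp add: exec_simps assms(1))
  apply (rule comb_cmd_ok)
   apply (simp add: assms)
  subgoal for s'
    apply (simp add: exec_simps)
    apply (rule assms(3))
        apply (auto simp: frame_def assms(1))
    done
  done

definition fix_cmd :: cmd where
  "fix_cmd = While rCUR fix_body"

text \<open>Invariant of the bottom-up repair: outside the nodes still to be visited, every node of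
  \<open>S\<close> is locally minimal. Recomputing \<open>u\<close> can spoil only its parent, by
  \<open>parent_ok\<close>, and the parent is next on the walk or the null pointer, which is not in
  \<open>S\<close>.\<close>

lemma fix_cmd_ok:
  assumes "walk (ar s aPAR) (rg s rCUR) us 0" "distinct us" "set us \<subseteq> S" "0 \<notin> S"
    and "\<And>a. a \<in> S \<Longrightarrow> parent_ok (ar s aLFT) (ar s aRGT) (ar s aPAR) a"
    and "\<And>a. a \<in> S \<Longrightarrow> a \<notin> set us \<Longrightarrow> locally_min L (ar s aLFT) (ar s aRGT) (ar s aWIN) a"
    and "rg s rONE = 1"
    and "\<And>s'. frame {rCUR, rX, rY, rW, rP, rQ} {aWIN} s s' \<Longrightarrow>
      (\<And>a. a \<notin> set us \<Longrightarrow> ar s' aWIN a = ar s aWIN a) \<Longrightarrow>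
      (\<And>a. a \<in> S \<Longrightarrow> locally_min L (ar s aLFT) (ar s aRGT) (ar s' aWIN) a) \<Longrightarrow>
      tm s' \<le> tm s + 60 * length us + 1 \<Longrightarrow> cm s' \<le> cm s + length us \<Longrightarrow> Q s'"
  shows "wp L B fix_cmd Q s"
  using assms
proof (induction us arbitrary: s)
  case Nil
  then have "rg s rCUR = 0" by simp
  then show ?case unfolding fix_cmd_def
    by (subst wp_While_iff) (auto simp: exec_simps frame_def intro!: Nil)
next
  case (Cons u us)
  have u0: "u \<in> S" using Cons.prems(3) by simp
  then have "u \<noteq> 0" using Cons.prems(4) by (intro notI) simp
  with u0 have u: "rg s rCUR = u" "u \<in> S" "u \<noteq> 0" "u \<notin> set us" "walk (ar s aPAR) (ar s aPAR u) us 0"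
    using Cons.prems(1-2) by auto
  have nopar: "ar s aPAR u \<noteq> u"
    using u by (cases us) auto
  have par_in: "ar s aPAR u \<in> S \<Longrightarrow> ar s aPAR u \<in> set us"
    using u(5) Cons.prems(4) by (cases us) auto
  have "wp L B fix_body (\<lambda>s'. wp L B fix_cmd Q (tick 1 s')) (tick 1 s)"
  proof (rule fix_body_ok)
    show "rg (tick 1 s) rCUR = u" "rg (tick 1 s) rONE = 1"
      using u Cons.prems(7) by (simp_all add: tick_def)
  next
    fix s1 assume fr: "frame {rCUR, rX, rY, rW, rP, rQ} {aWIN} (tick 1 s) s1"
      and win: "ar s1 aWIN = (ar (tick 1 s) aWIN)(u :=
         comb L (ar (tick 1 s) aWIN (ar (tick 1 s) aLFT u)) (ar (tick 1 s) aWIN (ar (tick 1 s) aRGT u)))"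
      and cur: "rg s1 rCUR = ar (tick 1 s) aPAR u"
      and tm: "tm s1 \<le> tm (tick 1 s) + 58" and cm: "cm s1 \<le> cm (tick 1 s) + 1"
    have ars: "ar s1 aPAR = ar s aPAR" "ar s1 aLFT = ar s aLFT" "ar s1 aRGT = ar s aRGT" "rg s1 rONE = 1"
      using fr Cons.prems(7) by (auto simp: frame_def tick_def)
    have win': "ar s1 aWIN = (ar s aWIN)(u :=
         comb L (ar s aWIN (ar s aLFT u)) (ar s aWIN (ar s aRGT u)))"
      using win by (simp add: tick_def)
    \<comment> \<open>\<open>u\<close> is no child of itself, so writing its winner leaves the
      inputs of the comparison unchanged.\<close>
    have ch: "ar s aLFT u \<noteq> u" "ar s aRGT u \<noteq> u"
      using Cons.prems(5)[OF u(2)] u(3) nopar unfolding parent_ok_def by metis+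
    show "wp L B fix_cmd Q (tick 1 s1)"
    proof (rule Cons.IH)
      show "walk (ar (tick 1 s1) aPAR) (rg (tick 1 s1) rCUR) us 0"
        using u(5) cur ars by (simp add: tick_def)
      show "distinct us" "set us \<subseteq> S" "0 \<notin> S" using Cons.prems(2-4) by auto
      show "parent_ok (ar (tick 1 s1) aLFT) (ar (tick 1 s1) aRGT) (ar (tick 1 s1) aPAR) a" if "a \<in> S" for a
        using Cons.prems(5)[OF that] ars by (simp add: tick_def)
      show "locally_min L (ar (tick 1 s1) aLFT) (ar (tick 1 s1) aRGT) (ar (tick 1 s1) aWIN) a"
        if a: "a \<in> S" "a \<notin> set us" for a
      proof (cases "a = u")
        case True
        then show ?thesis using ch ars win' by (simp add: locally_min_def tick_def)
      next
        case False
        have "ar s aLFT a \<noteq> u" "ar s aRGT a \<noteq> u"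
          using Cons.prems(5)[OF a(1)] u(3) par_in a unfolding parent_ok_def by metis+
        then show ?thesis using Cons.prems(6)[OF a(1)] a False ars win'
          by (simp add: locally_min_def tick_def)
      qed
      show "rg (tick 1 s1) rONE = 1" using ars by (simp add: tick_def)
    next
      fix s' assume fr': "frame {rCUR, rX, rY, rW, rP, rQ} {aWIN} (tick 1 s1) s'"
        and w: "\<And>a. a \<notin> set us \<Longrightarrow> ar s' aWIN a = ar (tick 1 s1) aWIN a"
        and l: "\<And>a. a \<in> S \<Longrightarrow> locally_min L (ar (tick 1 s1) aLFT) (ar (tick 1 s1) aRGT) (ar s' aWIN) a"
        and tm': "tm s' \<le> tm (tick 1 s1) + 60 * length us + 1" and cm': "cm s' \<le> cm (tick 1 s1) + length us"
      show "Q s'"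
      proof (rule Cons.prems(8))
        show "frame {rCUR, rX, rY, rW, rP, rQ} {aWIN} s s'"
          using fr fr' by (auto simp: frame_def tick_def)
        show "ar s' aWIN a = ar s aWIN a" if "a \<notin> set (u # us)" for a
          using w[of a] win' that by (simp add: tick_def)
        show "locally_min L (ar s aLFT) (ar s aRGT) (ar s' aWIN) a" if "a \<in> S" for a
          using l[OF that] ars by (simp add: tick_def)
        show "tm s' \<le> tm s + 60 * length (u # us) + 1" using tm tm' by (simp add: tick_def)
        show "cm s' \<le> cm s + length (u # us)" using cm cm' by (simp add: tick_def)
      qed
    qed
  qed
  then show ?case unfolding fix_cmd_def
    by (subst wp_While_iff) (simp add: u)
qed

subsection \<open>The heap invariant\<close>

text \<open>\<open>ts\<close> are trees outside the spine, and \<open>X\<close> are the nodes whose winner may be out of date.\<close>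

definition core :: "nat rel \<Rightarrow> nat \<Rightarrow> state \<Rightarrow> spine \<Rightarrow> tree list \<Rightarrow> nat set \<Rightarrow> nat set \<Rightarrow> bool" where
  "core L n s sp ts X S \<longleftrightarrow>
     links (ar s aRGT) (ar s aPAR) 0 (map fst sp) (rg s rROOT) \<and>
     (\<forall>b \<in> set sp. block_ok (ar s aLFT) (ar s aRGT) (ar s aPAR) (ar s aDIG) b) \<and>
     (\<forall>t \<in> set ts. trep (ar s aLFT) (ar s aRGT) (ar s aPAR) t) \<and>
     distinct (all_ids sp @ concat (map tids ts)) \<and>
     (\<forall>a \<in> inner_ids sp \<union> \<Union> (set ` iids ` set ts). n < a \<and> a < rg s rNEW) \<and>
     (\<forall>x \<in> set (contents sp) \<union> \<Union> (set ` leaves ` set ts). x < n) \<and>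
     (\<forall>a \<in> inner_ids sp \<union> \<Union> (set ` iids ` set ts). a \<notin> X \<longrightarrow>
        locally_min L (ar s aLFT) (ar s aRGT) (ar s aWIN) a) \<and>
     (\<forall>x \<in> set (contents sp) \<union> \<Union> (set ` leaves ` set ts).
        ar s aWIN (Suc x) = (if x \<in> S then Suc x else 0)) \<and>
     ar s aWIN 0 = 0 \<and> (\<forall>a \<ge> rg s rNEW. ar s aRGT a = 0 \<and> ar s aDIG a = 0) \<and> ar s aDIG 0 = 0 \<and>
     n < rg s rNEW \<and> rg s rONE = 1 \<and> rg s rZERO = 0"

definition heap :: "nat rel \<Rightarrow> nat \<Rightarrow> state \<Rightarrow> spine \<Rightarrow> nat set \<Rightarrow> bool" where
  "heap L n s sp S \<longleftrightarrow> core L n s sp [] {} S \<and> heights_ok 0 sp"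

lemma block_ok_cong:
  assumes "block_ok lf rt pr dg (s, d, t)" "distinct (tids t)"
    and "\<And>a. a \<in> set (iids t) \<Longrightarrow> lf' a = lf a \<and> rt' a = rt a"
    and "\<And>a. a \<in> set (tids t) \<Longrightarrow> pr' a = pr a"
    and "lf' s = lf s" "dg' s = dg s"
  shows "block_ok lf' rt' pr' dg' (s, d, t)"
  using assms trep_cong[of lf rt pr t lf' rt' pr'] rid_in_tids[of t] by (auto simp: block_ok_def)

lemma in_spine_ids:
  "(s, d, t) \<in> set sp \<Longrightarrow> s \<in> set (all_ids sp) \<and> set (tids t) \<subseteq> set (all_ids sp)"
  by (auto simp: all_ids_def)

lemma distinct_spine_tids:
  "distinct (all_ids sp) \<Longrightarrow> (s, d, t) \<in> set sp \<Longrightarrow> distinct (tids t) \<and> s \<notin> set (tids t)"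
  by (induction sp) auto

lemma fst_in_all_ids: "set (map fst sp) \<subseteq> set (all_ids sp)"
  by (auto simp: all_ids_def)

lemma fst_in_inner_ids: "set (map fst sp) \<subseteq> inner_ids sp"
  by (auto simp: inner_ids_def)

lemma distinct_fst: "distinct (all_ids sp) \<Longrightarrow> distinct (map fst sp)"
proof (induction sp)
  case (Cons y sp)
  then show ?case using fst_in_all_ids[of sp] by (cases y) auto
qed simp

text \<open>The right pointers of spine nodes may change: they belong to the list described by
  \<open>links\<close>, not to any block.\<close>

lemma blocks_cong:
  assumes "\<And>b. b \<in> set sp \<Longrightarrow> block_ok lf rt pr dg b" "distinct (all_ids sp)"
    and "\<And>a. a \<in> set (all_ids sp) \<Longrightarrow> lf' a = lf a \<and> dg' a = dg a \<and> pr' a = pr a"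
    and "\<And>a. a \<in> inner_ids sp \<Longrightarrow> a \<notin> set (map fst sp) \<Longrightarrow> rt' a = rt a"
    and "b \<in> set sp"
  shows "block_ok lf' rt' pr' dg' b"
proof -
  obtain s d t where b: "b = (s, d, t)" by (cases b) auto
  note ids = in_spine_ids[of s d t sp]
  note dt = distinct_spine_tids[OF assms(2), of s d t]
  have inner: "set (iids t) \<subseteq> inner_ids sp" using assms(5) b by (auto simp: inner_ids_def)
  have disj: "a \<notin> set (map fst sp)" if "a \<in> set (iids t)" for a
  proof -
    have "a \<in> set (tids t)" using that iids_subset by blast
    then show ?thesis using assms(2,5) b
    proof (induction sp)
      case (Cons c sp)
      obtain s' d' t' where c: "c = (s', d', t')" by (cases c) auto
      show ?case
      proof (cases "c = b")
        case True
        then show ?thesis using Cons.prems c b fst_in_all_ids[of sp] by auto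
      next
        case False
        then have "b \<in> set sp" using Cons.prems by auto
        moreover from this have "a \<in> set (all_ids sp)"
          using Cons.prems(1,4) in_spine_ids[of s d t sp] by auto
        ultimately show ?thesis using Cons c by auto
      qed
    qed simp
  qed
  show ?thesis unfolding b
  proof (rule block_ok_cong)
    show "block_ok lf rt pr dg (s, d, t)" using assms(1,5) b by simp
    show "distinct (tids t)" using dt assms(5) b by simp
    show "\<And>a. a \<in> set (iids t) \<Longrightarrow> lf' a = lf a \<and> rt' a = rt a"
    proof -
      fix a assume a: "a \<in> set (iids t)"
      then have "a \<in> set (all_ids sp)" using iids_subset[of t] ids assms(5) b by blast
      moreover have "rt' a = rt a" using assms(4) inner disj a by blast
      ultimately show "lf' a = lf a \<and> rt' a = rt a" using assms(3) by blast
    qed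
    show "\<And>a. a \<in> set (tids t) \<Longrightarrow> pr' a = pr a"
      using assms(3,5) ids b by blast
    show "lf' s = lf s" "dg' s = dg s"
      using assms(3,5) ids b by blast+
  qed
qed

lemma coreD:
  assumes "core L n s sp ts X S"
  shows "links (ar s aRGT) (ar s aPAR) 0 (map fst sp) (rg s rROOT)"
    and "\<And>b. b \<in> set sp \<Longrightarrow> block_ok (ar s aLFT) (ar s aRGT) (ar s aPAR) (ar s aDIG) b"
    and "\<And>t. t \<in> set ts \<Longrightarrow> trep (ar s aLFT) (ar s aRGT) (ar s aPAR) t"
    and "distinct (all_ids sp @ concat (map tids ts))"
    and "\<And>a. a \<in> inner_ids sp \<union> \<Union> (set ` iids ` set ts) \<Longrightarrow> n < a \<and> a < rg s rNEW"
    and "\<And>x. x \<in> set (contents sp) \<union> \<Union> (set ` leaves ` set ts) \<Longrightarrow> x < n"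
    and "\<And>a. a \<in> inner_ids sp \<union> \<Union> (set ` iids ` set ts) \<Longrightarrow> a \<notin> X \<Longrightarrow>
        locally_min L (ar s aLFT) (ar s aRGT) (ar s aWIN) a"
    and "\<And>x. x \<in> set (contents sp) \<union> \<Union> (set ` leaves ` set ts) \<Longrightarrow>
        ar s aWIN (Suc x) = (if x \<in> S then Suc x else 0)"
    and "ar s aWIN 0 = 0" "\<And>a. rg s rNEW \<le> a \<Longrightarrow> ar s aRGT a = 0 \<and> ar s aDIG a = 0" "ar s aDIG 0 = 0"
    and "n < rg s rNEW" "rg s rONE = 1" "rg s rZERO = 0"
proof -
  note c = assms[unfolded core_def]
  show "links (ar s aRGT) (ar s aPAR) 0 (map fst sp) (rg s rROOT)"
    using c[THEN conjunct1] by simp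
  show "\<And>b. b \<in> set sp \<Longrightarrow> block_ok (ar s aLFT) (ar s aRGT) (ar s aPAR) (ar s aDIG) b"
    using c[THEN conjunct2, THEN conjunct1] by blast
  show "\<And>t. t \<in> set ts \<Longrightarrow> trep (ar s aLFT) (ar s aRGT) (ar s aPAR) t"
    using c[THEN conjunct2, THEN conjunct2, THEN conjunct1] by blast
  show "distinct (all_ids sp @ concat (map tids ts))"
    using c[THEN conjunct2, THEN conjunct2, THEN conjunct2, THEN conjunct1] by simp
  show "\<And>a. a \<in> inner_ids sp \<union> \<Union> (set ` iids ` set ts) \<Longrightarrow> n < a \<and> a < rg s rNEW"
    using c[THEN conjunct2, THEN conjunct2, THEN conjunct2, THEN conjunct2, THEN conjunct1] by blast
  show "\<And>x. x \<in> set (contents sp) \<union> \<Union> (set ` leaves ` set ts) \<Longrightarrow> x < n"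
    using c[THEN conjunct2, THEN conjunct2, THEN conjunct2, THEN conjunct2, THEN conjunct2, THEN conjunct1] by blast
  show "\<And>a. a \<in> inner_ids sp \<union> \<Union> (set ` iids ` set ts) \<Longrightarrow> a \<notin> X \<Longrightarrow>
        locally_min L (ar s aLFT) (ar s aRGT) (ar s aWIN) a"
    using c[THEN conjunct2, THEN conjunct2, THEN conjunct2, THEN conjunct2, THEN conjunct2, THEN conjunct2, THEN conjunct1] by blast
  show "\<And>x. x \<in> set (contents sp) \<union> \<Union> (set ` leaves ` set ts) \<Longrightarrow>
        ar s aWIN (Suc x) = (if x \<in> S then Suc x else 0)"
    using c[THEN conjunct2, THEN conjunct2, THEN conjunct2, THEN conjunct2, THEN conjunct2, THEN conjunct2, THEN conjunct2, THEN conjunct1] by blast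
  show "ar s aWIN 0 = 0"
    using c[THEN conjunct2, THEN conjunct2, THEN conjunct2, THEN conjunct2, THEN conjunct2, THEN conjunct2, THEN conjunct2, THEN conjunct2, THEN conjunct1] by simp
  show "\<And>a. rg s rNEW \<le> a \<Longrightarrow> ar s aRGT a = 0 \<and> ar s aDIG a = 0"
    using c[THEN conjunct2, THEN conjunct2, THEN conjunct2, THEN conjunct2, THEN conjunct2, THEN conjunct2, THEN conjunct2, THEN conjunct2, THEN conjunct2, THEN conjunct1] by blast
  show "ar s aDIG 0 = 0"
    using c[THEN conjunct2, THEN conjunct2, THEN conjunct2, THEN conjunct2, THEN conjunct2, THEN conjunct2, THEN conjunct2, THEN conjunct2, THEN conjunct2, THEN conjunct2, THEN conjunct1] by simp
  show "n < rg s rNEW"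
    using c[THEN conjunct2, THEN conjunct2, THEN conjunct2, THEN conjunct2, THEN conjunct2, THEN conjunct2, THEN conjunct2, THEN conjunct2, THEN conjunct2, THEN conjunct2, THEN conjunct2, THEN conjunct1] by simp
  show "rg s rONE = 1"
    using c[THEN conjunct2, THEN conjunct2, THEN conjunct2, THEN conjunct2, THEN conjunct2, THEN conjunct2, THEN conjunct2, THEN conjunct2, THEN conjunct2, THEN conjunct2, THEN conjunct2, THEN conjunct2, THEN conjunct1] by simp
  show "rg s rZERO = 0"
    using c[THEN conjunct2, THEN conjunct2, THEN conjunct2, THEN conjunct2, THEN conjunct2, THEN conjunct2, THEN conjunct2, THEN conjunct2, THEN conjunct2, THEN conjunct2, THEN conjunct2, THEN conjunct2, THEN conjunct2] by simp
qed

lemma coreI: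
  assumes "links (ar s aRGT) (ar s aPAR) 0 (map fst sp) (rg s rROOT)"
    and "\<And>b. b \<in> set sp \<Longrightarrow> block_ok (ar s aLFT) (ar s aRGT) (ar s aPAR) (ar s aDIG) b"
    and "\<And>t. t \<in> set ts \<Longrightarrow> trep (ar s aLFT) (ar s aRGT) (ar s aPAR) t"
    and "distinct (all_ids sp @ concat (map tids ts))"
    and "\<And>a. a \<in> inner_ids sp \<union> \<Union> (set ` iids ` set ts) \<Longrightarrow> n < a \<and> a < rg s rNEW"
    and "\<And>x. x \<in> set (contents sp) \<union> \<Union> (set ` leaves ` set ts) \<Longrightarrow> x < n"
    and "\<And>a. a \<in> inner_ids sp \<union> \<Union> (set ` iids ` set ts) \<Longrightarrow> a \<notin> X \<Longrightarrow>
        locally_min L (ar s aLFT) (ar s aRGT) (ar s aWIN) a"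
    and "\<And>x. x \<in> set (contents sp) \<union> \<Union> (set ` leaves ` set ts) \<Longrightarrow>
        ar s aWIN (Suc x) = (if x \<in> S then Suc x else 0)"
    and "ar s aWIN 0 = 0"
    and "\<And>a. rg s rNEW \<le> a \<Longrightarrow> ar s aRGT a = 0 \<and> ar s aDIG a = 0"
    and "ar s aDIG 0 = 0"
    and "n < rg s rNEW"
    and "rg s rONE = 1"
    and "rg s rZERO = 0"
  shows "core L n s sp ts X S"
  unfolding core_def
  by (intro conjI ballI allI impI; rule assms assms(5)[THEN conjunct1] assms(5)[THEN conjunct2]
      assms(10)[THEN conjunct1] assms(10)[THEN conjunct2]; assumption)

lemma core_ids:
  assumes "core L n s sp ts X S"
  shows "a \<in> set (all_ids sp) \<union> \<Union> (set ` tids ` set ts) \<Longrightarrow> 0 < a \<and> a < rg s rNEW"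
proof -
  note D = coreD[OF assms]
  assume "a \<in> set (all_ids sp) \<union> \<Union> (set ` tids ` set ts)"
  then consider "a \<in> inner_ids sp \<union> \<Union> (set ` iids ` set ts)"
    | x where "a = Suc x" "x \<in> set (contents sp) \<union> \<Union> (set ` leaves ` set ts)"
    unfolding set_all_ids set_tids by (auto simp: set_tids)
  then show ?thesis
  proof cases
    case 1
    then show ?thesis using D(5) by fastforce
  next
    case 2
    then show ?thesis using D(6)[of x] D(12) by simp
  qed
qed

section \<open>Elementary changes of the heap structure\<close>

text \<open>A level with two trees keeps the incoming tree alone and hands on its two old trees as
  the single tree \<open>c\<close> that they already form. No node is created, and it is the older
  items that move up.\<close>

lemma core_carry:
  assumes c: "core L n s (pre @ (v, True, c) # rest) [t] X S"
    and e: "ar s' aLFT = (ar s aLFT)(v := rid t)" "ar s' aPAR = (ar s aPAR)(rid t := v)"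
      "ar s' aDIG = (ar s aDIG)(v := 0)" "ar s' aRGT = ar s aRGT" "ar s' aWIN = ar s aWIN"
      "rg s' rROOT = rg s rROOT" "rg s' rNEW = rg s rNEW" "rg s' rONE = rg s rONE" "rg s' rZERO = rg s rZERO"
  shows "core L n s' (pre @ (v, False, t) # rest) [c] (insert v X) S"
proof -
  note D = coreD[OF c]
  have d: "distinct (all_ids pre @ v # tids c @ all_ids rest @ tids t)" using D(4) by simp
  have r: "rid t \<in> set (tids t)" "rid c \<in> set (tids c)" by (rule rid_in_tids)+
  have 1: "links (ar s' aRGT) (ar s' aPAR) 0 (map fst (pre @ (v, False, t) # rest)) (rg s' rROOT)"
  proof (rule links_cong)
    show "links (ar s aRGT) (ar s aPAR) 0 (map fst (pre @ (v, False, t) # rest)) (rg s' rROOT)"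
      using D(1) e by simp
    show "ar s' aRGT a = ar s aRGT a \<and> ar s' aPAR a = ar s aPAR a"
      if "a \<in> set (map fst (pre @ (v, False, t) # rest))" for a
    proof -
      have "a \<in> set (all_ids pre) \<union> {v} \<union> set (all_ids rest)"
        using that fst_in_all_ids[of pre] fst_in_all_ids[of rest] by auto
      then have "a \<noteq> rid t" using d r by auto
      then show ?thesis using e by simp
    qed
  qed
  have bl: "block_ok (ar s' aLFT) (ar s' aRGT) (ar s' aPAR) (ar s' aDIG) b"
    if "b \<in> set sp" "sp = pre \<or> sp = rest" for b sp
  proof (rule blocks_cong[OF _ _ _ _ that(1)])
    show "block_ok (ar s aLFT) (ar s aRGT) (ar s aPAR) (ar s aDIG) b" if "b \<in> set sp" for b
      by (rule D(2)) (use that \<open>sp = pre \<or> sp = rest\<close> in auto)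
    show "distinct (all_ids sp)" using d that(2) by auto
    show "ar s' aLFT a = ar s aLFT a \<and> ar s' aDIG a = ar s aDIG a \<and> ar s' aPAR a = ar s aPAR a"
      if "a \<in> set (all_ids sp)" for a
    proof -
      have "a \<noteq> v" "a \<noteq> rid t" using that \<open>sp = pre \<or> sp = rest\<close> d r by auto
      then show ?thesis using e by simp
    qed
    show "ar s' aRGT a = ar s aRGT a" for a using e by simp
  qed
  have tr: "trep (ar s' aLFT) (ar s' aRGT) (ar s' aPAR) u" if "u = t \<or> u = c" for u
  proof (rule trep_cong)
    show "trep (ar s aLFT) (ar s aRGT) (ar s aPAR) u"
      using that D(2)[of "(v, True, c)"] D(3) by (auto simp: block_ok_def)
    show "distinct (tids u)" using d that by auto
    show "ar s' aLFT a = ar s aLFT a \<and> ar s' aRGT a = ar s aRGT a" if "a \<in> set (iids u)" for a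
    proof -
      have "a \<noteq> v" using that \<open>u = t \<or> u = c\<close> iids_subset[of u] d by auto
      then show ?thesis using e by simp
    qed
    show "ar s' aPAR a = ar s aPAR a" if "a \<in> set (tids u)" "a \<noteq> rid u" for a
    proof -
      have "a \<noteq> rid t" using that \<open>u = t \<or> u = c\<close> d r by auto
      then show ?thesis using e by simp
    qed
  qed
  have bv: "block_ok (ar s' aLFT) (ar s' aRGT) (ar s' aPAR) (ar s' aDIG) (v, False, t)"
    using tr[of t] e by (simp add: block_ok_def)
  have 2: "block_ok (ar s' aLFT) (ar s' aRGT) (ar s' aPAR) (ar s' aDIG) b"
    if "b \<in> set (pre @ (v, False, t) # rest)" for b
  proof -
    have "b \<in> set pre \<or> b = (v, False, t) \<or> b \<in> set rest" using that by auto
    then show ?thesis using bl bv by blast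
  qed
  have in_eq: "inner_ids (pre @ (v, False, t) # rest) \<union> \<Union> (set ` iids ` set [c]) =
      inner_ids (pre @ (v, True, c) # rest) \<union> \<Union> (set ` iids ` set [t])"
    by auto
  have co_eq: "set (contents (pre @ (v, False, t) # rest)) \<union> \<Union> (set ` leaves ` set [c]) =
      set (contents (pre @ (v, True, c) # rest)) \<union> \<Union> (set ` leaves ` set [t])"
    by auto
  have lm: "locally_min L (ar s' aLFT) (ar s' aRGT) (ar s' aWIN) a"
    if "a \<in> inner_ids (pre @ (v, True, c) # rest) \<union> \<Union> (set ` iids ` set [t])" "a \<notin> insert v X" for a
    using D(7)[OF that(1)] that(2) e by (auto simp: locally_min_def)
  show ?thesis
  proof (rule coreI, unfold in_eq co_eq)
    show "trep (ar s' aLFT) (ar s' aRGT) (ar s' aPAR) u" if "u \<in> set [c]" for u using that tr by simp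
    show "distinct (all_ids (pre @ (v, False, t) # rest) @ concat (map tids [c]))" using d by auto
  qed (use 1 2 lm D(5,6,8-14) e in simp_all)
qed

text \<open>A level with one tree combines it with the incoming tree, the older one on the left so
  that \<open>contents\<close> stays in the order of insertion. The new node \<open>z\<close> and
  the spine node \<open>v\<close> become stale.\<close>

lemma core_join:
  assumes c: "core L n s (pre @ (v, False, c) # rest) [t] X S"
    and e: "z = rg s rNEW" "ar s' aLFT = (ar s aLFT)(z := rid c, v := z)" "ar s' aRGT = (ar s aRGT)(z := rid t)"
      "ar s' aPAR = (ar s aPAR)(rid c := z, rid t := z, z := v)"
      "ar s' aDIG = (ar s aDIG)(v := 1)" "ar s' aWIN = ar s aWIN"
      "rg s' rROOT = rg s rROOT" "rg s' rNEW = Suc z" "rg s' rONE = rg s rONE" "rg s' rZERO = rg s rZERO"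
  shows "core L n s' (pre @ (v, True, Node z c t) # rest) [] (insert z (insert v X)) S"
proof -
  note D = coreD[OF c]
  have d: "distinct (all_ids pre @ v # tids c @ all_ids rest @ tids t)" using D(4) by simp
  have z: "z \<notin> set (all_ids pre @ v # tids c @ all_ids rest @ tids t)"
    using core_ids[OF c, of z] e(1) by auto
  have r: "rid t \<in> set (tids t)" "rid c \<in> set (tids c)" by (rule rid_in_tids)+
  have ne: "v \<noteq> z" "rid c \<noteq> z" "rid t \<noteq> z" "rid c \<noteq> rid t" "v \<noteq> rid c" "v \<noteq> rid t" using d z r by auto
  have 1: "links (ar s' aRGT) (ar s' aPAR) 0 (map fst (pre @ (v, True, Node z c t) # rest)) (rg s' rROOT)"
  proof (rule links_cong)
    show "links (ar s aRGT) (ar s aPAR) 0 (map fst (pre @ (v, True, Node z c t) # rest)) (rg s' rROOT)"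
      using D(1) e by simp
    show "ar s' aRGT a = ar s aRGT a \<and> ar s' aPAR a = ar s aPAR a"
      if "a \<in> set (map fst (pre @ (v, True, Node z c t) # rest))" for a
    proof -
      have "a \<in> set (all_ids pre) \<union> {v} \<union> set (all_ids rest)"
        using that fst_in_all_ids[of pre] fst_in_all_ids[of rest] by auto
      then have "a \<noteq> rid t" "a \<noteq> rid c" "a \<noteq> z" using d r z by auto
      then show ?thesis using e by simp
    qed
  qed
  have bl: "block_ok (ar s' aLFT) (ar s' aRGT) (ar s' aPAR) (ar s' aDIG) b"
    if "b \<in> set sp" "sp = pre \<or> sp = rest" for b sp
  proof (rule blocks_cong[OF _ _ _ _ that(1)])
    show "block_ok (ar s aLFT) (ar s aRGT) (ar s aPAR) (ar s aDIG) b" if "b \<in> set sp" for b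
      by (rule D(2)) (use that \<open>sp = pre \<or> sp = rest\<close> in auto)
    show "distinct (all_ids sp)" using d that(2) by auto
    show "ar s' aLFT a = ar s aLFT a \<and> ar s' aDIG a = ar s aDIG a \<and> ar s' aPAR a = ar s aPAR a"
      if "a \<in> set (all_ids sp)" for a
    proof -
      have "a \<noteq> v" "a \<noteq> rid t" "a \<noteq> rid c" "a \<noteq> z" using that \<open>sp = pre \<or> sp = rest\<close> d r z by auto
      then show ?thesis using e by simp
    qed
    show "ar s' aRGT a = ar s aRGT a" if "a \<in> inner_ids sp" for a
    proof -
      have "a \<noteq> z" using that \<open>sp = pre \<or> sp = rest\<close> z by (auto simp: set_all_ids)
      then show ?thesis using e by simp
    qed
  qed
  have tr: "trep (ar s' aLFT) (ar s' aRGT) (ar s' aPAR) u" if "u = t \<or> u = c" for u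
  proof (rule trep_cong)
    show "trep (ar s aLFT) (ar s aRGT) (ar s aPAR) u"
      using that D(2)[of "(v, False, c)"] D(3) by (auto simp: block_ok_def)
    show "distinct (tids u)" using d that by auto
    show "ar s' aLFT a = ar s aLFT a \<and> ar s' aRGT a = ar s aRGT a" if "a \<in> set (iids u)" for a
    proof -
      have "a \<noteq> v" "a \<noteq> z" using that \<open>u = t \<or> u = c\<close> iids_subset[of u] d z by auto
      then show ?thesis using e by simp
    qed
    show "ar s' aPAR a = ar s aPAR a" if "a \<in> set (tids u)" "a \<noteq> rid u" for a
    proof -
      have "a \<noteq> rid t" "a \<noteq> rid c" "a \<noteq> z" using that \<open>u = t \<or> u = c\<close> d r z by auto
      then show ?thesis using e by simp
    qed
  qed
  have bv: "block_ok (ar s' aLFT) (ar s' aRGT) (ar s' aPAR) (ar s' aDIG) (v, True, Node z c t)"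
    using tr[of t] tr[of c] e ne by (simp add: block_ok_def)
  have 2: "block_ok (ar s' aLFT) (ar s' aRGT) (ar s' aPAR) (ar s' aDIG) b"
    if "b \<in> set (pre @ (v, True, Node z c t) # rest)" for b
  proof -
    have "b \<in> set pre \<or> b = (v, True, Node z c t) \<or> b \<in> set rest" using that by auto
    then show ?thesis using bl bv by blast
  qed
  let ?I = "inner_ids (pre @ (v, False, c) # rest) \<union> \<Union> (set ` iids ` set [t])"
  have in_eq: "inner_ids (pre @ (v, True, Node z c t) # rest) \<union> \<Union> (set ` iids ` set []) = insert z ?I"
    by auto
  have co_eq: "set (contents (pre @ (v, True, Node z c t) # rest)) \<union> \<Union> (set ` leaves ` set []) =
      set (contents (pre @ (v, False, c) # rest)) \<union> \<Union> (set ` leaves ` set [t])"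
    by auto
  have lm: "locally_min L (ar s' aLFT) (ar s' aRGT) (ar s' aWIN) a"
    if "a \<in> insert z ?I" "a \<notin> insert z (insert v X)" for a
    using D(7)[of a] that e by (auto simp: locally_min_def)
  have dist: "distinct (all_ids (pre @ (v, True, Node z c t) # rest) @ concat (map tids []))"
    using d z by auto
  have bound: "n < a \<and> a < rg s' rNEW" if "a \<in> insert z ?I" for a
    using D(5)[of a] D(12) that e by (auto simp: less_Suc_eq)
  have vz: "v < z" using core_ids[OF c, of v] e(1) by simp
  have fresh: "\<forall>a \<ge> rg s' rNEW. ar s' aRGT a = 0 \<and> ar s' aDIG a = 0"
    using D(10) e vz by auto
  have "ar s' aDIG 0 = 0" using D(11) e core_ids[OF c, of v] by auto
  moreover have "n < rg s' rNEW" using D(12) e by simp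
  ultimately show ?thesis
    using 1 2 lm dist bound fresh D(6,8-9,13-14) e
    by (intro coreI; (unfold in_eq co_eq)?) simp_all
qed

text \<open>The right pointer and the digit of the appended node are never written; the invariant
  that cells from \<open>rNEW\<close> on are 0 makes it the end of the list, with a single
  tree.\<close>

lemma core_new:
  assumes c: "core L n s pre [t] X S"
    and e: "z = rg s rNEW" "ar s' aLFT = (ar s aLFT)(z := rid t)"
      "ar s' aRGT = (if pre = [] then ar s aRGT else (ar s aRGT)(fst (last pre) := z))"
      "ar s' aPAR = (ar s aPAR)(rid t := z, z := (if pre = [] then 0 else fst (last pre)))"
      "ar s' aDIG = ar s aDIG" "ar s' aWIN = ar s aWIN"
      "rg s' rROOT = (if pre = [] then z else rg s rROOT)" "rg s' rNEW = Suc z"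
      "rg s' rONE = rg s rONE" "rg s' rZERO = rg s rZERO"
  shows "core L n s' (pre @ [(z, False, t)]) [] (insert z (set (map fst pre) \<union> X)) S"
proof -
  note D = coreD[OF c]
  have d: "distinct (all_ids pre @ tids t)" using D(4) by simp
  have z: "z \<notin> set (all_ids pre @ tids t)"
    using core_ids[OF c, of z] e(1) by auto
  have r: "rid t \<in> set (tids t)" by (rule rid_in_tids)
  have ne: "rid t \<noteq> z" using z r by auto
  have lp: "pre \<noteq> [] \<Longrightarrow> fst (last pre) \<in> set (map fst pre)" by auto
  have lz: "pre \<noteq> [] \<Longrightarrow> fst (last pre) < z"
  proof -
    assume "pre \<noteq> []"
    then have "fst (last pre) \<in> set (all_ids pre)" using lp fst_in_all_ids[of pre] by blast
    then show ?thesis using core_ids[OF c, of "fst (last pre)"] e(1) by simp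
  qed
  have df: "distinct (map fst pre @ [z])" using distinct_fst[of pre] d z fst_in_all_ids[of pre] by auto
  have fr: "a \<noteq> rid t \<and> a \<noteq> z" if "a \<in> set (all_ids pre)" for a using that d z r by auto
  have "links (ar s' aRGT) (ar s' aPAR) 0 (map fst pre @ [z]) (if map fst pre = [] then z else rg s rROOT)"
  proof (rule links_snoc[OF D(1) df])
    show "ar s' aPAR z = last (0 # map fst pre)" using e by (simp add: last_map)
    show "ar s' aRGT z = 0" using e D(10)[of z] lz by (cases "pre = []") auto
    show "ar s' aPAR a = ar s aPAR a" if "a \<in> set (map fst pre)" for a
      using fr[of a] that fst_in_all_ids[of pre] e by auto
    show "ar s' aRGT a = ar s aRGT a" if "a \<in> set (map fst pre)" "a \<noteq> last (map fst pre)" for a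
      using that e by (auto simp: last_map split: if_splits)
    show "ar s' aRGT (last (map fst pre)) = z" if "map fst pre \<noteq> []"
      using that e by (auto simp: last_map)
  qed
  then have 1: "links (ar s' aRGT) (ar s' aPAR) 0 (map fst (pre @ [(z, False, t)])) (rg s' rROOT)"
    using e by simp
  have bl: "block_ok (ar s' aLFT) (ar s' aRGT) (ar s' aPAR) (ar s' aDIG) b" if "b \<in> set pre" for b
  proof (rule blocks_cong[OF _ _ _ _ that])
    show "block_ok (ar s aLFT) (ar s aRGT) (ar s aPAR) (ar s aDIG) b" if "b \<in> set pre" for b
      by (rule D(2)[OF that])
    show "distinct (all_ids pre)" using d by auto
    show "ar s' aLFT a = ar s aLFT a \<and> ar s' aDIG a = ar s aDIG a \<and> ar s' aPAR a = ar s aPAR a"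
      if "a \<in> set (all_ids pre)" for a using fr[OF that] e by simp
    show "ar s' aRGT a = ar s aRGT a" if "a \<in> inner_ids pre" "a \<notin> set (map fst pre)" for a
      using that lp e by (cases "pre = []") auto
  qed
  have tr: "trep (ar s' aLFT) (ar s' aRGT) (ar s' aPAR) t"
  proof (rule trep_cong)
    show "trep (ar s aLFT) (ar s aRGT) (ar s aPAR) t" using D(3) by auto
    show "distinct (tids t)" using d by auto
    show "ar s' aLFT a = ar s aLFT a \<and> ar s' aRGT a = ar s aRGT a" if "a \<in> set (iids t)" for a
    proof -
      have "a \<in> set (tids t)" using that iids_subset[of t] by auto
      then have "a \<noteq> z" "pre \<noteq> [] \<Longrightarrow> a \<noteq> fst (last pre)"
      proof -
        have "a \<notin> set (all_ids pre)" using \<open>a \<in> set (tids t)\<close> d by auto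
        then show "pre \<noteq> [] \<Longrightarrow> a \<noteq> fst (last pre)" using lp fst_in_all_ids[of pre] by blast
        show "a \<noteq> z" using \<open>a \<in> set (tids t)\<close> z by auto
      qed
      then show ?thesis using e by simp
    qed
    show "ar s' aPAR a = ar s aPAR a" if "a \<in> set (tids t)" "a \<noteq> rid t" for a
      using that z e by auto
  qed
  have bv: "block_ok (ar s' aLFT) (ar s' aRGT) (ar s' aPAR) (ar s' aDIG) (z, False, t)"
    using tr e ne D(10)[of z] by (simp add: block_ok_def)
  have 2: "block_ok (ar s' aLFT) (ar s' aRGT) (ar s' aPAR) (ar s' aDIG) b"
    if "b \<in> set (pre @ [(z, False, t)])" for b
  proof -
    have "b \<in> set pre \<or> b = (z, False, t)" using that by auto
    then show ?thesis using bl bv by blast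
  qed
  let ?I = "inner_ids pre \<union> \<Union> (set ` iids ` set [t])"
  have in_eq: "inner_ids (pre @ [(z, False, t)]) \<union> \<Union> (set ` iids ` set []) = insert z ?I"
    by auto
  have co_eq: "set (contents (pre @ [(z, False, t)])) \<union> \<Union> (set ` leaves ` set []) =
      set (contents pre) \<union> \<Union> (set ` leaves ` set [t])"
    by auto
  have lm: "locally_min L (ar s' aLFT) (ar s' aRGT) (ar s' aWIN) a"
    if "a \<in> insert z ?I" "a \<notin> insert z (set (map fst pre) \<union> X)" for a
  proof -
    have "pre \<noteq> [] \<Longrightarrow> a \<noteq> fst (last pre)" using that(2) lp by auto
    then show ?thesis using D(7)[of a] that e by (auto simp: locally_min_def)
  qed
  have dist: "distinct (all_ids (pre @ [(z, False, t)]) @ concat (map tids []))"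
    using d z by auto
  have bound: "n < a \<and> a < rg s' rNEW" if "a \<in> insert z ?I" for a
    using D(5)[of a] D(12) that e by (auto simp: less_Suc_eq)
  have fresh: "\<forall>a \<ge> rg s' rNEW. ar s' aRGT a = 0 \<and> ar s' aDIG a = 0"
    using D(10) e lz by auto
  have "n < rg s' rNEW" using D(12) e by simp
  then show ?thesis
    using 1 2 lm dist bound fresh D(6,8-9,11,13-14) e
    by (intro coreI; (unfold in_eq co_eq)?) simp_all
qed

lemma tree_children: "trep lf rt pr t \<Longrightarrow> a \<in> set (iids t) \<Longrightarrow> lf a \<in> set (tids t) \<and> rt a \<in> set (tids t)"
proof (induction t)
  case (Node b l r)
  then show ?case using rid_in_tids[of l] rid_in_tids[of r] by auto
qed simp

lemma spine_children:
  assumes "links rt pr p (map fst sp) i" "\<And>b. b \<in> set sp \<Longrightarrow> block_ok lf rt pr dg b"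
    and "a \<in> inner_ids sp"
  shows "lf a \<in> set (all_ids sp) \<and> rt a \<in> insert 0 (set (all_ids sp))"
  using assms
proof (induction sp arbitrary: p i)
  case (Cons b sp)
  obtain v d t where b: "b = (v, d, t)" by (cases b) auto
  have ok: "block_ok lf rt pr dg (v, d, t)" using Cons.prems(2) b by auto
  have l: "links rt pr v (map fst sp) (rt v)" using Cons.prems(1) b by auto
  consider "a = v" | "a \<in> set (iids t)" | "a \<in> inner_ids sp" using Cons.prems(3) b by auto
  then show ?case
  proof cases
    case 1
    have "rt v \<in> insert 0 (set (all_ids sp))" using l fst_in_all_ids[of sp] by (cases sp) auto
    then show ?thesis using ok 1 b rid_in_tids[of t] by (auto simp: block_ok_def)
  next
    case 2
    then show ?thesis using ok tree_children[of lf rt pr t a] b by (auto simp: block_ok_def)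
  next
    case 3
    have "lf a \<in> set (all_ids sp) \<and> rt a \<in> insert 0 (set (all_ids sp))"
      using Cons.prems(2) 3 by (intro Cons.IH[OF l]) auto
    then show ?thesis using b by auto
  qed
qed simp

lemma core_leaf:
  assumes c: "core L n s sp [] X S" and x: "x < n" "x \<notin> set (contents sp)"
    and e: "ar s' aLFT = ar s aLFT" "ar s' aPAR = ar s aPAR"
      "ar s' aDIG = ar s aDIG" "ar s' aRGT = ar s aRGT" "ar s' aWIN = (ar s aWIN)(Suc x := Suc x)"
      "rg s' rROOT = rg s rROOT" "rg s' rNEW = rg s rNEW" "rg s' rONE = rg s rONE" "rg s' rZERO = rg s rZERO"
  shows "core L n s' sp [Leaf x] X (insert x S)"
proof -
  note D = coreD[OF c]
  have ni: "Suc x \<notin> inner_ids sp" using D(5)[of "Suc x"] x by auto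
  then have na: "Suc x \<notin> set (all_ids sp)" using x(2) by (auto simp: set_all_ids)
  then have d: "distinct (all_ids sp @ concat (map tids [Leaf x]))"
    using D(4) by auto
  have X: "ar s aLFT a \<noteq> Suc x \<and> ar s aRGT a \<noteq> Suc x" if "a \<in> inner_ids sp" for a
    using spine_children[OF D(1) D(2) that] na by auto
  have lm: "locally_min L (ar s' aLFT) (ar s' aRGT) (ar s' aWIN) a"
    if "a \<in> inner_ids sp" "a \<notin> X" for a
  proof -
    have "a \<noteq> Suc x" using ni that by auto
    then show ?thesis using D(7)[of a] X[of a] that e by (simp add: locally_min_def)
  qed
  have w: "ar s' aWIN (Suc y) = (if y \<in> insert x S then Suc y else 0)" if "y \<in> insert x (set (contents sp))" for y
    using D(8)[of y] e that x(2) by auto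
  show ?thesis
  proof (rule coreI)
    show "block_ok (ar s' aLFT) (ar s' aRGT) (ar s' aPAR) (ar s' aDIG) b" if "b \<in> set sp" for b
      using D(2)[OF that] e by simp
  qed (use D(1,5,6,9-14) d lm w x e in auto)
qed

lemma core_fix:
  assumes c: "core L n s sp [] X S" and fr: "frame R {aWIN} s s'"
    and R: "rROOT \<notin> R" "rNEW \<notin> R" "rONE \<notin> R" "rZERO \<notin> R"
    and w: "\<And>a. a \<notin> inner_ids sp \<Longrightarrow> ar s' aWIN a = ar s aWIN a"
    and l: "\<And>a. a \<in> inner_ids sp \<Longrightarrow> locally_min L (ar s aLFT) (ar s aRGT) (ar s' aWIN) a"
  shows "core L n s' sp [] {} S"
proof -
  note D = coreD[OF c]
  have e: "ar s' aLFT = ar s aLFT" "ar s' aPAR = ar s aPAR"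
      "ar s' aDIG = ar s aDIG" "ar s' aRGT = ar s aRGT"
      "rg s' rROOT = rg s rROOT" "rg s' rNEW = rg s rNEW" "rg s' rONE = rg s rONE" "rg s' rZERO = rg s rZERO"
    using fr R by (auto simp: frame_def)
  have "Suc x \<notin> inner_ids sp" if "x \<in> set (contents sp)" for x
    using D(5)[of "Suc x"] D(6)[of x] that by auto
  then have w': "ar s' aWIN (Suc x) = (if x \<in> S then Suc x else 0)" if "x \<in> set (contents sp)" for x
    using D(8)[of x] w that by simp
  have "ar s' aWIN 0 = 0" using w[of 0] D(5)[of 0] D(9) by auto
  then show ?thesis
  proof (intro coreI)
    show "block_ok (ar s' aLFT) (ar s' aRGT) (ar s' aPAR) (ar s' aDIG) b" if "b \<in> set sp" for b
      using D(2)[OF that] e by simp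
  qed (use D(1,4,5,6,10-14) l w' e in auto)
qed

text \<open>The leaf stays in place with winner 0, so no level changes its shape and only the parent
  of the leaf becomes stale.\<close>

lemma core_delete:
  assumes c: "core L n s sp [] {} S" and x: "x \<in> set (contents sp)"
    and e: "ar s' aLFT = ar s aLFT" "ar s' aPAR = ar s aPAR"
      "ar s' aDIG = ar s aDIG" "ar s' aRGT = ar s aRGT" "ar s' aWIN = (ar s aWIN)(Suc x := 0)"
      "rg s' rROOT = rg s rROOT" "rg s' rNEW = rg s rNEW" "rg s' rONE = rg s rONE" "rg s' rZERO = rg s rZERO"
  shows "core L n s' sp [] {ar s aPAR (Suc x)} (S - {x})"
proof -
  note D = coreD[OF c]
  have lm: "locally_min L (ar s' aLFT) (ar s' aRGT) (ar s' aWIN) a"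
    if a: "a \<in> inner_ids sp" "a \<noteq> ar s aPAR (Suc x)" for a
  proof -
    have "ar s aLFT a \<noteq> Suc x" "ar s aRGT a \<noteq> Suc x"
      using spine_parent_ok[OF D(1) D(2) a(1)] a(2) unfolding parent_ok_def by auto
    moreover have "a \<noteq> Suc x" using D(5)[of a] D(6)[of x] x a by auto
    ultimately show ?thesis using D(7)[of a] a e by (simp add: locally_min_def)
  qed
  have w: "ar s' aWIN (Suc y) = (if y \<in> S - {x} then Suc y else 0)" if "y \<in> set (contents sp)" for y
    using D(8)[of y] e that by auto
  show ?thesis
  proof (rule coreI)
    show "block_ok (ar s' aLFT) (ar s' aRGT) (ar s' aPAR) (ar s' aDIG) b" if "b \<in> set sp" for b
      using D(2)[OF that] e by simp
  qed (use D(1,4,5,6,9-14) lm w e in auto)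
qed

abbreviation (input) "heap_regs \<equiv> {rROOT, rNEW, rT, rCUR, rPREV, rC, rW, rX, rY, rP, rQ, rF}"
abbreviation (input) "heap_arrays \<equiv> {aLFT, aRGT, aPAR, aWIN, aDIG}"

section \<open>Insertion and deletion\<close>

definition carry_body :: cmd where
  "carry_body = Get rC aLFT rCUR ;; Put aLFT rCUR rT ;; Put aPAR rT rCUR ;; Put aDIG rCUR rZERO ;; Mov rT rC ;;
     Mov rPREV rCUR ;; Get rCUR aRGT rCUR ;; Get rF aDIG rCUR"

lemma core_hd:
  assumes "core L n s (pre @ (v, d, c) # rest) ts X S"
  shows "ar s aLFT v = rid c" "ar s aDIG v = of_bool d" "0 < v" "v < rg s rNEW" "rid c < rg s rNEW"
    "ar s aRGT v = (if rest = [] then 0 else fst (hd rest))" "v \<noteq> rid c"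
    "pre \<noteq> [] \<Longrightarrow> 0 < fst (last pre)" "\<And>t. t \<in> set ts \<Longrightarrow> rid t < rg s rNEW \<and> rid t \<noteq> v \<and> rid t \<noteq> rid c"
proof -
  note D = coreD[OF assms]
  show "ar s aLFT v = rid c" "ar s aDIG v = of_bool d"
    using D(2)[of "(v, d, c)"] by (auto simp: block_ok_def)
  show "0 < v" "v < rg s rNEW" "rid c < rg s rNEW"
    using core_ids[OF assms, of v] core_ids[OF assms, of "rid c"] rid_in_tids[of c] by auto
  show "ar s aRGT v = (if rest = [] then 0 else fst (hd rest))"
    using links_nth[of "ar s aRGT" "ar s aPAR" 0 "map fst pre" v "map fst rest" "rg s rROOT"] D(1)
    by (auto simp: hd_map)
  show "v \<noteq> rid c" using D(4) rid_in_tids[of c] by auto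
  show "0 < fst (last pre)" if "pre \<noteq> []"
  proof -
    have "fst (last pre) \<in> set (all_ids pre)" using that fst_in_all_ids[of pre] by auto
    then show ?thesis using core_ids[OF assms, of "fst (last pre)"] by auto
  qed
  show "rid t < rg s rNEW \<and> rid t \<noteq> v \<and> rid t \<noteq> rid c" if t: "t \<in> set ts" for t
  proof -
    have "rid t \<in> set (concat (map tids ts))" using t rid_in_tids[of t] by auto
    then show ?thesis using core_ids[OF assms, of "rid t"] t rid_in_tids[of t] rid_in_tids[of c] D(4)
      by auto
  qed
qed

lemma state_upds [simp]:
  "rg_update f (ar_update g s) = ar_update g (rg_update f s)"
  "rg_update f (raw_update h s) = raw_update h (rg_update f s)"
  "rg_update f (tm_update p s) = tm_update p (rg_update f s)"
  "rg_update f (cm_update p s) = cm_update p (rg_update f s)"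
  "ar_update g (raw_update h s) = raw_update h (ar_update g s)"
  "ar_update g (tm_update p s) = tm_update p (ar_update g s)"
  "ar_update g (cm_update p s) = cm_update p (ar_update g s)"
  "raw_update h (tm_update p s) = tm_update p (raw_update h s)"
  "raw_update h (cm_update p s) = cm_update p (raw_update h s)"
  "tm_update p (cm_update p' s) = cm_update p' (tm_update p s)"
  by simp_all

lemma core_tick [simp]: "core L n (tick k s) sp ts X S = core L n s sp ts X S"
  by (simp add: core_def tick_def)

lemma tick_simps [simp]: "rg (tick k s) = rg s" "ar (tick k s) = ar s" "raw (tick k s) = raw s"
    "tm (tick k s) = tm s + k" "cm (tick k s) = cm s"
  by (simp_all add: tick_def)

lemma frame_tick [simp]: "frame R S s (tick k s')= frame R S s s'" "frame R S (tick k s) s' = frame R S s s'"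
  by (simp_all add: frame_def)

lemma frame_refl [simp]: "frame R S s s"
  by (simp add: frame_def)

text \<open>The spine nodes passed stay stale until \<open>fix_cmd\<close> repairs them all in one
  walk, which is why the set of stale nodes is \<open>set (map fst pre)\<close>. Each iteration
  makes \<open>pre\<close> longer by a level that has lost its second tree, so
  \<open>length pre\<close> plus \<open>carries\<close> is invariant.\<close>

lemma carry_ok:
  assumes "core L n s (pre @ rest) [t] (set (map fst pre)) S"
    and "heights_ok 0 (pre @ rest)" "full (length pre) t" "rg s rT = rid t"
    and "rg s rCUR = (if rest = [] then 0 else fst (hd rest))"
    and "rg s rPREV = (if pre = [] then 0 else fst (last pre))" "rg s rF = ar s aDIG (rg s rCUR)"
    and "\<And>s' pre' rest' t'. frame heap_regs heap_arrays s s' \<Longrightarrow>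
      core L n s' (pre' @ rest') [t'] (set (map fst pre')) S \<Longrightarrow>
      heights_ok 0 (pre' @ rest') \<Longrightarrow> full (length pre') t' \<Longrightarrow> rg s' rT = rid t' \<Longrightarrow>
      rg s' rCUR = (if rest' = [] then 0 else fst (hd rest')) \<Longrightarrow>
      rg s' rPREV = (if pre' = [] then 0 else fst (last pre')) \<Longrightarrow>
      (rest' \<noteq> [] \<Longrightarrow> \<not> fst (snd (hd rest'))) \<Longrightarrow>
      contents rest' @ leaves t' @ contents pre' = contents rest @ leaves t @ contents pre \<Longrightarrow>
      length pre' + carries (pre' @ rest') = length pre + carries (pre @ rest) \<Longrightarrow>
      tm s' + 60 * length pre \<le> tm s + 60 * length pre' + 1 \<Longrightarrow> cm s' = cm s \<Longrightarrow> Q s'"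
  shows "wp L B (While rF carry_body) Q s"
  using assms
proof (induction rest arbitrary: s pre t)
  case Nil
  \<comment> \<open>Beyond the last level \<open>rCUR\<close> is the null pointer, whose digit is 0
    by the invariant; so the same test also stops at the end of the spine.\<close>
  have "rg s rF = 0" using Nil.prems(5,7) coreD(11)[OF Nil.prems(1)] by simp
  moreover have "Q (tick 1 s)"
    by (rule Nil.prems(8)[where rest' = "[]" and pre' = pre and t' = t]) (use Nil.prems(1-6) in simp_all)
  ultimately show ?case
    by (subst wp_While_iff) simp
next
  case (Cons b rest)
  obtain v d c where b: "b = (v, d, c)" by (cases b) auto
  note core0 = Cons.prems(1)[unfolded b]
  note H = core_hd[OF core0]
  have cur: "rg s rCUR = v" using Cons.prems(5) b by simp
  show ?case
  proof (cases d)
    case False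
    then have "rg s rF = 0" using Cons.prems(7) cur H(2) by simp
    moreover have "Q (tick 1 s)"
      by (rule Cons.prems(8)[where rest' = "b # rest" and pre' = pre and t' = t])
        (use Cons.prems(1-6) False b in simp_all)
    ultimately show ?thesis
      by (subst wp_While_iff) simp
  next
    case True
    then have F: "rg s rF \<noteq> 0" using Cons.prems(7) cur H(2) by simp
    let ?pre = "pre @ [(v, False, t)]"
    define s1 where "s1 = s\<lparr>rg := (rg s)(rC := rid c, rT := rid c, rPREV := v,
        rCUR := ar s aRGT v, rF := ((ar s aDIG)(v := 0)) (ar s aRGT v)),
      ar := (ar s)(aLFT := (ar s aLFT)(v := rid t), aPAR := (ar s aPAR)(rid t := v),
        aDIG := (ar s aDIG)(v := 0)), tm := tm s + 52\<rparr>"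
    have zero: "rg s rZERO = 0" using coreD(14)[OF core0] .
    have "wp L B carry_body (\<lambda>s'. wp L B (While rF carry_body) Q (tick 1 s')) (tick 1 s) =
        wp L B (While rF carry_body) Q s1"
      unfolding carry_body_def s1_def
      by (simp add: exec_simps cur H Cons.prems(4) zero fun_upd_twist add.commute)
    moreover have "wp L B (While rF carry_body) Q s1"
    proof (rule Cons.IH)
      have "core L n s1 (pre @ (v, False, t) # rest) [c] (insert v (set (map fst pre))) S"
        using core0 True by (intro core_carry[of L n s pre v c rest t _ S s1]) (simp_all add: s1_def)
      then show "core L n s1 (?pre @ rest) [c] (set (map fst ?pre)) S" by simp
      show "heights_ok 0 (?pre @ rest)" "full (length ?pre) c"
        using Cons.prems(2,3) b True by (simp_all add: heights_ok_append)
      show "rg s1 rT = rid c" by (simp add: s1_def)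
      show "rg s1 rCUR = (if rest = [] then 0 else fst (hd rest))" using H(6) by (simp add: s1_def)
      show "rg s1 rPREV = (if ?pre = [] then 0 else fst (last ?pre))" by (simp add: s1_def)
      show "rg s1 rF = ar s1 aDIG (rg s1 rCUR)" by (simp add: s1_def)
    next
      fix s' pre' rest' t'
      assume a: "frame heap_regs heap_arrays s1 s'"
        "core L n s' (pre' @ rest') [t'] (set (map fst pre')) S"
        "heights_ok 0 (pre' @ rest')" "full (length pre') t'" "rg s' rT = rid t'"
        "rg s' rCUR = (if rest' = [] then 0 else fst (hd rest'))"
        "rg s' rPREV = (if pre' = [] then 0 else fst (last pre'))"
        "rest' \<noteq> [] \<Longrightarrow> \<not> fst (snd (hd rest'))"
        "contents rest' @ leaves t' @ contents pre' = contents rest @ leaves c @ contents ?pre"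
        "length pre' + carries (pre' @ rest') = length ?pre + carries (?pre @ rest)"
        "tm s' + 60 * length ?pre \<le> tm s1 + 60 * length pre' + 1" "cm s' = cm s1"
      show "Q s'"
      proof (rule Cons.prems(8)[OF _ a(2-8)])
        show "frame heap_regs heap_arrays s s'" using a(1) by (simp add: frame_def s1_def)
        show "contents rest' @ leaves t' @ contents pre' = contents (b # rest) @ leaves t @ contents pre"
          using a(9) b by simp
        show "length pre' + carries (pre' @ rest') = length pre + carries (pre @ b # rest)"
          using a(10) b True by (simp add: carries_def)
        show "tm s' + 60 * length pre \<le> tm s + 60 * length pre' + 1" using a(11) by (simp add: s1_def)
        show "cm s' = cm s" using a(12) by (simp add: s1_def)
      qed
    qed
    ultimately show ?thesis using F by (subst wp_While_iff) simp
  qed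
qed

definition join_cmd :: cmd where
  "join_cmd = Get rC aLFT rCUR ;; Put aLFT rNEW rC ;; Put aRGT rNEW rT ;; Put aPAR rC rNEW ;; Put aPAR rT rNEW ;;
     Put aLFT rCUR rNEW ;; Put aPAR rNEW rCUR ;; Put aDIG rCUR rONE ;; Mov rCUR rNEW"

definition new_cmd :: cmd where
  "new_cmd = Put aLFT rNEW rT ;; Put aPAR rT rNEW ;; Put aPAR rNEW rPREV ;;
     Cond rPREV (Put aRGT rPREV rNEW) (Mov rROOT rNEW) ;; Mov rCUR rNEW"

definition insert_cmd :: cmd where
  "insert_cmd = Put aWIN rT rT ;; Mov rCUR rROOT ;; Set rPREV 0 ;; Get rF aDIG rCUR ;; While rF carry_body ;;
     Cond rCUR join_cmd new_cmd ;; Plus rNEW rNEW rONE ;; fix_cmd"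

text \<open>The walk has two shapes: after appending a level it starts at the new spine node, after
  a join at the new tree node below the spine.\<close>

lemma spine_fix:
  assumes c: "core L n s (pre @ (v, d, t) # rest) [] (set us) S" and h: "heights_ok 0 (pre @ (v, d, t) # rest)"
    and us: "us = v # rev (map fst pre) \<or>
      (\<exists>z l r. t = Node z l r \<and> us = z # v # rev (map fst pre))" and cur: "rg s rCUR = hd us"
    and Q: "\<And>s'. frame {rCUR, rX, rY, rW, rP, rQ} {aWIN} s s' \<Longrightarrow>
      heap L n s' (pre @ (v, d, t) # rest) S \<Longrightarrow> tm s' \<le> tm s + 60 * (length pre + 2) + 1 \<Longrightarrow>
      cm s' \<le> cm s + length pre + 2 \<Longrightarrow> Q s'"
  shows "wp L B fix_cmd Q s"
proof -
  let ?sp = "pre @ (v, d, t) # rest"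
  note D = coreD[OF c]
  have w: "walk (ar s aPAR) v (v # rev (map fst pre)) 0"
    using links_walk[of "ar s aRGT" "ar s aPAR" 0 "map fst pre" v "map fst rest" "rg s rROOT"] D(1) by simp
  have d: "distinct (all_ids pre)" "v \<notin> set (all_ids pre)" "set (tids t) \<inter> insert v (set (all_ids pre)) = {}"
    using D(4) by auto
  have d2: "distinct (v # rev (map fst pre))" using d distinct_fst[of pre] fst_in_all_ids[of pre] by auto
  have in1: "set (v # rev (map fst pre)) \<subseteq> inner_ids ?sp" using fst_in_inner_ids[of pre] by auto
  have U: "walk (ar s aPAR) (rg s rCUR) us 0 \<and> distinct us \<and> set us \<subseteq> inner_ids ?sp \<and> length us \<le> length pre + 2"
    using us
  proof
    assume "us = v # rev (map fst pre)"
    then show ?thesis using w d2 in1 cur by simp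
  next
    assume "\<exists>z l r. t = Node z l r \<and> us = z # v # rev (map fst pre)"
    then obtain z l r where z: "t = Node z l r" "us = z # v # rev (map fst pre)" by blast
    have "ar s aPAR z = v" using D(2)[of "(v, d, t)"] z by (auto simp: block_ok_def)
    moreover have "z \<notin> set (v # rev (map fst pre))" using d(3) z(1) fst_in_all_ids[of pre] by auto
    ultimately show ?thesis using w d2 in1 cur z by auto
  qed
  show ?thesis
  proof (rule fix_cmd_ok[where us = us and S = "inner_ids ?sp"])
    show "0 \<notin> inner_ids ?sp" using D(5)[of 0] by fastforce
    show "parent_ok (ar s aLFT) (ar s aRGT) (ar s aPAR) a" if "a \<in> inner_ids ?sp" for a
      using spine_parent_ok[OF D(1) D(2) that] .
    show "locally_min L (ar s aLFT) (ar s aRGT) (ar s aWIN) a" if "a \<in> inner_ids ?sp" "a \<notin> set us" for a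
      using D(7)[of a] that by auto
    show "rg s rONE = 1" by (rule D(13))
  next
    fix s' assume a: "frame {rCUR, rX, rY, rW, rP, rQ} {aWIN} s s'"
      "\<And>a. a \<notin> set us \<Longrightarrow> ar s' aWIN a = ar s aWIN a"
      "\<And>a. a \<in> inner_ids ?sp \<Longrightarrow> locally_min L (ar s aLFT) (ar s aRGT) (ar s' aWIN) a"
      "tm s' \<le> tm s + 60 * length us + 1" "cm s' \<le> cm s + length us"
    have "core L n s' ?sp [] {} S"
      using U a(2,3) by (intro core_fix[OF c a(1)]) auto
    then show "Q s'" using a(1,4,5) U h by (intro Q) (auto simp: heap_def)
  qed (use U in auto)
qed

text \<open>Each carried level costs one loop iteration and one repaired node, at most 60 steps
  each, and lowers \<open>carries\<close> by one; a final join raises it by one. So the potential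
  pays 120 steps and one comparison per carry, and the amortized cost is constant.\<close>

lemma insert_cmd_ok:
  assumes h: "heap L n s sp S" and T: "rg s rT = Suc x" and x: "x < n" "x \<notin> set (contents sp)"
    and Q: "\<And>s' sp'. frame heap_regs heap_arrays s s' \<Longrightarrow> heap L n s' sp' (insert x S) \<Longrightarrow>
      contents sp' = contents sp @ [x] \<Longrightarrow> tm s' + 120 * carries sp' \<le> tm s + 120 * carries sp + 400 \<Longrightarrow>
      cm s' + carries sp' \<le> cm s + carries sp + 3 \<Longrightarrow> Q s'"
  shows "wp L B insert_cmd Q s"
proof -
  have c: "core L n s sp [] {} S" and ht: "heights_ok 0 sp" using h by (auto simp: heap_def)
  note D = coreD[OF c]
  define s1 where "s1 = s\<lparr>rg := (rg s)(rCUR := rg s rROOT, rPREV := 0, rF := ar s aDIG (rg s rROOT)),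
      ar := (ar s)(aWIN := (ar s aWIN)(Suc x := Suc x)), tm := tm s + 18\<rparr>"
  have c1: "core L n s1 ([] @ sp) [Leaf x] (set (map fst [])) (insert x S)"
    using core_leaf[OF c x, of s1] by (simp add: s1_def)
  have "wp L B (While rF carry_body)
      (wp L B (Cond rCUR join_cmd new_cmd ;; Plus rNEW rNEW rONE ;; fix_cmd) Q) s1"
  proof (rule carry_ok[OF c1])
    show "heights_ok 0 ([] @ sp)" "full (length []) (Leaf x)" using ht by simp_all
    show "rg s1 rT = rid (Leaf x)" using T by (simp add: s1_def)
    show "rg s1 rCUR = (if sp = [] then 0 else fst (hd sp))"
      using links_hd[OF D(1)] by (auto simp: s1_def hd_map)
    show "rg s1 rPREV = (if [] = [] then 0 else fst (last []))" by (simp add: s1_def)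
    show "rg s1 rF = ar s1 aDIG (rg s1 rCUR)" by (simp add: s1_def)
  next
    fix s2 pre rest t
    assume fr: "frame heap_regs heap_arrays s1 s2"
      and c2: "core L n s2 (pre @ rest) [t] (set (map fst pre)) (insert x S)"
      and ht2: "heights_ok 0 (pre @ rest)" "full (length pre) t" and T2: "rg s2 rT = rid t"
      and cur: "rg s2 rCUR = (if rest = [] then 0 else fst (hd rest))"
      and prev: "rg s2 rPREV = (if pre = [] then 0 else fst (last pre))"
      and nd: "rest \<noteq> [] \<Longrightarrow> \<not> fst (snd (hd rest))"
      and co: "contents rest @ leaves t @ contents pre = contents sp @ leaves (Leaf x) @ contents []"
      and ca: "length pre + carries (pre @ rest) = length [] + carries ([] @ sp)"
      and tm2: "tm s2 + 60 * length [] \<le> tm s1 + 60 * length pre + 1" and cm2: "cm s2 = cm s1"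
    note D2 = coreD[OF c2]
    let ?z = "rg s2 rNEW"
    show "wp L B (Cond rCUR join_cmd new_cmd ;; Plus rNEW rNEW rONE ;; fix_cmd) Q s2"
    proof (cases rest)
      case (Cons b rest')
      then obtain v c where r: "rest = (v, False, c) # rest'" using nd by (cases b) auto
      note H = core_hd[OF c2[unfolded r]]
      define s3 where "s3 = s2\<lparr>rg := (rg s2)(rC := rid c, rCUR := ?z, rNEW := Suc ?z),
        ar := (ar s2)(aLFT := (ar s2 aLFT)(?z := rid c, v := ?z), aRGT := (ar s2 aRGT)(?z := rid t),
          aPAR := (ar s2 aPAR)(rid c := ?z, rid t := ?z, ?z := v), aDIG := (ar s2 aDIG)(v := 1)),
        tm := tm s2 + 68\<rparr>"
      have e: "wp L B (Cond rCUR join_cmd new_cmd ;; Plus rNEW rNEW rONE ;; fix_cmd) Q s2 = wp L B fix_cmd Q s3"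
        using cur H(1,3) r T2 D2(13) by (simp add: exec_simps join_cmd_def s3_def fun_upd_twist add.commute)
      have c3: "core L n s3 (pre @ (v, True, Node ?z c t) # rest') [] (insert ?z (insert v (set (map fst pre)))) (insert x S)"
        by (rule core_join[OF c2[unfolded r] refl]) (simp_all add: s3_def)
      show ?thesis unfolding e
      proof (rule spine_fix[where us = "?z # v # rev (map fst pre)"])
        show "core L n s3 (pre @ (v, True, Node ?z c t) # rest') [] (set (?z # v # rev (map fst pre))) (insert x S)"
          using c3 by simp
        show "heights_ok 0 (pre @ (v, True, Node ?z c t) # rest')" using ht2 r by (simp add: heights_ok_append)
        show "?z # v # rev (map fst pre) = v # rev (map fst pre) \<or>
          (\<exists>z l r. Node ?z c t = Node z l r \<and> ?z # v # rev (map fst pre) = z # v # rev (map fst pre))" by simp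
        show "rg s3 rCUR = hd (?z # v # rev (map fst pre))" by (simp add: s3_def)
      next
        fix s' assume a: "frame {rCUR, rX, rY, rW, rP, rQ} {aWIN} s3 s'"
          "heap L n s' (pre @ (v, True, Node ?z c t) # rest') (insert x S)"
          "tm s' \<le> tm s3 + 60 * (length pre + 2) + 1" "cm s' \<le> cm s3 + length pre + 2"
        show "Q s'"
        proof (rule Q[OF _ a(2)])
          show "frame heap_regs heap_arrays s s'" using fr a(1) by (simp add: frame_def s3_def s1_def)
          show "contents (pre @ (v, True, Node ?z c t) # rest') = contents sp @ [x]" using co r by simp
          show "tm s' + 120 * carries (pre @ (v, True, Node ?z c t) # rest') \<le> tm s + 120 * carries sp + 400"
            using a(3) tm2 ca r by (simp add: carries_def s3_def s1_def)
          show "cm s' + carries (pre @ (v, True, Node ?z c t) # rest') \<le> cm s + carries sp + 3"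
            using a(4) cm2 ca r by (simp add: carries_def s3_def s1_def)
        qed
      qed
    next
      case Nil
      have ppos: "pre \<noteq> [] \<Longrightarrow> 0 < fst (last pre)"
      proof -
        assume "pre \<noteq> []"
        then have "fst (last pre) \<in> set (all_ids pre)" using fst_in_all_ids[of pre] by auto
        then show ?thesis using core_ids[OF c2, of "fst (last pre)"] by auto
      qed
      define s3 where "s3 = s2\<lparr>rg := (rg s2)(rROOT := (if pre = [] then ?z else rg s2 rROOT), rCUR := ?z, rNEW := Suc ?z),
        ar := (ar s2)(aLFT := (ar s2 aLFT)(?z := rid t),
          aRGT := (if pre = [] then ar s2 aRGT else (ar s2 aRGT)(fst (last pre) := ?z)),
          aPAR := (ar s2 aPAR)(rid t := ?z, ?z := (if pre = [] then 0 else fst (last pre)))),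
        tm := tm s2 + (if pre = [] then 29 else 37)\<rparr>"
      have e: "wp L B (Cond rCUR join_cmd new_cmd ;; Plus rNEW rNEW rONE ;; fix_cmd) Q s2 = wp L B fix_cmd Q s3"
        using cur prev ppos Nil T2 D2(13)
        by (cases "pre = []") (simp_all add: exec_simps new_cmd_def s3_def fun_upd_twist add.commute)
      have c2': "core L n s2 pre [t] (set (map fst pre)) (insert x S)" using c2 Nil by simp
      have c3: "core L n s3 (pre @ [(?z, False, t)]) [] (insert ?z (set (map fst pre) \<union> set (map fst pre))) (insert x S)"
        by (rule core_new[OF c2' refl]) (simp_all add: s3_def)
      show ?thesis unfolding e
      proof (rule spine_fix[where us = "?z # rev (map fst pre)"])
        show "core L n s3 (pre @ (?z, False, t) # []) [] (set (?z # rev (map fst pre))) (insert x S)"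
          using c3 by simp
        show "heights_ok 0 (pre @ (?z, False, t) # [])" using ht2 Nil by (simp add: heights_ok_append)
        show "?z # rev (map fst pre) = ?z # rev (map fst pre) \<or>
          (\<exists>z l r. t = Node z l r \<and> ?z # rev (map fst pre) = z # ?z # rev (map fst pre))" by simp
        show "rg s3 rCUR = hd (?z # rev (map fst pre))" by (simp add: s3_def)
      next
        fix s' assume a: "frame {rCUR, rX, rY, rW, rP, rQ} {aWIN} s3 s'"
          "heap L n s' (pre @ (?z, False, t) # []) (insert x S)"
          "tm s' \<le> tm s3 + 60 * (length pre + 2) + 1" "cm s' \<le> cm s3 + length pre + 2"
        show "Q s'"
        proof (rule Q[OF _ a(2)])
          show "frame heap_regs heap_arrays s s'" using fr a(1) by (simp add: frame_def s3_def s1_def)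
          show "contents (pre @ (?z, False, t) # []) = contents sp @ [x]" using co Nil by simp
          show "tm s' + 120 * carries (pre @ (?z, False, t) # []) \<le> tm s + 120 * carries sp + 400"
            using a(3) tm2 ca Nil by (simp add: carries_def s3_def s1_def split: if_splits)
          show "cm s' + carries (pre @ (?z, False, t) # []) \<le> cm s + carries sp + 3"
            using a(4) cm2 ca Nil by (simp add: carries_def s3_def s1_def)
        qed
      qed
    qed
  qed
  moreover have "wp L B insert_cmd Q s = wp L B (While rF carry_body)
      (wp L B (Cond rCUR join_cmd new_cmd ;; Plus rNEW rNEW rONE ;; fix_cmd) Q) s1"
    unfolding insert_cmd_def by (simp add: wp_simps put_rg_def T s1_def fun_upd_twist add.commute)
  ultimately show ?thesis by simp
qed

text \<open>Register \<open>rT\<close> holds the leaf to delete.\<close>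

definition delete_cmd :: cmd where
  "delete_cmd = Put aWIN rT rZERO ;; Get rCUR aPAR rT ;; fix_cmd"

text \<open>The exponent \<open>e\<close> is the level of \<open>x\<close>. It is bounded through
  the later insertions \<open>bs\<close> alone, since deletions never shrink
  \<open>contents\<close>.\<close>

lemma delete_cmd_ok:
  assumes h: "heap L n s sp S" and T: "rg s rT = Suc x" and x: "x \<in> set (contents sp)"
    and Q: "\<And>s' e as bs. frame heap_regs heap_arrays s s' \<Longrightarrow> heap L n s' sp (S - {x}) \<Longrightarrow>
      contents sp = as @ x # bs \<Longrightarrow> 2 ^ e \<le> length bs + 1 \<Longrightarrow>
      tm s' \<le> tm s + 120 * e + 160 \<Longrightarrow> cm s' \<le> cm s + 2 * e + 2 \<Longrightarrow> Q s'"
  shows "wp L B delete_cmd Q s"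
proof -
  have c: "core L n s sp [] {} S" and ht: "heights_ok 0 sp" using h by (auto simp: heap_def)
  note D = coreD[OF c]
  obtain us e as bs where us: "walk (ar s aPAR) (ar s aPAR (Suc x)) us 0" "distinct us" "set us \<subseteq> inner_ids sp"
      "length us \<le> 2 * e + 2" "contents sp = as @ x # bs" "2 ^ e \<le> length bs + 1"
    using spine_walk[OF D(1) D(2) _ ht x] D(4) by auto
  define s1 where "s1 = s\<lparr>rg := (rg s)(rCUR := ar s aPAR (Suc x)),
      ar := (ar s)(aWIN := (ar s aWIN)(Suc x := 0)), tm := tm s + 16\<rparr>"
  have c1: "core L n s1 sp [] {ar s aPAR (Suc x)} (S - {x})"
    by (rule core_delete[OF c x]) (simp_all add: s1_def)
  note D1 = coreD[OF c1]
  have hd_us: "a \<in> set us" if "a = ar s aPAR (Suc x)" "a \<in> inner_ids sp" for a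
    using us(1) that D(5)[of 0] by (cases us) auto
  have "wp L B fix_cmd Q s1"
  proof (rule fix_cmd_ok[where us = us and S = "inner_ids sp"])
    show "walk (ar s1 aPAR) (rg s1 rCUR) us 0" using us(1) by (simp add: s1_def)
    show "0 \<notin> inner_ids sp" using D(5)[of 0] by auto
    show "parent_ok (ar s1 aLFT) (ar s1 aRGT) (ar s1 aPAR) a" if "a \<in> inner_ids sp" for a
      using spine_parent_ok[OF D1(1) D1(2) that] .
    show "locally_min L (ar s1 aLFT) (ar s1 aRGT) (ar s1 aWIN) a" if "a \<in> inner_ids sp" "a \<notin> set us" for a
      using D1(7)[of a] hd_us[of a] that by auto
    show "rg s1 rONE = 1" by (rule D1(13))
  next
    fix s' assume a: "frame {rCUR, rX, rY, rW, rP, rQ} {aWIN} s1 s'"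
      "\<And>a. a \<notin> set us \<Longrightarrow> ar s' aWIN a = ar s1 aWIN a"
      "\<And>a. a \<in> inner_ids sp \<Longrightarrow> locally_min L (ar s1 aLFT) (ar s1 aRGT) (ar s' aWIN) a"
      "tm s' \<le> tm s1 + 60 * length us + 1" "cm s' \<le> cm s1 + length us"
    have "core L n s' sp [] {} (S - {x})"
      using us(3) a(2,3) by (intro core_fix[OF c1 a(1)]) auto
    then have "heap L n s' sp (S - {x})" using ht by (simp add: heap_def)
    then show "Q s'"
    proof (rule Q[OF _ _ us(5,6), rotated])
      show "frame heap_regs heap_arrays s s'" using a(1) by (simp add: frame_def s1_def)
      show "tm s' \<le> tm s + 120 * e + 160" "cm s' \<le> cm s + 2 * e + 2"
        using a(4,5) us(4) by (simp_all add: s1_def)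
    qed
  qed (use us in auto)
  moreover have "wp L B delete_cmd Q s = wp L B fix_cmd Q s1"
    unfolding delete_cmd_def using D(14) by (simp add: wp_simps put_rg_def T s1_def add.commute)
  ultimately show ?thesis by simp
qed

lemma heap_min:
  assumes "topological_order {..<n} A L" "heap L n s sp S"
  shows "is_min L (ar s aWIN (rg s rROOT)) (set (contents sp) \<inter> S)"
proof -
  have c: "core L n s sp [] {} S" using assms(2) by (simp add: heap_def)
  note D = coreD[OF c]
  show ?thesis
    by (rule spine_min[OF assms(1) D(1) D(2)]) (use D(6,7,8,9) in auto)
qed

lemma heap_cong:
  assumes "heap L n s sp S"
    and "\<And>a. a \<in> heap_arrays \<Longrightarrow> ar s' a = ar s a"
    and "rg s' rROOT = rg s rROOT" "rg s' rNEW = rg s rNEW" "rg s' rONE = rg s rONE" "rg s' rZERO = rg s rZERO"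
  shows "heap L n s' sp S"
  using assms unfolding heap_def core_def by simp

lemma heap_empty:
  assumes "\<And>a. ar s aRGT a = 0" "\<And>a. ar s aDIG a = 0" "ar s aWIN 0 = 0" "rg s rROOT = 0"
    "n < rg s rNEW" "rg s rONE = 1" "rg s rZERO = 0"
  shows "heap L n s [] S"
  using assms unfolding heap_def core_def by simp

section \<open>Preprocessing the graph\<close>

abbreviation (input) "rI \<equiv> 17 :: nat"
abbreviation (input) "rV \<equiv> 18 :: nat"
abbreviation (input) "rE \<equiv> 19 :: nat"
abbreviation (input) "rU \<equiv> 20 :: nat"
abbreviation (input) "rTL \<equiv> 21 :: nat"
abbreviation (input) "rD \<equiv> 22 :: nat"
abbreviation (input) "rJ \<equiv> 23 :: nat"
abbreviation (input) "rA \<equiv> 24 :: nat"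
abbreviation (input) "rZ \<equiv> 25 :: nat"
abbreviation (input) "rH \<equiv> 26 :: nat"

abbreviation (input) "aHEAD \<equiv> 0 :: nat"
abbreviation (input) "aNXT \<equiv> 1 :: nat"
abbreviation (input) "aTGT \<equiv> 2 :: nat"
abbreviation (input) "aDEG \<equiv> 3 :: nat"
abbreviation (input) "aREM \<equiv> 4 :: nat"
abbreviation (input) "aQUE \<equiv> 5 :: nat"
abbreviation (input) "aPRV \<equiv> 6 :: nat"
abbreviation (input) "aPATH \<equiv> 7 :: nat"
abbreviation (input) "aINP \<equiv> 8 :: nat"

text \<open>Arc numbers are stored increased by one, because 0 has to mark the end of the
  list.\<close>

fun alist :: "(nat \<Rightarrow> nat) \<Rightarrow> nat \<Rightarrow> nat list \<Rightarrow> bool" where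
  "alist nx h [] \<longleftrightarrow> h = 0"
| "alist nx h (e # es) \<longleftrightarrow> h = Suc e \<and> alist nx (nx e) es"

lemma alist_cong: "alist nx h es \<Longrightarrow> (\<And>e. e \<in> set es \<Longrightarrow> nx' e = nx e) \<Longrightarrow> alist nx' h es"
  by (induction es arbitrary: h) auto

text \<open>Reversed, as arcs are put at the front of their lists.\<close>

definition out_arcs :: "(nat \<times> nat) list \<Rightarrow> nat \<Rightarrow> nat \<Rightarrow> nat list" where
  "out_arcs arcs i u = filter (\<lambda>e. fst (arcs ! e) = u) (rev [0..<i])"

lemma out_arcs_Suc:
  "out_arcs arcs (Suc i) u = (if fst (arcs ! i) = u then [i] else []) @ out_arcs arcs i u"
  by (simp add: out_arcs_def)

lemma set_out_arcs: "set (out_arcs arcs i u) = {e. e < i \<and> fst (arcs ! e) = u}"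
  by (auto simp: out_arcs_def)

lemma distinct_out_arcs: "distinct (out_arcs arcs i u)"
  by (simp add: out_arcs_def)

text \<open>If \<open>R\<close> are the arcs not yet traversed, this is the remaining in-degree of
  \<open>w\<close>, with parallel arcs counted separately.\<close>

definition cnt :: "(nat \<times> nat) list \<Rightarrow> nat set \<Rightarrow> nat \<Rightarrow> nat" where
  "cnt arcs R w = card {e \<in> R. snd (arcs ! e) = w}"

lemma cnt_remove:
  assumes "finite R" "e \<in> R"
  shows "cnt arcs (R - {e}) w = (if w = snd (arcs ! e) then cnt arcs R w - 1 else cnt arcs R w)"
proof -
  have "{f \<in> R - {e}. snd (arcs ! f) = w} =
      (if w = snd (arcs ! e) then {f \<in> R. snd (arcs ! f) = w} - {e} else {f \<in> R. snd (arcs ! f) = w})"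
    by auto
  then show ?thesis using assms by (simp add: cnt_def)
qed

lemma cnt_pos: "finite R \<Longrightarrow> e \<in> R \<Longrightarrow> cnt arcs R (snd (arcs ! e)) \<noteq> 0"
  by (auto simp: cnt_def)

lemma cnt_insert: "finite R \<Longrightarrow> e \<notin> R \<Longrightarrow>
    cnt arcs (insert e R) w = (if w = snd (arcs ! e) then Suc (cnt arcs R w) else cnt arcs R w)"
  using cnt_remove[of "insert e R" e arcs w] cnt_pos[of "insert e R" e arcs] by (auto split: if_splits)

lemma cnt_eq_0: "finite R \<Longrightarrow> cnt arcs R w = 0 \<longleftrightarrow> (\<forall>e \<in> R. snd (arcs ! e) \<noteq> w)"
  by (auto simp: cnt_def)

definition graph :: "(nat \<times> nat) list \<Rightarrow> state \<Rightarrow> bool" where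
  "graph arcs s \<longleftrightarrow> (\<forall>e < length arcs. ar s aTGT e = snd (arcs ! e)) \<and>
     (\<forall>u. alist (ar s aNXT) (ar s aHEAD u) (out_arcs arcs (length arcs) u))"

subsection \<open>Adjacency lists\<close>

text \<open>\<open>aDEG\<close> is used up by the computation of the levels; its copy
  \<open>aREM\<close> is kept for the main loop.\<close>

definition adj_body :: cmd where
  "adj_body = Raw_Get rV rA ;; Plus rA rA rONE ;; Raw_Get rZ rA ;; Plus rA rA rONE ;;
     Put aTGT rI rZ ;; Get rX aHEAD rV ;; Put aNXT rI rX ;; Plus rI rI rONE ;; Put aHEAD rV rI ;;
     Get rX aDEG rZ ;; Plus rX rX rONE ;; Put aDEG rZ rX ;; Put aREM rZ rX ;; Minus rD rD rONE"

definition adj_cmd :: cmd where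
  "adj_cmd = Set rONE 1 ;; Mov rD rM ;; While rD adj_body"

definition adj_inv :: "nat \<Rightarrow> nat \<Rightarrow> (nat \<times> nat) list \<Rightarrow> state \<Rightarrow> nat \<Rightarrow> bool" where
  "adj_inv n k arcs s i \<longleftrightarrow> i \<le> length arcs \<and> frame {rV, rA, rZ, rX, rI, rD, rONE} {aTGT, aHEAD, aNXT, aDEG, aREM} (start n k arcs) s \<and>
     rg s rONE = 1 \<and> rg s rI = i \<and> rg s rA = 2 * i \<and> rg s rD = length arcs - i \<and>
     (\<forall>e < i. ar s aTGT e = snd (arcs ! e)) \<and>
     (\<forall>u. alist (ar s aNXT) (ar s aHEAD u) (out_arcs arcs i u)) \<and>
     (\<forall>w. ar s aDEG w = cnt arcs {..<i} w \<and> ar s aREM w = cnt arcs {..<i} w) \<and>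
     tm s \<le> 8 + 100 * i \<and> cm s = 0"

lemma adj_body_ok:
  assumes inv: "adj_inv n k arcs s i" and i: "i < length arcs" and B: "B = 2 * length arcs + n"
  shows "wp L B adj_body (\<lambda>s'. adj_inv n k arcs (tick 1 s') (Suc i)) (tick 1 s)"
proof -
  let ?u = "fst (arcs ! i)" and ?w = "snd (arcs ! i)"
  note I = inv[unfolded adj_inv_def]
  have raw: "raw s (2 * i) = ?u" "raw s (Suc (2 * i)) = ?w"
    using I i by (auto simp: frame_def start_def init_config_def)
  have lt: "2 * i < B" "Suc (2 * i) < B" using i B by auto
  have cnt: "cnt arcs {..<Suc i} w = (if w = ?w then Suc (cnt arcs {..<i} w) else cnt arcs {..<i} w)" for w
    using cnt_insert[of "{..<i}" i arcs w] by (simp add: lessThan_Suc)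
  define s1 where "s1 = s\<lparr>rg := (rg s)(rV := ?u, rA := 2 * Suc i, rZ := ?w, rX := Suc (cnt arcs {..<i} ?w),
      rI := Suc i, rD := length arcs - Suc i),
    ar := (ar s)(aTGT := (ar s aTGT)(i := ?w), aNXT := (ar s aNXT)(i := ar s aHEAD ?u),
      aHEAD := (ar s aHEAD)(?u := Suc i), aDEG := (ar s aDEG)(?w := Suc (cnt arcs {..<i} ?w)),
      aREM := (ar s aREM)(?w := Suc (cnt arcs {..<i} ?w))), tm := tm s + 64\<rparr>"
  have "adj_inv n k arcs (tick 1 s1) (Suc i)"
    unfolding adj_inv_def
  proof (intro conjI allI impI)
    show "Suc i \<le> length arcs" using i by simp
    show "frame {rV, rA, rZ, rX, rI, rD, rONE} {aTGT, aHEAD, aNXT, aDEG, aREM} (start n k arcs) (tick 1 s1)"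
      using I by (auto simp: frame_def s1_def)
    show "ar (tick 1 s1) aTGT e = snd (arcs ! e)" if "e < Suc i" for e
      using I that by (auto simp: s1_def less_Suc_eq)
    show "alist (ar (tick 1 s1) aNXT) (ar (tick 1 s1) aHEAD u) (out_arcs arcs (Suc i) u)" for u
    proof -
      have "alist ((ar s aNXT)(i := ar s aHEAD ?u)) (ar s aHEAD v) (out_arcs arcs i v)" for v
      proof (rule alist_cong)
        show "alist (ar s aNXT) (ar s aHEAD v) (out_arcs arcs i v)" using I by blast
        show "((ar s aNXT)(i := ar s aHEAD ?u)) e = ar s aNXT e" if "e \<in> set (out_arcs arcs i v)" for e
          using that by (simp add: set_out_arcs)
      qed
      then show ?thesis by (simp add: s1_def out_arcs_Suc)
    qed
    show "ar (tick 1 s1) aDEG w = cnt arcs {..<Suc i} w" "ar (tick 1 s1) aREM w = cnt arcs {..<Suc i} w" for w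
      using I cnt by (auto simp: s1_def)
    show "tm (tick 1 s1) \<le> 8 + 100 * Suc i" "cm (tick 1 s1) = 0" using I by (simp_all add: s1_def)
  qed (use I in \<open>simp_all add: s1_def\<close>)
  moreover have "wp L B adj_body (\<lambda>s'. adj_inv n k arcs (tick 1 s') (Suc i)) (tick 1 s) =
      adj_inv n k arcs (tick 1 s1) (Suc i)"
    unfolding adj_body_def s1_def
    using I raw lt by (simp add: exec_simps fun_upd_twist add.commute)
  ultimately show ?thesis by simp
qed

lemma adj_cmd_ok:
  assumes B: "B = 2 * length arcs + n" and Q: "\<And>s. adj_inv n k arcs s (length arcs) \<Longrightarrow> Q (tick 1 s)"
  shows "wp L B adj_cmd Q (start n k arcs)"
proof -
  define s0 where "s0 = (start n k arcs)\<lparr>rg := (rg (start n k arcs))(rONE := 1, rD := length arcs), tm := 7\<rparr>"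
  have "adj_inv n k arcs s0 0"
    by (simp add: adj_inv_def frame_def s0_def start_def out_arcs_def cnt_def)
  moreover have "wp L B (While rD adj_body) Q s" if "adj_inv n k arcs s i" for s i
    using that
  proof (induction "length arcs - i" arbitrary: s i)
    case 0
    then have "i = length arcs" "rg s rD = 0" by (auto simp: adj_inv_def)
    then show ?case using 0 Q by (subst wp_While_iff) simp
  next
    case (Suc d)
    then have i: "i < length arcs" by auto
    have "wp L B adj_body (\<lambda>s'. wp L B (While rD adj_body) Q (tick 1 s')) (tick 1 s)"
      by (rule wp_mono[OF adj_body_ok[OF Suc.prems i B]], rule Suc.hyps(1)[of "Suc i"]) (use Suc.hyps(2) in auto)
    moreover have "rg s rD \<noteq> 0" using Suc.prems i by (simp add: adj_inv_def)
    ultimately show ?case by (subst wp_While_iff) simp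
  qed
  ultimately have "wp L B (While rD adj_body) Q s0" by blast
  then show ?thesis unfolding adj_cmd_def
    by (simp add: exec_simps s0_def start_def add.commute)
qed

subsection \<open>Levels\<close>

definition skip_cmd :: cmd where
  "skip_cmd = Set rX 0"

definition push_cmd :: cmd where
  "push_cmd = Put aQUE rTL rZ ;; Plus rTL rTL rONE"

definition sources_body :: cmd where
  "sources_body = Get rX aDEG rZ ;; Cond rX skip_cmd push_cmd ;; Plus rZ rZ rONE ;; Minus rD rD rONE"

text \<open>\<open>aPRV\<close> is overwritten by every arc, so it ends up with the predecessor that
  was taken from the queue last.\<close>

definition kahn_arc :: cmd where
  "kahn_arc = Minus rE rE rONE ;; Get rZ aTGT rE ;; Put aPRV rZ rU ;; Get rX aDEG rZ ;; Minus rX rX rONE ;;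
     Put aDEG rZ rX ;; Cond rX skip_cmd push_cmd ;; Get rE aNXT rE"

definition kahn_body :: cmd where
  "kahn_body = Get rV aQUE rH ;; Plus rH rH rONE ;; Plus rU rV rONE ;; Get rE aHEAD rV ;;
     While rE kahn_arc ;; Minus rD rTL rH"

definition kahn_cmd :: cmd where
  "kahn_cmd = Mov rD rN ;; Set rZ 0 ;; While rD sources_body ;; Minus rD rTL rH ;; While rD kahn_body"

context
  fixes n k :: nat and arcs :: "(nat \<times> nat) list" and L :: "nat rel"
  assumes L: "topological_order {..<n} (set arcs) L"
begin

abbreviation "m \<equiv> length arcs"
abbreviation "src e \<equiv> fst (arcs ! e)"
abbreviation "tgt e \<equiv> snd (arcs ! e)"

lemma arc_in:
  assumes "e < m"
  shows "(src e, tgt e) \<in> set arcs \<and> (src e, tgt e) \<in> L \<and> src e < n \<and> tgt e < n"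
proof -
  have "(src e, tgt e) \<in> set arcs" using nth_mem[OF assms] by simp
  then have "(src e, tgt e) \<in> L" using topological_orderD(5)[OF L] by blast
  then have "src e \<in> {..<n} \<and> tgt e \<in> {..<n}" using topological_orderD(4)[OF L] by blast
  then show ?thesis using \<open>(src e, tgt e) \<in> set arcs\<close> \<open>(src e, tgt e) \<in> L\<close> by simp
qed

lemma arc_ex: "(u, v) \<in> set arcs \<Longrightarrow> \<exists>e < m. src e = u \<and> tgt e = v"
  by (metis fst_conv in_set_conv_nth snd_conv)

text \<open>\<open>qs\<close> is the queue, whose first \<open>h\<close> vertices have been taken out; \<open>R\<close> are the arcs that
  have not been traversed.\<close>

definition kahn_inv :: "state \<Rightarrow> nat list \<Rightarrow> (nat \<Rightarrow> nat) \<Rightarrow> nat \<Rightarrow> nat set \<Rightarrow> bool" where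
  "kahn_inv s qs dep h R \<longleftrightarrow>
     frame {rV, rA, rZ, rX, rI, rD, rONE, rE, rU, rTL, rH}
       {aTGT, aHEAD, aNXT, aDEG, aREM, aQUE, aPRV} (start n k arcs) s \<and>
     graph arcs s \<and> rg s rONE = 1 \<and> ar s aREM = cnt arcs {..<m} \<and> cm s = 0 \<and>
     R \<subseteq> {..<m} \<and> h \<le> length qs \<and>
     rg s rTL = length qs \<and> (\<forall>i < length qs. ar s aQUE i = qs ! i) \<and> distinct qs \<and>
     set qs = {w. w < n \<and> cnt arcs R w = 0} \<and> ar s aDEG = cnt arcs R \<and>
     (\<forall>e < m. e \<notin> R \<longrightarrow> src e \<in> set (take h qs)) \<and>
     sorted (map dep qs) \<and> (0 < h \<longrightarrow> (\<forall>w \<in> set qs. dep w \<le> Suc (dep (qs ! (h - 1))))) \<and>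
     (h = 0 \<longrightarrow> (\<forall>w \<in> set qs. dep w = 0)) \<and>
     (\<forall>w \<in> set qs. ar s aPRV w = 0 \<and> dep w = 0 \<or>
        (\<exists>u. ar s aPRV w = Suc u \<and> (u, w) \<in> set arcs \<and> dep w = Suc (dep u) \<and> u \<in> set qs)) \<and>
     (\<forall>e < m. e \<notin> R \<longrightarrow> tgt e \<in> set qs \<longrightarrow> dep (src e) < dep (tgt e))"

lemma kahn_invD:
  assumes "kahn_inv s qs dep h R"
  shows "frame {rV, rA, rZ, rX, rI, rD, rONE, rE, rU, rTL, rH} {aTGT, aHEAD, aNXT, aDEG, aREM, aQUE, aPRV} (start n k arcs) s"
    and "graph arcs s"
    and "rg s rONE = 1"
    and "ar s aREM = cnt arcs {..<m}"
    and "cm s = 0"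
    and "R \<subseteq> {..<m}"
    and "h \<le> length qs"
    and "rg s rTL = length qs"
    and "i < length qs \<Longrightarrow> ar s aQUE i = qs ! i"
    and "distinct qs"
    and "set qs = {w. w < n \<and> cnt arcs R w = 0}"
    and "ar s aDEG = cnt arcs R"
    and "e < m \<Longrightarrow> e \<notin> R \<Longrightarrow> src e \<in> set (take h qs)"
    and "sorted (map dep qs)"
    and "0 < h \<Longrightarrow> w \<in> set qs \<Longrightarrow> dep w \<le> Suc (dep (qs ! (h - 1)))"
    and "h = 0 \<Longrightarrow> w \<in> set qs \<Longrightarrow> dep w = 0"
    and "w \<in> set qs \<Longrightarrow> ar s aPRV w = 0 \<and> dep w = 0 \<or> (\<exists>u. ar s aPRV w = Suc u \<and> (u, w) \<in> set arcs \<and> dep w = Suc (dep u) \<and> u \<in> set qs)"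
    and "e < m \<Longrightarrow> e \<notin> R \<Longrightarrow> tgt e \<in> set qs \<Longrightarrow> dep (src e) < dep (tgt e)"
proof -
  note c = assms[unfolded kahn_inv_def]
  show "frame {rV, rA, rZ, rX, rI, rD, rONE, rE, rU, rTL, rH} {aTGT, aHEAD, aNXT, aDEG, aREM, aQUE, aPRV} (start n k arcs) s"
    using c[THEN conjunct1] by simp
  show "graph arcs s"
    using c[THEN conjunct2, THEN conjunct1] by simp
  show "rg s rONE = 1"
    using c[THEN conjunct2, THEN conjunct2, THEN conjunct1] by simp
  show "ar s aREM = cnt arcs {..<m}"
    using c[THEN conjunct2, THEN conjunct2, THEN conjunct2, THEN conjunct1] by simp
  show "cm s = 0"
    using c[THEN conjunct2, THEN conjunct2, THEN conjunct2, THEN conjunct2, THEN conjunct1] by simp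
  show "R \<subseteq> {..<m}"
    using c[THEN conjunct2, THEN conjunct2, THEN conjunct2, THEN conjunct2, THEN conjunct2, THEN conjunct1] by simp
  show "h \<le> length qs"
    using c[THEN conjunct2, THEN conjunct2, THEN conjunct2, THEN conjunct2, THEN conjunct2, THEN conjunct2, THEN conjunct1] by simp
  show "rg s rTL = length qs"
    using c[THEN conjunct2, THEN conjunct2, THEN conjunct2, THEN conjunct2, THEN conjunct2, THEN conjunct2, THEN conjunct2, THEN conjunct1] by simp
  show "i < length qs \<Longrightarrow> ar s aQUE i = qs ! i"
    using c[THEN conjunct2, THEN conjunct2, THEN conjunct2, THEN conjunct2, THEN conjunct2, THEN conjunct2, THEN conjunct2, THEN conjunct2, THEN conjunct1] by blast
  show "distinct qs"
    using c[THEN conjunct2, THEN conjunct2, THEN conjunct2, THEN conjunct2, THEN conjunct2, THEN conjunct2, THEN conjunct2, THEN conjunct2, THEN conjunct2, THEN conjunct1] by simp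
  show "set qs = {w. w < n \<and> cnt arcs R w = 0}"
    using c[THEN conjunct2, THEN conjunct2, THEN conjunct2, THEN conjunct2, THEN conjunct2, THEN conjunct2, THEN conjunct2, THEN conjunct2, THEN conjunct2, THEN conjunct2, THEN conjunct1] by simp
  show "ar s aDEG = cnt arcs R"
    using c[THEN conjunct2, THEN conjunct2, THEN conjunct2, THEN conjunct2, THEN conjunct2, THEN conjunct2, THEN conjunct2, THEN conjunct2, THEN conjunct2, THEN conjunct2, THEN conjunct2, THEN conjunct1] by simp
  show "e < m \<Longrightarrow> e \<notin> R \<Longrightarrow> src e \<in> set (take h qs)"
    using c[THEN conjunct2, THEN conjunct2, THEN conjunct2, THEN conjunct2, THEN conjunct2, THEN conjunct2, THEN conjunct2, THEN conjunct2, THEN conjunct2, THEN conjunct2, THEN conjunct2, THEN conjunct2, THEN conjunct1] by blast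
  show "sorted (map dep qs)"
    using c[THEN conjunct2, THEN conjunct2, THEN conjunct2, THEN conjunct2, THEN conjunct2, THEN conjunct2, THEN conjunct2, THEN conjunct2, THEN conjunct2, THEN conjunct2, THEN conjunct2, THEN conjunct2, THEN conjunct2, THEN conjunct1] by simp
  show "0 < h \<Longrightarrow> w \<in> set qs \<Longrightarrow> dep w \<le> Suc (dep (qs ! (h - 1)))"
    using c[THEN conjunct2, THEN conjunct2, THEN conjunct2, THEN conjunct2, THEN conjunct2, THEN conjunct2, THEN conjunct2, THEN conjunct2, THEN conjunct2, THEN conjunct2, THEN conjunct2, THEN conjunct2, THEN conjunct2, THEN conjunct2, THEN conjunct1] by blast
  show "h = 0 \<Longrightarrow> w \<in> set qs \<Longrightarrow> dep w = 0"
    using c[THEN conjunct2, THEN conjunct2, THEN conjunct2, THEN conjunct2, THEN conjunct2, THEN conjunct2, THEN conjunct2, THEN conjunct2, THEN conjunct2, THEN conjunct2, THEN conjunct2, THEN conjunct2, THEN conjunct2, THEN conjunct2, THEN conjunct2, THEN conjunct1] by blast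
  show "w \<in> set qs \<Longrightarrow> ar s aPRV w = 0 \<and> dep w = 0 \<or> (\<exists>u. ar s aPRV w = Suc u \<and> (u, w) \<in> set arcs \<and> dep w = Suc (dep u) \<and> u \<in> set qs)"
    using c[THEN conjunct2, THEN conjunct2, THEN conjunct2, THEN conjunct2, THEN conjunct2, THEN conjunct2, THEN conjunct2, THEN conjunct2, THEN conjunct2, THEN conjunct2, THEN conjunct2, THEN conjunct2, THEN conjunct2, THEN conjunct2, THEN conjunct2, THEN conjunct2, THEN conjunct1] by blast
  show "e < m \<Longrightarrow> e \<notin> R \<Longrightarrow> tgt e \<in> set qs \<Longrightarrow> dep (src e) < dep (tgt e)"
    using c[THEN conjunct2, THEN conjunct2, THEN conjunct2, THEN conjunct2, THEN conjunct2, THEN conjunct2, THEN conjunct2, THEN conjunct2, THEN conjunct2, THEN conjunct2, THEN conjunct2, THEN conjunct2, THEN conjunct2, THEN conjunct2, THEN conjunct2, THEN conjunct2, THEN conjunct2] by blast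
qed

lemma kahn_invI:
  assumes "frame {rV, rA, rZ, rX, rI, rD, rONE, rE, rU, rTL, rH} {aTGT, aHEAD, aNXT, aDEG, aREM, aQUE, aPRV} (start n k arcs) s"
    and "graph arcs s"
    and "rg s rONE = 1"
    and "ar s aREM = cnt arcs {..<m}"
    and "cm s = 0"
    and "R \<subseteq> {..<m}"
    and "h \<le> length qs"
    and "rg s rTL = length qs"
    and "\<And>i. i < length qs \<Longrightarrow> ar s aQUE i = qs ! i"
    and "distinct qs"
    and "set qs = {w. w < n \<and> cnt arcs R w = 0}"
    and "ar s aDEG = cnt arcs R"
    and "\<And>e. e < m \<Longrightarrow> e \<notin> R \<Longrightarrow> src e \<in> set (take h qs)"
    and "sorted (map dep qs)"
    and "\<And>w. 0 < h \<Longrightarrow> w \<in> set qs \<Longrightarrow> dep w \<le> Suc (dep (qs ! (h - 1)))"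
    and "\<And>w. h = 0 \<Longrightarrow> w \<in> set qs \<Longrightarrow> dep w = 0"
    and "\<And>w. w \<in> set qs \<Longrightarrow> ar s aPRV w = 0 \<and> dep w = 0 \<or> (\<exists>u. ar s aPRV w = Suc u \<and> (u, w) \<in> set arcs \<and> dep w = Suc (dep u) \<and> u \<in> set qs)"
    and "\<And>e. e < m \<Longrightarrow> e \<notin> R \<Longrightarrow> tgt e \<in> set qs \<Longrightarrow> dep (src e) < dep (tgt e)"
  shows "kahn_inv s qs dep h R"
  unfolding kahn_inv_def by (intro conjI allI ballI impI; rule assms; assumption)

lemma kahn_inv_tick [simp]: "kahn_inv (tick c s) qs dep h R = kahn_inv s qs dep h R"
  unfolding kahn_inv_def graph_def tick_simps frame_tick ..

lemma sources_ok:
  assumes adj: "adj_inv n k arcs s0 m"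
    and Q: "\<And>s qs. kahn_inv s qs (\<lambda>_. 0) 0 {..<m} \<Longrightarrow> rg s rH = 0 \<Longrightarrow> tm s \<le> 20 + 100 * m + 40 * n \<Longrightarrow> Q s"
  shows "wp L B (Mov rD rN ;; Set rZ 0 ;; While rD sources_body) Q (tick 1 s0)"
proof -
  define inv where "inv s i \<longleftrightarrow> i \<le> n \<and>
     frame {rV, rA, rZ, rX, rI, rD, rONE, rE, rU, rTL, rH}
       {aTGT, aHEAD, aNXT, aDEG, aREM, aQUE} (start n k arcs) s \<and>
     graph arcs s \<and> rg s rONE = 1 \<and> rg s rH = 0 \<and> ar s aDEG = cnt arcs {..<m} \<and> ar s aREM = cnt arcs {..<m} \<and>
     rg s rZ = i \<and> rg s rD = n - i \<and> cm s = 0 \<and> tm s \<le> 12 + 100 * m + 40 * i \<and>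
     (\<exists>qs. rg s rTL = length qs \<and> (\<forall>j < length qs. ar s aQUE j = qs ! j) \<and> distinct qs \<and>
        set qs = {w. w < i \<and> cnt arcs {..<m} w = 0})" for s i
  have base: "inv ((tick 1 s0)\<lparr>rg := (rg s0)(rD := n, rZ := 0), tm := Suc (Suc (Suc (tm s0)))\<rparr>) 0"
  proof -
    have "rg s0 rTL = 0 \<and> rg s0 rH = 0" using adj by (simp add: adj_inv_def frame_def start_def)
    moreover have "frame {rV, rA, rZ, rX, rI, rD, rONE, rE, rU, rTL, rH}
       {aTGT, aHEAD, aNXT, aDEG, aREM, aQUE} (start n k arcs) s0"
      using adj by (auto simp: adj_inv_def frame_def)
    moreover have "ar s0 aDEG = cnt arcs {..<m}" "ar s0 aREM = cnt arcs {..<m}"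
      using adj by (auto simp: adj_inv_def)
    ultimately show ?thesis using adj unfolding inv_def
      by (auto simp: adj_inv_def graph_def frame_def)
  qed
  have "wp L B (While rD sources_body) Q s" if "inv s i" for s i
    using that
  proof (induction "n - i" arbitrary: s i)
    case 0
    then have i: "i = n" "rg s rD = 0" by (auto simp: inv_def)
    then obtain qs where "rg s rTL = length qs" "\<forall>j < length qs. ar s aQUE j = qs ! j" "distinct qs"
        "set qs = {w. w < n \<and> cnt arcs {..<m} w = 0}" using 0 by (auto simp: inv_def)
    moreover have "ar s aPRV w = 0" for w using 0 by (auto simp: inv_def frame_def start_def)
    ultimately have "kahn_inv (tick 1 s) qs (\<lambda>_. 0) 0 {..<m}"
      using 0 i by (auto simp: inv_def kahn_inv_def graph_def frame_def sorted_iff_nth_mono)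
    then have "Q (tick 1 s)" using 0 i by (intro Q) (auto simp: inv_def)
    then show ?case using i by (subst wp_While_iff) simp
  next
    case (Suc d)
    then have i: "i < n" by auto
    note I = Suc.prems[unfolded inv_def]
    obtain qs where qs: "rg s rTL = length qs" "\<And>j. j < length qs \<Longrightarrow> ar s aQUE j = qs ! j" "distinct qs"
        "set qs = {w. w < i \<and> cnt arcs {..<m} w = 0}" using I by auto
    have "wp L B sources_body (\<lambda>s'. inv (tick 1 s') (Suc i)) (tick 1 s)"
    proof (cases "cnt arcs {..<m} i = 0")
      case True
      define s1 where "s1 = s\<lparr>rg := (rg s)(rX := 0, rTL := Suc (length qs), rZ := Suc i, rD := n - Suc i),
        ar := (ar s)(aQUE := (ar s aQUE)(length qs := i)), tm := tm s + 21\<rparr>"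
      have "distinct (qs @ [i])" "set (qs @ [i]) = {w. w < Suc i \<and> cnt arcs {..<m} w = 0}"
        using qs(3,4) True by (auto simp: less_Suc_eq)
      moreover have "\<forall>j < length (qs @ [i]). ar (tick 1 s1) aQUE j = (qs @ [i]) ! j"
        using qs(2) by (auto simp: s1_def nth_append less_Suc_eq)
      moreover have "rg (tick 1 s1) rTL = length (qs @ [i])" by (simp add: s1_def)
      ultimately have "inv (tick 1 s1) (Suc i)"
        using I i unfolding inv_def by (intro conjI exI[of _ "qs @ [i]"]) (auto simp: s1_def graph_def frame_def)
      then show ?thesis using I True qs(1) unfolding sources_body_def skip_cmd_def push_cmd_def s1_def
        by (simp add: exec_simps fun_upd_twist add.commute)
    next
      case False
      define s1 where "s1 = s\<lparr>rg := (rg s)(rX := 0, rZ := Suc i, rD := n - Suc i), tm := tm s + 14\<rparr>"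
      have "w < Suc i \<and> cnt arcs {..<m} w = 0 \<longleftrightarrow> w < i \<and> cnt arcs {..<m} w = 0" for w
        using False by (cases "w = i") auto
      then have "set qs = {w. w < Suc i \<and> cnt arcs {..<m} w = 0}" unfolding qs(4) by simp
      then have "inv (tick 1 s1) (Suc i)"
        using I i qs unfolding inv_def by (intro conjI exI[of _ qs]) (auto simp: s1_def graph_def frame_def)
      then show ?thesis using I False unfolding sources_body_def skip_cmd_def push_cmd_def s1_def
        by (simp add: exec_simps fun_upd_twist add.commute)
    qed
    then have "wp L B sources_body (\<lambda>s'. wp L B (While rD sources_body) Q (tick 1 s')) (tick 1 s)"
      by (rule wp_mono, intro Suc.hyps(1)[of "Suc i"]) (use Suc.hyps(2) in auto)
    moreover have "rg s rD \<noteq> 0" using I i by simp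
    ultimately show ?case by (subst wp_While_iff) simp
  qed
  from this[OF base] show ?thesis
    using adj by (simp add: exec_simps adj_inv_def frame_def start_def add.commute)
qed

text \<open>The queue is sorted by \<open>dep\<close>, so the last arc traversed into
  \<open>w\<close> comes from a predecessor of largest depth. This arc lets the count of
  \<open>w\<close> drop to 0 and fixes both its depth and its \<open>aPRV\<close> entry, which
  therefore continues a longest path to \<open>w\<close>.\<close>

lemma kahn_arcs_ok:
  assumes "kahn_inv s qs dep h R" "0 < h" "rg s rU = Suc (qs ! (h - 1))" "alist (ar s aNXT) (rg s rE) es"
    and "distinct es" "set es \<subseteq> R" "\<And>e. e \<in> set es \<Longrightarrow> src e = qs ! (h - 1)" "rg s rH = h"
    and "\<And>s' qs' dep'. kahn_inv s' qs' dep' h (R - set es) \<Longrightarrow> take h qs' = take h qs \<Longrightarrow> rg s' rH = h \<Longrightarrow>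
      tm s' \<le> tm s + 64 * length es + 1 \<Longrightarrow> Q s'"
  shows "wp L B (While rE kahn_arc) Q s"
  using assms
proof (induction es arbitrary: s qs dep R)
  case Nil
  have "kahn_inv (tick 1 s) qs dep h (R - set [])"
    using Nil.prems(1) by simp
  then have "Q (tick 1 s)" using Nil.prems(8) by (intro Nil.prems(9)) auto
  then show ?case using Nil.prems(4) by (subst wp_While_iff) simp
next
  case (Cons e es)
  define v where "v = qs ! (h - 1)"
  define w where "w = tgt e"
  note D = kahn_invD[OF Cons.prems(1)]
  have e: "e \<in> R" "e < m" "src e = v" "e \<notin> set es" using Cons.prems(5,6,7) D(6) by (auto simp: v_def)
  have fR: "finite R" using D(6) finite_subset by blast
  have rE: "rg s rE = Suc e" and al: "alist (ar s aNXT) (ar s aNXT e) es" using Cons.prems(4) by auto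
  have w: "w < n" "cnt arcs R w \<noteq> 0" "w \<notin> set qs" "ar s aTGT e = w"
    using arc_in[OF e(2)] cnt_pos[OF fR e(1)] D(2,11) e(2) by (auto simp: w_def graph_def)
  have vq: "v \<in> set qs" "v \<in> set (take h qs)"
    using D(7) Cons.prems(2) by (auto simp: v_def in_set_conv_nth intro!: exI[of _ "h - 1"])
  have cnt': "cnt arcs (R - {e}) = (cnt arcs R)(w := cnt arcs R w - 1)"
    using cnt_remove[OF fR e(1)] by (auto simp: w_def)
  define z where "z = (cnt arcs R w = 1)"
  define qs' where "qs' = (if z then qs @ [w] else qs)"
  define dep' where "dep' = (if z then dep(w := Suc (dep v)) else dep)"
  define s1 where "s1 = s\<lparr>rg := (if z then (rg s)(rTL := Suc (length qs)) else rg s)(rE := ar s aNXT e, rZ := w, rX := 0),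
    ar := (ar s)(aPRV := (ar s aPRV)(w := Suc v), aDEG := cnt arcs (R - {e}),
      aQUE := (if z then (ar s aQUE)(length qs := w) else ar s aQUE)), tm := tm s + (if z then 53 else 46)\<rparr>"
  have tk: "take h qs' = take h qs" using D(7) by (simp add: qs'_def)
  have set': "set qs' = {u. u < n \<and> cnt arcs (R - {e}) u = 0}"
  proof -
    have "u \<in> set qs' \<longleftrightarrow> u < n \<and> cnt arcs (R - {e}) u = 0" for u
    proof (cases "u = w")
      case True
      have "cnt arcs R w - 1 = 0 \<longleftrightarrow> cnt arcs R w = 1" using w(2) by linarith
      then show ?thesis using True w(1,3) by (simp add: qs'_def z_def cnt')
    next
      case False
      then have "u \<in> set qs' \<longleftrightarrow> u \<in> set qs" by (simp add: qs'_def)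
      then show ?thesis using False D(11) by (simp add: cnt')
    qed
    then show ?thesis by blast
  qed
  have nth: "qs' ! (h - 1) = v" using D(7) Cons.prems(2) by (auto simp: qs'_def v_def nth_append)
  have dep_eq: "dep' u = dep u" if "u \<in> set qs" for u using that w by (auto simp: dep'_def)
  have srcq: "src f \<in> set qs" if "f < m" "f \<notin> R - {e}" for f
    using D(13)[of f] that e vq by (cases "f = e") (auto dest: in_set_takeD)
  have le_v: "dep u \<le> dep v" if u: "u \<in> set (take h qs)" for u
  proof -
    obtain i where "i < h" "i < length qs" "u = qs ! i" using u by (auto simp: in_set_conv_nth)
    then have "map dep qs ! i \<le> map dep qs ! (h - 1)"
      using D(7) Cons.prems(2) by (intro sorted_nth_mono[OF D(14)]) auto
    then show ?thesis using \<open>u = qs ! i\<close> \<open>i < length qs\<close> D(7) Cons.prems(2) by (simp add: v_def)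
  qed
  have inv1: "kahn_inv s1 qs' dep' h (R - {e})"
  proof (rule kahn_invI)
    show "frame {rV, rA, rZ, rX, rI, rD, rONE, rE, rU, rTL, rH} {aTGT, aHEAD, aNXT, aDEG, aREM, aQUE, aPRV}
        (start n k arcs) s1"
      using D(1) by (auto simp: frame_def s1_def)
    show "graph arcs s1" using D(2) by (simp add: graph_def s1_def)
    show "R - {e} \<subseteq> {..<m}" using D(6) by auto
    show "h \<le> length qs'" using D(7) by (simp add: qs'_def)
    show "ar s1 aQUE i = qs' ! i" if "i < length qs'" for i
      using D(9) that by (auto simp: s1_def qs'_def nth_append less_Suc_eq)
    show "distinct qs'" using D(10) w by (simp add: qs'_def)
    show "set qs' = {u. u < n \<and> cnt arcs (R - {e}) u = 0}" by (rule set')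
    show "src f \<in> set (take h qs')" if "f < m" "f \<notin> R - {e}" for f
      using D(13)[of f] that e vq tk by (cases "f = e") auto
    show "sorted (map dep' qs')"
    proof -
      have eq: "map dep' qs = map dep qs" using dep_eq by auto
      have "u \<in> set qs \<Longrightarrow> dep u \<le> Suc (dep v)" for u using D(15)[OF Cons.prems(2)] by (simp add: v_def)
      moreover have "map dep' qs' = (if z then map dep qs @ [Suc (dep v)] else map dep qs)"
        unfolding qs'_def using eq w(3) by (simp add: dep'_def)
      ultimately show ?thesis using D(14) by (auto simp: sorted_append)
    qed
    show "dep' u \<le> Suc (dep' (qs' ! (h - 1)))" if "0 < h" "u \<in> set qs'" for u
    proof -
      have "dep' v = dep v" using dep_eq vq by simp
      moreover have "dep' u \<le> Suc (dep v)"
        using that(2) D(15)[OF Cons.prems(2), of u] dep_eq[of u]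
        by (cases "u = w") (auto simp: qs'_def dep'_def v_def w(3) split: if_splits)
      ultimately show ?thesis unfolding nth by simp
    qed
    show "dep' u = 0" if "h = 0" for u using that Cons.prems(2) by simp
    show "ar s1 aPRV u = 0 \<and> dep' u = 0 \<or>
        (\<exists>t. ar s1 aPRV u = Suc t \<and> (t, u) \<in> set arcs \<and> dep' u = Suc (dep' t) \<and> t \<in> set qs')"
      if u: "u \<in> set qs'" for u
    proof (cases "u = w")
      case True
      then have "z" using u w by (auto simp: qs'_def split: if_splits)
      moreover have "(v, w) \<in> set arcs" using arc_in[OF e(2)] e(3) by (simp add: w_def)
      moreover have "v \<noteq> w" using vq w by auto
      ultimately show ?thesis using True vq by (auto simp: s1_def dep'_def qs'_def)
    next
      case False
      then have uq: "u \<in> set qs" using u by (auto simp: qs'_def split: if_splits)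
      show ?thesis
        using D(17)[OF uq]
      proof
        assume "ar s aPRV u = 0 \<and> dep u = 0"
        then show ?thesis using False dep_eq[OF uq] by (simp add: s1_def)
      next
        assume "\<exists>t. ar s aPRV u = Suc t \<and> (t, u) \<in> set arcs \<and> dep u = Suc (dep t) \<and> t \<in> set qs"
        then obtain t where "ar s aPRV u = Suc t" "(t, u) \<in> set arcs" "dep u = Suc (dep t)" "t \<in> set qs" by blast
        then show ?thesis using False dep_eq[OF uq] dep_eq[of t]
          by (intro disjI2 exI[of _ t]) (auto simp: s1_def qs'_def)
      qed
    qed
    show "dep' (src f) < dep' (tgt f)" if f: "f < m" "f \<notin> R - {e}" "tgt f \<in> set qs'" for f
    proof (cases "tgt f = w")
      case True
      have z
      proof (rule ccontr)
        assume "\<not> z"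
        then show False using f(3) w(3) unfolding True qs'_def by simp
      qed
      have "src f \<in> set (take h qs)" using D(13)[of f] f e vq by (cases "f = e") auto
      then have "dep (src f) \<le> dep v" by (rule le_v)
      moreover have "dep' (src f) = dep (src f)" using srcq[OF f(1,2)] by (rule dep_eq)
      ultimately show ?thesis using True \<open>z\<close> by (simp add: dep'_def)
    next
      case False
      then have "f \<noteq> e" by (auto simp: w_def)
      then have "f \<notin> R" "tgt f \<in> set qs" using f False by (auto simp: qs'_def split: if_splits)
      then show ?thesis using D(18)[OF f(1)] dep_eq srcq[OF f(1,2)] by simp
    qed
    show "rg s1 rTL = length qs'" using D(8) by (simp add: s1_def qs'_def)
  qed (use D in \<open>simp_all add: s1_def\<close>)
  have "wp L B (While rE kahn_arc) Q (tick 1 s1)"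
  proof (rule Cons.IH[OF _ Cons.prems(2)])
    show "kahn_inv (tick 1 s1) qs' dep' h (R - {e})" using inv1 by simp
    show "rg (tick 1 s1) rU = Suc (qs' ! (h - 1))" using Cons.prems(3) nth by (simp add: s1_def v_def)
    show "alist (ar (tick 1 s1) aNXT) (rg (tick 1 s1) rE) es" using al by (simp add: s1_def)
    show "distinct es" "set es \<subseteq> R - {e}" using Cons.prems(5,6) by auto
    show "src f = qs' ! (h - 1)" if "f \<in> set es" for f using Cons.prems(7)[of f] that nth by (simp add: v_def)
    show "rg (tick 1 s1) rH = h" using Cons.prems(8) by (simp add: s1_def)
  next
    fix s' qs2 dep2
    assume a: "kahn_inv s' qs2 dep2 h (R - {e} - set es)" "take h qs2 = take h qs'" "rg s' rH = h"
      "tm s' \<le> tm (tick 1 s1) + 64 * length es + 1"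
    show "Q s'"
    proof (rule Cons.prems(9))
      have "R - {e} - set es = R - set (e # es)" by auto
      then show "kahn_inv s' qs2 dep2 h (R - set (e # es))" using a(1) by simp
      show "take h qs2 = take h qs" "rg s' rH = h" using a tk by simp_all
      show "tm s' \<le> tm s + 64 * length (e # es) + 1" using a(4) by (auto simp: s1_def split: if_splits)
    qed
  qed
  moreover have "wp L B kahn_arc (\<lambda>s'. wp L B (While rE kahn_arc) Q (tick 1 s')) (tick 1 s) =
      wp L B (While rE kahn_arc) Q (tick 1 s1)"
  proof (cases z)
    case True
    then show ?thesis
      using Cons.prems(3) rE w(2,4) D(3,8,12) unfolding kahn_arc_def skip_cmd_def push_cmd_def s1_def
      by (simp add: exec_simps z_def qs'_def cnt' v_def fun_upd_twist add.commute)
  next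
    case False
    then have "cnt arcs R w - 1 \<noteq> 0" using w(2) by (simp add: z_def)
    then show ?thesis
      using False Cons.prems(3) rE w(4) D(3,8,12) unfolding kahn_arc_def skip_cmd_def push_cmd_def s1_def
      by (simp add: exec_simps qs'_def cnt' v_def fun_upd_twist add.commute)
  qed
  ultimately show ?case using rE by (subst wp_While_iff) simp
qed

end

lemma wf_topological_order:
  assumes "topological_order V A L" "finite V"
  shows "wf L"
proof (rule finite_acyclic_wf)
  note D = topological_orderD[OF assms(1)]
  show "finite L" using D(4) assms(2) by (meson finite_SigmaI finite_subset)
  show "acyclic L" using D(1,2) by (auto simp: acyclic_def irrefl_def trancl_id)
qed

section \<open>A longest path from the levels\<close>

definition path_body :: cmd where
  "path_body = Minus rU rU rONE ;; Put aPATH rJ rU ;; Put aINP rU rONE ;; Plus rJ rJ rONE ;; Get rU aPRV rU"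

definition path_cmd :: cmd where
  "path_cmd = Minus rX rN rONE ;; Get rU aQUE rX ;; Plus rU rU rONE ;; While rU path_body"

context
  fixes n k :: nat and arcs :: "(nat \<times> nat) list" and L :: "nat rel"
  assumes L: "topological_order {..<n} (set arcs) L"
begin

abbreviation (input) "kinv \<equiv> kahn_inv n k arcs"

lemma kahn_ok:
  assumes "kinv s qs dep h R" "R = {e. e < length arcs \<and> src arcs e \<notin> set (take h qs)}"
    and "rg s rH = h" "rg s rD = length qs - h"
    and "\<And>s' qs' dep'. kinv s' qs' dep' n {} \<Longrightarrow> set qs' = {..<n} \<Longrightarrow>
      tm s' \<le> tm s + 40 * (n - h) + 64 * card R + 1 \<Longrightarrow> Q s'"
  shows "wp L B (While rD kahn_body) Q s"
  using assms
proof (induction "n - h" arbitrary: s qs dep h R rule: less_induct)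
  case less
  note D = kahn_invD[OF L less.prems(1)]
  have len: "length qs \<le> n"
  proof -
    have "card (set qs) \<le> card {..<n}" using D(11) by (intro card_mono) auto
    then show ?thesis using D(10) by (simp add: distinct_card)
  qed
  have fR: "finite R" using D(6) finite_subset by blast
  show ?case
  proof (cases "h < length qs")
    case False
    then have h: "h = length qs" "rg s rD = 0" using D(7) less.prems(4) by auto
    have all: "set qs = {..<n}"
    proof (rule ccontr)
      assume "set qs \<noteq> {..<n}"
      then have "{..<n} - set qs \<noteq> {}" using D(11) by auto
      \<comment> \<open>A least vertex missing in the queue would have an untraversed incoming arc,
        whose tail is missing as well.\<close>
      then obtain w where w: "w \<in> {..<n} - set qs" "\<And>y. (y, w) \<in> L \<Longrightarrow> y \<notin> {..<n} - set qs"
        using wf_topological_order[OF L] by (metis finite_lessThan wfE_min equals0I)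
      then have "cnt arcs R w \<noteq> 0" using D(11) by auto
      then obtain e where "e \<in> R" "tgt arcs e = w" using cnt_eq_0[OF fR] by auto
      then have "src arcs e \<notin> set qs" "e < length arcs" using less.prems(2) h by auto
      then show False using w(2)[of "src arcs e"] arc_in[OF L \<open>e < length arcs\<close>] \<open>tgt arcs e = w\<close> by auto
    qed
    then have "length qs = n" using D(10) by (metis card_lessThan distinct_card)
    moreover have "R = {}" using less.prems(2) h all arc_in[OF L] by auto
    ultimately have "kinv (tick 1 s) qs dep n {}" using less.prems(1) h by (simp add: kahn_inv_tick[OF L])
    then have "Q (tick 1 s)" using all by (intro less.prems(5)) auto
    then show ?thesis using h(2) by (subst wp_While_iff) simp
  next
    case True
    define v where "v = qs ! h"
    define es where "es = out_arcs arcs (length arcs) v"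
    have v: "v \<in> set qs" "v \<notin> set (take h qs)"
      using True D(10) by (auto simp: v_def in_set_conv_nth nth_eq_iff_index_eq)
    have tk: "take (Suc h) qs = take h qs @ [v]" using True by (simp add: v_def take_Suc_conv_app_nth)
    have es: "set es = {e. e < length arcs \<and> src arcs e = v}" "distinct es" by (simp_all add: es_def set_out_arcs distinct_out_arcs)
    have esR: "set es \<subseteq> R" using es(1) less.prems(2) v(2) by auto
    have R': "R - set es = {e. e < length arcs \<and> src arcs e \<notin> set (take (Suc h) qs)}"
      unfolding es(1) less.prems(2) tk by auto
    define s1 where "s1 = s\<lparr>rg := (rg s)(rV := v, rH := Suc h, rU := Suc v, rE := ar s aHEAD v), tm := tm s + 19\<rparr>"
    have inv1: "kinv s1 qs dep (Suc h) R"
    proof (rule kahn_invI[OF L])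
      show "frame {rV, rA, rZ, rX, rI, rD, rONE, rE, rU, rTL, rH} {aTGT, aHEAD, aNXT, aDEG, aREM, aQUE, aPRV}
          (start n k arcs) s1"
        using D(1) by (auto simp: frame_def s1_def)
      show "graph arcs s1" using D(2) by (simp add: graph_def s1_def)
      show "src arcs e \<in> set (take (Suc h) qs)" if "e < length arcs" "e \<notin> R" for e
        using D(13)[OF that] by (simp add: tk)
      show "dep w \<le> Suc (dep (qs ! (Suc h - 1)))" if "w \<in> set qs" for w
      proof (cases "h = 0")
        case True
        then show ?thesis using D(16) that by simp
      next
        case False
        then have "dep w \<le> Suc (dep (qs ! (h - 1)))" using D(15) that by simp
        moreover have "map dep qs ! (h - 1) \<le> map dep qs ! h"
          using True by (intro sorted_nth_mono[OF D(14)]) auto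
        ultimately show ?thesis using True by simp
      qed
    qed (use D True in \<open>simp_all add: s1_def\<close>)
    have "wp L B (While rE kahn_arc) (\<lambda>s'. wp L B (Minus rD rTL rH) (\<lambda>s'. wp L B (While rD kahn_body) Q (tick 1 s')) s') s1"
    proof (rule kahn_arcs_ok[OF L inv1])
      show "rg s1 rU = Suc (qs ! (Suc h - 1))" "rg s1 rH = Suc h" by (simp_all add: s1_def v_def)
      show "alist (ar s1 aNXT) (rg s1 rE) es" using D(2) by (simp add: s1_def es_def graph_def)
      show "src arcs e = qs ! (Suc h - 1)" if "e \<in> set es" for e using that es(1) by (simp add: v_def)
    next
      fix s2 qs2 dep2
      assume a: "kinv s2 qs2 dep2 (Suc h) (R - set es)" "take (Suc h) qs2 = take (Suc h) qs"
        "rg s2 rH = Suc h" "tm s2 \<le> tm s1 + 64 * length es + 1"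
      define s3 where "s3 = s2\<lparr>rg := (rg s2)(rD := length qs2 - Suc h), tm := Suc (Suc (tm s2))\<rparr>"
      note D2 = kahn_invD[OF L a(1)]
      have inv3: "kinv s3 qs2 dep2 (Suc h) (R - set es)"
      proof (rule kahn_invI[OF L])
        show "frame {rV, rA, rZ, rX, rI, rD, rONE, rE, rU, rTL, rH} {aTGT, aHEAD, aNXT, aDEG, aREM, aQUE, aPRV}
            (start n k arcs) s3"
          using D2(1) by (auto simp: frame_def s3_def)
        show "graph arcs s3" using D2(2) by (simp add: graph_def s3_def)
      qed (use D2 in \<open>simp_all add: s3_def\<close>)
      have "wp L B (While rD kahn_body) Q s3"
      proof (rule less.hyps[OF _ inv3])
        show "n - Suc h < n - h" using True len by simp
        show "R - set es = {e. e < length arcs \<and> src arcs e \<notin> set (take (Suc h) qs2)}" using R' a(2) by simp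
        show "rg s3 rH = Suc h" "rg s3 rD = length qs2 - Suc h" using a(3) by (simp_all add: s3_def)
      next
        fix s' qs' dep'
        assume b: "kinv s' qs' dep' n {}" "set qs' = {..<n}"
          "tm s' \<le> tm s3 + 40 * (n - Suc h) + 64 * card (R - set es) + 1"
        have "card (R - set es) + length es = card R"
          using esR fR es(2) card_mono[OF fR esR] by (simp add: card_Diff_subset distinct_card)
        moreover have "n - h = Suc (n - Suc h)" using True len by simp
        ultimately have "tm s' \<le> tm s + 40 * (n - h) + 64 * card R + 1"
          using b(3) a(4) by (simp add: s3_def s1_def)
        then show "Q s'" using less.prems(5)[OF b(1,2)] by simp
      qed
      then show "wp L B (Minus rD rTL rH) (\<lambda>s'. wp L B (While rD kahn_body) Q (tick 1 s')) s2"
        using a(3) D2(8) by (simp add: exec_simps s3_def)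
    qed (use es esR in auto)
    moreover have "wp L B kahn_body (\<lambda>s'. wp L B (While rD kahn_body) Q (tick 1 s')) (tick 1 s) =
        wp L B (While rE kahn_arc) (\<lambda>s'. wp L B (Minus rD rTL rH) (\<lambda>s'. wp L B (While rD kahn_body) Q (tick 1 s')) s') s1"
      using less.prems(3) D(3) D(9)[OF True]
      by (subst (1) kahn_body_def) (simp add: wp_Seq wp_basic put_rg_def tick_def s1_def v_def add.commute)
    moreover have "rg s rD \<noteq> 0" using less.prems(4) True by simp
    ultimately show ?thesis by (subst wp_While_iff) simp
  qed
qed

text \<open>\<open>ps\<close> lists a longest path backwards, and \<open>dep\<close> is the length of a longest path to a vertex.\<close>

definition prepared :: "state \<Rightarrow> (nat \<Rightarrow> nat) \<Rightarrow> nat list \<Rightarrow> bool" where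
  "prepared s dep ps \<longleftrightarrow>
     frame {rV, rA, rZ, rX, rI, rD, rONE, rE, rU, rTL, rH, rJ} {..8} (start n k arcs) s \<and>
     graph arcs s \<and> rg s rONE = 1 \<and> ar s aREM = cnt arcs {..<length arcs} \<and> cm s = 0 \<and>
     rg s rJ = length ps \<and> (\<forall>i < length ps. ar s aPATH i = ps ! i) \<and>
     (\<forall>v. ar s aINP v = of_bool (v \<in> set ps)) \<and>
     (\<forall>i < length ps. ps ! i < n \<and> dep (ps ! i) = length ps - Suc i) \<and>
     (\<forall>i. Suc i < length ps \<longrightarrow> (ps ! Suc i, ps ! i) \<in> set arcs) \<and>
     (\<forall>u v. (u, v) \<in> set arcs \<longrightarrow> dep u < dep v) \<and>
     (\<forall>v < n. 0 < dep v \<longrightarrow> (\<exists>u. (u, v) \<in> set arcs \<and> Suc (dep u) = dep v)) \<and>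
     (\<forall>v < n. dep v < length ps)"

text \<open>The queue is sorted by depth, so its last vertex ends a longest path, and each step
  along \<open>aPRV\<close> lowers the depth by exactly one.\<close>

lemma path_ok:
  assumes kahn: "kinv s qs dep n {}" and all: "set qs = {..<n}" and n: "0 < n"
    and Q: "\<And>s' ps. prepared s' dep ps \<Longrightarrow> tm s' \<le> tm s + 40 * n + 20 \<Longrightarrow> Q s'"
  shows "wp L B path_cmd Q s"
proof -
  note D = kahn_invD[OF L kahn]
  have len: "length qs = n" using D(10) all by (metis card_lessThan distinct_card)
  define x0 where "x0 = qs ! (n - 1)"
  have x0: "x0 < n" using len n all nth_mem[of "n - 1" qs] by (auto simp: x0_def)
  have le_x0: "dep v \<le> dep x0" if "v < n" for v
  proof -
    obtain i where i: "i < n" "v = qs ! i" using \<open>v < n\<close> all len by (metis in_set_conv_nth lessThan_iff)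
    have "map dep qs ! i \<le> map dep qs ! (n - 1)"
      using i len by (intro sorted_nth_mono[OF D(14)]) auto
    then show ?thesis using i len n by (simp add: x0_def)
  qed
  have prv: "ar s aPRV w = 0 \<and> dep w = 0 \<or>
      (\<exists>u. ar s aPRV w = Suc u \<and> (u, w) \<in> set arcs \<and> dep w = Suc (dep u) \<and> u < n)" if "w < n" for w
    using D(17)[of w] that all by auto
  have dep_arc: "dep u < dep v" if uv: "(u, v) \<in> set arcs" for u v
  proof -
    obtain e where "e < length arcs" "src arcs e = u" "tgt arcs e = v" using arc_ex[OF L uv] by auto
    then show ?thesis using D(18)[of e] arc_in[OF L, of e] all by auto
  qed
  have dep_pred: "\<exists>u. (u, v) \<in> set arcs \<and> Suc (dep u) = dep v" if "v < n" "0 < dep v" for v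
    using prv[OF that(1)] that(2) by fastforce
  define inv where "inv s' ps \<longleftrightarrow>
      frame {rV, rA, rZ, rX, rI, rD, rONE, rE, rU, rTL, rH, rJ} {..8} (start n k arcs) s' \<and>
      graph arcs s' \<and> rg s' rONE = 1 \<and> ar s' aREM = cnt arcs {..<length arcs} \<and> cm s' = 0 \<and> ar s' aPRV = ar s aPRV \<and>
      rg s' rJ = length ps \<and> (\<forall>i < length ps. ar s' aPATH i = ps ! i) \<and>
      (\<forall>v. ar s' aINP v = of_bool (v \<in> set ps)) \<and>
      (\<forall>i < length ps. ps ! i < n \<and> dep (ps ! i) + i = dep x0) \<and>
      (\<forall>i. Suc i < length ps \<longrightarrow> (ps ! Suc i, ps ! i) \<in> set arcs) \<and> tm s' \<le> tm s + 40 * length ps + 12" for s' ps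
  have loop: "wp L B (While rU path_body) Q s'"
    if "inv s' ps" "rg s' rU = 0 \<and> length ps = Suc (dep x0) \<or>
      (\<exists>u < n. rg s' rU = Suc u \<and> dep u + length ps = dep x0 \<and> (ps \<noteq> [] \<longrightarrow> (u, last ps) \<in> set arcs))" for s' ps
    using that
  proof (induction "Suc (dep x0) - length ps" arbitrary: s' ps rule: less_induct)
    case less
    note I = less.prems(1)[unfolded inv_def]
    show ?case
      using less.prems(2)
    proof
      assume a: "rg s' rU = 0 \<and> length ps = Suc (dep x0)"
      have "length ps \<le> n"
      proof -
        have "distinct ps" using I by (auto simp: distinct_conv_nth) (metis add_left_cancel)
        moreover have "set ps \<subseteq> {..<n}" using I by (auto simp: in_set_conv_nth)
        ultimately show ?thesis by (metis card_lessThan card_mono distinct_card finite_lessThan)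
      qed
      moreover have "prepared (tick 1 s') dep ps"
        unfolding prepared_def
      proof (intro conjI allI impI)
        show "graph arcs (tick 1 s')" using I by (simp add: graph_def)
        show "dep (ps ! i) = length ps - Suc i" if "i < length ps" for i
        proof -
          have "dep (ps ! i) + i = dep x0" using I that by blast
          then show ?thesis using a by simp
        qed
        show "dep v < length ps" if "v < n" for v using le_x0[OF that] a by simp
      qed (use I dep_arc dep_pred in auto)
      ultimately have "Q (tick 1 s')" using I by (intro Q) auto
      then show ?thesis using a by (subst wp_While_iff) simp
    next
      assume "\<exists>u < n. rg s' rU = Suc u \<and> dep u + length ps = dep x0 \<and> (ps \<noteq> [] \<longrightarrow> (u, last ps) \<in> set arcs)"
      then obtain u where u: "u < n" "rg s' rU = Suc u" "dep u + length ps = dep x0" "ps \<noteq> [] \<Longrightarrow> (u, last ps) \<in> set arcs"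
        by blast
      define s1 where "s1 = s'\<lparr>rg := (rg s')(rU := ar s aPRV u, rJ := Suc (length ps)),
          ar := (ar s')(aPATH := (ar s' aPATH)(length ps := u), aINP := (ar s' aINP)(u := 1)), tm := tm s' + 28\<rparr>"
      have "inv s1 (ps @ [u])"
        unfolding inv_def
      proof (intro conjI allI impI)
        show "frame {rV, rA, rZ, rX, rI, rD, rONE, rE, rU, rTL, rH, rJ} {..8} (start n k arcs) s1"
          using I by (auto simp: frame_def s1_def)
        show "graph arcs s1" using I by (simp add: graph_def s1_def)
        show "ar s1 aPATH i = (ps @ [u]) ! i" if "i < length (ps @ [u])" for i
          using I that by (auto simp: s1_def nth_append less_Suc_eq)
        show "ar s1 aINP v = of_bool (v \<in> set (ps @ [u]))" for v using I by (auto simp: s1_def)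
        show "(ps @ [u]) ! i < n" "dep ((ps @ [u]) ! i) + i = dep x0" if "i < length (ps @ [u])" for i
          using I that u by (auto simp: nth_append less_Suc_eq)
        show "((ps @ [u]) ! Suc i, (ps @ [u]) ! i) \<in> set arcs" if "Suc i < length (ps @ [u])" for i
        proof (cases "Suc i < length ps")
          case True
          then show ?thesis using I by (simp add: nth_append)
        next
          case False
          then have "Suc i = length ps" using that by simp
          then have "ps \<noteq> []" "i = length ps - 1" by auto
          then have "ps \<noteq> []" "last ps = ps ! i" by (simp_all add: last_conv_nth)
          then show ?thesis using u(4) \<open>Suc i = length ps\<close> by (simp add: nth_append)
        qed
      qed (use I in \<open>simp_all add: s1_def\<close>)
      moreover have "rg s1 rU = 0 \<and> length (ps @ [u]) = Suc (dep x0) \<or>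
        (\<exists>t < n. rg s1 rU = Suc t \<and> dep t + length (ps @ [u]) = dep x0 \<and> (ps @ [u] \<noteq> [] \<longrightarrow> (t, last (ps @ [u])) \<in> set arcs))"
        using prv[OF u(1)] u(3) by (auto simp: s1_def)
      moreover have "Suc (dep x0) - length (ps @ [u]) < Suc (dep x0) - length ps" using u(3) by simp
      ultimately have "wp L B (While rU path_body) Q s1" by (intro less.hyps)
      moreover have "wp L B path_body (\<lambda>s'. wp L B (While rU path_body) Q (tick 1 s')) (tick 1 s') =
          wp L B (While rU path_body) Q s1"
        using I u(2) unfolding path_body_def s1_def by (simp add: exec_simps fun_upd_twist add.commute)
      ultimately show ?thesis using u(2) by (subst wp_While_iff) simp
    qed
  qed
  define s1 where "s1 = s\<lparr>rg := (rg s)(rX := n - 1, rU := Suc x0), tm := tm s + 10\<rparr>"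
  have N: "rg s rN = n" "rg s rJ = 0" using D(1) by (auto simp: frame_def start_def)
  have "ar s aPATH = (\<lambda>_. 0)" "ar s aINP = (\<lambda>_. 0)" using D(1) by (auto simp: frame_def start_def)
  then have "inv s1 []"
    using D(1-5) N unfolding inv_def by (auto simp: s1_def graph_def frame_def)
  then have "wp L B (While rU path_body) Q s1"
    by (rule loop) (use x0 in \<open>auto simp: s1_def\<close>)
  moreover have "wp L B path_cmd Q s = wp L B (While rU path_body) Q s1"
    unfolding path_cmd_def using N D(3) D(9)[of "n - 1"] len n
    by (simp add: wp_Seq wp_basic put_rg_def s1_def x0_def add.commute)
  ultimately show ?thesis by simp
qed

lemma prepare_ok:
  assumes B: "B = 2 * length arcs + n" and n: "0 < n"
    and Q: "\<And>s dep ps. prepared s dep ps \<Longrightarrow> tm s \<le> 200 * length arcs + 200 * n + 100 \<Longrightarrow> Q s"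
  shows "wp L B (adj_cmd ;; kahn_cmd ;; path_cmd) Q (start n k arcs)"
  unfolding wp_Seq[of L B adj_cmd]
proof (rule adj_cmd_ok[OF B])
  fix s assume "adj_inv n k arcs s (length arcs)"
  then have "wp L B (Mov rD rN ;; Set rZ 0 ;; While rD sources_body)
      (wp L B (Minus rD rTL rH ;; While rD kahn_body) (wp L B path_cmd Q)) (tick 1 s)"
  proof (rule sources_ok[OF L])
    fix s1 qs assume a: "kinv s1 qs (\<lambda>_. 0) 0 {..<length arcs}" "rg s1 rH = 0" "tm s1 \<le> 20 + 100 * length arcs + 40 * n"
    note D = kahn_invD[OF L a(1)]
    define s2 where "s2 = s1\<lparr>rg := (rg s1)(rD := length qs), tm := Suc (tm s1)\<rparr>"
    have inv: "kinv s2 qs (\<lambda>_. 0) 0 {..<length arcs}"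
    proof (rule kahn_invI[OF L])
      show "frame {rV, rA, rZ, rX, rI, rD, rONE, rE, rU, rTL, rH} {aTGT, aHEAD, aNXT, aDEG, aREM, aQUE, aPRV}
          (start n k arcs) s2"
        using D(1) by (auto simp: frame_def s2_def)
      show "graph arcs s2" using D(2) by (simp add: graph_def s2_def)
    qed (use D in \<open>simp_all add: s2_def\<close>)
    have "wp L B (While rD kahn_body) (wp L B path_cmd Q) s2"
    proof (rule kahn_ok[OF inv])
      fix s' qs' dep' assume b: "kinv s' qs' dep' n {}" "set qs' = {..<n}"
        "tm s' \<le> tm s2 + 40 * (n - 0) + 64 * card {..<length arcs} + 1"
      show "wp L B path_cmd Q s'"
      proof (rule path_ok[OF b(1,2) n])
        fix s'' ps assume "prepared s'' dep' ps" "tm s'' \<le> tm s' + 40 * n + 20"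
        then show "Q s''" using b(3) a(3) by (intro Q) (auto simp: s2_def)
      qed
    qed (use a(2) in \<open>auto simp: s2_def\<close>)
    then show "wp L B (Minus rD rTL rH ;; While rD kahn_body) (wp L B path_cmd Q) s1"
      using a(2) D(8) by (simp add: exec_simps s2_def)
  qed
  then show "wp L B (kahn_cmd ;; path_cmd) Q (tick 1 s)"
    unfolding kahn_cmd_def wp_Seq .
qed

text \<open>\<open>ps\<close> runs backwards and \<open>?p\<close> forwards. The outputs are closed
  under predecessors, so \<open>off_path_bound\<close> applies to them.\<close>

lemma prepared_off_path:
  assumes p: "prepared s dep ps" and vs: "smallest_sorted {..<n} L j vs"
  shows "2 ^ card (set vs - set ps) \<le> card (output_seqs {..<n} (set arcs) j) ^ 2"
proof -
  note P = p[unfolded prepared_def]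
  let ?N = "length ps" and ?p = "\<lambda>i. ps ! (length ps - Suc i)"
  have "?p ` {..<?N} = set ps"
  proof -
    have "set ps = (\<lambda>i. ps ! i) ` {..<?N}" by (auto simp: in_set_conv_nth)
    also have "\<dots> = ?p ` {..<?N}"
    proof (intro set_eqI iffI)
      fix x assume "x \<in> (\<lambda>i. ps ! i) ` {..<?N}"
      then obtain i where "i < ?N" "x = ps ! i" by auto
      then show "x \<in> ?p ` {..<?N}" by (intro image_eqI[of _ _ "?N - Suc i"]) auto
    qed auto
    finally show ?thesis by simp
  qed
  moreover have "card (set vs) = j"
    using smallest_sorted_distinct[OF L vs] vs by (simp add: distinct_card smallest_sorted_def)
  moreover have "2 ^ card (set vs - ?p ` {..<?N}) \<le> card (output_seqs {..<n} (set arcs) (card (set vs))) ^ 2"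
  proof (rule off_path_bound[where dep = dep and N = ?N])
    show "set arcs \<subseteq> {..<n} \<times> {..<n}" using topological_orderD(4,5)[OF L] by blast
    show "?p i \<in> {..<n} \<and> dep (?p i) = i" if "i < ?N" for i
    proof -
      have "?N - Suc i < ?N" using that by simp
      then have "?p i < n \<and> dep (?p i) = ?N - Suc (?N - Suc i)" using P by blast
      then show ?thesis using that by simp
    qed
    show "(?p i, ?p (Suc i)) \<in> set arcs" if "Suc i < ?N" for i
    proof -
      have e: "?N - Suc i = Suc (?N - Suc (Suc i))" using that by simp
      have "Suc (?N - Suc (Suc i)) < ?N" using that by simp
      then have "(ps ! Suc (?N - Suc (Suc i)), ps ! (?N - Suc (Suc i))) \<in> set arcs" using P by blast
      then show ?thesis unfolding e .
    qed
    show "set vs \<subseteq> {..<n}" using vs by (auto simp: smallest_sorted_def)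
    show "u \<in> set vs" if "(u, v) \<in> set arcs" "v \<in> set vs" for u v
    proof (rule ccontr)
      have uv: "(u, v) \<in> L" "u \<in> {..<n}" using that topological_orderD(4,5)[OF L] by blast+
      assume "u \<notin> set vs"
      then have "(v, u) \<in> L" using vs that(2) uv by (auto simp: smallest_sorted_def)
      then show False using topological_order_asym[OF L] uv by blast
    qed
    show "\<exists>u. (u, v) \<in> set arcs \<and> Suc (dep u) = dep v" if "v \<in> {..<n}" "0 < dep v" for v
      using P that by blast
    show "dep u < dep v" if "(u, v) \<in> set arcs" for u v using P that by blast
    show "dep v < ?N" if "v \<in> {..<n}" for v using P that by blast
  qed simp
  ultimately show ?thesis by simp
qed

end

section \<open>The main loop\<close>

context
  fixes n k :: nat and arcs :: "(nat \<times> nat) list" and L :: "nat rel" and ps vs :: "nat list"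
  assumes L: "topological_order {..<n} (set arcs) L"
    and vs: "smallest_sorted {..<n} L k vs"
    and path: "\<And>i. Suc i < length ps \<Longrightarrow> (ps ! Suc i, ps ! i) \<in> set arcs" "set ps \<subseteq> {..<n}"
begin

section \<open>The order on the path and on the outputs\<close>

lemma tr: "(x, y) \<in> L \<Longrightarrow> (y, z) \<in> L \<Longrightarrow> (x, z) \<in> L"
  using topological_orderD(1)[OF L] by (meson transD)

lemma asym: "(x, y) \<in> L \<Longrightarrow> (y, x) \<notin> L"
  using topological_order_asym[OF L] by blast

lemma irr: "(x, x) \<notin> L"
  using topological_orderD(2)[OF L] by (auto simp: irrefl_def)

lemma tot: "x < n \<Longrightarrow> y < n \<Longrightarrow> x \<noteq> y \<Longrightarrow> (x, y) \<in> L \<or> (y, x) \<in> L"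
  using topological_orderD(3)[OF L] by (auto simp: total_on_def)

lemma path_sorted: "a < b \<Longrightarrow> b < length ps \<Longrightarrow> (ps ! b, ps ! a) \<in> L"
proof (induction b)
  case (Suc b)
  have 1: "(ps ! Suc b, ps ! b) \<in> L" using path(1)[OF Suc.prems(2)] topological_orderD(5)[OF L] by blast
  show ?case
  proof (cases "a = b")
    case False
    then have "(ps ! b, ps ! a) \<in> L" using Suc by simp
    then show ?thesis using tr 1 by blast
  qed (use 1 in simp)
qed simp

lemma distinct_path: "distinct ps"
  unfolding distinct_conv_nth using path_sorted irr by (metis linorder_neqE_nat)

lemma vs_least:
  assumes "i < k" "z < n" "z \<notin> set (take i vs)" "z \<noteq> vs ! i"
  shows "(vs ! i, z) \<in> L"
proof -
  have len: "length vs = k" using vs by (simp add: smallest_sorted_def)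
  show ?thesis
  proof (cases "z \<in> set vs")
    case True
    then obtain j where j: "j < k" "z = vs ! j" using len by (auto simp: in_set_conv_nth)
    have "\<not> j < i"
    proof
      assume "j < i"
      then have "z \<in> set (take i vs)" using j len by (auto simp: in_set_conv_nth intro!: exI[of _ j])
      then show False using assms by simp
    qed
    then have "i < j" using j assms(4) by (cases "i = j") auto
    then show ?thesis using vs j by (auto simp: smallest_sorted_def sorted_wrt_iff_nth_less)
  next
    case False
    then show ?thesis using vs assms len by (auto simp: smallest_sorted_def)
  qed
qed

lemma vs_fresh: "i < k \<Longrightarrow> vs ! i \<notin> set (take i vs) \<and> vs ! i < n"
  using vs smallest_sorted_distinct[OF L vs] nth_mem[of i vs]
  by (auto simp: smallest_sorted_def in_set_conv_nth nth_eq_iff_index_eq subset_iff)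

lemma vs_preds: "i < k \<Longrightarrow> (u, vs ! i) \<in> set arcs \<Longrightarrow> u \<in> set (take i vs)"
  using smallest_sorted_output_seqs[OF L vs] by (auto simp: output_seqs_def)

text \<open>Outputs are numbered from 0. The path vertices \<open>ps ! 0, \<dots>, ps ! (J - 1)\<close> are still to come. A
  searched item \<open>x\<close>, with \<open>is x\<close> outputs and \<open>Js x\<close> path vertices to come at the time of the search,
  comes after the path vertices from index \<open>q x - 1\<close> on.\<close>

definition searched_ok :: "(nat + nat) list \<Rightarrow> nat \<Rightarrow> (nat \<Rightarrow> nat) \<Rightarrow> (nat \<Rightarrow> nat) \<Rightarrow> (nat \<Rightarrow> nat) \<Rightarrow> (nat \<Rightarrow> nat) \<Rightarrow> nat \<Rightarrow> bool" where
  "searched_ok ev J is Js es q x \<longleftrightarrow>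
     (let i = length (popped ev); c = q x - 1 in
     q x \<noteq> 0 \<and> c \<le> Js x \<and> Js x \<le> length ps \<and> J \<le> Js x \<and> Js x + is x \<le> J + i \<and> is x \<le> i \<and>
     Js x + is x \<le> c + k \<and> 2 ^ es x \<le> Suc (Js x - c) \<and>
     (\<forall>j < Js x. Js x + is x \<le> j + k \<longrightarrow> ((ps ! j, x) \<in> L \<longleftrightarrow> c \<le> j)) \<and>
     (\<exists>a < length ev. ev ! a = Inl x \<and> Suc (a + i) \<le> length ev + is x \<and> length (popped (take a ev)) \<le> is x))"

definition popped_ok :: "(nat + nat) list \<Rightarrow> (nat \<Rightarrow> nat) \<Rightarrow> (nat \<Rightarrow> nat) \<Rightarrow> nat \<Rightarrow> bool" where
  "popped_ok ev es eh x \<longleftrightarrow> (\<exists>a b. a < length ev \<and> b < length ev \<and> ev ! a = Inl x \<and> ev ! b = Inr x \<and>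
     2 ^ es x \<le> Suc (b - a) \<and> 2 ^ eh x \<le> Suc (b - a))"

text \<open>\<open>Sr\<close> are the searched items, and \<open>is x\<close> is the number of
  outputs made before the search for \<open>x\<close>. Injectivity of \<open>is\<close> says that
  there is at most one search per output; \<open>fact_half_le\<close> depends on this.\<close>

definition hist :: "(nat + nat) list \<Rightarrow> nat \<Rightarrow> nat set \<Rightarrow> (nat \<Rightarrow> nat) \<Rightarrow> (nat \<Rightarrow> nat) \<Rightarrow> (nat \<Rightarrow> nat) \<Rightarrow>
    (nat \<Rightarrow> nat) \<Rightarrow> (nat \<Rightarrow> nat) \<Rightarrow> bool" where
  "hist ev J Sr is Js es eh q \<longleftrightarrow>
     length (popped ev) \<le> k \<and> popped ev = take (length (popped ev)) vs \<and>
     distinct (inserted ev) \<and> set (inserted ev) \<subseteq> {..<n} - set ps \<and>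
     (\<forall>a x u. a < length ev \<longrightarrow> ev ! a = Inl x \<longrightarrow> (u, x) \<in> set arcs \<longrightarrow> u \<in> set (popped (take a ev))) \<and>
     (\<forall>a x. a < length ev \<longrightarrow> ev ! a = Inl x \<longrightarrow> length (popped (take a ev)) < k) \<and>
     (\<forall>b v. b < length ev \<longrightarrow> ev ! b = Inr v \<longrightarrow> v \<notin> set ps \<longrightarrow> Inl v \<in> set (take b ev)) \<and>
     J \<le> length ps \<and> set (drop J ps) = set ps \<inter> set (popped ev) \<and>
     Sr \<subseteq> set (inserted ev) \<and> inj_on is Sr \<and> (\<forall>x. q x \<noteq> 0 \<longleftrightarrow> x \<in> Sr) \<and>
     (\<forall>x \<in> Sr - set (popped ev). searched_ok ev J is Js es q x) \<and>
     (\<forall>x \<in> set (popped ev) - set ps. x \<in> Sr \<and> popped_ok ev es eh x)"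

lemma histD:
  assumes "hist ev J Sr is Js es eh q"
  shows "length (popped ev) \<le> k" "popped ev = take (length (popped ev)) vs"
    "distinct (inserted ev)" "set (inserted ev) \<subseteq> {..<n} - set ps"
    "\<And>a x u. a < length ev \<Longrightarrow> ev ! a = Inl x \<Longrightarrow> (u, x) \<in> set arcs \<Longrightarrow> u \<in> set (popped (take a ev))"
    "\<And>a x. a < length ev \<Longrightarrow> ev ! a = Inl x \<Longrightarrow> length (popped (take a ev)) < k"
    "\<And>b v. b < length ev \<Longrightarrow> ev ! b = Inr v \<Longrightarrow> v \<notin> set ps \<Longrightarrow> Inl v \<in> set (take b ev)"
    "J \<le> length ps" "set (drop J ps) = set ps \<inter> set (popped ev)"
    "Sr \<subseteq> set (inserted ev)" "inj_on is Sr" "\<And>x. q x \<noteq> 0 \<longleftrightarrow> x \<in> Sr"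
    "\<And>x. x \<in> Sr \<Longrightarrow> x \<notin> set (popped ev) \<Longrightarrow> searched_ok ev J is Js es q x"
    "\<And>x. x \<in> set (popped ev) \<Longrightarrow> x \<notin> set ps \<Longrightarrow> x \<in> Sr \<and> popped_ok ev es eh x"
  using assms unfolding hist_def by auto

lemma histI:
  assumes "length (popped ev) \<le> k" "popped ev = take (length (popped ev)) vs"
    "distinct (inserted ev)" "set (inserted ev) \<subseteq> {..<n} - set ps"
    "\<And>a x u. a < length ev \<Longrightarrow> ev ! a = Inl x \<Longrightarrow> (u, x) \<in> set arcs \<Longrightarrow> u \<in> set (popped (take a ev))"
    "\<And>a x. a < length ev \<Longrightarrow> ev ! a = Inl x \<Longrightarrow> length (popped (take a ev)) < k"
    "\<And>b v. b < length ev \<Longrightarrow> ev ! b = Inr v \<Longrightarrow> v \<notin> set ps \<Longrightarrow> Inl v \<in> set (take b ev)"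
    "J \<le> length ps" "set (drop J ps) = set ps \<inter> set (popped ev)"
    "Sr \<subseteq> set (inserted ev)" "inj_on is Sr" "\<And>x. q x \<noteq> 0 \<longleftrightarrow> x \<in> Sr"
    "\<And>x. x \<in> Sr \<Longrightarrow> x \<notin> set (popped ev) \<Longrightarrow> searched_ok ev J is Js es q x"
    "\<And>x. x \<in> set (popped ev) \<Longrightarrow> x \<notin> set ps \<Longrightarrow> x \<in> Sr \<and> popped_ok ev es eh x"
  shows "hist ev J Sr is Js es eh q"
  unfolding hist_def
  by (intro conjI allI impI ballI; (elim DiffE)?; (rule assms, assumption+ | rule assms | (rule assms(14)[THEN conjunct1], assumption+) | (rule assms(14)[THEN conjunct2], assumption+)))

section \<open>Effect of events on the history\<close>

text \<open>The condition on \<open>J'\<close> expresses that path vertices leave only by being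
  output. It preserves \<open>Js x + is x \<le> J + i\<close>, that is, \<open>J\<close> falls by at
  most one per output since the search.\<close>

lemma searched_ok_step:
  assumes x: "searched_ok ev J is Js es q x" and J': "J' \<le> J" "J + length (popped ev) \<le> J' + length (popped (ev @ [e]))"
  shows "searched_ok (ev @ [e]) J' is Js es q x"
proof -
  note S = x[unfolded searched_ok_def Let_def]
  have l: "length (popped ev) \<le> length (popped (ev @ [e]))" "length (popped (ev @ [e])) \<le> Suc (length (popped ev))"
    by (cases e; simp)+
  obtain a where a: "a < length ev" "ev ! a = Inl x" "Suc (a + length (popped ev)) \<le> length ev + is x"
      "length (popped (take a ev)) \<le> is x"
    using S by blast
  have "\<exists>a < length (ev @ [e]). (ev @ [e]) ! a = Inl x \<and>
      Suc (a + length (popped (ev @ [e]))) \<le> length (ev @ [e]) + is x \<and> length (popped (take a (ev @ [e]))) \<le> is x"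
  proof (intro exI[of _ a] conjI)
    show "length (popped (take a (ev @ [e]))) \<le> is x" using a by simp
    show "Suc (a + length (popped (ev @ [e]))) \<le> length (ev @ [e]) + is x" using a(3) l(2) by simp
  qed (use a in \<open>auto simp: nth_append\<close>)
  moreover have "Js x + is x \<le> J' + length (popped (ev @ [e]))" "J' \<le> Js x" "is x \<le> length (popped (ev @ [e]))"
    using S J' l by linarith+
  ultimately show ?thesis using S unfolding searched_ok_def Let_def by blast
qed

lemma popped_ok_step: "popped_ok ev es eh x \<Longrightarrow> popped_ok (ev @ [e]) es eh x"
  unfolding popped_ok_def
proof (elim exE conjE)
  fix a b assume "a < length ev" "b < length ev" "ev ! a = Inl x" "ev ! b = Inr x"
    "2 ^ es x \<le> Suc (b - a)" "2 ^ eh x \<le> Suc (b - a)"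
  then show "\<exists>a b. a < length (ev @ [e]) \<and> b < length (ev @ [e]) \<and> (ev @ [e]) ! a = Inl x \<and> (ev @ [e]) ! b = Inr x \<and>
      2 ^ es x \<le> Suc (b - a) \<and> 2 ^ eh x \<le> Suc (b - a)"
    by (intro exI[of _ a] exI[of _ b]) (auto simp: nth_append)
qed

lemma hist_insert:
  assumes h: "hist ev J Sr is Js es eh q" and w: "w < n" "w \<notin> set ps" "w \<notin> set (inserted ev)"
    and pr: "\<And>u. (u, w) \<in> set arcs \<Longrightarrow> u \<in> set (popped ev)" and k: "length (popped ev) < k"
  shows "hist (ev @ [Inl w]) J Sr is Js es eh q"
proof -
  note D = histD[OF h]
  show ?thesis
  proof (rule histI)
    show "u \<in> set (popped (take a (ev @ [Inl w])))"
      if "a < length (ev @ [Inl w])" "(ev @ [Inl w]) ! a = Inl x" "(u, x) \<in> set arcs" for a x u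
      using that D(5)[of a x u] pr by (cases "a < length ev") (auto simp: nth_append)
    show "length (popped (take a (ev @ [Inl w]))) < k"
      if "a < length (ev @ [Inl w])" "(ev @ [Inl w]) ! a = Inl x" for a x
      using that D(6)[of a x] k by (cases "a < length ev") (auto simp: nth_append)
    show "Inl v \<in> set (take b (ev @ [Inl w]))"
      if "b < length (ev @ [Inl w])" "(ev @ [Inl w]) ! b = Inr v" "v \<notin> set ps" for b v
      using that D(7)[of b v] by (cases "b < length ev") (auto simp: nth_append)
    show "searched_ok (ev @ [Inl w]) J is Js es q x" if "x \<in> Sr" "x \<notin> set (popped (ev @ [Inl w]))" for x
      using that D(13)[of x] by (intro searched_ok_step[of ev J]) auto
    show "x \<in> Sr \<and> popped_ok (ev @ [Inl w]) es eh x" if "x \<in> set (popped (ev @ [Inl w]))" "x \<notin> set ps" for x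
      using that D(14)[of x] popped_ok_step by auto
  qed (use D w in auto)
qed

lemma hist_pop:
  assumes h: "hist ev J Sr is Js es eh q" and i: "i = length (popped ev)" "i < k"
    and J': "J' \<le> J" "J \<le> Suc J'" "set (drop J' ps) = set ps \<inter> insert (vs ! i) (set (popped ev))"
    and v: "vs ! i \<notin> set ps \<Longrightarrow> vs ! i \<in> Sr \<and> popped_ok (ev @ [Inr (vs ! i)]) es eh (vs ! i)"
  shows "hist (ev @ [Inr (vs ! i)]) J' Sr is Js es eh q"
proof -
  note D = histD[OF h]
  have len: "length vs = k" using vs by (simp add: smallest_sorted_def)
  let ?v = "vs ! i"
  show ?thesis
  proof (rule histI)
    show "popped (ev @ [Inr ?v]) = take (length (popped (ev @ [Inr ?v]))) vs"
      using D(2) i len by (simp add: take_Suc_conv_app_nth)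
    show "u \<in> set (popped (take a (ev @ [Inr ?v])))"
      if "a < length (ev @ [Inr ?v])" "(ev @ [Inr ?v]) ! a = Inl x" "(u, x) \<in> set arcs" for a x u
      using that D(5)[of a x u] by (cases "a < length ev") (auto simp: nth_append)
    show "length (popped (take a (ev @ [Inr ?v]))) < k"
      if "a < length (ev @ [Inr ?v])" "(ev @ [Inr ?v]) ! a = Inl x" for a x
      using that D(6)[of a x] by (cases "a < length ev") (auto simp: nth_append)
    show "Inl w \<in> set (take b (ev @ [Inr ?v]))"
      if "b < length (ev @ [Inr ?v])" "(ev @ [Inr ?v]) ! b = Inr w" "w \<notin> set ps" for b w
    proof (cases "b < length ev")
      case True
      then show ?thesis using that D(7)[of b w] by (auto simp: nth_append)
    next
      case False
      then have "b = length ev" "w = ?v" using that by (auto simp: nth_append)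
      moreover have "Inl ?v \<in> set ev" using v that(3) \<open>w = ?v\<close> D(10) by (auto simp: set_inserted)
      ultimately show ?thesis by simp
    qed
    show "searched_ok (ev @ [Inr ?v]) J' is Js es q x" if "x \<in> Sr" "x \<notin> set (popped (ev @ [Inr ?v]))" for x
      using that D(13)[of x] J' by (intro searched_ok_step[of ev J]) auto
    show "x \<in> Sr \<and> popped_ok (ev @ [Inr ?v]) es eh x" if "x \<in> set (popped (ev @ [Inr ?v]))" "x \<notin> set ps" for x
      using that D(14)[of x] popped_ok_step v by auto
  qed (use D i J' in auto)
qed

text \<open>All predecessors of the next output have been output. So off the path it has already
  been inserted, and on the path it is the first vertex to come, because that one is smaller than
  the rest of the path.\<close>

lemma hist_next:
  assumes h: "hist ev J Sr is Js es eh q" and i: "i = length (popped ev)" "i < k"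
    and all: "\<forall>w < n. w \<notin> set ps \<longrightarrow> (\<forall>u. (u, w) \<in> set arcs \<longrightarrow> u \<in> set (popped ev)) \<longrightarrow> w \<in> set (inserted ev)"
  shows "vs ! i \<in> set ps \<Longrightarrow> 0 < J \<and> vs ! i = ps ! (J - 1)"
    and "vs ! i \<notin> set ps \<Longrightarrow> vs ! i \<in> set (inserted ev) - set (popped ev)"
    and "0 < J \<Longrightarrow> ps ! (J - 1) \<notin> set (popped ev) \<and> ps ! (J - 1) < n"
proof -
  note D = histD[OF h]
  have pe: "popped ev = take i vs" using D(2) i by simp
  have unp: "ps ! j \<notin> set (popped ev)" if "j < J" for j
  proof
    assume "ps ! j \<in> set (popped ev)"
    then have "ps ! j \<in> set (drop J ps)" using D(8,9) that by auto
    then obtain l where "J \<le> l" "l < length ps" "ps ! j = ps ! l" 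
      by (auto simp: in_set_conv_nth) (metis le_add1 less_diff_conv add.commute)
    then show False using distinct_path that by (simp add: nth_eq_iff_index_eq)
  qed
  show 3: "ps ! (J - 1) \<notin> set (popped ev) \<and> ps ! (J - 1) < n" if "0 < J"
  proof -
    have "J - 1 < length ps" using that D(8) by simp
    then have "ps ! (J - 1) \<in> set ps" by simp
    then show ?thesis using unp[of "J - 1"] that path(2) by auto
  qed
  show "0 < J \<and> vs ! i = ps ! (J - 1)" if v: "vs ! i \<in> set ps"
  proof -
    obtain j where j: "j < length ps" "vs ! i = ps ! j" using v by (auto simp: in_set_conv_nth)
    have "j < J"
    proof (rule ccontr)
      assume "\<not> j < J"
      then have "ps ! j \<in> set (drop J ps)" using j by (auto simp: in_set_conv_nth intro!: exI[of _ "j - J"])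
      then show False using D(9) pe vs_fresh[OF i(2)] j by auto
    qed
    moreover have "j = J - 1"
    proof (rule ccontr)
      assume "j \<noteq> J - 1"
      then have "j < J - 1" "J - 1 < length ps" using \<open>j < J\<close> D(8) by auto
      then have "(ps ! (J - 1), vs ! i) \<in> L" using path_sorted j by simp
      moreover have "ps ! (J - 1) \<noteq> vs ! i" using calculation irr by metis
      ultimately show False using vs_least[OF i(2), of "ps ! (J - 1)"] 3 \<open>j < J\<close> asym pe by auto
    qed
    ultimately show ?thesis using j by simp
  qed
  show "vs ! i \<in> set (inserted ev) - set (popped ev)" if "vs ! i \<notin> set ps"
    using all vs_preds[OF i(2)] vs_fresh[OF i(2)] that pe by auto
qed

text \<open>The result of a search is a fixed index of the path and stays valid while
  \<open>J\<close> falls. So after one search, comparing indices replaces comparing items at all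
  later outputs.\<close>

lemma choose:
  assumes h: "hist ev J Sr is Js es eh q" and i: "i = length (popped ev)" "i < k"
    and all: "\<forall>w < n. w \<notin> set ps \<longrightarrow> (\<forall>u. (u, w) \<in> set arcs \<longrightarrow> u \<in> set (popped ev)) \<longrightarrow> w \<in> set (inserted ev)"
    and y: "y \<in> Sr" "y \<in> set (inserted ev) - set (popped ev)"
      "\<And>z. z \<in> set (inserted ev) - set (popped ev) \<Longrightarrow> z = y \<or> (y, z) \<in> L"
  shows "q y - 1 < J \<Longrightarrow> vs ! i = ps ! (J - 1)" and "J \<le> q y - 1 \<Longrightarrow> vs ! i = y"
proof -
  note D = histD[OF h]
  note N = hist_next[OF h i all]
  have pe: "popped ev = take i vs" using D(2) i by simp
  have yn: "y < n" "y \<notin> set ps" using y(2) D(4) by auto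
  have S: "searched_ok ev J is Js es q y" using D(13) y by auto
  note S = S[unfolded searched_ok_def Let_def]
  have iff: "(ps ! (J - 1), y) \<in> L \<longleftrightarrow> q y - 1 \<le> J - 1" if "0 < J"
  proof -
    \<comment> \<open>Since the search, \<open>J\<close> has fallen by at most one per output; hence
      before the k-th output the index \<open>J - 1\<close> still lies in the part of the path to
      which the search was restricted.\<close>
    have "J - 1 < Js y" "Js y + is y \<le> (J - 1) + k" using S that i by auto
    then show ?thesis using S by blast
  qed
  show "vs ! i = ps ! (J - 1)" if "q y - 1 < J"
  proof (cases "vs ! i \<in> set ps")
    case True
    then show ?thesis using N(1) by blast
  next
    case False
    have J: "0 < J" using that by simp
    then have 1: "(ps ! (J - 1), y) \<in> L" using iff that by auto
    have 2: "vs ! i = y \<or> (y, vs ! i) \<in> L" using y(3) N(2)[OF False] by blast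
    have "ps ! (J - 1) \<noteq> vs ! i" using 1 2 asym irr by metis
    then have "(vs ! i, ps ! (J - 1)) \<in> L" using vs_least[OF i(2)] N(3)[OF J] pe by auto
    then show ?thesis using 1 2 tr asym by metis
  qed
  show "vs ! i = y" if "J \<le> q y - 1"
  proof (rule ccontr)
    assume ne: "vs ! i \<noteq> y"
    then have 1: "(vs ! i, y) \<in> L" using vs_least[OF i(2), of y] y(2) yn pe by auto
    show False
    proof (cases "vs ! i \<in> set ps")
      case True
      then have "0 < J" "vs ! i = ps ! (J - 1)" using N(1) by auto
      then have "q y - 1 \<le> J - 1" using iff 1 by simp
      then show False using that \<open>0 < J\<close> by simp
    next
      case False
      then show False using y(3)[of "vs ! i"] N(2) ne 1 asym by blast
    qed
  qed
qed

lemma hist_pop_path: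
  assumes h: "hist ev J Sr is Js es eh q" and i: "i = length (popped ev)" "i < k"
    and J: "0 < J" "vs ! i = ps ! (J - 1)"
  shows "hist (ev @ [Inr (vs ! i)]) (J - 1) Sr is Js es eh q"
proof (rule hist_pop[OF h i])
  note D = histD[OF h]
  have lt: "J - 1 < length ps" using J D(8) by simp
  then have "drop (J - 1) ps = ps ! (J - 1) # drop J ps" using J Cons_nth_drop_Suc[of "J - 1" ps] by simp
  moreover have mem: "ps ! (J - 1) \<in> set ps" using lt by simp
  ultimately show "set (drop (J - 1) ps) = set ps \<inter> insert (vs ! i) (set (popped ev))" using D(9) J by auto
  show "vs ! i \<in> Sr \<and> popped_ok (ev @ [Inr (vs ! i)]) es eh (vs ! i)" if "vs ! i \<notin> set ps"
    using that mem J by simp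
qed auto

text \<open>When \<open>y\<close> is output, the \<open>Js y - (q y - 1)\<close> path vertices that
  its search found smaller have been output in the meantime, and the items \<open>bs\<close> were
  inserted after it. Both numbers are bounded by the length of the interval of \<open>y\<close>,
  which thus pays for the search and for the deletion.\<close>

lemma hist_pop_heap:
  assumes h: "hist ev J Sr is Js es eh q" and i: "i = length (popped ev)" "i < k"
    and y: "vs ! i = y" "y \<in> Sr" "y \<in> set (inserted ev)" and J: "J \<le> q y - 1"
    and e: "inserted ev = as @ y # bs" "2 ^ e \<le> length bs + 1"
  shows "hist (ev @ [Inr (vs ! i)]) J Sr is Js es (eh(y := e)) q"
proof -
  note D = histD[OF h]
  have yp: "y \<notin> set (popped ev)" using vs_fresh[OF i(2)] y(1) D(2) i by simp
  have h': "hist ev J Sr is Js es (eh(y := e)) q"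
  proof (rule histI)
    show "x \<in> Sr \<and> popped_ok ev es (eh(y := e)) x" if "x \<in> set (popped ev)" "x \<notin> set ps" for x
      using D(14)[OF that] that yp by (auto simp: popped_ok_def)
  qed (use D in auto)
  have S: "searched_ok ev J is Js es q y" using D(13) y yp by auto
  note S = S[unfolded searched_ok_def Let_def]
  obtain a where a: "a < length ev" "ev ! a = Inl y" "Suc (a + length (popped ev)) \<le> length ev + is y"
    using S by blast
  have "ev = take a ev @ Inl y # drop (Suc a) ev" using a id_take_nth_drop[of a ev] by simp
  then have "inserted ev = inserted (take a ev) @ y # inserted (drop (Suc a) ev)"
    by (metis history_simps(2,4))
  then have "bs = inserted (drop (Suc a) ev)"
    using e(1) D(3) by (metis append_Cons_eq_iff distinct_append not_distinct_conv_prefix append_eq_append_conv2 distinct.simps(2) list.inject in_set_conv_decomp)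
  then have lb: "length bs \<le> length ev - Suc a" using length_history[of "drop (Suc a) ev"] by simp
  show ?thesis
  proof (rule hist_pop[OF h' i])
    show "set (drop J ps) = set ps \<inter> insert (vs ! i) (set (popped ev))"
      using D(4,9) y by auto
    have "2 ^ es y \<le> Suc (Js y - (q y - 1))" using S by blast
    also have "\<dots> \<le> Suc (length ev - a)" using S J a(3) by linarith
    finally have "2 ^ es y \<le> Suc (length ev - a)" .
    moreover have "2 ^ e \<le> Suc (length ev - a)" using e(2) lb by linarith
    ultimately have "popped_ok (ev @ [Inr y]) es (eh(y := e)) y"
      unfolding popped_ok_def using a
      by (intro exI[of _ a] exI[of _ "length ev"]) (auto simp: nth_append)
    then show "vs ! i \<in> Sr \<and> popped_ok (ev @ [Inr (vs ! i)]) es (eh(y := e)) (vs ! i)"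
      using y by simp
  qed auto
qed

text \<open>\<open>t\<close> counts the path vertices to come that are smaller than
  \<open>y\<close>, cut off at the number \<open>k - i\<close> of outputs to come; path vertices
  beyond that cannot be among the outputs.\<close>

lemma hist_search:
  assumes h: "hist ev J Sr is Js es eh q" and i: "i = length (popped ev)" "i < k"
    and y: "y \<notin> Sr" "y \<in> set (inserted ev) - set (popped ev)" and lt: "\<And>x. x \<in> Sr \<Longrightarrow> is x < i"
    and t: "t \<le> J" "t \<le> k - i" "2 ^ e \<le> t + 1"
      "\<And>j. j < J \<Longrightarrow> J \<le> j + (k - i) \<Longrightarrow> (ps ! j, y) \<in> L \<longleftrightarrow> J - t \<le> j"
  shows "hist ev J (insert y Sr) (is(y := i)) (Js(y := J)) (es(y := e)) eh (q(y := Suc (J - t)))"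
proof -
  note D = histD[OF h]
  show ?thesis
  proof (rule histI)
    show "insert y Sr \<subseteq> set (inserted ev)" using D(10) y by auto
    show "inj_on (is(y := i)) (insert y Sr)"
      using D(11) y lt by (auto simp: inj_on_def)
    show "(q(y := Suc (J - t))) x \<noteq> 0 \<longleftrightarrow> x \<in> insert y Sr" for x using D(12) by auto
    show "searched_ok ev J (is(y := i)) (Js(y := J)) (es(y := e)) (q(y := Suc (J - t))) x"
      if "x \<in> insert y Sr" "x \<notin> set (popped ev)" for x
    proof (cases "x = y")
      case True
      obtain a where a: "a < length ev" "ev ! a = Inl y" using y(2) by (auto simp: set_inserted in_set_conv_nth)
      have "length (popped (take a ev)) \<le> i"
        using i length_append[of "popped (take a ev)" "popped (drop a ev)"] history_simps(8)[of "take a ev" "drop a ev"] by simp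
      then have "\<exists>a < length ev. ev ! a = Inl y \<and> Suc (a + i) \<le> length ev + i \<and> length (popped (take a ev)) \<le> i"
        using a by (intro exI[of _ a]) auto
      moreover have "J + i \<le> (J - t) + k" using t i by linarith
      moreover have "2 ^ e \<le> Suc (J - (J - t))" using t by simp
      moreover have "(ps ! j, y) \<in> L \<longleftrightarrow> J - t \<le> j" if "j < J" "J + i \<le> j + k" for j
        using t(4)[of j] that i by linarith
      ultimately show ?thesis unfolding searched_ok_def Let_def
        using True D(8) i by auto
    next
      case False
      then have "searched_ok ev J is Js es q x" using D(13) that by auto
      then show ?thesis using False by (simp add: searched_ok_def)
    qed
    show "x \<in> insert y Sr \<and> popped_ok ev (es(y := e)) eh x" if "x \<in> set (popped ev)" "x \<notin> set ps" for x
      using D(14)[OF that] that y(2) by (auto simp: popped_ok_def)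
  qed (use D in auto)
qed

lemma hist_final:
  assumes h: "hist ev J Sr is Js es eh q" and p: "popped ev = vs" and k: "0 < k" "k \<le> n"
    and lt: "\<And>x. x \<in> Sr \<Longrightarrow> is x < k"
    and off: "2 ^ card (set vs - set ps) \<le> card (output_seqs {..<n} (set arcs) k) ^ 2"
  shows "length (inserted ev) \<le> 3 * OPT {..<n} (set arcs) k"
    and "sum es Sr \<le> 18 * OPT {..<n} (set arcs) k + 1"
    and "sum eh (set vs - set ps) \<le> 18 * OPT {..<n} (set arcs) k + 1"
proof -
  note D = histD[OF h]
  have fin: "finite {..<n}" "k \<le> card {..<n}" using k by simp_all
  have len: "length vs = k" using vs by (simp add: smallest_sorted_def)
  have lp: "length (popped ev) = k" using p len by simp
  note C = L fin(1) k(1) fin(2) vs p off D(3) D(4) D(5) D(6) D(7)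
  show "length (inserted ev) \<le> 3 * OPT {..<n} (set arcs) k"
    by (rule inserted_le[OF C])
  define Y where "Y = Sr - set vs"
  have Sr: "Sr = (set vs - set ps) \<union> Y"
    using D(4,10,14) p by (auto simp: Y_def)
  have S: "searched_ok ev J is Js es q y" if "y \<in> Y" for y using D(13) that p by (auto simp: Y_def)
  have "sum es ((set vs - set ps) \<union> Y) \<le> 18 * OPT {..<n} (set arcs) k + 1"
  proof (rule sum_costs_le[OF C])
    show "Y \<subseteq> set (inserted ev) - set vs" using D(10) by (auto simp: Y_def)
    show "inj_on is Y" using D(11) by (rule inj_on_subset) (auto simp: Y_def)
    show "is y < k" if "y \<in> Y" for y using lt that by (auto simp: Y_def)
    show "u \<in> set (take (is y) vs)" if y: "y \<in> Y" "(u, y) \<in> set arcs" for u y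
    proof -
      obtain a where a: "a < length ev" "ev ! a = Inl y" "length (popped (take a ev)) \<le> is y"
        using S[OF y(1)] unfolding searched_ok_def Let_def by blast
      have "popped (take a ev) @ popped (drop a ev) = vs"
        using p by (metis append_take_drop_id history_simps(8))
      then have "popped (take a ev) = take (length (popped (take a ev))) vs" by (metis append_eq_conv_conj)
      then have "set (popped (take a ev)) \<subseteq> set (take (is y) vs)" using a(3) by (metis set_take_subset_set_take)
      then show ?thesis using D(5)[OF a(1,2) y(2)] by blast
    qed
    show "\<exists>a b. a < length ev \<and> b < length ev \<and> ev ! a = Inl x \<and> ev ! b = Inr x \<and> 2 ^ es x \<le> Suc (b - a)"
      if "x \<in> set vs - set ps" for x
      using D(14)[of x] that p unfolding popped_ok_def by blast
    show "\<exists>a < length ev. ev ! a = Inl y \<and> 2 ^ es y \<le> Suc (length ev - a)" if "y \<in> Y" for y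
    proof -
      note T = S[OF that, unfolded searched_ok_def Let_def]
      obtain a where a: "a < length ev" "ev ! a = Inl y" "Suc (a + length (popped ev)) \<le> length ev + is y"
        using T by blast
      have "2 ^ es y \<le> Suc (Js y - (q y - 1))" using T by blast
      \<comment> \<open>For an item that is never output, the cutoff of its search at
        \<open>k - is y\<close> path vertices takes the place of the missing output: that many
        outputs follow the search.\<close>
      also have "\<dots> \<le> Suc (length ev - a)" using T a(3) lp by linarith
      finally show ?thesis using a by blast
    qed
  qed
  then show "sum es Sr \<le> 18 * OPT {..<n} (set arcs) k + 1" using Sr by simp
  have "sum eh ((set vs - set ps) \<union> {}) \<le> 18 * OPT {..<n} (set arcs) k + 1"
  proof (rule sum_costs_le[OF C])
    show "\<exists>a b. a < length ev \<and> b < length ev \<and> ev ! a = Inl x \<and> ev ! b = Inr x \<and> 2 ^ eh x \<le> Suc (b - a)"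
      if "x \<in> set vs - set ps" for x
      using D(14)[of x] that p unfolding popped_ok_def by blast
  qed auto
  then show "sum eh (set vs - set ps) \<le> 18 * OPT {..<n} (set arcs) k + 1" by simp
qed

end

subsection \<open>Searching the path\<close>

abbreviation (input) "rR \<equiv> 27 :: nat"
abbreviation (input) "rL \<equiv> 28 :: nat"
abbreviation (input) "rG \<equiv> 29 :: nat"
abbreviation (input) "rS \<equiv> 30 :: nat"
abbreviation (input) "rEX \<equiv> 31 :: nat"
abbreviation (input) "rLIM \<equiv> 32 :: nat"
abbreviation (input) "rK2 \<equiv> 33 :: nat"
abbreviation (input) "rB \<equiv> 34 :: nat"
abbreviation (input) "rC2 \<equiv> 35 :: nat"
abbreviation (input) "rO \<equiv> 36 :: nat"
abbreviation (input) "rYY \<equiv> 37 :: nat"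

abbreviation (input) "aQ \<equiv> 14 :: nat"
abbreviation (input) "aPW \<equiv> 15 :: nat"

lemma wp_Seq_fun: "wp L B (c ;; d) Q = wp L B c (wp L B d Q)"
  by (rule ext) (rule wp_Seq)

text \<open>\<open>rR\<close> counts the outputs to come, \<open>rO\<close> those made, and \<open>rJ\<close> the path vertices to come. The search
  determines how many of the last path vertices to come first are smaller than item \<open>rYY\<close>: \<open>rG\<close> of them
  are known to be, \<open>rS\<close> is the next increment, and \<open>aPW\<close> remembers the powers of two for the way back.\<close>

definition test_cmd :: cmd where
  "test_cmd = Plus rK2 rG rS ;; Minus rA rK2 rLIM ;;
     Cond rA (Set rB 0) (Minus rA rJ rK2 ;; Get rA aPATH rA ;; Less rB rA rYY)"

definition gallop_body :: cmd where
  "gallop_body = Put aPW rEX rS ;; Plus rEX rEX rONE ;; Plus rG rG rS ;; Plus rS rS rS ;; test_cmd"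

definition bisect_body :: cmd where
  "bisect_body = Minus rEX rEX rONE ;; Get rS aPW rEX ;; test_cmd ;; Cond rB (Plus rG rG rS) (Set rA 0)"

definition search_cmd :: cmd where
  "search_cmd = Minus rA rJ rR ;; Minus rLIM rJ rA ;; Set rG 0 ;; Mov rS rONE ;; Set rEX 0 ;; test_cmd ;;
     While rB gallop_body ;; While rEX bisect_body ;;
     Minus rA rJ rG ;; Plus rC2 rA rONE ;; Put aQ rYY rC2"

context
  fixes L :: "nat rel" and J lim y t :: nat and p :: "nat \<Rightarrow> nat"
  assumes lim: "lim \<le> J" and t: "t \<le> lim"
    and less: "\<And>j. j < t \<Longrightarrow> (p (J - Suc j), y) \<in> L" "t < lim \<Longrightarrow> (p (J - Suc t), y) \<notin> L"
    and mono: "\<And>j. t \<le> j \<Longrightarrow> j < lim \<Longrightarrow> (p (J - Suc j), y) \<notin> L"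
begin

definition search_state :: "state \<Rightarrow> bool" where
  "search_state s \<longleftrightarrow> rg s rJ = J \<and> rg s rLIM = lim \<and> rg s rYY = y \<and> rg s rONE = 1 \<and> (\<forall>j < J. ar s aPATH j = p j)"

abbreviation (input) "search_regs \<equiv> {rA, rK2, rB, rG, rS, rEX}"

lemma search_state_frame:
  "search_state s \<Longrightarrow> frame search_regs {aPW} s s' \<Longrightarrow> search_state s'"
  by (simp add: search_state_def frame_def)

text \<open>Positions beyond \<open>lim\<close> count as not smaller and are not compared, so that
  \<open>t\<close> is the only threshold the search has to find.\<close>

lemma test_cmd_ok:
  assumes s: "search_state s" and g: "g = rg s rG + rg s rS" "0 < g"
    and Q: "\<And>s'. frame {rA, rK2, rB} {} s s' \<Longrightarrow> rg s' rB = of_bool (g \<le> t) \<Longrightarrow>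
      tm s' \<le> tm s + 14 \<Longrightarrow> cm s' \<le> cm s + 1 \<Longrightarrow> Q s'"
  shows "wp L B test_cmd Q s"
proof (cases "g \<le> lim")
  case False
  then have "g - lim \<noteq> 0" "\<not> g \<le> t" using t by auto
  then show ?thesis
    using s g(1) unfolding test_cmd_def
    by (auto simp: exec_simps search_state_def frame_def intro!: Q)
next
  case True
  then have lt: "J - g < J" "g - lim = 0" using g(2) lim by auto
  have "(p (J - g), y) \<in> L \<longleftrightarrow> g \<le> t"
  proof
    assume a: "(p (J - g), y) \<in> L"
    show "g \<le> t"
    proof (rule ccontr)
      assume "\<not> g \<le> t"
      then have "t \<le> g - 1" "g - 1 < lim" using True g(2) by linarith+
      then show False using mono[of "g - 1"] a g(2) by simp
    qed
  next
    assume "g \<le> t"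
    then show "(p (J - g), y) \<in> L" using less(1)[of "g - 1"] g(2) by simp
  qed
  moreover have "ar s aPATH (J - g) = p (J - g)" using s lt by (simp add: search_state_def)
  moreover have "g \<le> lim" by (rule True)
  ultimately show ?thesis
    using s g(1) lt unfolding test_cmd_def
    by (auto simp: exec_simps search_state_def frame_def intro!: Q)
qed

text \<open>\<open>rG\<close> is \<open>2 ^ e - 1\<close> throughout, so the next increment is a
  mere doubling, and the number of rounds is logarithmic in \<open>t\<close> instead of
  \<open>lim\<close>.\<close>

lemma gallop_ok:
  assumes "search_state s" "rg s rEX = e" "rg s rS = 2 ^ e" "Suc (rg s rG) = 2 ^ e" "2 ^ e \<le> Suc t"
    and "\<And>i. i < e \<Longrightarrow> ar s aPW i = 2 ^ i" "rg s rB = of_bool (rg s rG + rg s rS \<le> t)"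
    and "\<And>s' e'. frame search_regs {aPW} s s' \<Longrightarrow> rg s' rEX = e' \<Longrightarrow> Suc (rg s' rG) = 2 ^ e' \<Longrightarrow>
      2 ^ e' \<le> Suc t \<Longrightarrow> t < rg s' rG + 2 ^ e' \<Longrightarrow> (\<And>i. i < e' \<Longrightarrow> ar s' aPW i = 2 ^ i) \<Longrightarrow>
      tm s' + 27 * e \<le> tm s + 27 * e' + 1 \<Longrightarrow> cm s' + e \<le> cm s + e' \<Longrightarrow> Q s'"
  shows "wp L B (While rB gallop_body) Q s"
  using assms
proof (induction "Suc t - 2 ^ e" arbitrary: s e rule: less_induct)
  case less
  show ?case
  proof (cases "rg s rG + rg s rS \<le> t")
    case False
    then have "Q (tick 1 s)" using less.prems by (intro less.prems(8)) auto
    then show ?thesis using False less.prems(7) by (subst wp_While_iff) simp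
  next
    case True
    have two: "2 ^ Suc e = (2 ^ e + 2 ^ e :: nat)" by simp
    define s1 where "s1 = s\<lparr>rg := (rg s)(rEX := Suc e, rG := rg s rG + 2 ^ e, rS := 2 ^ e + 2 ^ e),
      ar := (ar s)(aPW := (ar s aPW)(e := 2 ^ e)), tm := tm s + 12\<rparr>"
    have fr1: "frame search_regs {aPW} s s1" by (simp add: frame_def s1_def)
    have "wp L B test_cmd (\<lambda>s'. wp L B (While rB gallop_body) Q (tick 1 s')) s1"
    proof (rule test_cmd_ok[OF search_state_frame[OF less.prems(1) fr1] refl])
      show "0 < rg s1 rG + rg s1 rS" by (simp add: s1_def)
    next
      fix s2 assume a: "frame {rA, rK2, rB} {} s1 s2" "rg s2 rB = of_bool (rg s1 rG + rg s1 rS \<le> t)"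
        "tm s2 \<le> tm s1 + 14" "cm s2 \<le> cm s1 + 1"
      have fr2: "frame search_regs {aPW} s (tick 1 s2)" using a(1) fr1 by (simp add: frame_def)
      have g2: "rg s2 rEX = Suc e" "rg s2 rS = 2 ^ Suc e" "rg s2 rG = rg s rG + 2 ^ e"
        "ar s2 aPW = (ar s aPW)(e := 2 ^ e)" "rg s1 rG = rg s2 rG" "rg s1 rS = rg s2 rS"
        using a(1) by (simp_all add: frame_def s1_def)
      have le: "2 ^ Suc e \<le> Suc t" using True less.prems(3,4) two by linarith
      show "wp L B (While rB gallop_body) Q (tick 1 s2)"
      proof (rule less.hyps[where e = "Suc e"])
        show "Suc t - 2 ^ Suc e < Suc t - 2 ^ e" 
        proof -
          have "(0 :: nat) < 2 ^ e" by simp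
          then show ?thesis using le two by linarith
        qed
        show "search_state (tick 1 s2)" by (rule search_state_frame[OF less.prems(1) fr2])
        show "rg (tick 1 s2) rEX = Suc e" "rg (tick 1 s2) rS = 2 ^ Suc e" using g2 by simp_all
        show "Suc (rg (tick 1 s2) rG) = 2 ^ Suc e" using g2 less.prems(4) by simp
        show "2 ^ Suc e \<le> Suc t" by (rule le)
        show "ar (tick 1 s2) aPW i = 2 ^ i" if "i < Suc e" for i
          using g2(4) less.prems(6) that by (auto simp: less_Suc_eq)
        show "rg (tick 1 s2) rB = of_bool (rg (tick 1 s2) rG + rg (tick 1 s2) rS \<le> t)"
          using a(2) g2(5,6) by simp
      next
        fix s' e' assume b: "frame search_regs {aPW} (tick 1 s2) s'" "rg s' rEX = e'" "Suc (rg s' rG) = 2 ^ e'"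
          "2 ^ e' \<le> Suc t" "t < rg s' rG + 2 ^ e'" "\<And>i. i < e' \<Longrightarrow> ar s' aPW i = 2 ^ i"
          "tm s' + 27 * Suc e \<le> tm (tick 1 s2) + 27 * e' + 1" "cm s' + Suc e \<le> cm (tick 1 s2) + e'"
        show "Q s'"
        proof (rule less.prems(8)[OF _ b(2-6)])
          show "frame search_regs {aPW} s s'" using b(1) fr2 by (simp add: frame_def)
          show "tm s' + 27 * e \<le> tm s + 27 * e' + 1" using b(7) a(3) by (simp add: s1_def)
          show "cm s' + e \<le> cm s + e'" using b(8) a(4) by (simp add: s1_def)
        qed
      qed
    qed
    moreover have "wp L B gallop_body (\<lambda>s'. wp L B (While rB gallop_body) Q (tick 1 s')) (tick 1 s) =
        wp L B test_cmd (\<lambda>s'. wp L B (While rB gallop_body) Q (tick 1 s')) s1"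
      using less.prems(1,2,3) unfolding search_state_def
      by (subst (1) gallop_body_def) (simp add: wp_Seq wp_basic put_rg_def tick_def s1_def two fun_upd_twist add.commute)
    ultimately show ?thesis using True less.prems(7) by (subst wp_While_iff) simp
  qed
qed

text \<open>The powers stored on the way up replace halving, for which the machine has no
  instruction.\<close>

lemma bisect_ok:
  assumes "search_state s" "rg s rEX = e" "rg s rG \<le> t" "t < rg s rG + 2 ^ e"
    and "\<And>i. i < e \<Longrightarrow> ar s aPW i = 2 ^ i"
    and "\<And>s'. frame search_regs {} s s' \<Longrightarrow> rg s' rG = t \<Longrightarrow> tm s' \<le> tm s + 30 * e + 1 \<Longrightarrow> cm s' \<le> cm s + e \<Longrightarrow> Q s'"
  shows "wp L B (While rEX bisect_body) Q s"
  using assms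
proof (induction e arbitrary: s)
  case 0
  then have "Q (tick 1 s)" by (intro 0(6)) auto
  then show ?case using 0 by (subst wp_While_iff) simp
next
  case (Suc e)
  define s1 where "s1 = s\<lparr>rg := (rg s)(rEX := e, rS := 2 ^ e), tm := tm s + 10\<rparr>"
  have fr1: "frame search_regs {aPW} s s1" by (simp add: frame_def s1_def)
  have "wp L B test_cmd (\<lambda>s'. wp L B (Cond rB (Plus rG rG rS) (Set rA 0)) (\<lambda>s'. wp L B (While rEX bisect_body) Q (tick 1 s')) s') s1"
  proof (rule test_cmd_ok[OF search_state_frame[OF Suc.prems(1) fr1] refl])
    show "0 < rg s1 rG + rg s1 rS" by (simp add: s1_def)
  next
    fix s2 assume a: "frame {rA, rK2, rB} {} s1 s2" "rg s2 rB = of_bool (rg s1 rG + rg s1 rS \<le> t)"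
      "tm s2 \<le> tm s1 + 14" "cm s2 \<le> cm s1 + 1"
    have g2: "rg s2 rEX = e" "rg s2 rS = 2 ^ e" "rg s2 rG = rg s rG" "ar s2 aPW = ar s aPW"
      "rg s2 rB = of_bool (rg s rG + 2 ^ e \<le> t)"
      using a(1,2) by (simp_all add: frame_def s1_def)
    have go: "wp L B (While rEX bisect_body) Q s3" if s3: "frame search_regs {} s2 s3" "rg s3 rEX = e"
      "rg s3 rG = (if rg s rG + 2 ^ e \<le> t then rg s rG + 2 ^ e else rg s rG)" "tm s3 \<le> tm s2 + 4" "cm s3 = cm s2" for s3
    proof (rule Suc.IH)
      have fr3: "frame search_regs {aPW} s s3" using fr1 a(1) s3(1) by (simp add: frame_def)
      show "search_state s3" by (rule search_state_frame[OF Suc.prems(1) fr3])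
      show "rg s3 rEX = e" "rg s3 rG \<le> t" using s3 Suc.prems(3) by auto
      show "t < rg s3 rG + 2 ^ e" using s3(3) Suc.prems(4) by auto
      show "ar s3 aPW i = 2 ^ i" if "i < e" for i
        using Suc.prems(5)[of i] that g2(4) s3(1) by (simp add: frame_def)
    next
      fix s' assume b: "frame search_regs {} s3 s'" "rg s' rG = t" "tm s' \<le> tm s3 + 30 * e + 1" "cm s' \<le> cm s3 + e"
      show "Q s'"
      proof (rule Suc.prems(6)[OF _ b(2)])
        show "frame search_regs {} s s'" using b(1) s3(1) a(1) by (simp add: frame_def s1_def)
        show "tm s' \<le> tm s + 30 * Suc e + 1" "cm s' \<le> cm s + Suc e" using b(3,4) s3(4,5) a(3,4) by (simp_all add: s1_def)
      qed
    qed
    show "wp L B (Cond rB (Plus rG rG rS) (Set rA 0)) (\<lambda>s'. wp L B (While rEX bisect_body) Q (tick 1 s')) s2"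
    proof (cases "rg s rG + 2 ^ e \<le> t")
      case True
      then show ?thesis unfolding wp_Cond wp_basic using g2 by (auto intro!: go simp: put_rg_def frame_def)
    next
      case False
      then show ?thesis unfolding wp_Cond wp_basic using g2 by (auto intro!: go simp: put_rg_def frame_def)
    qed
  qed
  moreover have "wp L B bisect_body (\<lambda>s'. wp L B (While rEX bisect_body) Q (tick 1 s')) (tick 1 s) =
      wp L B test_cmd (\<lambda>s'. wp L B (Cond rB (Plus rG rG rS) (Set rA 0)) (\<lambda>s'. wp L B (While rEX bisect_body) Q (tick 1 s')) s') s1"
    using Suc.prems(1,2) Suc.prems(5)[of e] unfolding search_state_def
    by (subst (1) bisect_body_def) (simp add: wp_Seq wp_basic put_rg_def tick_def s1_def fun_upd_twist add.commute)
  ultimately show ?case using Suc.prems(2) by (subst wp_While_iff) simp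
qed

lemma search_cmd_ok:
  assumes s: "rg s rJ = J" "rg s rR = R" "lim = min J R" "rg s rYY = y" "rg s rONE = 1" "\<And>j. j < J \<Longrightarrow> ar s aPATH j = p j"
    and Q: "\<And>s' e. frame (search_regs \<union> {rLIM, rC2}) {aPW, aQ} s s' \<Longrightarrow> ar s' aQ = (ar s aQ)(y := Suc (J - t)) \<Longrightarrow>
      rg s' rC2 = Suc (J - t) \<Longrightarrow> 2 ^ e \<le> t + 1 \<Longrightarrow> tm s' \<le> tm s + 60 * e + 40 \<Longrightarrow> cm s' \<le> cm s + 2 * e + 1 \<Longrightarrow> Q s'"
  shows "wp L B search_cmd Q s"
proof -
  define post where "post = wp L B (Minus rA rJ rG ;; Plus rC2 rA rONE ;; Put aQ rYY rC2) Q"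
  define s0 where "s0 = s\<lparr>rg := (rg s)(rA := J - R, rLIM := lim, rG := 0, rS := 1, rEX := 0), tm := Suc (Suc (Suc (Suc (Suc (tm s)))))\<rparr>"
  have fr0: "frame (search_regs \<union> {rLIM, rC2}) {} s s0" by (simp add: frame_def s0_def)
  have st0: "search_state s0" unfolding search_state_def using s(1,4,5,6) by (simp add: s0_def)
  \<comment> \<open>Two truncated subtractions compute \<open>min J R\<close>.\<close>
  have lim': "J - (J - R) = lim" using s(3) by simp
  have "wp L B test_cmd (wp L B (While rB gallop_body) (wp L B (While rEX bisect_body) post)) s0"
  proof (rule test_cmd_ok[OF st0 refl])
    show "0 < rg s0 rG + rg s0 rS" by (simp add: s0_def)
  next
    fix s1 assume a: "frame {rA, rK2, rB} {} s0 s1" "rg s1 rB = of_bool (rg s0 rG + rg s0 rS \<le> t)"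
      "tm s1 \<le> tm s0 + 14" "cm s1 \<le> cm s0 + 1"
    have fr1: "frame search_regs {aPW} s0 s1" using a(1) by (simp add: frame_def)
    have g1: "rg s1 rG = 0" "rg s1 rS = 1" "rg s1 rEX = 0" "rg s0 rG = 0" "rg s0 rS = 1" using a(1) by (simp_all add: frame_def s0_def)
    show "wp L B (While rB gallop_body) (wp L B (While rEX bisect_body) post) s1"
    proof (rule gallop_ok[OF search_state_frame[OF st0 fr1]])
      show "rg s1 rEX = 0" "rg s1 rS = 2 ^ 0" "Suc (rg s1 rG) = 2 ^ 0" "2 ^ 0 \<le> Suc t"
        "rg s1 rB = of_bool (rg s1 rG + rg s1 rS \<le> t)" using g1 a(2) by simp_all
    next
      fix s2 e assume b: "frame search_regs {aPW} s1 s2" "rg s2 rEX = e" "Suc (rg s2 rG) = 2 ^ e"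
        "2 ^ e \<le> Suc t" "t < rg s2 rG + 2 ^ e" "\<And>i. i < e \<Longrightarrow> ar s2 aPW i = 2 ^ i"
        "tm s2 + 27 * 0 \<le> tm s1 + 27 * e + 1" "cm s2 + 0 \<le> cm s1 + e"
      have fr2: "frame search_regs {aPW} s0 s2" using fr1 b(1) by (simp add: frame_def)
      note st2 = search_state_frame[OF st0 fr2]
      show "wp L B (While rEX bisect_body) post s2"
      proof (rule bisect_ok[OF st2 b(2) _ b(5,6)])
        show "rg s2 rG \<le> t" using b(3,4) by simp
      next
        fix s3 assume c: "frame search_regs {} s2 s3" "rg s3 rG = t" "tm s3 \<le> tm s2 + 30 * e + 1" "cm s3 \<le> cm s2 + e"
        have fr3: "frame search_regs {aPW} s0 s3" using fr2 c(1) by (simp add: frame_def)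
        note st3 = search_state_frame[OF st0 fr3, unfolded search_state_def]
        define s4 where "s4 = s3\<lparr>rg := (rg s3)(rA := J - t, rC2 := Suc (J - t)),
          ar := (ar s3)(aQ := (ar s3 aQ)(y := Suc (J - t))), tm := tm s3 + 10\<rparr>"
        have "post s3 = Q s4" using st3 c(2) by (simp add: post_def exec_simps s4_def fun_upd_twist add.commute)
        moreover have "Q s4"
        proof (rule Q[where e = e])
          show "frame (search_regs \<union> {rLIM, rC2}) {aPW, aQ} s s4" using fr3 fr0 by (simp add: frame_def s4_def)
          show "ar s4 aQ = (ar s aQ)(y := Suc (J - t))" using fr3 fr0 by (simp add: frame_def s4_def)
          show "rg s4 rC2 = Suc (J - t)" by (simp add: s4_def)
          show "2 ^ e \<le> t + 1" using b(4) by simp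
          show "tm s4 \<le> tm s + 60 * e + 40" using a(3) b(7) c(3) by (simp add: s4_def s0_def)
          show "cm s4 \<le> cm s + 2 * e + 1" using a(4) b(8) c(4) by (simp add: s4_def s0_def)
        qed
        ultimately show "post s3" by simp
      qed
    qed simp
  qed
  moreover have "wp L B search_cmd Q s =
      wp L B test_cmd (wp L B (While rB gallop_body) (wp L B (While rEX bisect_body) post)) s0"
    unfolding search_cmd_def post_def wp_Seq_fun
    using s(1,2,4,5) lim' by (simp add: wp_basic put_rg_def s0_def fun_upd_twist add.commute)
  ultimately show ?thesis by simp
qed

end

subsection \<open>Steps of the main loop\<close>

definition ins_cmd :: cmd where
  "ins_cmd = Plus rT rZ rONE ;; insert_cmd"

text \<open>The sum of remaining in-degree and path membership is 0 exactly for the vertices to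
  insert, so a single jump decides; \<open>arc_body\<close> uses the same test.\<close>

definition init_body :: cmd where
  "init_body = Get rX aREM rZ ;; Get rF aINP rZ ;; Plus rX rX rF ;; Cond rX skip_cmd ins_cmd ;;
     Plus rZ rZ rONE ;; Minus rD rD rONE"

definition arc_body :: cmd where
  "arc_body = Minus rE rE rONE ;; Get rZ aTGT rE ;; Get rX aREM rZ ;; Minus rX rX rONE ;; Put aREM rZ rX ;;
     Get rF aINP rZ ;; Plus rX rX rF ;; Cond rX skip_cmd ins_cmd ;; Get rE aNXT rE"

text \<open>\<open>rB\<close> ends up nonzero iff the next output comes from the path. It is the
  truncated difference of \<open>J + 1\<close> and the entry of \<open>aQ\<close>, which is the
  index found plus one; this offset distinguishes searched items from the default 0.\<close>

definition select_cmd :: cmd where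
  "select_cmd = Get rL aWIN rROOT ;;
     Cond rL
       (Minus rYY rL rONE ;; Get rC2 aQ rYY ;; Cond rC2 (Set rA 0) search_cmd ;; Plus rA rJ rONE ;; Minus rB rA rC2)
       (Mov rB rONE)"

definition pop_cmd :: cmd where
  "pop_cmd = Cond rB (Minus rJ rJ rONE ;; Get rV aPATH rJ) (Mov rV rYY ;; Mov rT rL ;; delete_cmd) ;;
     Raw_Put rO rV ;; Plus rO rO rONE ;; Minus rR rR rONE"

text \<open>After the last output no arcs are traversed: an item freed only by the k-th output could
  not have been the k-th itself, so the certificate bound would not cover its insertion.\<close>

definition main_body :: cmd where
  "main_body = select_cmd ;; pop_cmd ;; Cond rR (Get rE aHEAD rV ;; While rE arc_body) (Set rA 0)"

definition init_cmd :: cmd where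
  "init_cmd = Plus rNEW rN rONE ;; Mov rR rK ;; Mov rD rN ;; Set rZ 0 ;; While rD init_body"

definition sources :: "nat \<Rightarrow> (nat \<times> nat) list \<Rightarrow> nat list \<Rightarrow> nat set" where
  "sources n arcs ps = {w. w < n \<and> w \<notin> set ps \<and> cnt arcs {..<length arcs} w = 0}"

context
  fixes n k :: nat and arcs :: "(nat \<times> nat) list" and L :: "nat rel" and ps vs :: "nat list"
  assumes L: "topological_order {..<n} (set arcs) L"
    and vs: "smallest_sorted {..<n} L k vs"
    and path: "\<And>i. Suc i < length ps \<Longrightarrow> (ps ! Suc i, ps ! i) \<in> set arcs" "set ps \<subseteq> {..<n}"
begin

abbreviation (input) "hst \<equiv> hist n k arcs L ps vs"

text \<open>\<open>R\<close> are the arcs not yet traversed. The search for the place of \<open>x\<close> in the path costs \<open>O(es x)\<close>, and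
  the deletion of \<open>x\<close> from the heap \<open>O(eh x)\<close>. The carries are a potential that amortizes the
  insertions, and \<open>T\<close> is the time that is not charged to an item.\<close>

definition base :: "state \<Rightarrow> (nat + nat) list \<Rightarrow> nat \<Rightarrow> nat set \<Rightarrow> (nat \<Rightarrow> nat) \<Rightarrow> (nat \<Rightarrow> nat) \<Rightarrow> (nat \<Rightarrow> nat) \<Rightarrow>
    (nat \<Rightarrow> nat) \<Rightarrow> spine \<Rightarrow> nat set \<Rightarrow> nat \<Rightarrow> bool" where
  "base s ev J Sr is Js es eh sp R T \<longleftrightarrow>
     hst ev J Sr is Js es eh (ar s aQ) \<and> graph arcs s \<and> ar s aREM = cnt arcs R \<and>
     rg s rJ = J \<and> (\<forall>j < length ps. ar s aPATH j = ps ! j) \<and> (\<forall>v. ar s aINP v = of_bool (v \<in> set ps)) \<and>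
     heap L n s sp (set (inserted ev) - set (popped ev)) \<and> contents sp = inserted ev \<and>
     rg s rR = k - length (popped ev) \<and> rg s rO = length (popped ev) \<and>
     (\<forall>j < length (popped ev). raw s j = vs ! j) \<and>
     cm s + carries sp \<le> 3 * length (inserted ev) + (\<Sum>x \<in> set (popped ev) - set ps. 2 * eh x + 2) +
       (\<Sum>x \<in> Sr. 2 * es x + 1) \<and>
     tm s + 120 * carries sp \<le> T + 500 * length (inserted ev) + (\<Sum>x \<in> set (popped ev) - set ps. 120 * eh x + 200) +
       (\<Sum>x \<in> Sr. 60 * es x + 60)"

lemma baseD:
  assumes "base s ev J Sr is Js es eh sp R T"
  shows "hst ev J Sr is Js es eh (ar s aQ)" "graph arcs s" "ar s aREM = cnt arcs R" "rg s rJ = J"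
    "\<And>j. j < length ps \<Longrightarrow> ar s aPATH j = ps ! j" "\<And>v. ar s aINP v = of_bool (v \<in> set ps)"
    "heap L n s sp (set (inserted ev) - set (popped ev))" "contents sp = inserted ev"
    "rg s rR = k - length (popped ev)" "rg s rO = length (popped ev)"
    "\<And>j. j < length (popped ev) \<Longrightarrow> raw s j = vs ! j"
    "cm s + carries sp \<le> 3 * length (inserted ev) + (\<Sum>x \<in> set (popped ev) - set ps. 2 * eh x + 2) +
       (\<Sum>x \<in> Sr. 2 * es x + 1)"
    "tm s + 120 * carries sp \<le> T + 500 * length (inserted ev) + (\<Sum>x \<in> set (popped ev) - set ps. 120 * eh x + 200) +
       (\<Sum>x \<in> Sr. 60 * es x + 60)"
    "rg s rONE = 1" "rg s rZERO = 0"
  using assms unfolding base_def by (blast, blast, blast, blast, blast, blast, blast, blast, blast, blast, blast, blast, blast)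
    (use assms in \<open>simp_all add: base_def heap_def core_def\<close>)

abbreviation (input) "inv_regs \<equiv> {rJ, rROOT, rNEW, rONE, rZERO, rR, rO}"
abbreviation (input) "inv_arrays \<equiv> {aHEAD, aNXT, aTGT, aREM, aPATH, aINP, aQ, aLFT, aRGT, aPAR, aWIN, aDIG}"

lemma base_cong:
  assumes b: "base s ev J Sr is Js es eh sp R T"
    and e: "\<And>r. r \<in> inv_regs \<Longrightarrow> rg s' r = rg s r" "\<And>a. a \<in> inv_arrays \<Longrightarrow> ar s' a = ar s a" "raw s' = raw s"
      "cm s' \<le> cm s" "tm s' \<le> tm s + d" "T + d \<le> T'"
  shows "base s' ev J Sr is Js es eh sp R T'"
proof -
  note D = baseD[OF b]
  have "heap L n s' sp (set (inserted ev) - set (popped ev))"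
    by (rule heap_cong[OF D(7)]) (use e in auto)
  moreover have "graph arcs s'" using D(2) e(2) by (simp add: graph_def)
  moreover have "rg s' rJ = rg s rJ" "rg s' rR = rg s rR" "rg s' rO = rg s rO" "ar s' aQ = ar s aQ"
    "ar s' aREM = ar s aREM" "ar s' aPATH = ar s aPATH" "ar s' aINP = ar s aINP"
    using e(1,2) by simp_all
  moreover note D(1,3-6,8-11) e(3)
  moreover have "cm s' + carries sp \<le> 3 * length (inserted ev) + (\<Sum>x \<in> set (popped ev) - set ps. 2 * eh x + 2) +
       (\<Sum>x \<in> Sr. 2 * es x + 1)"
    using D(12) e(4) by linarith
  moreover have "tm s' + 120 * carries sp \<le> T' + 500 * length (inserted ev) +
       (\<Sum>x \<in> set (popped ev) - set ps. 120 * eh x + 200) + (\<Sum>x \<in> Sr. 60 * es x + 60)"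
    using D(13) e(5,6) by linarith
  ultimately show ?thesis unfolding base_def by (intro conjI allI impI) simp_all
qed

lemma ins_cmd_ok:
  assumes b: "base s ev J Sr is Js es eh sp R T" and Z: "rg s rZ = w"
    and w: "w < n" "w \<notin> set ps" "w \<notin> set (inserted ev)" "\<And>u. (u, w) \<in> set arcs \<Longrightarrow> u \<in> set (popped ev)"
    and k: "length (popped ev) < k"
    and Q: "\<And>s' sp'. frame heap_regs heap_arrays s s' \<Longrightarrow>
      base s' (ev @ [Inl w]) J Sr is Js es eh sp' R T \<Longrightarrow> Q s'"
  shows "wp L B ins_cmd Q s"
proof -
  note D = baseD[OF b]
  define s1 where "s1 = s\<lparr>rg := (rg s)(rT := Suc w), tm := Suc (tm s)\<rparr>"
  have h1: "heap L n s1 sp (set (inserted ev) - set (popped ev))"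
    by (rule heap_cong[OF D(7)]) (auto simp: s1_def)
  have h': "hst (ev @ [Inl w]) J Sr is Js es eh (ar s aQ)"
    by (rule hist_insert[OF L vs path D(1) w k])
  have wp: "w \<notin> set (popped ev)"
  proof
    assume "w \<in> set (popped ev)"
    then have "w \<in> Sr" using histD(14)[OF L vs path D(1), of w] w(2) by blast
    then show False using histD(10)[OF L vs path D(1)] w(3) by blast
  qed
  have "wp L B insert_cmd Q s1"
  proof (rule insert_cmd_ok[OF h1])
    show "rg s1 rT = Suc w" by (simp add: s1_def)
    show "w < n" "w \<notin> set (contents sp)" using w D(8) by simp_all
  next
    fix s' sp' assume a: "frame heap_regs heap_arrays s1 s'"
      "heap L n s' sp' (insert w (set (inserted ev) - set (popped ev)))" "contents sp' = contents sp @ [w]"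
      "tm s' + 120 * carries sp' \<le> tm s1 + 120 * carries sp + 400" "cm s' + carries sp' \<le> cm s1 + carries sp + 3"
    have fr: "frame heap_regs heap_arrays s s'" using a(1) by (simp add: frame_def s1_def)
    have "base s' (ev @ [Inl w]) J Sr is Js es eh sp' R T"
      unfolding base_def
    proof (intro conjI allI impI)
      show "hst (ev @ [Inl w]) J Sr is Js es eh (ar s' aQ)" using h' fr by (simp add: frame_def)
      show "graph arcs s'" using D(2) fr by (simp add: frame_def graph_def)
      have "set (inserted (ev @ [Inl w])) - set (popped (ev @ [Inl w])) = insert w (set (inserted ev) - set (popped ev))"
        using wp by auto
      then show "heap L n s' sp' (set (inserted (ev @ [Inl w])) - set (popped (ev @ [Inl w])))" using a(2) by simp
      show "cm s' + carries sp' \<le> 3 * length (inserted (ev @ [Inl w])) +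
          (\<Sum>x \<in> set (popped (ev @ [Inl w])) - set ps. 2 * eh x + 2) + (\<Sum>x \<in> Sr. 2 * es x + 1)"
        using D(12) a(5) by (simp add: s1_def)
      show "tm s' + 120 * carries sp' \<le> T + 500 * length (inserted (ev @ [Inl w])) +
          (\<Sum>x \<in> set (popped (ev @ [Inl w])) - set ps. 120 * eh x + 200) + (\<Sum>x \<in> Sr. 60 * es x + 60)"
        using D(13) a(4) by (simp add: s1_def)
    qed (use D a(3) fr in \<open>simp_all add: frame_def\<close>)
    then show "Q s'" by (rule Q[OF fr])
  qed
  then show ?thesis unfolding ins_cmd_def using Z D(14) by (simp add: exec_simps s1_def)
qed

text \<open>A vertex is inserted exactly when its last incoming arc is traversed.\<close>

definition arcs_ok :: "(nat + nat) list \<Rightarrow> nat set \<Rightarrow> bool" where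
  "arcs_ok ev R \<longleftrightarrow> R \<subseteq> {..<length arcs} \<and> (\<forall>e < length arcs. e \<notin> R \<longrightarrow> src arcs e \<in> set (popped ev)) \<and>
     set (inserted ev) = {w. w < n \<and> w \<notin> set ps \<and> cnt arcs R w = 0}"

lemma arcs_cmd_ok:
  assumes "base s ev J Sr is Js es eh sp R T" "arcs_ok ev R" "alist (ar s aNXT) (rg s rE) fs" "distinct fs" "set fs \<subseteq> R"
    and "\<And>e. e \<in> set fs \<Longrightarrow> src arcs e \<in> set (popped ev)" "length (popped ev) < k"
    and "\<And>s' ev' sp'. base s' ev' J Sr is Js es eh sp' (R - set fs) (T + 60 * length fs + 1) \<Longrightarrow> arcs_ok ev' (R - set fs) \<Longrightarrow>
      popped ev' = popped ev \<Longrightarrow> Q s'"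
  shows "wp L B (While rE arc_body) Q s"
  using assms
proof (induction fs arbitrary: s ev sp R T)
  case Nil
  have "base (tick 1 s) ev J Sr is Js es eh sp R (T + 1)"
    by (rule base_cong[OF Nil.prems(1), of _ 1]) auto
  then have "Q (tick 1 s)" using Nil.prems(2) Nil.prems(8)[of "tick 1 s" ev sp] by simp
  then show ?case using Nil.prems(3) by (subst wp_While_iff) simp
next
  case (Cons e fs)
  note D = baseD[OF Cons.prems(1)]
  define w where "w = tgt arcs e"
  have e: "e \<in> R" "e < length arcs" "e \<notin> set fs" using Cons.prems(2,4,5) by (auto simp: arcs_ok_def)
  have fR: "finite R" using Cons.prems(2) finite_subset by (auto simp: arcs_ok_def)
  have rE: "rg s rE = Suc e" and al: "alist (ar s aNXT) (ar s aNXT e) fs" using Cons.prems(3) by auto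
  have w: "w < n" "cnt arcs R w \<noteq> 0" "w \<notin> set (inserted ev)" "ar s aTGT e = w"
    using arc_in[OF L e(2)] cnt_pos[OF fR e(1)] D(2) Cons.prems(2) e(2) by (auto simp: w_def graph_def arcs_ok_def)
  have cnt': "cnt arcs (R - {e}) = (cnt arcs R)(w := cnt arcs R w - 1)"
    using cnt_remove[OF fR e(1)] by (auto simp: w_def)
  have src: "src arcs f \<in> set (popped ev)" if "f < length arcs" "f \<notin> R - {e}" for f
    using that Cons.prems(2) Cons.prems(6)[of e] by (cases "f = e") (auto simp: arcs_ok_def)
  define z where "z = (cnt arcs R w = 1 \<and> w \<notin> set ps)"
  define s1 where "s1 = s\<lparr>rg := (rg s)(rE := e, rZ := w, rX := cnt arcs R w - 1 + of_bool (w \<in> set ps), rF := of_bool (w \<in> set ps)),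
    ar := (ar s)(aREM := cnt arcs (R - {e})), tm := tm s + 36\<rparr>"
  have zX: "rg s1 rX = 0 \<longleftrightarrow> z" using w(2) by (auto simp: s1_def z_def)
  have b1: "base s1 ev J Sr is Js es eh sp (R - {e}) (T + 36)"
    unfolding base_def
  proof (intro conjI allI impI)
    show "heap L n s1 sp (set (inserted ev) - set (popped ev))"
      by (rule heap_cong[OF D(7)]) (auto simp: s1_def)
    show "graph arcs s1" using D(2) by (simp add: graph_def s1_def)
  qed (use D in \<open>simp_all add: s1_def\<close>)
  let ?rest = "\<lambda>s. wp L B (Get rE aNXT rE) (\<lambda>s'. wp L B (While rE arc_body) Q (tick 1 s')) s"
  have rest: "?rest s2" if s2: "base s2 ev2 J Sr is Js es eh sp2 (R - {e}) (T + 40)" "arcs_ok ev2 (R - {e})"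
    "popped ev2 = popped ev" "rg s2 rE = e" "ar s2 aNXT = ar s aNXT" for s2 ev2 sp2
  proof -
    define s3 where "s3 = s2\<lparr>rg := (rg s2)(rE := ar s aNXT e), tm := tm s2 + 9\<rparr>"
    have "wp L B (While rE arc_body) Q s3"
    proof (rule Cons.IH[where R = "R - {e}" and ev = ev2])
      show "base s3 ev2 J Sr is Js es eh sp2 (R - {e}) (T + 49)"
        by (rule base_cong[OF s2(1), of _ 9]) (auto simp: s3_def)
      show "arcs_ok ev2 (R - {e})" by (rule s2(2))
      show "alist (ar s3 aNXT) (rg s3 rE) fs" using al s2(5) by (simp add: s3_def)
      show "distinct fs" "set fs \<subseteq> R - {e}" using Cons.prems(4,5) by auto
      show "src arcs f \<in> set (popped ev2)" if "f \<in> set fs" for f using Cons.prems(6) that s2(3) by simp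
      show "length (popped ev2) < k" using Cons.prems(7) s2(3) by simp
    next
      fix s' ev' sp' assume a: "base s' ev' J Sr is Js es eh sp' (R - {e} - set fs) (T + 49 + 60 * length fs + 1)"
        "arcs_ok ev' (R - {e} - set fs)" "popped ev' = popped ev2"
      have R: "R - {e} - set fs = R - set (e # fs)" by auto
      show "Q s'"
      proof (rule Cons.prems(8))
        show "base s' ev' J Sr is Js es eh sp' (R - set (e # fs)) (T + 60 * length (e # fs) + 1)"
          by (rule base_cong[OF a(1)[unfolded R], of _ 0]) auto
      qed (use a R s2(3) in auto)
    qed
    then show ?thesis using s2(4,5) by (simp add: exec_simps s3_def add.commute)
  qed
  have "wp L B (Cond rX skip_cmd ins_cmd) ?rest s1"
  proof (cases z)
    case False
    define s2 where "s2 = s1\<lparr>rg := (rg s1)(rX := 0), tm := tm s1 + 3\<rparr>"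
    have "?rest s2"
    proof (rule rest)
      show "base s2 ev J Sr is Js es eh sp (R - {e}) (T + 40)"
        by (rule base_cong[OF b1, of _ 3]) (auto simp: s2_def)
      have "cnt arcs (R - {e}) v = 0 \<longleftrightarrow> cnt arcs R v = 0" if "v \<notin> set ps" for v
        using False w(2) that unfolding z_def cnt' by auto
      then show "arcs_ok ev (R - {e})" using Cons.prems(2) src unfolding arcs_ok_def by auto
    qed (simp_all add: s2_def s1_def)
    then show ?thesis using False zX by (simp add: wp_Cond skip_cmd_def wp_basic put_rg_def s2_def tick_def)
  next
    case True
    have "wp L B ins_cmd ?rest (tick 1 s1)"
    proof (rule ins_cmd_ok[where T = "T + 40"])
      show "base (tick 1 s1) ev J Sr is Js es eh sp (R - {e}) (T + 40)"
        by (rule base_cong[OF b1, of _ 1]) auto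
      show "rg (tick 1 s1) rZ = w" by (simp add: s1_def)
      show "w < n" "w \<notin> set (inserted ev)" "w \<notin> set ps" using w True by (auto simp: z_def)
      show "length (popped ev) < k" by (rule Cons.prems(7))
      have c0: "cnt arcs (R - {e}) w = 0" using True by (simp add: cnt' z_def)
      show "u \<in> set (popped ev)" if uw: "(u, w) \<in> set arcs" for u
      proof -
        obtain f where "f < length arcs" "src arcs f = u" "tgt arcs f = w" using arc_ex[OF L uw] by auto
        moreover from this have "f \<notin> R - {e}" using c0 cnt_eq_0[of "R - {e}" arcs w] fR by auto
        ultimately show ?thesis using src by blast
      qed
      fix s' sp' assume a: "frame heap_regs heap_arrays (tick 1 s1) s'"
        "base s' (ev @ [Inl w]) J Sr is Js es eh sp' (R - {e}) (T + 40)"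
      show "?rest s'"
      proof (rule rest[OF a(2)])
        have "cnt arcs (R - {e}) v = 0 \<longleftrightarrow> v = w \<or> cnt arcs R v = 0" for v
          using True unfolding z_def cnt' by auto
        then show "arcs_ok (ev @ [Inl w]) (R - {e})"
          using Cons.prems(2) src True w(1) unfolding arcs_ok_def z_def by auto
      qed (use a(1) in \<open>simp_all add: frame_def s1_def\<close>)
    qed
    then show ?thesis using True zX by (simp add: wp_Cond)
  qed
  moreover have "wp L B arc_body (\<lambda>s'. wp L B (While rE arc_body) Q (tick 1 s')) (tick 1 s) = wp L B (Cond rX skip_cmd ins_cmd) ?rest s1"
    using rE w(4) D(3,6,14) cnt'
    by (subst (1) arc_body_def) (simp add: wp_Seq wp_basic put_rg_def tick_def s1_def fun_upd_twist add.commute)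
  ultimately show ?case using rE by (subst wp_While_iff) simp
qed

lemma select_cmd_ok:
  assumes b: "base s ev J Sr is Js es eh sp R T" and i: "i = length (popped ev)" "i < k"
    and all: "\<forall>w < n. w \<notin> set ps \<longrightarrow> (\<forall>u. (u, w) \<in> set arcs \<longrightarrow> u \<in> set (popped ev)) \<longrightarrow> w \<in> set (inserted ev)"
    and lt: "\<And>x. x \<in> Sr \<Longrightarrow> is x < i"
    and Q: "\<And>s' Sr' is' Js' es'. base s' ev J Sr' is' Js' es' eh sp R (T + 30) \<Longrightarrow> (\<And>x. x \<in> Sr' \<Longrightarrow> is' x \<le> i) \<Longrightarrow>
      (rg s' rB \<noteq> 0 \<Longrightarrow> 0 < J \<and> vs ! i = ps ! (J - 1)) \<Longrightarrow>
      (rg s' rB = 0 \<Longrightarrow> rg s' rL = Suc (vs ! i) \<and> rg s' rYY = vs ! i \<and> vs ! i \<in> Sr' \<and>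
         vs ! i \<in> set (inserted ev) \<and> J \<le> ar s' aQ (vs ! i) - 1) \<Longrightarrow> Q s'"
  shows "wp L B select_cmd Q s"
proof -
  note D = baseD[OF b]
  let ?H = "set (inserted ev) - set (popped ev)"
  have mn: "is_min L (ar s aWIN (rg s rROOT)) ?H"
  proof -
    have "set (contents sp) \<inter> ?H = ?H" using D(8) by auto
    then show ?thesis using heap_min[OF L D(7)] by simp
  qed
  show ?thesis
  proof (cases "ar s aWIN (rg s rROOT)")
    case 0
    then have H: "?H = {}" using mn by (simp add: is_min_def)
    define s1 where "s1 = s\<lparr>rg := (rg s)(rL := 0, rB := 1), tm := tm s + 10\<rparr>"
    have "Q s1"
    proof (rule Q)
      show "base s1 ev J Sr is Js es eh sp R (T + 30)"
        by (rule base_cong[OF b, of _ 10]) (auto simp: s1_def)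
      have "vs ! i \<in> set ps" using hist_next(2)[OF L vs path D(1) i all] H by blast
      then show "0 < J \<and> vs ! i = ps ! (J - 1)" using hist_next(1)[OF L vs path D(1) i all] by blast
      show "is x \<le> i" if "x \<in> Sr" for x using lt[OF that] by simp
    qed (simp add: s1_def)
    then show ?thesis unfolding select_cmd_def using 0 D(14)
      by (simp add: exec_simps s1_def fun_upd_twist add.commute)
  next
    case (Suc y)
    then have y: "y \<in> ?H" "\<And>z. z \<in> ?H \<Longrightarrow> z = y \<or> (y, z) \<in> L" using mn by (auto simp: is_min_def)
    define post where "post = wp L B (Plus rA rJ rONE ;; Minus rB rA rC2) (\<lambda>s. Q (tick 1 s))"
    have fin: "post s2" if s2: "base s2 ev J Sr' is' Js' es' eh sp R (T + 25)" "rg s2 rL = Suc y" "rg s2 rYY = y"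
      "rg s2 rC2 = ar s2 aQ y" "y \<in> Sr'" and lt': "\<And>x. x \<in> Sr' \<Longrightarrow> is' x \<le> i" for s2 Sr' is' Js' es'
    proof -
      note E = baseD[OF s2(1)]
      define s3 where "s3 = s2\<lparr>rg := (rg s2)(rA := Suc J, rB := Suc J - ar s2 aQ y), tm := Suc (Suc (Suc (tm s2)))\<rparr>"
      have q: "ar s2 aQ y \<noteq> 0" using histD(12)[OF L vs path E(1)] s2(5) by blast
      note C = choose[OF L vs path E(1) i all s2(5) y]
      have "Q s3"
      proof (rule Q)
        show "base s3 ev J Sr' is' Js' es' eh sp R (T + 30)"
          by (rule base_cong[OF s2(1), of _ 3]) (auto simp: s3_def)
        show "is' x \<le> i" if "x \<in> Sr'" for x using lt'[OF that] .
      next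
        assume "rg s3 rB \<noteq> 0"
        then have "ar s2 aQ y - 1 < J" using q by (simp add: s3_def)
        then show "0 < J \<and> vs ! i = ps ! (J - 1)" using C(1) by linarith
      next
        assume "rg s3 rB = 0"
        then have "J \<le> ar s2 aQ y - 1" by (simp add: s3_def)
        then show "rg s3 rL = Suc (vs ! i) \<and> rg s3 rYY = vs ! i \<and> vs ! i \<in> Sr' \<and>
            vs ! i \<in> set (inserted ev) \<and> J \<le> ar s3 aQ (vs ! i) - 1"
          using C(2) s2 y(1) by (simp add: s3_def)
      qed
      then show ?thesis unfolding post_def using E(4,14) s2(4)
        by (simp add: exec_simps s3_def fun_upd_twist add.commute)
    qed
    define s1 where "s1 = s\<lparr>rg := (rg s)(rL := Suc y, rYY := y, rC2 := ar s aQ y), tm := tm s + 19\<rparr>"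
    have b1: "base s1 ev J Sr is Js es eh sp R (T + 19)"
      by (rule base_cong[OF b, of _ 19]) (auto simp: s1_def)
    note E = baseD[OF b1]
    have goal: "wp L B select_cmd Q s = (if ar s aQ y \<noteq> 0 then post ((tick 2 s1)\<lparr>rg := (rg s1)(rA := 0)\<rparr>)
        else wp L B search_cmd post s1)"
      unfolding select_cmd_def post_def using Suc D(14)
      by (simp add: exec_simps wp_Seq_fun s1_def fun_upd_twist add.commute)
    show ?thesis
    proof (cases "ar s aQ y = 0")
      case False
      have "post ((tick 2 s1)\<lparr>rg := (rg s1)(rA := 0)\<rparr>)"
      proof (rule fin)
        show "base ((tick 2 s1)\<lparr>rg := (rg s1)(rA := 0)\<rparr>) ev J Sr is Js es eh sp R (T + 25)"
          by (rule base_cong[OF b1, of _ 2]) auto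
        show "y \<in> Sr" using False histD(12)[OF L vs path D(1)] by blast
        show "is x \<le> i" if "x \<in> Sr" for x using lt[OF that] by simp
      qed (auto simp: s1_def)
      then show ?thesis using goal False by simp
    next
      case True
      then have yS: "y \<notin> Sr" using histD(12)[OF L vs path D(1)] by blast
      have lps: "J \<le> length ps" by (rule histD(8)[OF L vs path D(1)])
      define lim where "lim = min J (k - i)"
      \<comment> \<open>Read from the vertex to come first, the path ascends, so the vertices
        smaller than \<open>y\<close> form an initial part and the first failure counts them;
        \<open>lim\<close> serves as a sentinel.\<close>
      define t where "t = (LEAST t. t = lim \<or> (ps ! (J - Suc t), y) \<notin> L)"
      have t: "t \<le> lim" unfolding t_def by (rule Least_le) simp
      have tl: "t = lim \<or> (ps ! (J - Suc t), y) \<notin> L" unfolding t_def by (rule LeastI[of _ lim]) simp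
      have tm: "(ps ! (J - Suc j), y) \<in> L" if "j < t" for j
        using not_less_Least[of j "\<lambda>t. t = lim \<or> (ps ! (J - Suc t), y) \<notin> L"] that unfolding t_def by blast
      have above: "(ps ! (J - Suc j), y) \<notin> L" if j: "t \<le> j" "j < lim" for j
      proof
        assume a: "(ps ! (J - Suc j), y) \<in> L"
        have "t < lim" using j by linarith
        then have nt: "(ps ! (J - Suc t), y) \<notin> L" using tl by blast
        then have "t < j" using a j by (cases "t = j") auto
        then have "J - Suc j < J - Suc t" "J - Suc t < length ps" using j lps unfolding lim_def by auto
        then have "(ps ! (J - Suc t), ps ! (J - Suc j)) \<in> L" using path_sorted[OF L vs path] by blast
        then show False using a nt tr[OF L vs path] by blast
      qed
      have "wp L B search_cmd post s1"
      proof (rule search_cmd_ok[where J = J and lim = lim and t = t and y = y and R = "k - i" and p = "\<lambda>j. ps ! j" and L = L])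
        show "lim \<le> J" by (simp add: lim_def)
        show "t \<le> lim" by (rule t)
        show "(ps ! (J - Suc j), y) \<in> L" if "j < t" for j by (rule tm[OF that])
        show "(ps ! (J - Suc t), y) \<notin> L" if "t < lim" using tl that by simp
        show "(ps ! (J - Suc j), y) \<notin> L" if "t \<le> j" "j < lim" for j by (rule above[OF that])
        show "rg s1 rJ = J" "rg s1 rR = k - i" "rg s1 rONE = 1" using E(4,9,14) i by simp_all
        show "lim = min J (k - i)" by (rule lim_def)
        show "rg s1 rYY = y" by (simp add: s1_def)
        show "ar s1 aPATH j = ps ! j" if "j < J" for j using E(5)[of j] that lps by simp
      next
        fix s2 e assume a: "frame ({rA, rK2, rB, rG, rS, rEX} \<union> {rLIM, rC2}) {aPW, aQ} s1 s2"
          "ar s2 aQ = (ar s1 aQ)(y := Suc (J - t))" "rg s2 rC2 = Suc (J - t)" "2 ^ e \<le> t + 1"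
          "tm s2 \<le> tm s1 + 60 * e + 40" "cm s2 \<le> cm s1 + 2 * e + 1"
        have h: "hist n k arcs L ps vs ev J (insert y Sr) (is(y := i)) (Js(y := J)) (es(y := e)) eh
            ((ar s1 aQ)(y := Suc (J - t)))"
        proof (rule hist_search[OF L vs path E(1) i yS y(1) lt _ _ a(4)])
          show "t \<le> J" "t \<le> k - i" using t by (simp_all add: lim_def)
          show "(ps ! j, y) \<in> L \<longleftrightarrow> J - t \<le> j" if j: "j < J" "J \<le> j + (k - i)" for j
          proof -
            define j' where "j' = J - Suc j"
            have j': "j = J - Suc j'" "j' < lim" using j by (auto simp: j'_def lim_def)
            have "(ps ! (J - Suc j'), y) \<in> L \<longleftrightarrow> j' < t" using tm above j'(2) by (meson not_le)
            moreover have "j' < t \<longleftrightarrow> J - t \<le> j" using j t by (auto simp: j'_def lim_def)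
            ultimately show ?thesis using j'(1) by simp
          qed
        qed
        have fS: "finite Sr" using finite_subset[OF histD(10)[OF L vs path D(1)]] by simp
        have su: "(\<Sum>x \<in> insert y Sr. c * (es(y := e)) x + d) = c * e + d + (\<Sum>x \<in> Sr. c * es x + d)" for c d
        proof -
          have "(\<Sum>x \<in> Sr. c * (es(y := e)) x + d) = (\<Sum>x \<in> Sr. c * es x + d)"
            using yS by (intro sum.cong) auto
          then show ?thesis using fS yS by simp
        qed
        have rgs: "rg s2 r = rg s1 r" if "r \<in> inv_regs" for r using a(1) that by (auto simp: frame_def)
        have ars: "ar s2 r = ar s1 r" if "r \<in> inv_arrays - {aQ}" for r using a(1) that by (auto simp: frame_def)
        show "post s2"
        proof (rule fin)
          show "base s2 ev J (insert y Sr) (is(y := i)) (Js(y := J)) (es(y := e)) eh sp R (T + 25)"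
            unfolding base_def
          proof (intro conjI allI impI)
            show "hist n k arcs L ps vs ev J (insert y Sr) (is(y := i)) (Js(y := J)) (es(y := e)) eh (ar s2 aQ)"
              using h a(2) by simp
            show "graph arcs s2" using E(2) by (simp add: graph_def ars)
            show "heap L n s2 sp ?H" by (rule heap_cong[OF E(7)]) (auto intro!: ars simp: rgs)
            show "cm s2 + carries sp \<le> 3 * length (inserted ev) + (\<Sum>x \<in> set (popped ev) - set ps. 2 * eh x + 2) +
                (\<Sum>x \<in> insert y Sr. 2 * (es(y := e)) x + 1)"
              unfolding su using E(12) a(6) by linarith
            show "tm s2 + 120 * carries sp \<le> T + 25 + 500 * length (inserted ev) +
                (\<Sum>x \<in> set (popped ev) - set ps. 120 * eh x + 200) + (\<Sum>x \<in> insert y Sr. 60 * (es(y := e)) x + 60)"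
              unfolding su using E(13) a(5) by linarith
            show "raw s2 j = vs ! j" if "j < length (popped ev)" for j using E(11)[OF that] a(1) by (simp add: frame_def)
          qed (simp_all add: E(3-6,8-10) rgs ars)
          show "rg s2 rL = Suc y" "rg s2 rYY = y" using a(1) by (simp_all add: frame_def s1_def)
          show "rg s2 rC2 = ar s2 aQ y" using a(2,3) by simp
          show "(is(y := i)) x \<le> i" if "x \<in> insert y Sr" for x using lt[of x] that by auto
        qed simp
      qed
      then show ?thesis using goal True by simp
    qed
  qed
qed

lemma pop_cmd_ok:
  assumes b: "base s ev J Sr is Js es eh sp R T" and i: "i = length (popped ev)" "i < k" and B: "k \<le> B"
    and p: "rg s rB \<noteq> 0 \<Longrightarrow> 0 < J \<and> vs ! i = ps ! (J - 1)"
    and h: "rg s rB = 0 \<Longrightarrow> rg s rL = Suc (vs ! i) \<and> rg s rYY = vs ! i \<and> vs ! i \<in> Sr \<and>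
         vs ! i \<in> set (inserted ev) \<and> J \<le> ar s aQ (vs ! i) - 1"
    and Q: "\<And>s' J' eh' sp'. base s' (ev @ [Inr (vs ! i)]) J' Sr is Js es eh' sp' R (T + 30) \<Longrightarrow> rg s' rV = vs ! i \<Longrightarrow> Q s'"
  shows "wp L B pop_cmd Q s"
proof -
  note D = baseD[OF b]
  let ?ev = "ev @ [Inr (vs ! i)]" and ?H = "set (inserted ev) - set (popped ev)"
  define post where "post = wp L B (Raw_Put rO rV ;; Plus rO rO rONE ;; Minus rR rR rONE) Q"
  have pe: "popped ev = take i vs" using histD(2)[OF L vs path D(1)] i by simp
  have fresh: "vs ! i \<notin> set (popped ev)" using vs_fresh[OF L vs path i(2)] pe by simp
  have fin: "post s1" if s1: "hist n k arcs L ps vs ?ev J' Sr is Js es eh' (ar s1 aQ)" "graph arcs s1"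
    "heap L n s1 sp (?H - {vs ! i})" "rg s1 rJ = J'" "rg s1 rV = vs ! i" "rg s1 rO = i" "rg s1 rR = k - i"
    "raw s1 = raw s" "ar s1 aREM = ar s aREM" "ar s1 aPATH = ar s aPATH" "ar s1 aINP = ar s aINP"
    "cm s1 + carries sp \<le> 3 * length (inserted ev) + (\<Sum>x \<in> set (popped ?ev) - set ps. 2 * eh' x + 2) +
       (\<Sum>x \<in> Sr. 2 * es x + 1)"
    "tm s1 + 120 * carries sp \<le> T + 26 + 500 * length (inserted ev) +
       (\<Sum>x \<in> set (popped ?ev) - set ps. 120 * eh' x + 200) + (\<Sum>x \<in> Sr. 60 * es x + 60)" for s1 J' eh'
  proof -
    define s2 where "s2 = s1\<lparr>rg := (rg s1)(rO := Suc i, rR := k - Suc i), raw := (raw s1)(i := vs ! i), tm := Suc (Suc (Suc (tm s1)))\<rparr>"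
    have one: "rg s1 rONE = 1" using s1(3) by (simp add: heap_def core_def)
    have "Q s2"
    proof (rule Q)
      show "base s2 ?ev J' Sr is Js es eh' sp R (T + 30)"
        unfolding base_def
      proof (intro conjI allI impI)
        show "hist n k arcs L ps vs ?ev J' Sr is Js es eh' (ar s2 aQ)" using s1(1) by (simp add: s2_def)
        show "graph arcs s2" using s1(2) by (simp add: graph_def s2_def)
        have "set (inserted ?ev) - set (popped ?ev) = ?H - {vs ! i}" by auto
        then show "heap L n s2 sp (set (inserted ?ev) - set (popped ?ev))"
          by (simp only:) (rule heap_cong[OF s1(3)], auto simp: s2_def)
        show "raw s2 j = vs ! j" if "j < length (popped ?ev)" for j
          using that i(1) s1(8) D(11)[of j] by (auto simp: s2_def less_Suc_eq)
      qed (use s1 D i(1) in \<open>simp_all add: s2_def\<close>)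
      show "rg s2 rV = vs ! i" using s1(5) by (simp add: s2_def)
    qed
    then show ?thesis unfolding post_def using s1(5-7) one i(2) B
      by (simp add: exec_simps s2_def fun_upd_twist add.commute Suc_diff_Suc)
  qed
  have rOR: "rg s rO = i" "rg s rR = k - i" using D(9,10) i(1) by simp_all
  have step: "wp L B pop_cmd Q s =
      wp L B (Cond rB (Minus rJ rJ rONE ;; Get rV aPATH rJ) (Mov rV rYY ;; Mov rT rL ;; delete_cmd)) post s"
    unfolding pop_cmd_def post_def wp_Seq_fun ..
  show ?thesis
  proof (cases "rg s rB = 0")
    case False
    then have J: "0 < J" "vs ! i = ps ! (J - 1)" using p by simp_all
    have lps: "J - 1 < length ps" using J(1) histD(8)[OF L vs path D(1)] by simp
    then have ps: "vs ! i \<in> set ps" using J(2) by simp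
    define s1 where "s1 = s\<lparr>rg := (rg s)(rJ := J - 1, rV := vs ! i), tm := tm s + 11\<rparr>"
    \<comment> \<open>An output from the path costs neither a search nor a deletion, so the charged
      sums stay the same.\<close>
    have "set (popped ?ev) - set ps = set (popped ev) - set ps" using ps by auto
    note eq = this
    have "vs ! i \<notin> set (inserted ev)" using histD(4)[OF L vs path D(1)] ps by blast
    then have H: "?H - {vs ! i} = ?H" by blast
    have "post s1"
    proof (rule fin)
      show "hist n k arcs L ps vs ?ev (J - 1) Sr is Js es eh (ar s1 aQ)"
        using hist_pop_path[OF L vs path D(1) i J] by (simp add: s1_def)
      show "graph arcs s1" using D(2) by (simp add: graph_def s1_def)
      show "heap L n s1 sp (?H - {vs ! i})" unfolding H by (rule heap_cong[OF D(7)]) (auto simp: s1_def)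
      show "cm s1 + carries sp \<le> 3 * length (inserted ev) + (\<Sum>x \<in> set (popped ?ev) - set ps. 2 * eh x + 2) +
          (\<Sum>x \<in> Sr. 2 * es x + 1)" unfolding eq using D(12) by (simp add: s1_def)
      show "tm s1 + 120 * carries sp \<le> T + 26 + 500 * length (inserted ev) +
          (\<Sum>x \<in> set (popped ?ev) - set ps. 120 * eh x + 200) + (\<Sum>x \<in> Sr. 60 * es x + 60)"
        unfolding eq using D(13) by (simp add: s1_def)
    qed (use rOR in \<open>simp_all add: s1_def\<close>)
    moreover have "ar s aPATH (J - 1) = vs ! i" using D(5)[OF lps] J(2) by simp
    ultimately show ?thesis unfolding step using False D(4,14)
      by (simp add: exec_simps s1_def fun_upd_twist add.commute)
  next
    case True
    define y where "y = vs ! i"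
    have y: "rg s rL = Suc y" "rg s rYY = y" "y \<in> Sr" "y \<in> set (inserted ev)" "J \<le> ar s aQ y - 1"
      using h[OF True] by (simp_all add: y_def)
    have yp: "y \<notin> set ps" using histD(4)[OF L vs path D(1)] y(4) by blast
    define s1 where "s1 = s\<lparr>rg := (rg s)(rV := y, rT := Suc y), tm := Suc (Suc (Suc (tm s)))\<rparr>"
    have h1: "heap L n s1 sp ?H" by (rule heap_cong[OF D(7)]) (auto simp: s1_def)
    have "wp L B delete_cmd post s1"
    proof (rule delete_cmd_ok[OF h1])
      show "rg s1 rT = Suc y" by (simp add: s1_def)
      show "y \<in> set (contents sp)" using y(4) D(8) by simp
    next
      fix s2 e as bs assume a: "frame heap_regs heap_arrays s1 s2" "heap L n s2 sp (?H - {y})"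
        "contents sp = as @ y # bs" "2 ^ e \<le> length bs + 1" "tm s2 \<le> tm s1 + 120 * e + 160" "cm s2 \<le> cm s1 + 2 * e + 2"
      have su: "(\<Sum>x \<in> set (popped ?ev) - set ps. c * (eh(y := e)) x + d) =
          c * e + d + (\<Sum>x \<in> set (popped ev) - set ps. c * eh x + d)" for c d
      proof -
        have "set (popped ?ev) - set ps = insert y (set (popped ev) - set ps)" using yp by (auto simp: y_def)
        moreover have "(\<Sum>x \<in> set (popped ev) - set ps. c * (eh(y := e)) x + d) =
            (\<Sum>x \<in> set (popped ev) - set ps. c * eh x + d)"
          using fresh by (intro sum.cong) (auto simp: y_def)
        ultimately show ?thesis using fresh by (simp add: y_def)
      qed
      show "post s2"
      proof (rule fin)
        have "inserted ev = as @ y # bs" using a(3) D(8) by simp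
        from hist_pop_heap[OF L vs path D(1) i y_def[symmetric] y(3-5) this a(4)]
        show "hist n k arcs L ps vs ?ev J Sr is Js es (eh(y := e)) (ar s2 aQ)"
          using a(1) by (simp add: frame_def s1_def)
        show "graph arcs s2" using D(2) a(1) by (simp add: graph_def frame_def s1_def)
        show "heap L n s2 sp (?H - {vs ! i})" using a(2) by (simp add: y_def)
        show "cm s2 + carries sp \<le> 3 * length (inserted ev) +
            (\<Sum>x \<in> set (popped ?ev) - set ps. 2 * (eh(y := e)) x + 2) + (\<Sum>x \<in> Sr. 2 * es x + 1)"
          unfolding su using D(12) a(6) by (simp add: s1_def)
        show "tm s2 + 120 * carries sp \<le> T + 26 + 500 * length (inserted ev) +
            (\<Sum>x \<in> set (popped ?ev) - set ps. 120 * (eh(y := e)) x + 200) + (\<Sum>x \<in> Sr. 60 * es x + 60)"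
          unfolding su using D(13) a(5) by (simp add: s1_def)
      qed (use rOR D(4) a(1) in \<open>simp_all add: frame_def s1_def y_def\<close>)
    qed
    then show ?thesis unfolding step using True y(1,2)
      by (simp add: exec_simps s1_def fun_upd_twist add.commute)
  qed
qed

text \<open>Provides the premise \<open>all\<close> of the selection step: if exactly the arcs out
  of outputs have been traversed, an available vertex has no incoming arc left and is in the heap's
  history.\<close>

lemma arcs_ok_all:
  assumes "arcs_ok ev R" "R = {e. e < length arcs \<and> src arcs e \<notin> set (popped ev)}"
  shows "\<forall>w < n. w \<notin> set ps \<longrightarrow> (\<forall>u. (u, w) \<in> set arcs \<longrightarrow> u \<in> set (popped ev)) \<longrightarrow> w \<in> set (inserted ev)"
proof (intro allI impI)
  fix w assume w: "w < n" "w \<notin> set ps" and pr: "\<forall>u. (u, w) \<in> set arcs \<longrightarrow> u \<in> set (popped ev)"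
  have "tgt arcs e \<noteq> w" if e: "e \<in> R" for e
  proof
    assume t: "tgt arcs e = w"
    have "(src arcs e, tgt arcs e) \<in> set arcs" using arc_in[OF L, of e] e assms(2) by blast
    then show False using pr t e assms(2) by simp
  qed
  moreover have "finite R" using assms(2) by simp
  ultimately have "cnt arcs R w = 0" using cnt_eq_0 by blast
  then show "w \<in> set (inserted ev)" using assms(1) w unfolding arcs_ok_def by blast
qed

lemma arcs_ok_sources: "arcs_ok ev R \<Longrightarrow> sources n arcs ps \<subseteq> set (inserted ev)"
proof -
  assume a: "arcs_ok ev R"
  have sub: "R \<subseteq> {..<length arcs}" using a by (simp add: arcs_ok_def)
  then have "finite R" by (rule finite_subset) simp
  then have "cnt arcs R w = 0" if "cnt arcs {..<length arcs} w = 0" for w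
    using that sub by (auto simp: cnt_eq_0)
  then show ?thesis using a unfolding arcs_ok_def sources_def by auto
qed

text \<open>Only \<open>T\<close> grows with \<open>k\<close> and the number of arcs, by 100 per
  output and 60 per arc; all else is charged to items. The condition on the arcs is demanded only
  before the k-th output, because the last round skips them.\<close>

lemma main_loop_ok:
  assumes "base s ev J Sr is Js es eh sp R T" and "k \<le> B" "d = k - length (popped ev)"
    and "length (popped ev) < k \<Longrightarrow> arcs_ok ev R \<and> R = {e. e < length arcs \<and> src arcs e \<notin> set (popped ev)}"
    and "finite R" "\<And>x. x \<in> Sr \<Longrightarrow> is x < length (popped ev)" "sources n arcs ps \<subseteq> set (inserted ev)"
    and "\<And>s' ev' J' Sr' is' Js' es' eh' sp' R'. base s' ev' J' Sr' is' Js' es' eh' sp' R' (T + 100 * d + 60 * card R + 1) \<Longrightarrow>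
      popped ev' = vs \<Longrightarrow> (\<And>x. x \<in> Sr' \<Longrightarrow> is' x < k) \<Longrightarrow> sources n arcs ps \<subseteq> set (inserted ev') \<Longrightarrow> Q s'"
  shows "wp L B (While rR main_body) Q s"
  using assms
proof (induction d arbitrary: s ev J Sr "is" Js es eh sp R T)
  case 0
  note D = baseD[OF 0(1)]
  have len: "length (popped ev) = k" using histD(1)[OF L vs path D(1)] 0(3) by simp
  have "length vs = k" using vs by (simp add: smallest_sorted_def)
  then have pv: "popped ev = vs" using histD(2)[OF L vs path D(1)] len by simp
  have "Q (tick 1 s)"
  proof (rule 0(8)[OF _ _ _ 0(7)])
    show "base (tick 1 s) ev J Sr is Js es eh sp R (T + 100 * 0 + 60 * card R + 1)"
      by (rule base_cong[OF 0(1), of _ 1]) auto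
    show "popped ev = vs" by (rule pv)
    show "is x < k" if "x \<in> Sr" for x using 0(6)[OF that] len by simp
  qed
  then show ?case using D(9) len by (subst wp_While_iff) simp
next
  case (Suc d)
  note D = baseD[OF Suc.prems(1)]
  define i where "i = length (popped ev)"
  have i: "i = length (popped ev)" "i < k" using Suc.prems(3) by (auto simp: i_def)
  have A: "arcs_ok ev R" "R = {e. e < length arcs \<and> src arcs e \<notin> set (popped ev)}" using Suc.prems(4) i by auto
  have fresh: "vs ! i \<notin> set (popped ev)"
    using vs_fresh[OF L vs path i(2)] histD(2)[OF L vs path D(1)] i(1) by simp
  define next_arcs where "next_arcs = Cond rR (Get rE aHEAD rV ;; While rE arc_body) (Set rA 0)"
  let ?post = "\<lambda>s'. wp L B (While rR main_body) Q (tick 1 s')"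
  let ?ev = "ev @ [Inr (vs ! i)]"
  have again: "wp L B next_arcs ?post s2"
    if s2: "base s2 ?ev J' Sr' is' Js' es' eh' sp' R (T + 61)" "rg s2 rV = vs ! i" and lt: "\<And>x. x \<in> Sr' \<Longrightarrow> is' x \<le> i"
    for s2 J' Sr' is' Js' es' eh' sp'
  proof (cases "Suc i < k")
    case False
    then have k: "k = Suc i" using i by simp
    define s3 where "s3 = s2\<lparr>rg := (rg s2)(rA := 0), tm := Suc (Suc (Suc (tm s2)))\<rparr>"
    have "wp L B (While rR main_body) Q s3"
    proof (rule Suc.IH)
      show "base s3 ?ev J' Sr' is' Js' es' eh' sp' R (T + 70)"
        by (rule base_cong[OF s2(1), of _ 3]) (auto simp: s3_def)
      show "d = k - length (popped ?ev)" using Suc.prems(3) by simp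
      show "is' x < length (popped ?ev)" if "x \<in> Sr'" for x using lt[OF that] i by simp
      show "arcs_ok ?ev R \<and> R = {e. e < length arcs \<and> src arcs e \<notin> set (popped ?ev)}" if "length (popped ?ev) < k"
        using that k i by simp
      fix s' ev' J' Sr' is' Js' es' eh' sp' R'
      assume a: "base s' ev' J' Sr' is' Js' es' eh' sp' R' (T + 70 + 100 * d + 60 * card R + 1)"
        "popped ev' = vs" "\<And>x. x \<in> Sr' \<Longrightarrow> is' x < k" "sources n arcs ps \<subseteq> set (inserted ev')"
      show "Q s'"
        by (rule Suc.prems(8)[OF base_cong[OF a(1), of _ 0] a(2-4)]) auto
    qed (use Suc.prems in auto)
    moreover have "rg s2 rR = 0" using baseD(9)[OF s2(1)] k i by simp
    ultimately show ?thesis unfolding next_arcs_def by (simp add: exec_simps s3_def)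
  next
    case True
    note E = baseD[OF s2(1)]
    define fs where "fs = out_arcs arcs (length arcs) (vs ! i)"
    have fs: "set fs = {e. e < length arcs \<and> src arcs e = vs ! i}" "distinct fs"
      unfolding fs_def using set_out_arcs distinct_out_arcs by auto
    have sub: "set fs \<subseteq> R" unfolding fs(1) using fresh by (subst A(2)) auto
    have R': "R - set fs = {e. e < length arcs \<and> src arcs e \<notin> set (popped ?ev)}"
      unfolding fs(1) by (subst A(2)) auto
    define s3 where "s3 = s2\<lparr>rg := (rg s2)(rE := ar s2 aHEAD (vs ! i)), tm := tm s2 + 9\<rparr>"
    have b3: "base s3 ?ev J' Sr' is' Js' es' eh' sp' R (T + 70)"
      by (rule base_cong[OF s2(1), of _ 9]) (auto simp: s3_def)
    have "wp L B (While rE arc_body) (\<lambda>s'. ?post (tick 1 s')) s3"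
    proof (rule arcs_cmd_ok[OF b3, where fs = fs])
      show "arcs_ok ?ev R" using A(1) by (auto simp: arcs_ok_def)
      show "alist (ar s3 aNXT) (rg s3 rE) fs" using E(2) by (simp add: graph_def s3_def fs_def)
      show "distinct fs" "set fs \<subseteq> R" by (rule fs(2), rule sub)
      show "src arcs e \<in> set (popped ?ev)" if "e \<in> set fs" for e using that fs(1) by simp
      show "length (popped ?ev) < k" using True i by simp
    next
      fix s4 ev4 sp4 assume a: "base s4 ev4 J' Sr' is' Js' es' eh' sp4 (R - set fs) (T + 70 + 60 * length fs + 1)"
        "arcs_ok ev4 (R - set fs)" "popped ev4 = popped ?ev"
      have ca: "card (R - set fs) + length fs = card R"
        using sub Suc.prems(5) fs(2) by (metis card_Diff_subset card_mono distinct_card finite_set le_add_diff_inverse2)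
      show "wp L B (While rR main_body) Q (tick 1 (tick 1 s4))"
      proof (rule Suc.IH)
        show "base (tick 1 (tick 1 s4)) ev4 J' Sr' is' Js' es' eh' sp4 (R - set fs) (T + 80 + 60 * length fs)"
          by (rule base_cong[OF a(1), of _ 2]) auto
        show "sources n arcs ps \<subseteq> set (inserted ev4)" by (rule arcs_ok_sources[OF a(2)])
        show "d = k - length (popped ev4)" using Suc.prems(3) a(3) by simp
        show "is' x < length (popped ev4)" if "x \<in> Sr'" for x using lt[OF that] i a(3) by simp
        show "arcs_ok ev4 (R - set fs) \<and> R - set fs = {e. e < length arcs \<and> src arcs e \<notin> set (popped ev4)}"
          using a(2,3) R' by simp
        fix s' ev' J' Sr' is' Js' es' eh' sp' R'
        assume c: "base s' ev' J' Sr' is' Js' es' eh' sp' R' (T + 80 + 60 * length fs + 100 * d + 60 * card (R - set fs) + 1)"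
          "popped ev' = vs" "\<And>x. x \<in> Sr' \<Longrightarrow> is' x < k" "sources n arcs ps \<subseteq> set (inserted ev')"
        show "Q s'"
          by (rule Suc.prems(8)[OF base_cong[OF c(1), of _ 0] c(2-4)]) (use ca in auto)
      qed (use Suc.prems in auto)
    qed
    moreover have "rg s2 rR \<noteq> 0" using E(9) True i by simp
    ultimately show ?thesis unfolding next_arcs_def using s2(2) by (simp add: exec_simps s3_def add.commute)
  qed
  have b1: "base (tick 1 s) ev J Sr is Js es eh sp R (T + 1)"
    by (rule base_cong[OF Suc.prems(1), of _ 1]) auto
  have "wp L B select_cmd (wp L B pop_cmd (wp L B next_arcs ?post)) (tick 1 s)"
  proof (rule select_cmd_ok[OF b1 i arcs_ok_all[OF A]])
    show "is x < i" if "x \<in> Sr" for x using Suc.prems(6)[OF that] i by simp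
    fix s1 Sr' is' Js' es' assume a: "base s1 ev J Sr' is' Js' es' eh sp R (T + 1 + 30)" "\<And>x. x \<in> Sr' \<Longrightarrow> is' x \<le> i"
      "rg s1 rB \<noteq> 0 \<Longrightarrow> 0 < J \<and> vs ! i = ps ! (J - 1)"
      "rg s1 rB = 0 \<Longrightarrow> rg s1 rL = Suc (vs ! i) \<and> rg s1 rYY = vs ! i \<and> vs ! i \<in> Sr' \<and>
         vs ! i \<in> set (inserted ev) \<and> J \<le> ar s1 aQ (vs ! i) - 1"
    show "wp L B pop_cmd (wp L B next_arcs ?post) s1"
    proof (rule pop_cmd_ok[OF a(1) i Suc.prems(2) a(3,4)])
      fix s2 J' eh' sp' assume b: "base s2 ?ev J' Sr' is' Js' es' eh' sp' R (T + 1 + 30 + 30)" "rg s2 rV = vs ! i"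
      have "T + 1 + 30 + 30 = T + 61" by simp
      note b1 = b(1)[unfolded this]
      show "wp L B next_arcs ?post s2" by (rule again[OF b1 b(2) a(2)])
    qed
  qed
  moreover have "rg s rR \<noteq> 0" using D(9) i by simp
  ultimately show ?case
    by (subst wp_While_iff) (simp add: main_body_def wp_Seq_fun next_arcs_def)
qed

lemma init_loop_ok:
  assumes "base s ev J {} is Js es eh sp {..<length arcs} T" "popped ev = []" "rg s rZ = w" "rg s rD = n - w" "w \<le> n"
    and "set (inserted ev) = {v. v < w \<and> v \<notin> set ps \<and> cnt arcs {..<length arcs} v = 0}" "0 < k"
    and "\<And>s' ev' sp'. base s' ev' J {} is Js es eh sp' {..<length arcs} (T + 40 * (n - w) + 1) \<Longrightarrow> popped ev' = [] \<Longrightarrow>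
      arcs_ok ev' {..<length arcs} \<Longrightarrow> Q s'"
  shows "wp L B (While rD init_body) Q s"
  using assms
proof (induction "n - w" arbitrary: s ev sp T w)
  case 0
  have "Q (tick 1 s)"
  proof (rule 0(9))
    show "base (tick 1 s) ev J {} is Js es eh sp {..<length arcs} (T + 40 * (n - w) + 1)"
      by (rule base_cong[OF 0(2), of _ 1]) auto
    show "arcs_ok ev {..<length arcs}" unfolding arcs_ok_def using 0(1,6,7) by auto
  qed (rule 0(3))
  then show ?case using 0(1,5) by (subst wp_While_iff) simp
next
  case (Suc d)
  note D = baseD[OF Suc.prems(1)]
  let ?R = "{..<length arcs}"
  have w: "w < n" "n - w = Suc d" using Suc.hyps(2) by simp_all
  define z where "z = (w \<notin> set ps \<and> cnt arcs ?R w = 0)"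
  define s1 where "s1 = s\<lparr>rg := (rg s)(rX := cnt arcs ?R w + of_bool (w \<in> set ps), rF := of_bool (w \<in> set ps)), tm := tm s + 18\<rparr>"
  have b1: "base s1 ev J {} is Js es eh sp ?R (T + 18)"
    by (rule base_cong[OF Suc.prems(1), of _ 18]) (auto simp: s1_def)
  let ?post = "\<lambda>s. wp L B (Plus rZ rZ rONE ;; Minus rD rD rONE) (\<lambda>s'. wp L B (While rD init_body) Q (tick 1 s')) s"
  have post: "?post s2" if s2: "base s2 ev2 J {} is Js es eh sp2 ?R (T + 25)" "popped ev2 = []"
    "set (inserted ev2) = {v. v < Suc w \<and> v \<notin> set ps \<and> cnt arcs ?R v = 0}" "rg s2 rZ = w" "rg s2 rD = n - w" for s2 ev2 sp2
  proof -
    define s3 where "s3 = s2\<lparr>rg := (rg s2)(rZ := Suc w, rD := n - Suc w), tm := Suc (Suc (Suc (tm s2)))\<rparr>"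
    have "wp L B (While rD init_body) Q s3"
    proof (rule Suc.hyps(1)[where w = "Suc w" and ev = ev2])
      show "base s3 ev2 J {} is Js es eh sp2 ?R (T + 28)"
        by (rule base_cong[OF s2(1), of _ 3]) (auto simp: s3_def)
      fix s' ev' sp' assume a: "base s' ev' J {} is Js es eh sp' ?R (T + 28 + 40 * (n - Suc w) + 1)" "popped ev' = []" "arcs_ok ev' ?R"
      show "Q s'"
        by (rule Suc.prems(8)[OF base_cong[OF a(1), of _ 0] a(2,3)]) (use w in auto)
    qed (use w s2 Suc.prems in \<open>auto simp: s3_def\<close>)
    then show ?thesis using s2(4,5) baseD(14)[OF s2(1)]
      by (simp add: exec_simps s3_def fun_upd_twist add.commute)
  qed
  have zX: "rg s1 rX = 0 \<longleftrightarrow> z" by (auto simp: s1_def z_def)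
  have "{v. v < Suc w \<and> P v} = (if P w then insert w {v. v < w \<and> P v} else {v. v < w \<and> P v})" for P
    by (auto simp: less_Suc_eq)
  note ins = this[of "\<lambda>v. v \<notin> set ps \<and> cnt arcs ?R v = 0", folded z_def Suc.prems(6)]
  have "wp L B (Cond rX skip_cmd ins_cmd) ?post s1"
  proof (cases z)
    case False
    define s2 where "s2 = s1\<lparr>rg := (rg s1)(rX := 0), tm := Suc (Suc (Suc (tm s1)))\<rparr>"
    have "?post s2"
    proof (rule post)
      show "base s2 ev J {} is Js es eh sp ?R (T + 25)"
        by (rule base_cong[OF b1, of _ 3]) (auto simp: s2_def)
      show "set (inserted ev) = {v. v < Suc w \<and> v \<notin> set ps \<and> cnt arcs ?R v = 0}"
        using False ins by simp
    qed (use Suc.prems in \<open>simp_all add: s2_def s1_def\<close>)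
    then show ?thesis using False zX by (simp add: wp_Cond skip_cmd_def wp_basic put_rg_def s2_def tick_def)
  next
    case True
    have "wp L B ins_cmd ?post (tick 1 s1)"
    proof (rule ins_cmd_ok[where T = "T + 25"])
      show "base (tick 1 s1) ev J {} is Js es eh sp ?R (T + 25)"
        by (rule base_cong[OF b1, of _ 1]) auto
      show "rg (tick 1 s1) rZ = w" using Suc.prems(3) by (simp add: s1_def)
      show "w < n" "w \<notin> set (inserted ev)" "w \<notin> set ps" using w True Suc.prems(6) by (auto simp: z_def)
      show "length (popped ev) < k" using Suc.prems(2,7) by simp
      show "u \<in> set (popped ev)" if uw: "(u, w) \<in> set arcs" for u
      proof -
        obtain f where "f < length arcs" "tgt arcs f = w" using arc_ex[OF L uw] by auto
        then have "cnt arcs ?R w \<noteq> 0" using cnt_pos[of ?R f arcs] by auto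
        then show ?thesis using True by (simp add: z_def)
      qed
      fix s' sp' assume a: "frame heap_regs heap_arrays (tick 1 s1) s'"
        "base s' (ev @ [Inl w]) J {} is Js es eh sp' ?R (T + 25)"
      show "?post s'"
      proof (rule post[OF a(2)])
        show "set (inserted (ev @ [Inl w])) = {v. v < Suc w \<and> v \<notin> set ps \<and> cnt arcs ?R v = 0}"
          using True ins by simp
      qed (use a(1) Suc.prems(2-4) in \<open>simp_all add: frame_def s1_def\<close>)
    qed
    then show ?thesis using True zX by (simp add: wp_Cond)
  qed
  moreover have "wp L B init_body (\<lambda>s'. wp L B (While rD init_body) Q (tick 1 s')) (tick 1 s) = wp L B (Cond rX skip_cmd ins_cmd) ?post s1"
    using Suc.prems(3) D(3,6)
    by (subst (1) init_body_def) (simp add: wp_Seq wp_basic put_rg_def tick_def s1_def fun_upd_twist add.commute)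
  ultimately show ?case using Suc.prems(4) w by (subst wp_While_iff) simp
qed

lemma init_ok:
  assumes p: "prepared n k arcs s dep ps" and k: "0 < k"
    and Q: "\<And>s' ev' sp'. base s' ev' (length ps) {} (\<lambda>_. 0) (\<lambda>_. 0) (\<lambda>_. 0) (\<lambda>_. 0) sp' {..<length arcs} (tm s + 40 * n + 10) \<Longrightarrow>
      popped ev' = [] \<Longrightarrow> arcs_ok ev' {..<length arcs} \<Longrightarrow> Q s'"
  shows "wp L B init_cmd Q s"
proof -
  have P: "frame {rV, rA, rZ, rX, rI, rD, rONE, rE, rU, rTL, rH, rJ} {..8} (start n k arcs) s" "graph arcs s"
    "rg s rONE = 1" "ar s aREM = cnt arcs {..<length arcs}" "cm s = 0" "rg s rJ = length ps"
    "\<And>i. i < length ps \<Longrightarrow> ar s aPATH i = ps ! i" "\<And>v. ar s aINP v = of_bool (v \<in> set ps)"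
    using p unfolding prepared_def[OF L] by blast+
  have Z: "rg s rN = n" "rg s rK = k" "rg s rROOT = 0" "rg s rZERO = 0" "rg s rO = 0" "ar s aQ = (\<lambda>_. 0)"
    "ar s aRGT = (\<lambda>_. 0)" "ar s aDIG = (\<lambda>_. 0)" "ar s aWIN = (\<lambda>_. 0)"
    using P(1) by (simp_all add: frame_def start_def)
  define s1 where "s1 = s\<lparr>rg := (rg s)(rNEW := Suc n, rR := k, rD := n, rZ := 0), tm := Suc (Suc (Suc (Suc (tm s))))\<rparr>"
  have "base s1 [] (length ps) {} (\<lambda>_. 0) (\<lambda>_. 0) (\<lambda>_. 0) (\<lambda>_. 0) [] {..<length arcs} (tm s + 4)"
    unfolding base_def
  proof (intro conjI allI impI)
    show "hst [] (length ps) {} (\<lambda>_. 0) (\<lambda>_. 0) (\<lambda>_. 0) (\<lambda>_. 0) (ar s1 aQ)"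
      by (rule histI[OF L vs path]) (use Z in \<open>auto simp: s1_def\<close>)
    show "graph arcs s1" using P(2) by (simp add: graph_def s1_def)
    show "heap L n s1 [] (set (inserted []) - set (popped []))"
      by (rule heap_empty) (use Z P(3) in \<open>simp_all add: s1_def\<close>)
  qed (use P(3-8) Z in \<open>simp_all add: s1_def carries_def\<close>)
  then have "wp L B (While rD init_body) Q s1"
  proof (rule init_loop_ok)
    fix s' ev' sp' assume a: "base s' ev' (length ps) {} (\<lambda>_. 0) (\<lambda>_. 0) (\<lambda>_. 0) (\<lambda>_. 0) sp' {..<length arcs} (tm s + 4 + 40 * (n - 0) + 1)"
      "popped ev' = []" "arcs_ok ev' {..<length arcs}"
    show "Q s'" by (rule Q[OF base_cong[OF a(1), of _ 0] a(2,3)]) auto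
  qed (use k in \<open>auto simp: s1_def\<close>)
  then show ?thesis unfolding init_cmd_def using Z P(3)
    by (simp add: exec_simps s1_def fun_upd_twist add.commute)
qed

end

section \<open>Total cost\<close>

definition sort_cmd :: cmd where
  "sort_cmd = (adj_cmd ;; kahn_cmd ;; path_cmd) ;; init_cmd ;; While rR main_body"

lemma arrays_ok_sort_cmd: "arrays_ok sort_cmd"
  by (simp add: sort_cmd_def adj_cmd_def adj_body_def kahn_cmd_def sources_body_def kahn_body_def kahn_arc_def push_cmd_def
      skip_cmd_def path_cmd_def path_body_def init_cmd_def init_body_def main_body_def select_cmd_def pop_cmd_def
      arc_body_def ins_cmd_def insert_cmd_def delete_cmd_def fix_cmd_def fix_body_def comb_cmd_def carry_body_def
      join_cmd_def new_cmd_def search_cmd_def test_cmd_def gallop_body_def bisect_body_def)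

text \<open>Every vertex has an arc, is a source off the path, or is the end \<open>ps ! 0\<close>
  of the path. The sources off the path all enter the heap, so work linear in \<open>n\<close>, such
  as the initialization, is \<open>O(m + OPT)\<close>.\<close>

lemma num_vertices_le:
  assumes n: "0 < n" and L: "topological_order {..<n} (set arcs) L"
    and path: "\<And>i. Suc i < length ps \<Longrightarrow> (ps ! Suc i, ps ! i) \<in> set arcs" "set ps \<subseteq> {..<n}"
  shows "n \<le> 2 * length arcs + card (sources n arcs ps) + 1"
proof -
  let ?E = "fst ` set arcs \<union> snd ` set arcs"
  have "{..<n} \<subseteq> ?E \<union> sources n arcs ps \<union> {ps ! 0}"
  proof
    fix v assume v: "v \<in> {..<n}"
    show "v \<in> ?E \<union> sources n arcs ps \<union> {ps ! 0}"
    proof (cases "v \<in> set ps")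
      case True
      then obtain i where i: "i < length ps" "v = ps ! i" by (auto simp: in_set_conv_nth)
      show ?thesis
      proof (cases i)
        case (Suc j)
        then have "(v, ps ! j) \<in> set arcs" using path(1)[of j] i by simp
        then show ?thesis by force
      qed (use i in simp)
    next
      case False
      have "v \<in> ?E" if nz: "cnt arcs {..<length arcs} v \<noteq> 0"
      proof -
        obtain e where "e < length arcs" "tgt arcs e = v" using nz by (auto simp: cnt_eq_0)
        then have "v \<in> snd ` set arcs" by (metis image_eqI nth_mem)
        then show ?thesis by simp
      qed
      then show ?thesis using False v by (auto simp: sources_def)
    qed
  qed
  then have "card {..<n} \<le> card (?E \<union> sources n arcs ps \<union> {ps ! 0})"
    by (intro card_mono) (auto simp: sources_def)
  also have "\<dots> \<le> card (fst ` set arcs) + card (snd ` set arcs) + card (sources n arcs ps) + card {ps ! 0}"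
    by (meson add_mono card_Un_le order_trans order_refl)
  also have "\<dots> \<le> length arcs + length arcs + card (sources n arcs ps) + 1"
  proof -
    have "card (f ` set arcs) \<le> length arcs" for f :: "nat \<times> nat \<Rightarrow> nat"
      using card_image_le[of "set arcs" f] card_length[of arcs] by simp
    then show ?thesis by (intro add_mono) auto
  qed
  finally show ?thesis by simp
qed

text \<open>The time comes out as at most \<open>940 * m + 6540 * OPT + 631\<close>, where
  \<open>OPT\<close> being positive absorbs the constant.\<close>

lemma sort_cmd_ok:
  assumes L: "topological_order {..<n} (set arcs) L" and vs: "smallest_sorted {..<n} L k vs"
    and k: "0 < k" "k \<le> n" and B: "B = 2 * length arcs + n" and opt: "0 < OPT {..<n} (set arcs) k"
  shows "wp L B sort_cmd (\<lambda>s. map (raw s) [0..<k] = vs \<and>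
    tm s \<le> 8000 * (length arcs + OPT {..<n} (set arcs) k) \<and> cm s \<le> 8000 * OPT {..<n} (set arcs) k) (start n k arcs)"
    (is "wp L B sort_cmd ?Q _")
  unfolding sort_cmd_def wp_Seq[of _ _ "adj_cmd ;; kahn_cmd ;; path_cmd"] wp_Seq_fun[of _ _ init_cmd]
proof (rule prepare_ok[OF L B])
  show "0 < n" using k by simp
next
  fix s0 dep ps assume p: "prepared n k arcs s0 dep ps" and t0: "tm s0 \<le> 200 * length arcs + 200 * n + 100"
  note P = p[unfolded prepared_def[OF L]]
  have path1: "\<And>i. Suc i < length ps \<Longrightarrow> (ps ! Suc i, ps ! i) \<in> set arcs" using P by blast
  have path2: "set ps \<subseteq> {..<n}" using P by (auto simp: in_set_conv_nth)
  note path = path1 path2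
  let ?m = "length arcs" and ?o = "OPT {..<n} (set arcs) k"
  show "wp L B init_cmd (wp L B (While rR main_body) ?Q) s0"
  proof (rule init_ok[OF L vs path p k(1)])
    fix s1 ev1 sp1
    assume b1: "base n k arcs L ps vs s1 ev1 (length ps) {} (\<lambda>_. 0) (\<lambda>_. 0) (\<lambda>_. 0) (\<lambda>_. 0) sp1 {..<?m} (tm s0 + 40 * n + 10)"
      and ev1: "popped ev1 = []" and a1: "arcs_ok n arcs ps ev1 {..<?m}"
    show "wp L B (While rR main_body) ?Q s1"
    proof (rule main_loop_ok[OF L vs path b1, of _ k])
      show "k \<le> B" using k B by simp
      show "k = k - length (popped ev1)" using ev1 by simp
      show "arcs_ok n arcs ps ev1 {..<?m} \<and> {..<?m} = {e. e < ?m \<and> src arcs e \<notin> set (popped ev1)}" using a1 ev1 by auto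
      show "sources n arcs ps \<subseteq> set (inserted ev1)" by (rule arcs_ok_sources[OF L vs path a1])
    next
      fix s ev J Sr "is" Js es eh sp R
      assume b: "base n k arcs L ps vs s ev J Sr is Js es eh sp R (tm s0 + 40 * n + 10 + 100 * k + 60 * card {..<?m} + 1)"
        and pv: "popped ev = vs" and lt: "\<And>x. x \<in> Sr \<Longrightarrow> is x < k" and so: "sources n arcs ps \<subseteq> set (inserted ev)"
      note D = baseD[OF L vs path b]
      have len: "length vs = k" using vs by (simp add: smallest_sorted_def)
      have off: "2 ^ card (set vs - set ps) \<le> card (output_seqs {..<n} (set arcs) k) ^ 2"
        by (rule prepared_off_path[OF L p vs])
      let ?I = "length (inserted ev)" and ?U = "set vs - set ps"
      have F: "?I \<le> 3 * ?o" "sum es Sr \<le> 18 * ?o + 1" "sum eh ?U \<le> 18 * ?o + 1"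
        using hist_final[OF L vs path D(1) pv k lt off] by blast+
      have fS: "finite Sr" "card Sr \<le> ?I"
      proof -
        have sub: "Sr \<subseteq> set (inserted ev)" using histD(10)[OF L vs path D(1)] by blast
        then show "finite Sr" by (rule finite_subset) simp
        show "card Sr \<le> ?I" using card_mono[OF _ sub] card_length[of "inserted ev"] by simp
      qed
      have "?U \<subseteq> Sr" using histD(14)[OF L vs path D(1)] pv by blast
      then have U: "card ?U \<le> ?I" using order_trans[OF card_mono[OF fS(1)] fS(2)] by blast
      have su: "(\<Sum>x \<in> X. c * f x + d) = c * sum f X + d * card X" for c d :: nat and f and X :: "nat set"
        by (simp add: sum.distrib sum_distrib_left)
      have "card (sources n arcs ps) \<le> ?I"
        using card_mono[OF _ so] card_length[of "inserted ev"] by simp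
      moreover have "n \<le> 2 * ?m + card (sources n arcs ps) + 1"
        by (rule num_vertices_le[OF _ L path]) (use k in auto)
      ultimately have nn: "n \<le> 2 * ?m + ?I + 1" by linarith
      have cm: "cm s \<le> 3 * ?I + (2 * sum eh ?U + 2 * card ?U) + (2 * sum es Sr + 1 * card Sr)"
        using D(12) pv unfolding su by simp
      have tm: "tm s \<le> (tm s0 + 40 * n + 10 + 100 * k + 60 * ?m + 1) + 500 * ?I + (120 * sum eh ?U + 200 * card ?U) +
          (60 * sum es Sr + 60 * card Sr)"
        using D(13) pv unfolding su by simp
      show "?Q s"
      proof (intro conjI)
        show "map (raw s) [0..<k] = vs"
          by (rule nth_equalityI) (use D(11) pv len in auto)
        show "cm s \<le> 8000 * ?o" using cm F U fS(2) opt by linarith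
        \<comment> \<open>By \<open>hist_final\<close>, 3 times 500 + 200 + 60 plus 18 times 120 +
          60 gives 5520; the extra units in the two bounds on sums give 180.\<close>
        have "500 * ?I + (120 * sum eh ?U + 200 * card ?U) + (60 * sum es Sr + 60 * card Sr) \<le> 5520 * ?o + 180"
          using F U fS(2) by linarith
        \<comment> \<open>Together \<open>n\<close> and \<open>k\<close> occur with coefficient 340.
          Replacing both by \<open>2 * ?m + ?I + 1\<close> adds 680 to the 260 per arc, and the
          insertions contribute 3 times 340.\<close>
        moreover have "tm s0 + 40 * n + 10 + 100 * k + 60 * ?m + 1 \<le> 940 * ?m + 1020 * ?o + 451"
          using t0 nn k(2) F(1) by linarith
        ultimately have "tm s \<le> 940 * ?m + 6540 * ?o + 631" using tm by linarith
        then show "tm s \<le> 8000 * (?m + ?o)" using opt unfolding distrib_left by linarith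
      qed
    qed simp_all
  qed
qed

theorem theorem1p2:
  shows "\<exists>(P :: instr list) (C :: real).
    \<forall>(n :: nat) (k :: nat) (arcs :: (nat \<times> nat) list) (L :: nat rel).
      1 \<le> k \<and> k \<le> n \<and> topological_order {..<n} (set arcs) L \<and>
      2 \<le> num_outputs {..<n} (set arcs) k \<longrightarrow>
      (\<exists>t. let c = run L P t (init_config n k arcs); opt = OPT {..<n} (set arcs) k in
         halted P c \<and>
         smallest_sorted {..<n} L k (result k c) \<and>
         real t \<le> C * (real (length arcs) + real opt) \<and>
         real (comps c) \<le> C * real opt)"
proof (intro exI[of _ "prologue @ compile 5 sort_cmd"] exI[of _ "8000 :: real"] allI impI, elim conjE)
  fix n k :: nat and arcs :: "(nat \<times> nat) list" and L :: "nat rel"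
  assume k: "1 \<le> k" "k \<le> n" and L: "topological_order {..<n} (set arcs) L"
    and T: "2 \<le> num_outputs {..<n} (set arcs) k"
  let ?P = "prologue @ compile 5 sort_cmd" and ?o = "OPT {..<n} (set arcs) k"
  obtain vs where vs: "smallest_sorted {..<n} L k vs" using smallest_sorted_exists[OF L] k by auto
  \<comment> \<open>Two possible outputs force at least one comparison, which is what allows
    \<open>OPT\<close> to absorb additive constants.\<close>
  have "(2 :: nat) \<le> 2 ^ ?o" using T num_outputs_le_OPT[of "{..<n}" k "set arcs"] k by simp
  then have opt: "0 < ?o" by (cases ?o) auto
  have k0: "0 < k" using k(1) by simp
  show "\<exists>t. let c = run L ?P t (init_config n k arcs); opt = ?o in
         halted ?P c \<and> smallest_sorted {..<n} L k (result k c) \<and>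
         real t \<le> 8000 * (real (length arcs) + real opt) \<and> real (comps c) \<le> 8000 * real opt"
  proof (rule machine_run[OF arrays_ok_sort_cmd sort_cmd_ok[OF L vs k0 k(2) refl opt] k(2)])
    fix s :: state assume s: "map (raw s) [0..<k] = vs \<and> tm s \<le> 8000 * (length arcs + ?o) \<and> cm s \<le> 8000 * ?o"
      and run: "halted ?P (run L ?P (tm s) (init_config n k arcs))"
      "result k (run L ?P (tm s) (init_config n k arcs)) = map (raw s) [0..<k]"
      "comps (run L ?P (tm s) (init_config n k arcs)) = cm s"
    have "real (tm s) \<le> real (8000 * (length arcs + ?o))" "real (cm s) \<le> real (8000 * ?o)"
      using s unfolding of_nat_le_iff by blast+
    then have "real (tm s) \<le> 8000 * (real (length arcs) + real ?o)" "real (cm s) \<le> 8000 * real ?o" by simp_all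
    then show ?thesis using s run vs by (intro exI[of _ "tm s"]) (simp add: Let_def)
  qed
qed

end
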